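(* Let $p$ be a prime, $n\ge2$, $p>n+1$, and $G$ the pro-$p$ Iwahori subgroup of $SL_n(\mathbb{Z}_p)$ with Iwasawa algebra $\Lambda(G)$. The natural continuous surjection $\mathcal{A}\to\Lambda(G)$ (sending $U_\beta\mapsto x_\beta(p)-1$, $W_\delta\mapsto h_\delta(1+p)-1$, $V_\alpha\mapsto x_\alpha(1)-1$) induces, by passing to the quotient, an isomorphism $\mathcal{A}/\mathcal{R}\cong\Lambda(G)$.
   Context: $G$: matrices in $SL_n(\mathbb{Z}_p)$ upper unipotent mod $p$; $\Lambda(G)=\varprojlim_N\mathbb{Z}_p[G/N]$. Roots $\Phi=\{(i,j):i\ne j\}$, $\Phi^+$ ($i<j$), $\Phi^-$ ($i>j$), $\Pi=\{(i,i+1)\}$; $(i,j)+(j,k)=(i,k)$, $-(i,j)=(j,i)$. $x_{(i,j)}(t)=I+tE_{i,j}$; $h_{(c,c+1)}(\lambda)$ is diagonal with $\lambda$ at $(c,c)$, $\lambda^{-1}$ at $(c+1,c+1)$, $1$ elsewhere; $\langle\varsigma,\delta\rangle\in\mathbb{Z}$ is defined by $h_\delta(\lambda)x_\varsigma(t)h_\delta(\lambda)^{-1}=x_\varsigma(\lambda^{\langle\varsigma,\delta\rangle}t)$. $\mathcal{A}=\mathbb{Z}_p\{\{U_\beta,W_\delta,V_\alpha\}\}$ is the non-commutative power series ring over $\mathbb{Z}_p$ in variables $U_\beta$ ($\beta\in\Phi^-$), $W_\delta$ ($\delta\in\Pi$), $V_\alpha$ ($\alpha\in\Phi^+$), with topology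 given by $v(F)=\inf(\mathrm{val}_p(a)+\text{length of monomial})$; for $q\in\mathbb{Z}_p$, $(1+X)^q:=\sum_{r\ge0}\binom qrX^r$. $\mathcal{R}\subset\mathcal{A}$ is the closed two-sided ideal generated by LHS$-$RHS of: (1) $(1+W_\delta)(1+U_\beta)=(1+U_\beta)^{(1+p)^{\langle\beta,\delta\rangle}}(1+W_\delta)$; (2) $(1+W_\delta)(1+V_\alpha)=(1+V_\alpha)^{(1+p)^{\langle\alpha,\delta\rangle}}(1+W_\delta)$; (3) $V_\alpha U_\beta=U_\beta V_\alpha$ if $\alpha\ne-\beta$, $\alpha+\beta\notin\Phi$; (4) $(1+V_\alpha)(1+U_\beta)=(1+V_{(i,k)})^p(1+U_\beta)(1+V_\alpha)$, $\alpha=(i,j),\beta=(j,k)$, $i<k$; (5) $(1+V_\alpha)(1+U_\beta)=(1+U_{(i,k)})(1+U_\beta)(1+V_\alpha)$, $\alpha=(i,j),\beta=(j,k)$, $i>k$; (6) $(1+V_\alpha)(1+U_\beta)=(1+V_{(k,j)})^{-p}(1+U_\beta)(1+V_\alpha)$, $\alpha=(i,j),\beta=(k,i)$, $k<j$; (7) $(1+V_\alpha)(1+U_\beta)=(1+U_{(k,j)})^{-1}(1+U_\beta)(1+V_\alpha)$, $\alpha=(i,j),\beta=(k,i)$, $k>j$; (8) $(1+V_\alpha)(1+U_{-\alpha})=(1+U_{-\alpha})^{(1+p)^{-1}}(1+W_{(i,i+1)})\cdots(1+W_{(j-1,j)})(1+V_\alpha)^{(1+p)^{-1}}$, $\alpha=(i,j)$;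 (9) $U_{\beta_1}U_{\beta_2}=U_{\beta_2}U_{\beta_1}$ if $\beta_1+\beta_2\notin\Phi$; (10) $(1+U_{\beta_1})(1+U_{\beta_2})=(1+U_{(i,k)})^p(1+U_{\beta_2})(1+U_{\beta_1})$, $\beta_1=(i,j),\beta_2=(j,k)\in\Phi^-$; (11) $(1+U_{\beta_1})(1+U_{\beta_2})=(1+U_{(k,j)})^{-p}(1+U_{\beta_2})(1+U_{\beta_1})$, $\beta_1=(i,j),\beta_2=(k,i)\in\Phi^-$; (12) $W_{\delta_1}W_{\delta_2}=W_{\delta_2}W_{\delta_1}$; (13) $V_{\alpha_1}V_{\alpha_2}=V_{\alpha_2}V_{\alpha_1}$ if $\alpha_1+\alpha_2\notin\Phi$; (14) $(1+V_{\alpha_1})(1+V_{\alpha_2})=(1+V_{(i,k)})(1+V_{\alpha_2})(1+V_{\alpha_1})$, $\alpha_1=(i,j),\alpha_2=(j,k)\in\Phi^+$; (15) $(1+V_{\alpha_2})(1+V_{\alpha_1})=(1+V_{(k,j)})(1+V_{\alpha_1})(1+V_{\alpha_2})$, $\alpha_1=(i,j),\alpha_2=(k,i)\in\Phi^+$. *)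

theory Defs
  imports
    "HOL-Analysis.Function_Topology"
    "HOL-Algebra.QuotRing"
    "HOL-Library.Extended_Nat"
    "Jordan_Normal_Form.Determinant"
    "Berlekamp_Zassenhaus.Finite_Field"
begin

section \<open>The ring of p-adic integers\<close>

text \<open>
  The prime \<open>p\<close> is the cardinality of a type \<open>'p\<close> of class \<^class>\<open>prime_card\<close>
  (the class states precisely that \<open>CARD('p)\<close> is prime), so that the p-adic integers form a type.
  They are the inverse limit of the rings of residues \<open>{0..<p^k}\<close>; the condition below forces
  \<open>0 \<le> x k < p^k\<close>.
\<close>

typedef ('p::prime_card) padic_int =
  "{x :: nat \<Rightarrow> int. \<forall>k. x (Suc k) mod int CARD('p) ^ k = x k}"
  morphisms residue Abs_padic_int
  by (rule exI[of _ "\<lambda>_. 0"]) simp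

setup_lifting type_definition_padic_int

lemma int_CARD_gt_1: "1 < int CARD('p::prime_card)"
  using prime_gt_1_int[OF prime_card_int] .

lemma mod_mod_Suc_power: "(a :: int) mod q ^ Suc k mod q ^ k = a mod q ^ k"
  by (simp add: mod_mod_cancel)

instantiation padic_int :: (prime_card) comm_ring_1
begin

lift_definition zero_padic_int :: "'a padic_int" is "\<lambda>_. 0" by simp

lift_definition one_padic_int :: "'a padic_int" is "\<lambda>k. 1 mod int CARD('a) ^ k"
  by (simp only: mod_mod_Suc_power)

lift_definition plus_padic_int :: "'a padic_int \<Rightarrow> 'a padic_int \<Rightarrow> 'a padic_int"
  is "\<lambda>x y k. (x k + y k) mod int CARD('a) ^ k"
  by (metis mod_mod_Suc_power mod_add_eq)

lift_definition uminus_padic_int :: "'a padic_int \<Rightarrow> 'a padic_int"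
  is "\<lambda>x k. (- x k) mod int CARD('a) ^ k"
  by (metis mod_mod_Suc_power mod_minus_eq)

lift_definition minus_padic_int :: "'a padic_int \<Rightarrow> 'a padic_int \<Rightarrow> 'a padic_int"
  is "\<lambda>x y k. (x k - y k) mod int CARD('a) ^ k"
  by (metis mod_mod_Suc_power mod_diff_eq)

lift_definition times_padic_int :: "'a padic_int \<Rightarrow> 'a padic_int \<Rightarrow> 'a padic_int"
  is "\<lambda>x y k. (x k * y k) mod int CARD('a) ^ k"
  by (metis mod_mod_Suc_power mod_mult_eq)

instance
proof
  fix a b c :: "'a padic_int"
  show "a * b * c = a * (b * c)" by transfer (simp add: mod_simps mult.assoc)
  show "a * b = b * a" by transfer (simp add: mult.commute)
  show "1 * a = a"
  proof (transfer, rule ext)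
    fix x :: "nat \<Rightarrow> int" and k
    assume "\<forall>k. x (Suc k) mod int CARD('a) ^ k = x k"
    then have "x k mod int CARD('a) ^ k = x k" using mod_mod_trivial by metis
    then show "1 mod int CARD('a) ^ k * x k mod int CARD('a) ^ k = x k" by (simp add: mod_simps)
  qed
  show "a + b + c = a + (b + c)" by transfer (simp add: mod_simps add.assoc)
  show "a + b = b + a" by transfer (simp add: add.commute)
  show "0 + a = a"
  proof (transfer, rule ext)
    fix x :: "nat \<Rightarrow> int" and k
    assume "\<forall>k. x (Suc k) mod int CARD('a) ^ k = x k"
    then have "x k mod int CARD('a) ^ k = x k" using mod_mod_trivial by metis
    then show "(0 + x k) mod int CARD('a) ^ k = x k" by simp
  qed
  show "- a + a = 0" by transfer (simp add: mod_simps)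
  show "a - b = a + - b" by transfer (simp add: mod_simps)
  show "(a + b) * c = a * c + b * c" by transfer (simp add: mod_simps distrib_right)
  show "(0::'a padic_int) \<noteq> 1"
  proof
    assume "(0::'a padic_int) = 1"
    then have "residue (0::'a padic_int) 1 = residue (1::'a padic_int) 1" by simp
    then show False using int_CARD_gt_1[where 'p='a]
      by (simp add: zero_padic_int.rep_eq one_padic_int.rep_eq)
  qed
qed

end

lemma residue_of_nat: "residue (of_nat m :: 'p::prime_card padic_int) k = int m mod int CARD('p) ^ k"
  by (induction m)
    (simp_all add: zero_padic_int.rep_eq one_padic_int.rep_eq plus_padic_int.rep_eq mod_simps)

instance padic_int :: (prime_card) ring_char_0
proof
  show "inj (of_nat :: nat \<Rightarrow> 'a padic_int)"
  proof (rule injI)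
    fix m n :: nat
    assume eq: "(of_nat m :: 'a padic_int) = of_nat n"
    have "m + n < CARD('a) ^ (m + n)"
      using int_CARD_gt_1[where 'p='a] by (intro power_gt_expt) simp
    then have "int m < int CARD('a) ^ (m + n)" "int n < int CARD('a) ^ (m + n)"
      by (metis of_nat_power of_nat_less_iff le_add1 le_add2 order_le_less_trans)+
    with arg_cong[OF eq, of "\<lambda>x. residue x (m + n)"] show "m = n"
      by (simp add: residue_of_nat)
  qed
qed

lemma residue_Suc: "residue (x :: 'p::prime_card padic_int) (Suc k) mod int CARD('p) ^ k = residue x k"
  using residue[of x] by blast

lemma residue_mod: "j \<le> k \<Longrightarrow> residue (x :: 'p::prime_card padic_int) k mod int CARD('p) ^ j = residue x j"
proof (induction k rule: dec_induct)
  case base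
  show ?case using residue_Suc[of x j] by (metis mod_mod_trivial)
next
  case (step k)
  have "residue x (Suc k) mod int CARD('p) ^ j = residue x (Suc k) mod int CARD('p) ^ k mod int CARD('p) ^ j"
    using step.hyps(1) by (simp add: mod_mod_cancel le_imp_power_dvd)
  also have "\<dots> = residue x j" by (simp only: residue_Suc step.IH)
  finally show ?case .
qed

lemma padic_no_zero_divisors:
  fixes x y :: "'p::prime_card padic_int"
  assumes "x \<noteq> 0" "y \<noteq> 0"
  shows "x * y \<noteq> 0"
proof
  assume xy: "x * y = 0"
  let ?p = "int CARD('p)"
  obtain a where a: "residue x a \<noteq> 0"
    using assms(1) unfolding residue_inject[symmetric] zero_padic_int.rep_eq by auto
  obtain b where b: "residue y b \<noteq> 0"
    using assms(2) unfolding residue_inject[symmetric] zero_padic_int.rep_eq by auto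
  have "?p ^ (a + b) dvd residue x (a + b) * residue y (a + b)"
    using arg_cong[OF xy, of "\<lambda>z. residue z (a + b)"]
    by (simp add: times_padic_int.rep_eq zero_padic_int.rep_eq mod_eq_0_iff_dvd)
  then obtain r s where rs: "r + s = a + b" "?p ^ r dvd residue x (a + b)" "?p ^ s dvd residue y (a + b)"
    using prime_elem_power_dvd_prod[OF _ prime_imp_prime_elem[OF prime_card_int]] by blast
  then consider "a \<le> r" | "b \<le> s" by linarith
  then have "?p ^ a dvd residue x (a + b) \<or> ?p ^ b dvd residue y (a + b)"
    using rs by cases (meson power_le_dvd)+
  then show False
    using a b residue_mod[of a "a + b" x] residue_mod[of b "a + b" y]
    by (auto simp: mod_eq_0_iff_dvd[symmetric])
qed

text \<open>
  Here \<open>div\<close> is exact division (with value \<open>0\<close> if the division is not exact);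
  \<^term>\<open>1 div u\<close> is the inverse of a unit \<open>u\<close>.
\<close>

instantiation padic_int :: (prime_card) idom_divide
begin

definition divide_padic_int :: "'a padic_int \<Rightarrow> 'a padic_int \<Rightarrow> 'a padic_int" where
  "divide_padic_int x y = (if y \<noteq> 0 \<and> y dvd x then THE z. x = z * y else 0)"

instance
proof
  fix a b :: "'a padic_int"
  show "a \<noteq> 0 \<Longrightarrow> b \<noteq> 0 \<Longrightarrow> a * b \<noteq> 0" by (rule padic_no_zero_divisors)
  show "a div 0 = 0" by (simp add: divide_padic_int_def)
  show "a * b div b = a" if "b \<noteq> 0"
  proof -
    have "(THE z. a * b = z * b) = a"
    proof (rule the_equality)
      fix z assume "a * b = z * b"
      then have "(a - z) * b = 0" by (simp add: algebra_simps)
      then show "z = a" using padic_no_zero_divisors[of "a - z" b] that by auto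
    qed simp
    then show ?thesis using that by (simp add: divide_padic_int_def)
  qed
qed

end

definition padic_p :: "'p::prime_card padic_int" where
  "padic_p = of_nat CARD('p)"

definition padic_val :: "'p::prime_card padic_int \<Rightarrow> enat" where
  "padic_val x = (SUP k\<in>{k. padic_p ^ k dvd x}. enat k)"

definition padic_powi :: "'p::prime_card padic_int \<Rightarrow> int \<Rightarrow> 'p padic_int" where
  "padic_powi u m = (if m \<ge> 0 then u ^ nat m else (1 div u) ^ nat (- m))"

text \<open>The formula defining \<^const>\<open>gbinomial\<close>, whose use the library restricts to fields.
  The division is exact.\<close>

definition padic_gchoose :: "'p::prime_card padic_int \<Rightarrow> nat \<Rightarrow> 'p padic_int" where
  "padic_gchoose q r = (\<Prod>i=0..<r. q - of_nat i) div fact r"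

instantiation padic_int :: (prime_card) topological_space
begin

definition open_padic_int :: "'a padic_int set \<Rightarrow> bool" where
  "open_padic_int S \<longleftrightarrow> (\<forall>x\<in>S. \<exists>k. \<forall>y. padic_p ^ k dvd y - x \<longrightarrow> y \<in> S)"

instance
proof
  show "open (UNIV :: 'a padic_int set)" by (simp add: open_padic_int_def)
next
  fix S T :: "'a padic_int set"
  assume S: "open S" and T: "open T"
  show "open (S \<inter> T)"
    unfolding open_padic_int_def
  proof
    fix x assume x: "x \<in> S \<inter> T"
    obtain k l where
      "\<forall>y. padic_p ^ k dvd y - x \<longrightarrow> y \<in> S" "\<forall>y. padic_p ^ l dvd y - x \<longrightarrow> y \<in> T"
      using S T x unfolding open_padic_int_def by blast
    then have "\<forall>y. padic_p ^ max k l dvd y - x \<longrightarrow> y \<in> S \<inter> T"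
      by (meson IntI dvd_trans le_imp_power_dvd max.cobounded1 max.cobounded2)
    then show "\<exists>k. \<forall>y. padic_p ^ k dvd y - x \<longrightarrow> y \<in> S \<inter> T" ..
  qed
next
  fix K :: "'a padic_int set set"
  assume "\<forall>S\<in>K. open S"
  then show "open (\<Union>K)" unfolding open_padic_int_def by (meson UnionE UnionI)
qed

end

section \<open>The pro-p Iwahori subgroup\<close>

text \<open>Rows and columns are numbered \<open>0, \<dots>, n - 1\<close>; the root \<open>(i, j)\<close> stands for \<open>(i + 1, j + 1)\<close>
  in the numbering \<open>1, \<dots>, n\<close>.\<close>

type_synonym root = "nat \<times> nat"

definition roots :: "nat \<Rightarrow> root set" where
  "roots n = {(i, j). i < n \<and> j < n \<and> i \<noteq> j}"

definition pos_roots :: "nat \<Rightarrow> root set" where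
  "pos_roots n = {(i, j) \<in> roots n. i < j}"

definition neg_roots :: "nat \<Rightarrow> root set" where
  "neg_roots n = {(i, j) \<in> roots n. i > j}"

definition simple_roots :: "nat \<Rightarrow> root set" where
  "simple_roots n = {(i, i + 1) | i. i + 1 < n}"

definition neg_root :: "root \<Rightarrow> root" where
  "neg_root \<alpha> = (snd \<alpha>, fst \<alpha>)"

definition sum_is_root :: "nat \<Rightarrow> root \<Rightarrow> root \<Rightarrow> bool" where
  "sum_is_root n \<alpha> \<beta> \<longleftrightarrow>
    (snd \<alpha> = fst \<beta> \<and> (fst \<alpha>, snd \<beta>) \<in> roots n) \<or>
    (snd \<beta> = fst \<alpha> \<and> (fst \<beta>, snd \<alpha>) \<in> roots n)"

definition SL :: "nat \<Rightarrow> 'p::prime_card padic_int mat monoid" where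
  "SL n = \<lparr>carrier = {A \<in> carrier_mat n n. det A = 1}, monoid.mult = (*), one = 1\<^sub>m n\<rparr>"

definition iwahori :: "nat \<Rightarrow> 'p::prime_card padic_int mat monoid" where
  "iwahori n = SL n \<lparr>carrier :=
    {A \<in> carrier (SL n). \<forall>i<n. \<forall>j<n.
      (i > j \<longrightarrow> padic_p dvd A $$ (i, j)) \<and> (i = j \<longrightarrow> padic_p dvd A $$ (i, j) - 1)}\<rparr>"

definition iwahori_topology :: "nat \<Rightarrow> 'p::prime_card padic_int mat topology" where
  "iwahori_topology n = pullback_topology (carrier (iwahori n))
    (\<lambda>A. restrict (\<lambda>ij. A $$ ij) ({..<n} \<times> {..<n}))
    (product_topology (\<lambda>_. euclidean) ({..<n} \<times> {..<n}))"

definition x_mat :: "nat \<Rightarrow> root \<Rightarrow> 'p::prime_card padic_int \<Rightarrow> 'p padic_int mat" where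
  "x_mat n \<alpha> t = 1\<^sub>m n + t \<cdot>\<^sub>m mat n n (\<lambda>ij. if ij = \<alpha> then 1 else 0)"

definition h_mat :: "nat \<Rightarrow> root \<Rightarrow> 'p::prime_card padic_int \<Rightarrow> 'p padic_int mat" where
  "h_mat n \<delta> u = mat n n (\<lambda>(i, j).
    if i \<noteq> j then 0 else if i = fst \<delta> then u else if i = snd \<delta> then 1 div u else 1)"

definition root_pairing :: "'p::prime_card itself \<Rightarrow> nat \<Rightarrow> root \<Rightarrow> root \<Rightarrow> int" where
  "root_pairing _ n \<sigma> \<delta> = (THE m. \<forall>u t :: 'p padic_int. u dvd 1 \<longrightarrow>
    h_mat n \<delta> u \<otimes>\<^bsub>SL n\<^esub> x_mat n \<sigma> t \<otimes>\<^bsub>SL n\<^esub> inv\<^bsub>SL n\<^esub> (h_mat n \<delta> u) = x_mat n \<sigma> (padic_powi u m * t))"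

section \<open>The Iwasawa algebra\<close>

text \<open>Algebras over the p-adic integers are records of type \<^typ>\<open>(_, _) module\<close>, whose
  ring part is not required to be commutative.\<close>

definition group_ring ::
  "('g, 'x) monoid_scheme \<Rightarrow> ('p::prime_card padic_int, 'g \<Rightarrow> 'p padic_int) module" where
  "group_ring H = \<lparr>
    carrier = {f. finite {x. f x \<noteq> 0} \<and> {x. f x \<noteq> 0} \<subseteq> carrier H},
    monoid.mult = (\<lambda>f g z. \<Sum>(x, y) \<in> {(x, y). f x \<noteq> 0 \<and> g y \<noteq> 0 \<and> x \<otimes>\<^bsub>H\<^esub> y = z}. f x * g y),
    one = (\<lambda>z. if z = \<one>\<^bsub>H\<^esub> then 1 else 0),
    ring.zero = (\<lambda>_. 0),
    ring.add = (\<lambda>f g z. f z + g z),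
    module.smult = (\<lambda>c f z. c * f z)\<rparr>"

definition group_ring_map :: "('g \<Rightarrow> 'h) \<Rightarrow> ('g \<Rightarrow> 'p::prime_card padic_int) \<Rightarrow> 'h \<Rightarrow> 'p padic_int" where
  "group_ring_map q f = (\<lambda>z. \<Sum>x \<in> {x. f x \<noteq> 0 \<and> q x = z}. f x)"

definition open_normal_subgroups :: "nat \<Rightarrow> 'p::prime_card padic_int mat set set" where
  "open_normal_subgroups n = {N. N \<lhd> iwahori n \<and> openin (iwahori_topology n) N}"

type_synonym 'p iwasawa =
  "'p padic_int mat set \<Rightarrow> 'p padic_int mat set \<Rightarrow> 'p padic_int"

text \<open>
  An element of the inverse limit is a family \<open>x\<close>, indexed by the open normal subgroups \<open>N\<close> of \<open>G\<close>,
  with \<open>x N\<close> in the group ring of \<open>G/N\<close>; the transition map for \<open>N \<subseteq> M\<close> is induced by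
  \<open>C \<mapsto> M C\<close>, which sends the coset \<open>N g\<close> to \<open>M g\<close>.
\<close>

definition iwasawa_algebra :: "nat \<Rightarrow> ('p::prime_card padic_int, 'p iwasawa) module" where
  "iwasawa_algebra n = (let I = open_normal_subgroups n; Z = (\<lambda>N. group_ring (iwahori n Mod N)) in \<lparr>
    carrier = {x \<in> (\<Pi>\<^sub>E N\<in>I. carrier (Z N)).
      \<forall>N\<in>I. \<forall>M\<in>I. N \<subseteq> M \<longrightarrow> group_ring_map (\<lambda>C. M <#>\<^bsub>iwahori n\<^esub> C) (x N) = x M},
    monoid.mult = (\<lambda>x y. \<lambda>N\<in>I. x N \<otimes>\<^bsub>Z N\<^esub> y N),
    one = (\<lambda>N\<in>I. \<one>\<^bsub>Z N\<^esub>),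
    ring.zero = (\<lambda>N\<in>I. \<zero>\<^bsub>Z N\<^esub>),
    ring.add = (\<lambda>x y. \<lambda>N\<in>I. x N \<oplus>\<^bsub>Z N\<^esub> y N),
    module.smult = (\<lambda>c x. \<lambda>N\<in>I. c \<odot>\<^bsub>Z N\<^esub> x N)\<rparr>)"

text \<open>Each \<open>G/N\<close> is finite, so its group ring is a finite free module over the p-adic integers and
  carries the topology of coefficientwise convergence.\<close>

definition iwasawa_topology :: "nat \<Rightarrow> 'p::prime_card iwasawa topology" where
  "iwasawa_topology n = subtopology
    (product_topology (\<lambda>N. top_of_set (carrier (group_ring (iwahori n Mod N)))) (open_normal_subgroups n))
    (carrier (iwasawa_algebra n))"

definition iwasawa_of :: "nat \<Rightarrow> 'p::prime_card padic_int mat \<Rightarrow> 'p iwasawa" where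
  "iwasawa_of n g = (\<lambda>N\<in>open_normal_subgroups n.
    \<lambda>C. if C = N #>\<^bsub>iwahori n\<^esub> g then 1 else 0)"

section \<open>Non-commutative power series\<close>

text \<open>A power series is the family of its coefficients, indexed by the words in the variables.\<close>

typedef ('v, 'a) ncps = "UNIV :: ('v list \<Rightarrow> 'a) set"
  morphisms nc_coeff Abs_ncps ..

setup_lifting type_definition_ncps

lemma sum_triangle:
  fixes g :: "nat \<Rightarrow> nat \<Rightarrow> 'a::comm_monoid_add"
  shows "(\<Sum>k\<le>n. \<Sum>i\<le>k. g i (k - i)) = (\<Sum>k\<le>n. \<Sum>i\<le>n - k. g k i)"
  by (induction n) (simp_all add: Suc_diff_le sum.distrib add.assoc)

instantiation ncps :: (type, comm_ring_1) ring_1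
begin

lift_definition zero_ncps :: "('a, 'b) ncps" is "\<lambda>_. 0" .

lift_definition one_ncps :: "('a, 'b) ncps" is "\<lambda>w. if w = [] then 1 else 0" .

lift_definition plus_ncps :: "('a, 'b) ncps \<Rightarrow> ('a, 'b) ncps \<Rightarrow> ('a, 'b) ncps"
  is "\<lambda>F H w. F w + H w" .

lift_definition uminus_ncps :: "('a, 'b) ncps \<Rightarrow> ('a, 'b) ncps" is "\<lambda>F w. - F w" .

lift_definition minus_ncps :: "('a, 'b) ncps \<Rightarrow> ('a, 'b) ncps \<Rightarrow> ('a, 'b) ncps"
  is "\<lambda>F H w. F w - H w" .

lift_definition times_ncps :: "('a, 'b) ncps \<Rightarrow> ('a, 'b) ncps \<Rightarrow> ('a, 'b) ncps"
  is "\<lambda>F H w. \<Sum>k\<le>length w. F (take k w) * H (drop k w)" .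

instance
proof
  fix a b c :: "('a, 'b) ncps"
  show "a * b * c = a * (b * c)"
  proof (transfer, rule ext)
    fix F H K :: "'a list \<Rightarrow> 'b" and w :: "'a list"
    let ?f = "\<lambda>i j. F (take i w) * H (take j (drop i w)) * K (drop (i + j) w)"
    have "(\<Sum>k\<le>length w. (\<Sum>i\<le>length (take k w). F (take i (take k w)) * H (drop i (take k w))) * K (drop k w))
        = (\<Sum>k\<le>length w. \<Sum>i\<le>k. ?f i (k - i))"
      by (intro sum.cong refl) (auto simp: sum_distrib_right drop_take min_def intro!: sum.cong)
    also have "\<dots> = (\<Sum>k\<le>length w. \<Sum>i\<le>length w - k. ?f k i)"
      by (rule sum_triangle)
    also have "\<dots> = (\<Sum>k\<le>length w. F (take k w) *
        (\<Sum>i\<le>length (drop k w). H (take i (drop k w)) * K (drop i (drop k w))))"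
      by (intro sum.cong refl) (auto simp: sum_distrib_left mult.assoc add.commute intro!: sum.cong)
    finally show "(\<Sum>k\<le>length w. (\<Sum>i\<le>length (take k w). F (take i (take k w)) * H (drop i (take k w))) * K (drop k w))
      = (\<Sum>k\<le>length w. F (take k w) *
        (\<Sum>i\<le>length (drop k w). H (take i (drop k w)) * K (drop i (drop k w))))" .
  qed
  show "1 * a = a"
  proof (transfer, rule ext)
    fix F :: "'a list \<Rightarrow> 'b" and w :: "'a list"
    have "(\<Sum>k\<le>length w. (if take k w = [] then 1 else 0) * F (drop k w))
        = (\<Sum>k\<le>length w. if k = 0 then F w else 0)"
      by (intro sum.cong refl) auto
    then show "(\<Sum>k\<le>length w. (if take k w = [] then 1 else 0) * F (drop k w)) = F w" by simp
  qed
  show "a * 1 = a"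
  proof (transfer, rule ext)
    fix F :: "'a list \<Rightarrow> 'b" and w :: "'a list"
    have "(\<Sum>k\<le>length w. F (take k w) * (if drop k w = [] then 1 else 0))
        = (\<Sum>k\<le>length w. if k = length w then F w else 0)"
      by (intro sum.cong refl) auto
    then show "(\<Sum>k\<le>length w. F (take k w) * (if drop k w = [] then 1 else 0)) = F w" by simp
  qed
  show "a + b + c = a + (b + c)" by transfer (simp add: add.assoc)
  show "a + b = b + a" by transfer (simp add: add.commute)
  show "0 + a = a" by transfer simp
  show "- a + a = 0" by transfer simp
  show "a - b = a + - b" by transfer simp
  show "(a + b) * c = a * c + b * c" by transfer (simp add: distrib_right sum.distrib)
  show "a * (b + c) = a * b + a * c" by transfer (simp add: distrib_left sum.distrib)
  show "(0::('a, 'b) ncps) \<noteq> 1" by transfer (metis zero_neq_one)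
qed

end

lift_definition nc_smult :: "'a::comm_ring_1 \<Rightarrow> ('v, 'a) ncps \<Rightarrow> ('v, 'a) ncps"
  is "\<lambda>c F w. c * F w" .

lift_definition nc_var :: "'v \<Rightarrow> ('v, 'a::comm_ring_1) ncps"
  is "\<lambda>v w. if w = [v] then 1 else 0" .

text \<open>For \<open>X\<close> without constant term, \<open>one_plus_power X q\<close> is the series
  \<open>(1 + X)^q = (\<Sum>r. padic_gchoose q r * X^r)\<close>: only the terms with \<open>r \<le> length w\<close> contribute to the
  coefficient of a word \<open>w\<close>.\<close>

definition one_plus_power ::
  "('v, 'p::prime_card padic_int) ncps \<Rightarrow> 'p padic_int \<Rightarrow> ('v, 'p padic_int) ncps" where
  "one_plus_power X q = Abs_ncps (\<lambda>w. \<Sum>r\<le>length w. padic_gchoose q r * nc_coeff (X ^ r) w)"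

section \<open>The presentation\<close>

datatype iw_var = U_var root | W_var root | V_var root

definition iw_vars :: "nat \<Rightarrow> iw_var set" where
  "iw_vars n = U_var ` neg_roots n \<union> W_var ` simple_roots n \<union> V_var ` pos_roots n"

type_synonym 'p nc_series = "(iw_var, 'p padic_int) ncps"

definition nc_algebra :: "nat \<Rightarrow> ('p::prime_card padic_int, 'p nc_series) module" where
  "nc_algebra n = \<lparr>
    carrier = {F. \<forall>w. nc_coeff F w \<noteq> 0 \<longrightarrow> set w \<subseteq> iw_vars n},
    monoid.mult = (*), one = 1, ring.zero = 0, ring.add = (+), module.smult = nc_smult\<rparr>"

definition nc_val :: "'p::prime_card nc_series \<Rightarrow> enat" where
  "nc_val F = (INF w. padic_val (nc_coeff F w) + enat (length w))"

definition nc_topology :: "nat \<Rightarrow> 'p::prime_card nc_series topology" where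
  "nc_topology n = topology (\<lambda>S. S \<subseteq> carrier (nc_algebra n) \<and>
    (\<forall>F\<in>S. \<exists>m. \<forall>H\<in>carrier (nc_algebra n). nc_val (H - F) \<ge> enat m \<longrightarrow> H \<in> S))"

lemma openin_nc_topology:
  fixes S :: "'p::prime_card nc_series set"
  shows "openin (nc_topology n) S \<longleftrightarrow> S \<subseteq> carrier (nc_algebra n) \<and>
    (\<forall>F\<in>S. \<exists>m. \<forall>H\<in>carrier (nc_algebra n). nc_val (H - F) \<ge> enat m \<longrightarrow> H \<in> S)"
proof -
  let ?P = "\<lambda>S :: 'p nc_series set. S \<subseteq> carrier (nc_algebra n) \<and>
    (\<forall>F\<in>S. \<exists>m. \<forall>H\<in>carrier (nc_algebra n). nc_val (H - F) \<ge> enat m \<longrightarrow> H \<in> S)"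
  have "istopology ?P"
    unfolding istopology_def
  proof (intro conjI allI impI)
    fix S T assume S: "?P S" and T: "?P T"
    have "\<exists>m. \<forall>H\<in>carrier (nc_algebra n). enat m \<le> nc_val (H - F) \<longrightarrow> H \<in> S \<inter> T" if "F \<in> S \<inter> T" for F
    proof -
      obtain k where k: "\<forall>H\<in>carrier (nc_algebra n). enat k \<le> nc_val (H - F) \<longrightarrow> H \<in> S"
        using S \<open>F \<in> S \<inter> T\<close> by blast
      obtain l where l: "\<forall>H\<in>carrier (nc_algebra n). enat l \<le> nc_val (H - F) \<longrightarrow> H \<in> T"
        using T \<open>F \<in> S \<inter> T\<close> by blast
      show ?thesis
      proof (rule exI[of _ "max k l"], intro ballI impI)
        fix H assume H: "H \<in> carrier (nc_algebra n)" "enat (max k l) \<le> nc_val (H - F)"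
        have "enat k \<le> enat (max k l)" "enat l \<le> enat (max k l)" by simp_all
        with H k l show "H \<in> S \<inter> T" by (meson IntI order_trans)
      qed
    qed
    then show "S \<inter> T \<subseteq> carrier (nc_algebra n)"
      and "\<forall>F\<in>S \<inter> T. \<exists>m. \<forall>H\<in>carrier (nc_algebra n). enat m \<le> nc_val (H - F) \<longrightarrow> H \<in> S \<inter> T"
      using S by blast+
  next
    fix K assume K: "\<forall>S\<in>K. ?P S"
    then show "\<Union>K \<subseteq> carrier (nc_algebra n)" by blast
    show "\<forall>F\<in>\<Union>K. \<exists>m. \<forall>H\<in>carrier (nc_algebra n). enat m \<le> nc_val (H - F) \<longrightarrow> H \<in> \<Union>K"
      using K by (meson UnionE UnionI)
  qed
  then show ?thesis unfolding nc_topology_def by (subst topology_inverse') simp_all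
qed

abbreviation U_ser :: "root \<Rightarrow> 'p::prime_card nc_series" (\<open>\<^bold>U\<close>) where
  "\<^bold>U \<beta> \<equiv> nc_var (U_var \<beta>)"
abbreviation W_ser :: "root \<Rightarrow> 'p::prime_card nc_series" (\<open>\<^bold>W\<close>) where
  "\<^bold>W \<delta> \<equiv> nc_var (W_var \<delta>)"
abbreviation V_ser :: "root \<Rightarrow> 'p::prime_card nc_series" (\<open>\<^bold>V\<close>) where
  "\<^bold>V \<alpha> \<equiv> nc_var (V_var \<alpha>)"

text \<open>\<open>iwasawa_relation n L R\<close> states that \<open>L = R\<close> is one of the fifteen families of relations.\<close>

inductive iwasawa_relation :: "nat \<Rightarrow> 'p::prime_card nc_series \<Rightarrow> 'p nc_series \<Rightarrow> bool" for n where
  rel1: "\<beta> \<in> neg_roots n \<Longrightarrow> \<delta> \<in> simple_roots n \<Longrightarrow>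
    iwasawa_relation n ((1 + \<^bold>W \<delta>) * (1 + \<^bold>U \<beta>))
      (one_plus_power (\<^bold>U \<beta>) (padic_powi (1 + padic_p) (root_pairing TYPE('p) n \<beta> \<delta>)) * (1 + \<^bold>W \<delta>))"
| rel2: "\<alpha> \<in> pos_roots n \<Longrightarrow> \<delta> \<in> simple_roots n \<Longrightarrow>
    iwasawa_relation n ((1 + \<^bold>W \<delta>) * (1 + \<^bold>V \<alpha>))
      (one_plus_power (\<^bold>V \<alpha>) (padic_powi (1 + padic_p) (root_pairing TYPE('p) n \<alpha> \<delta>)) * (1 + \<^bold>W \<delta>))"
| rel3: "\<alpha> \<in> pos_roots n \<Longrightarrow> \<beta> \<in> neg_roots n \<Longrightarrow> \<alpha> \<noteq> neg_root \<beta> \<Longrightarrow> \<not> sum_is_root n \<alpha> \<beta> \<Longrightarrow>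
    iwasawa_relation n (\<^bold>V \<alpha> * \<^bold>U \<beta>) (\<^bold>U \<beta> * \<^bold>V \<alpha>)"
| rel4: "\<alpha> = (i, j) \<Longrightarrow> \<beta> = (j, k) \<Longrightarrow> \<alpha> \<in> pos_roots n \<Longrightarrow> \<beta> \<in> neg_roots n \<Longrightarrow> i < k \<Longrightarrow>
    iwasawa_relation n ((1 + \<^bold>V \<alpha>) * (1 + \<^bold>U \<beta>))
      (one_plus_power (\<^bold>V (i, k)) padic_p * (1 + \<^bold>U \<beta>) * (1 + \<^bold>V \<alpha>))"
| rel5: "\<alpha> = (i, j) \<Longrightarrow> \<beta> = (j, k) \<Longrightarrow> \<alpha> \<in> pos_roots n \<Longrightarrow> \<beta> \<in> neg_roots n \<Longrightarrow> i > k \<Longrightarrow>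
    iwasawa_relation n ((1 + \<^bold>V \<alpha>) * (1 + \<^bold>U \<beta>))
      ((1 + \<^bold>U (i, k)) * (1 + \<^bold>U \<beta>) * (1 + \<^bold>V \<alpha>))"
| rel6: "\<alpha> = (i, j) \<Longrightarrow> \<beta> = (k, i) \<Longrightarrow> \<alpha> \<in> pos_roots n \<Longrightarrow> \<beta> \<in> neg_roots n \<Longrightarrow> k < j \<Longrightarrow>
    iwasawa_relation n ((1 + \<^bold>V \<alpha>) * (1 + \<^bold>U \<beta>))
      (one_plus_power (\<^bold>V (k, j)) (- padic_p) * (1 + \<^bold>U \<beta>) * (1 + \<^bold>V \<alpha>))"
| rel7: "\<alpha> = (i, j) \<Longrightarrow> \<beta> = (k, i) \<Longrightarrow> \<alpha> \<in> pos_roots n \<Longrightarrow> \<beta> \<in> neg_roots n \<Longrightarrow> k > j \<Longrightarrow>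
    iwasawa_relation n ((1 + \<^bold>V \<alpha>) * (1 + \<^bold>U \<beta>))
      (one_plus_power (\<^bold>U (k, j)) (- 1) * (1 + \<^bold>U \<beta>) * (1 + \<^bold>V \<alpha>))"
| rel8: "\<alpha> = (i, j) \<Longrightarrow> \<alpha> \<in> pos_roots n \<Longrightarrow>
    iwasawa_relation n ((1 + \<^bold>V \<alpha>) * (1 + \<^bold>U (neg_root \<alpha>)))
      (one_plus_power (\<^bold>U (neg_root \<alpha>)) (padic_powi (1 + padic_p) (- 1)) *
       prod_list (map (\<lambda>c. 1 + \<^bold>W (c, c + 1)) [i..<j]) *
       one_plus_power (\<^bold>V \<alpha>) (padic_powi (1 + padic_p) (- 1)))"
| rel9: "\<beta>1 \<in> neg_roots n \<Longrightarrow> \<beta>2 \<in> neg_roots n \<Longrightarrow> \<not> sum_is_root n \<beta>1 \<beta>2 \<Longrightarrow>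
    iwasawa_relation n (\<^bold>U \<beta>1 * \<^bold>U \<beta>2) (\<^bold>U \<beta>2 * \<^bold>U \<beta>1)"
| rel10: "\<beta>1 = (i, j) \<Longrightarrow> \<beta>2 = (j, k) \<Longrightarrow> \<beta>1 \<in> neg_roots n \<Longrightarrow> \<beta>2 \<in> neg_roots n \<Longrightarrow>
    iwasawa_relation n ((1 + \<^bold>U \<beta>1) * (1 + \<^bold>U \<beta>2))
      (one_plus_power (\<^bold>U (i, k)) padic_p * (1 + \<^bold>U \<beta>2) * (1 + \<^bold>U \<beta>1))"
| rel11: "\<beta>1 = (i, j) \<Longrightarrow> \<beta>2 = (k, i) \<Longrightarrow> \<beta>1 \<in> neg_roots n \<Longrightarrow> \<beta>2 \<in> neg_roots n \<Longrightarrow>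
    iwasawa_relation n ((1 + \<^bold>U \<beta>1) * (1 + \<^bold>U \<beta>2))
      (one_plus_power (\<^bold>U (k, j)) (- padic_p) * (1 + \<^bold>U \<beta>2) * (1 + \<^bold>U \<beta>1))"
| rel12: "\<delta>1 \<in> simple_roots n \<Longrightarrow> \<delta>2 \<in> simple_roots n \<Longrightarrow>
    iwasawa_relation n (\<^bold>W \<delta>1 * \<^bold>W \<delta>2) (\<^bold>W \<delta>2 * \<^bold>W \<delta>1)"
| rel13: "\<alpha>1 \<in> pos_roots n \<Longrightarrow> \<alpha>2 \<in> pos_roots n \<Longrightarrow> \<not> sum_is_root n \<alpha>1 \<alpha>2 \<Longrightarrow>
    iwasawa_relation n (\<^bold>V \<alpha>1 * \<^bold>V \<alpha>2) (\<^bold>V \<alpha>2 * \<^bold>V \<alpha>1)"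
| rel14: "\<alpha>1 = (i, j) \<Longrightarrow> \<alpha>2 = (j, k) \<Longrightarrow> \<alpha>1 \<in> pos_roots n \<Longrightarrow> \<alpha>2 \<in> pos_roots n \<Longrightarrow>
    iwasawa_relation n ((1 + \<^bold>V \<alpha>1) * (1 + \<^bold>V \<alpha>2))
      ((1 + \<^bold>V (i, k)) * (1 + \<^bold>V \<alpha>2) * (1 + \<^bold>V \<alpha>1))"
| rel15: "\<alpha>1 = (i, j) \<Longrightarrow> \<alpha>2 = (k, i) \<Longrightarrow> \<alpha>1 \<in> pos_roots n \<Longrightarrow> \<alpha>2 \<in> pos_roots n \<Longrightarrow>
    iwasawa_relation n ((1 + \<^bold>V \<alpha>2) * (1 + \<^bold>V \<alpha>1))
      ((1 + \<^bold>V (k, j)) * (1 + \<^bold>V \<alpha>1) * (1 + \<^bold>V \<alpha>2))"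

definition iwasawa_ideal :: "nat \<Rightarrow> 'p::prime_card nc_series set" where
  "iwasawa_ideal n = \<Inter>{I. ideal I (nc_algebra n) \<and> closedin (nc_topology n) I \<and>
    {L - R | L R. iwasawa_relation n L R} \<subseteq> I}"

text \<open>A function on the carrier is represented by its extension with value \<^const>\<open>undefined\<close>,
  so that it makes sense to speak of a unique map.\<close>

definition is_natural_map :: "nat \<Rightarrow> ('p::prime_card nc_series \<Rightarrow> 'p iwasawa) \<Rightarrow> bool" where
  "is_natural_map n \<phi> \<longleftrightarrow>
    \<phi> \<in> extensional (carrier (nc_algebra n)) \<and>
    \<phi> \<in> Ring.ring_hom (nc_algebra n) (iwasawa_algebra n) \<and>
    (\<forall>c. \<forall>F\<in>carrier (nc_algebra n).
      \<phi> (c \<odot>\<^bsub>nc_algebra n\<^esub> F) = c \<odot>\<^bsub>iwasawa_algebra n\<^esub> \<phi> F) \<and>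
    continuous_map (nc_topology n) (iwasawa_topology n) \<phi> \<and>
    (\<forall>\<beta>\<in>neg_roots n. \<phi> (\<^bold>U \<beta>) =
      iwasawa_of n (x_mat n \<beta> padic_p) \<ominus>\<^bsub>iwasawa_algebra n\<^esub> \<one>\<^bsub>iwasawa_algebra n\<^esub>) \<and>
    (\<forall>\<delta>\<in>simple_roots n. \<phi> (\<^bold>W \<delta>) =
      iwasawa_of n (h_mat n \<delta> (1 + padic_p)) \<ominus>\<^bsub>iwasawa_algebra n\<^esub> \<one>\<^bsub>iwasawa_algebra n\<^esub>) \<and>
    (\<forall>\<alpha>\<in>pos_roots n. \<phi> (\<^bold>V \<alpha>) =
      iwasawa_of n (x_mat n \<alpha> 1) \<ominus>\<^bsub>iwasawa_algebra n\<^esub> \<one>\<^bsub>iwasawa_algebra n\<^esub>)"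

definition quotient_topology :: "'a topology \<Rightarrow> ('a \<Rightarrow> 'b) \<Rightarrow> 'b topology" where
  "quotient_topology X q =
    topology (\<lambda>S. S \<subseteq> q ` topspace X \<and> openin X {x \<in> topspace X. q x \<in> S})"

lemma openin_quotient_topology:
  "openin (quotient_topology X q) S \<longleftrightarrow>
    S \<subseteq> q ` topspace X \<and> openin X {x \<in> topspace X. q x \<in> S}"
proof -
  have "istopology (\<lambda>S. S \<subseteq> q ` topspace X \<and> openin X {x \<in> topspace X. q x \<in> S})"
    unfolding istopology_def
  proof (intro conjI allI impI)
    fix S T
    assume "S \<subseteq> q ` topspace X \<and> openin X {x \<in> topspace X. q x \<in> S}"
      and "T \<subseteq> q ` topspace X \<and> openin X {x \<in> topspace X. q x \<in> T}"
    moreover have "{x \<in> topspace X. q x \<in> S \<inter> T} =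
        {x \<in> topspace X. q x \<in> S} \<inter> {x \<in> topspace X. q x \<in> T}" by blast
    ultimately show "S \<inter> T \<subseteq> q ` topspace X" "openin X {x \<in> topspace X. q x \<in> S \<inter> T}"
      by auto
  next
    fix K
    assume K: "\<forall>S\<in>K. S \<subseteq> q ` topspace X \<and> openin X {x \<in> topspace X. q x \<in> S}"
    then show "\<Union>K \<subseteq> q ` topspace X" by blast
    have "{x \<in> topspace X. q x \<in> \<Union>K} = (\<Union>S\<in>K. {x \<in> topspace X. q x \<in> S})" by blast
    with K show "openin X {x \<in> topspace X. q x \<in> \<Union>K}" by auto
  qed
  then show ?thesis unfolding quotient_topology_def by (subst topology_inverse') simp_all
qed

end

(* Both sides are compact, so everything is checked modulo the congruence subgroups. A series is mapped to the
   sum of its monomials, evaluated at the g - 1; the sum converges because the augmentation ideal of the group ring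
   of a finite p-group is nilpotent modulo powers of p. The image is everything: Gauss elimination writes each
   matrix as a product of one-parameter elements, and compactness passes to the limit. The relations hold in G,
   so R lies in the kernel. Conversely, give V_(i,j) the weight j - i, U_(i,j) the weight n - (i - j), and W and p
   the weight n. The relations express each commutator of two variables, up to higher weight, by single variables,
   so every series is congruent modulo R to a combination of ordered monomials. Such a combination in the kernel
   vanishes: the ordered group words with exponents below p^k are distinct modulo the k-th congruence subgroup
   (uniqueness of the LDU decomposition), so the ordered monomials are triangular with respect to them modulo p,
   and dividing by p repeatedly shows that all coefficients are 0. *)
theory Submission
  imports Defs "HOL-Analysis.Abstract_Topological_Spaces" "HOL-Library.Sublist"
begin

section \<open>The p-adic integers\<close>

text \<open>Weights come from matrices: p^a E_(i,j) has weight n a + j - i. This adds up under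
  multiplication and is positive on the deviation of every element of G from 1. The bound p > n + 1
  makes the relations linear to first order: in (1 + X)^q, with q congruent to 0 or 1 modulo p, the
  binomial coefficients with 2 <= r < p contribute a factor p of weight n, but for r >= p only X^r
  itself helps, and for X of weight 1 it must outweigh n + 1. Elsewhere the bound serves through p >
  2. A commutator may have single variables of its own weight as leading term, so sorting cannot
  proceed by weight alone; at constant weight the length drops. An exact ordered form exists only in
  the limit, which is why R has to be closed. The nilpotency behind convergence needs a filtration
  of G so fine that each step is central and cyclic of order 1 or p: then h - 1 commutes with all
  other differences and (h - 1)^p vanishes modulo p. For independence the leading word is a longest
  one with coefficient prime to p, because a product of factors g - 1 expands over subwords.\<close>

instance padic_int :: (prime_card) algebraic_semidom ..

section \<open>Residues, limits and units\<close>

lemma residue_eqI: "(\<And>k. residue x k = residue y k) \<Longrightarrow> x = y"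
  by (simp add: residue_inject[symmetric] fun_eq_iff)

lemma residue_bounds: "0 \<le> residue (x :: 'p::prime_card padic_int) k" "residue x k < int CARD('p) ^ k"
proof -
  have "residue x k = residue x k mod int CARD('p) ^ k"
    using residue_mod[of k k x] by simp
  moreover have "int CARD('p) ^ k > 0" using int_CARD_gt_1[where 'p='p] by simp
  ultimately show "0 \<le> residue x k" "residue x k < int CARD('p) ^ k"
    by (metis pos_mod_sign, metis pos_mod_bound)
qed

lemma residue_self_mod [simp]: "residue (x :: 'p::prime_card padic_int) k mod int CARD('p) ^ k = residue x k"
  using residue_mod[of k k x] by simp

lemma residue_power_p: "residue (padic_p ^ j :: 'p::prime_card padic_int) k = int CARD('p) ^ j mod int CARD('p) ^ k"
proof -
  have "(padic_p ^ j :: 'p padic_int) = of_nat (CARD('p) ^ j)" by (simp add: padic_p_def)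
  then show ?thesis by (metis residue_of_nat of_nat_power)
qed

lemma padic_p_nonzero [simp]: "(padic_p :: 'p::prime_card padic_int) \<noteq> 0"
  by (simp add: padic_p_def)

text \<open>Dividing by p^k is an index shift: the quotient has the residues
  \<open>residue x (j + k) div ?q ^ k\<close>, which are compatible because
  \<open>residue x k = 0\<close> makes every later residue divisible by p^k.\<close>

lemma power_dvd_iff_residue: "padic_p ^ k dvd (x :: 'p::prime_card padic_int) \<longleftrightarrow> residue x k = 0"
proof
  assume "padic_p ^ k dvd x"
  then obtain y where "x = padic_p ^ k * y" by blast
  then show "residue x k = 0" by (simp add: times_padic_int.rep_eq residue_power_p)
next
  assume 0: "residue x k = 0"
  let ?q = "int CARD('p)"
  have q: "?q > 0" by simp
  have d: "?q ^ k dvd residue x (j + k)" for j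
    using residue_mod[of k "j + k" x] 0 by (simp add: mod_eq_0_iff_dvd)
  define y :: "'p padic_int" where "y = Abs_padic_int (\<lambda>j. residue x (j + k) div ?q ^ k)"
  have "\<forall>j. residue x (Suc j + k) div ?q ^ k mod ?q ^ j = residue x (j + k) div ?q ^ k"
  proof
    fix j
    obtain a where a: "residue x (Suc j + k) = ?q ^ k * a" using d by blast
    have "residue x (j + k) = residue x (Suc j + k) mod ?q ^ (j + k)"
      by (rule residue_mod[symmetric]) simp
    also have "\<dots> = ?q ^ k * (a mod ?q ^ j)"
      by (simp only: a add.commute[of j k] power_add mult_mod_right)
    finally have "residue x (j + k) = ?q ^ k * (a mod ?q ^ j)" .
    with a q show "residue x (Suc j + k) div ?q ^ k mod ?q ^ j = residue x (j + k) div ?q ^ k" by simp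
  qed
  then have ry: "residue y = (\<lambda>j. residue x (j + k) div ?q ^ k)"
    unfolding y_def by (intro Abs_padic_int_inverse) simp
  have "x = padic_p ^ k * y"
  proof (rule residue_eqI)
    fix j
    have "residue (padic_p ^ k * y) j = (?q ^ k * (residue x (j + k) div ?q ^ k)) mod ?q ^ j"
      by (simp add: times_padic_int.rep_eq residue_power_p ry mod_simps)
    also have "\<dots> = residue x (j + k) mod ?q ^ j" using d[of j] by simp
    finally show "residue x j = residue (padic_p ^ k * y) j" by (simp add: residue_mod)
  qed
  then show "padic_p ^ k dvd x" by simp
qed

lemma power_dvd_diff_iff_residue:
  "padic_p ^ k dvd (x - y :: 'p::prime_card padic_int) \<longleftrightarrow> residue x k = residue y k"
  unfolding power_dvd_iff_residue minus_padic_int.rep_eq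
  by (metis mod_eq_0_iff_dvd mod_eq_dvd_iff residue_self_mod)

lemma padic_eqI:
  fixes x y :: "'p::prime_card padic_int"
  assumes "\<And>k. padic_p ^ k dvd x - y"
  shows "x = y"
  using assms by (intro residue_eqI) (simp add: power_dvd_diff_iff_residue)

lemma padic_approx_nat: "\<exists>m. padic_p ^ k dvd (x :: 'p::prime_card padic_int) - of_nat m"
  by (rule exI[of _ "nat (residue x k)"])
    (simp add: power_dvd_diff_iff_residue residue_of_nat residue_bounds del: of_nat_nat)

lemma not_p_dvd_1: "\<not> padic_p dvd (1 :: 'p::prime_card padic_int)"
  using power_dvd_iff_residue[of 1 "1 :: 'p padic_int"] int_CARD_gt_1[where 'p='p]
  by (simp add: one_padic_int.rep_eq)

lemma p_dvd_mult_iff: "padic_p dvd (x * y :: 'p::prime_card padic_int) \<longleftrightarrow> padic_p dvd x \<or> padic_p dvd y"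
  using power_dvd_iff_residue[of 1 "x * y"] power_dvd_iff_residue[of 1 x] power_dvd_iff_residue[of 1 y]
    prime_dvd_mult_iff[OF prime_card_int[where 'a='p], of "residue x 1" "residue y 1"]
    residue_self_mod[of x 1] residue_self_mod[of y 1]
  by (simp add: times_padic_int.rep_eq mod_eq_0_iff_dvd) (metis mod_eq_0_iff_dvd)

text \<open>Completeness with an explicit modulus of convergence \<open>L\<close>, which the limit
  inherits. Its k-th residue is read off at stage \<open>L k\<close>.\<close>

lemma padic_Cauchy_limit:
  fixes x :: "nat \<Rightarrow> 'p::prime_card padic_int"
  assumes "\<And>k m. m \<ge> L k \<Longrightarrow> padic_p ^ k dvd x m - x (L k)"
  shows "\<exists>y. \<forall>k. \<forall>m\<ge>L k. padic_p ^ k dvd y - x m"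
proof -
  have r: "residue (x m) k = residue (x (L k)) k" if "m \<ge> L k" for k m
    using assms[OF that] by (simp add: power_dvd_diff_iff_residue)
  define y :: "'p padic_int" where "y = Abs_padic_int (\<lambda>k. residue (x (L k)) k)"
  have "\<forall>k. residue (x (L (Suc k))) (Suc k) mod int CARD('p) ^ k = residue (x (L k)) k"
  proof
    fix k
    \<comment> \<open>\<open>L\<close> need not be monotone, hence the comparison at the maximum of
      the two stages.\<close>
    have "residue (x (L (Suc k))) (Suc k) = residue (x (max (L k) (L (Suc k)))) (Suc k)"
      using r[of "Suc k" "max (L k) (L (Suc k))"] by simp
    then have "residue (x (L (Suc k))) (Suc k) mod int CARD('p) ^ k = residue (x (max (L k) (L (Suc k)))) k"
      by (simp add: residue_Suc)
    then show "residue (x (L (Suc k))) (Suc k) mod int CARD('p) ^ k = residue (x (L k)) k"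
      using r[of k "max (L k) (L (Suc k))"] by simp
  qed
  then have "residue y = (\<lambda>k. residue (x (L k)) k)"
    unfolding y_def by (intro Abs_padic_int_inverse) simp
  then show ?thesis by (intro exI[of _ y] allI impI) (metis power_dvd_diff_iff_residue r)
qed

text \<open>An inverse modulo p from Bezout is improved one power of p at a time: if 1 - x y = p^k z
  and a inverts x modulo p, adding p^k z a to y multiplies the error by 1 - x a.\<close>

lemma padic_unit_iff: "(x :: 'p::prime_card padic_int) dvd 1 \<longleftrightarrow> \<not> padic_p dvd x"
proof
  show "x dvd 1 \<Longrightarrow> \<not> padic_p dvd x" using not_p_dvd_1 dvd_trans by blast
next
  assume np: "\<not> padic_p dvd x"
  have "\<exists>y. padic_p ^ k dvd 1 - x * y" for k
  proof (induction k)
    case (Suc k)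
    then obtain y z where y: "1 - x * y = padic_p ^ k * z" by blast
    have "coprime (residue x 1) (int CARD('p))"
      using np power_dvd_iff_residue[of 1 x] residue_bounds[of x 1] prime_imp_coprime[OF prime_card_int[where 'a='p], of "residue x 1"]
      by (metis coprime_commute dvd_imp_mod_0 power_one_right residue_self_mod)
    then obtain a b where ab: "a * residue x 1 + b * int CARD('p) = 1"
      by (metis bezout_int coprime_iff_gcd_eq_1)
    have "padic_p dvd x - of_nat (nat (residue x 1))"
      using power_dvd_diff_iff_residue[of 1 x "of_nat (nat (residue x 1))"] residue_self_mod[of x 1]
      by (simp add: residue_of_nat residue_bounds del: of_nat_nat)
    moreover define \<rho> :: "'p padic_int" where "\<rho> = of_int (residue x 1)"
    ultimately have "padic_p dvd x - \<rho>" using residue_bounds(1)[of x 1] by simp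
    then obtain c where c: "x = \<rho> + padic_p * c" by (auto simp: dvd_def algebra_simps)
    have "of_int a * \<rho> + of_int b * padic_p = 1"
      using arg_cong[OF ab, of "of_int :: int \<Rightarrow> 'p padic_int"] by (simp add: padic_p_def \<rho>_def)
    then have "1 - x * of_int a = of_int a * \<rho> + of_int b * padic_p - (\<rho> + padic_p * c) * of_int a"
      by (simp add: c)
    then have xa: "1 - x * of_int a = padic_p * (of_int b - c * of_int a)" by (simp add: algebra_simps)
    have "1 - x * (y + padic_p ^ k * z * of_int a) = (1 - x * y) - padic_p ^ k * z * (x * of_int a)"
      by (simp add: algebra_simps)
    also have "\<dots> = padic_p ^ k * z * (1 - x * of_int a)" by (simp only: y right_diff_distrib mult_1_right)
    also have "\<dots> = padic_p ^ Suc k * (z * (of_int b - c * of_int a))"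
      by (simp only: xa power_Suc2 mult_ac)
    finally have "padic_p ^ Suc k dvd 1 - x * (y + padic_p ^ k * z * of_int a)" by (metis dvd_triv_left)
    then show ?case by blast
  qed auto
  then obtain f where f: "\<And>k. padic_p ^ k dvd 1 - x * f k" by metis
  \<comment> \<open>Inverses modulo p^k are unique modulo p^k, so the approximations form a Cauchy
    sequence.\<close>
  have "padic_p ^ k dvd f m - f k" if "m \<ge> k" for m k
  proof -
    have "padic_p ^ k dvd 1 - x * f m" using f[of m] that by (meson dvd_trans le_imp_power_dvd)
    from dvd_diff[OF f[of k] this] have "padic_p ^ k dvd x * (f m - f k)" by (simp add: algebra_simps)
    then have "padic_p ^ k dvd f k * (x * (f m - f k)) + (1 - x * f k) * (f m - f k)"
      using f[of k] by (intro dvd_add) auto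
    then show ?thesis by (simp add: algebra_simps)
  qed
  from padic_Cauchy_limit[of "\<lambda>k. k" f, OF this] obtain y where y: "\<And>k m. m \<ge> k \<Longrightarrow> padic_p ^ k dvd y - f m" by auto
  have "1 = x * y"
  proof (rule padic_eqI)
    fix k
    have "padic_p ^ k dvd (1 - x * f k) - x * (y - f k)" by (rule dvd_diff[OF f dvd_mult[OF y]]) simp
    then show "padic_p ^ k dvd 1 - x * y" by (simp add: algebra_simps)
  qed
  then show "x dvd 1" by (rule dvdI)
qed

section \<open>Binomial coefficients with p-adic upper entry\<close>

lemma fact_dvd_p_power: "\<exists>v. (fact r :: 'p::prime_card padic_int) dvd padic_p ^ v"
proof (induction r)
  case 0
  show ?case by auto
next
  case (Suc r)
  have "\<exists>v. (of_nat m :: 'p padic_int) dvd padic_p ^ v" if "m > 0" for m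
    using that
  proof (induction m rule: less_induct)
    case (less m)
    show ?case
    proof (cases "CARD('p) dvd m")
      case True
      then obtain l where l: "m = CARD('p) * l" by blast
      then have "l < m" "l > 0" using less.prems int_CARD_gt_1[where 'p='p] by auto
      then obtain v where "(of_nat l :: 'p padic_int) dvd padic_p ^ v" using less.IH by blast
      then have "(of_nat m :: 'p padic_int) dvd padic_p ^ Suc v" by (simp add: l padic_p_def mult_dvd_mono)
      then show ?thesis ..
    next
      case False
      then have "residue (of_nat m :: 'p padic_int) 1 \<noteq> 0"
        by (simp add: residue_of_nat mod_eq_0_iff_dvd)
      then have "\<not> padic_p dvd (of_nat m :: 'p padic_int)" using power_dvd_iff_residue[of 1 "of_nat m :: 'p padic_int"] by simp
      then have "(of_nat m :: 'p padic_int) dvd padic_p ^ 0" by (simp add: padic_unit_iff)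
      then show ?thesis ..
    qed
  qed
  from this[of "Suc r"] obtain w where "(of_nat (Suc r) :: 'p padic_int) dvd padic_p ^ w" by auto
  moreover obtain v where "(fact r :: 'p padic_int) dvd padic_p ^ v" using Suc by blast
  ultimately have "(of_nat (Suc r) * fact r :: 'p padic_int) dvd padic_p ^ w * padic_p ^ v" by (intro mult_dvd_mono)
  then show ?case by (auto simp flip: power_add)
qed

lemma prod_diff_cong:
  fixes q m :: "'a::comm_ring_1"
  assumes "d dvd q - m"
  shows "d dvd (\<Prod>i=0..<r. q - of_nat i) - (\<Prod>i=0..<r. m - of_nat i)"
proof (induction r)
  case (Suc r)
  let ?P = "\<lambda>q :: 'a. \<Prod>i=0..<r. q - of_nat i"
  have "?P q * (q - of_nat r) - ?P m * (m - of_nat r) = (?P q - ?P m) * (q - of_nat r) + ?P m * (q - m)"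
    by (simp add: algebra_simps)
  then show ?case using Suc assms by simp
qed simp

lemma prod_of_nat_diff: "(\<Prod>i=0..<r. of_nat m - of_nat i :: 'a::{comm_ring_1,semiring_char_0}) = fact r * of_nat (m choose r)"
proof (induction r)
  case (Suc r)
  have "(of_nat m - of_nat r) * of_nat (m choose r) = (of_nat (Suc r) * of_nat (m choose Suc r) :: 'a)"
  proof (cases "r \<le> m")
    case True
    have "(m - r) * (m choose r) = Suc r * (m choose Suc r)"
      by (metis binomial_absorb_comp binomial_absorption diff_Suc_1 mult.commute)
    then show ?thesis using True by (metis of_nat_diff of_nat_mult)
  qed (simp add: not_le binomial_eq_0)
  then show ?case using Suc by (simp add: algebra_simps)
qed simp

text \<open>Shows that the division in \<open>padic_gchoose\<close> is exact. Modulo a power of p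
  divisible by r!, q agrees with a natural number m, and for m the product is r! times an ordinary
  binomial coefficient.\<close>

lemma fact_mult_gchoose: "fact r * padic_gchoose q r = (\<Prod>i=0..<r. q - of_nat i :: 'p::prime_card padic_int)"
proof -
  obtain v where v: "(fact r :: 'p padic_int) dvd padic_p ^ v" using fact_dvd_p_power by blast
  obtain m where m: "padic_p ^ v dvd q - of_nat m" using padic_approx_nat by blast
  have "(fact r :: 'p padic_int) dvd (\<Prod>i=0..<r. q - of_nat i) - (\<Prod>i=0..<r. of_nat m - of_nat i)"
    by (rule dvd_trans[OF v prod_diff_cong[OF m]])
  then have e: "fact r dvd (\<Prod>i=0..<r. q - of_nat i) - fact r * of_nat (m choose r)"
    by (simp only: prod_of_nat_diff)
  have "fact r dvd (\<Prod>i=0..<r. q - of_nat i)"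
    using dvd_add[OF e dvd_triv_left[of "fact r" "of_nat (m choose r)"]] by (simp only: diff_add_cancel)
  then obtain y where y: "(\<Prod>i=0..<r. q - of_nat i) = fact r * y" by (elim dvdE)
  show ?thesis
    unfolding padic_gchoose_def y by (simp only: nonzero_mult_div_cancel_left[OF fact_nonzero])
qed

lemma padic_gchoose_of_nat: "padic_gchoose (of_nat m) r = (of_nat (m choose r) :: 'p::prime_card padic_int)"
proof -
  have "fact r * padic_gchoose (of_nat m) r = fact r * (of_nat (m choose r) :: 'p padic_int)"
    unfolding fact_mult_gchoose prod_of_nat_diff ..
  then show ?thesis by (rule mult_left_cancel[OF fact_nonzero, THEN iffD1])
qed

lemma padic_gchoose_0 [simp]: "padic_gchoose q 0 = (1 :: 'p::prime_card padic_int)"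
  using fact_mult_gchoose[of 0 q] by simp

lemma padic_gchoose_1: "padic_gchoose q (Suc 0) = (q :: 'p::prime_card padic_int)"
  using fact_mult_gchoose[of "Suc 0" q] by simp

text \<open>Uniform continuity of the binomial coefficients with r <= R: dividing by r! costs at
  most v powers of p, where R! divides p^v.\<close>

lemma padic_gchoose_cong:
  "\<exists>K. \<forall>q m :: 'p::prime_card padic_int. padic_p ^ K dvd q - m \<longrightarrow>
     (\<forall>r\<le>R. padic_p ^ k dvd padic_gchoose q r - padic_gchoose m r)"
proof -
  obtain v where v: "(fact R :: 'p padic_int) dvd padic_p ^ v" using fact_dvd_p_power by blast
  have "padic_p ^ k dvd padic_gchoose q r - padic_gchoose m r"
    if qm: "padic_p ^ (v + k) dvd q - m" and rR: "r \<le> R" for q m :: "'p padic_int" and r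
  proof -
    have "(fact r :: 'p padic_int) dvd padic_p ^ v" 
    proof (rule dvd_trans[OF _ v])
      obtain c where "fact R = fact r * (c :: nat)" using fact_dvd[OF rR] by (elim dvdE)
      then have "(fact R :: 'p padic_int) = fact r * of_nat c" by (metis of_nat_fact of_nat_mult)
      then show "(fact r :: 'p padic_int) dvd fact R" by (simp only: dvd_triv_left)
    qed
    then obtain y where y: "padic_p ^ v = (fact r :: 'p padic_int) * y" by (elim dvdE)
    have "padic_p ^ (v + k) dvd fact r * (padic_gchoose q r - padic_gchoose m r)"
      using prod_diff_cong[OF qm] by (simp only: fact_mult_gchoose right_diff_distrib)
    then have "padic_p ^ v * padic_p ^ k dvd y * (fact r * (padic_gchoose q r - padic_gchoose m r))"
      by (simp only: power_add dvd_mult)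
    then have "padic_p ^ v * padic_p ^ k dvd padic_p ^ v * (padic_gchoose q r - padic_gchoose m r)"
      by (simp only: y mult.assoc mult.left_commute[of y])
    then show ?thesis by (simp only: dvd_mult_cancel_left power_eq_0_iff padic_p_nonzero simp_thms)
  qed
  then show ?thesis by blast
qed

lemma p_power_dvd_val: "enat m \<le> padic_val (x :: 'p::prime_card padic_int) \<longleftrightarrow> padic_p ^ m dvd x"
proof
  assume "padic_p ^ m dvd x"
  then show "enat m \<le> padic_val x" unfolding padic_val_def by (intro SUP_upper) simp
next
  assume le: "enat m \<le> padic_val x"
  show "padic_p ^ m dvd x"
  proof (rule ccontr)
    assume nd: "\<not> padic_p ^ m dvd x"
    have "enat k \<le> enat (m - 1)" if "padic_p ^ k dvd x" for k
    proof -
      have "\<not> m \<le> k" using nd that by (meson dvd_trans le_imp_power_dvd)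
      then show ?thesis by simp
    qed
    then have "padic_val x \<le> enat (m - 1)" unfolding padic_val_def by (intro SUP_least) simp
    with le have "m \<le> m - 1" by (metis enat_ord_simps(1) order_trans)
    then have "m = 0" by simp
    with nd show False by simp
  qed
qed

section \<open>Powers of 1 + p\<close>

lemma binomial_first_order:
  fixes p z :: "'a::comm_ring_1"
  shows "p ^ 2 dvd (1 + p * z) ^ i - (1 + of_nat i * (p * z))"
proof (induction i)
  case (Suc i)
  have "a * (1 + t) - (1 + (1 + c) * t) = (a - (1 + c * t)) * (1 + t) + t ^ 2 * c" for a c t :: 'a
    by (simp add: algebra_simps power2_eq_square)
  note eq = this[of "(1 + p * z) ^ i" "p * z" "of_nat i"]
  have d: "p ^ 2 dvd (p * z) ^ 2 * of_nat i" by (simp only: power_mult_distrib mult.assoc dvd_triv_left)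
  have "p ^ 2 dvd (1 + p * z) ^ i * (1 + p * z) - (1 + (1 + of_nat i) * (p * z))"
    unfolding eq using dvd_add[OF dvd_mult2[OF Suc] d] .
  then show ?case by (metis power_Suc2 of_nat_Suc)
qed simp

text \<open>Each further power of p in (1 + p)^m - 1 costs one factor p of m. Modulo p^2 the
  binomial theorem gives m = p l, and then the quotient of y^p - 1 by y - 1, for y = (1 + p)^l, is p
  times a unit, so l inherits the hypothesis with one power less.\<close>

lemma one_plus_p_power_dvd:
  assumes "CARD('p::prime_card) > 2"
  shows "padic_p ^ Suc k dvd ((1 + padic_p) ^ m - 1 :: 'p padic_int) \<Longrightarrow> CARD('p) ^ k dvd m"
proof (induction k arbitrary: m)
  case (Suc k)
  let ?p = "padic_p :: 'p padic_int"
  note cong = binomial_first_order[of ?p]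
  have "?p ^ 2 dvd (1 + ?p) ^ m - 1"
    using Suc.prems by (rule dvd_trans[rotated]) (rule le_imp_power_dvd, simp)
  have A: "(a - 1) - (a - (1 + x)) = x" for a x :: "'p padic_int" by simp
  have "?p ^ 2 dvd of_nat m * ?p"
    using dvd_diff[OF \<open>?p ^ 2 dvd (1 + ?p) ^ m - 1\<close> cong[of 1 m]] unfolding mult_1_right A .
  then have "?p * ?p dvd of_nat m * ?p" by (simp only: power2_eq_square)
  then have "?p dvd of_nat m" by simp
  then have "residue (of_nat m :: 'p padic_int) 1 = 0" using power_dvd_iff_residue[of 1 "of_nat m :: 'p padic_int"] by simp
  then have "int CARD('p) dvd int m" by (simp add: residue_of_nat mod_eq_0_iff_dvd)
  then obtain l where l: "m = CARD('p) * l" by auto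
  define y where "y = (1 + ?p) ^ l"
  have "?p dvd y - 1" unfolding y_def using dvd_diff[of "1 + ?p - 1"] power_diff_1_eq[of "1 + ?p" l] by simp
  then obtain z where z: "y = 1 + ?p * z" by (auto simp: dvd_def algebra_simps)
  have "?p ^ 2 dvd (\<Sum>i<CARD('p). y ^ i) - (\<Sum>i<CARD('p). 1 + of_nat i * (?p * z))"
    unfolding z sum_subtractf[symmetric] by (intro dvd_sum cong)
  moreover have "(\<Sum>i<CARD('p). 1 + of_nat i * (?p * z)) = ?p + of_nat (\<Sum>i<CARD('p). i) * (?p * z)"
    by (simp add: sum.distrib padic_p_def sum_distrib_right)
  \<comment> \<open>Here p odd is used: 0 + 1 + ... + (p - 1) is p times (p - 1) / 2.\<close>
  moreover have "?p dvd of_nat (\<Sum>i<CARD('p). i)"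
  proof -
    have "odd CARD('p)" using assms prime_odd_nat[OF prime_card[where 'a='p]] by simp
    then obtain c where c: "CARD('p) = 2 * c + 1" by (elim oddE)
    have "(\<Sum>i<2 * c + 1. i) = (2 * c + 1) * c" for c :: nat by (induction c) (auto simp: algebra_simps)
    then have "(\<Sum>i<CARD('p). i) = CARD('p) * c" using c by metis
    then show ?thesis by (simp add: padic_p_def)
  qed
  ultimately have "?p ^ 2 dvd (\<Sum>i<CARD('p). y ^ i) - ?p"
    by (smt (verit) add_diff_eq diff_add_cancel diff_diff_eq dvd_add dvd_mult dvd_triv_left mult_dvd_mono power2_eq_square)
  then obtain u where u: "(\<Sum>i<CARD('p). y ^ i) = ?p * (1 + ?p * u)"
    by (auto simp: dvd_def algebra_simps power2_eq_square)
  have "(1 + ?p) ^ m - 1 = y ^ CARD('p) - 1" by (simp add: y_def l power_mult mult.commute[of "CARD('p)"])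
  also have "\<dots> = (y - 1) * (?p * (1 + ?p * u))" by (simp only: power_diff_1_eq u)
  finally have "?p * ?p ^ Suc k dvd ?p * ((y - 1) * (1 + ?p * u))" using Suc.prems by (simp add: mult_ac)
  then have "?p ^ Suc k dvd (y - 1) * (1 + ?p * u)" by (simp del: power_Suc)
  moreover have "(1 + ?p * u) dvd 1" by (simp add: padic_unit_iff not_p_dvd_1 dvd_add_left_iff)
  ultimately have "?p ^ Suc k dvd y - 1" by (simp only: dvd_mult_unit_iff)
  then have "CARD('p) ^ k dvd l" unfolding y_def by (rule Suc.IH)
  then show ?case by (simp add: l)
qed simp

text \<open>For y congruent to 1 modulo p, the factor 1 + y + ... + y^(p-1) of y^p - 1 is a sum of p
  terms congruent to 1, hence divisible by p.\<close>

lemma one_plus_p_power_cong: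
  assumes "padic_p dvd (x - 1 :: 'p::prime_card padic_int)"
  shows "padic_p ^ Suc k dvd x ^ CARD('p) ^ k - 1"
proof (induction k)
  case (Suc k)
  define y where "y = x ^ CARD('p) ^ k"
  have y: "padic_p ^ Suc k dvd y - 1" using Suc by (simp add: y_def)
  then have y1: "padic_p dvd y - 1" by (meson dvd_trans dvd_power zero_less_Suc)
  have "padic_p dvd (\<Sum>i<CARD('p). y ^ i - 1) + of_nat CARD('p)"
  proof (intro dvd_add dvd_sum)
    fix i show "padic_p dvd y ^ i - 1" using y1 power_diff_1_eq[of y i] by simp
  qed (simp add: padic_p_def)
  then have "padic_p dvd (\<Sum>i<CARD('p). y ^ i)" by (simp add: sum_subtractf)
  then have "padic_p ^ Suc k * padic_p dvd (y - 1) * (\<Sum>i<CARD('p). y ^ i)" using y by (intro mult_dvd_mono)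
  also have "\<dots> = x ^ CARD('p) ^ Suc k - 1"
    unfolding power_diff_1_eq[symmetric] y_def by (simp only: power_mult[symmetric] power_Suc2)
  finally show ?case by (simp add: mult.commute)
qed (use assms in simp)

lemma one_plus_p_power_unit: "(1 + padic_p) ^ a dvd (1 :: 'p::prime_card padic_int)"
proof -
  have "(1 + padic_p) dvd (1 :: 'p padic_int)"
    unfolding padic_unit_iff using not_p_dvd_1[where 'p='p] by (simp add: dvd_add_left_iff)
  from dvd_power_same[OF this, of a] show ?thesis by (simp only: power_one)
qed

text \<open>By counting: the powers with exponent below p^k are distinct modulo p^(k+1), and there
  are just p^k residues modulo p^(k+1) that are congruent to 1 modulo p.\<close>

lemma one_plus_p_power_surj:
  assumes "CARD('p::prime_card) > 2" "padic_p dvd (u - 1 :: 'p padic_int)"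
  shows "\<exists>b. padic_p ^ Suc k dvd (1 + padic_p) ^ b - u"
proof -
  let ?q = "int CARD('p)"
  let ?f = "\<lambda>b. residue ((1 + padic_p) ^ b :: 'p padic_int) (Suc k)"
  define X where "X = (\<lambda>c. 1 + ?q * c) ` {0..<?q ^ k}"
  have r1: "residue x (Suc k) \<in> X" if "padic_p dvd (x - 1 :: 'p padic_int)" for x
  proof -
    have "residue x 1 = 1" using power_dvd_diff_iff_residue[of 1 x 1] that int_CARD_gt_1[where 'p='p]
      by (simp add: one_padic_int.rep_eq)
    then have "residue x (Suc k) mod ?q = 1" using residue_mod[of 1 "Suc k" x] by simp
    then have "residue x (Suc k) = 1 + ?q * (residue x (Suc k) div ?q)"
      by (metis add.commute mult.commute div_mult_mod_eq)
    moreover from calculation have "residue x (Suc k) div ?q < ?q ^ k"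
      using residue_bounds(2)[of x "Suc k"] int_CARD_gt_1[where 'p='p]
        mult_left_mono[of "?q ^ k" "residue x (Suc k) div ?q" ?q] by (simp only: power_Suc) linarith
    moreover have "0 \<le> residue x (Suc k) div ?q" 
      using residue_bounds(1)[of x "Suc k"] by (simp add: pos_imp_zdiv_nonneg_iff)
    ultimately show ?thesis unfolding X_def by (metis atLeastLessThan_iff image_eqI)
  qed
  have inj: "inj_on ?f {..<CARD('p) ^ k}"
  proof (rule linorder_inj_onI')
    fix a b assume ab: "a \<in> {..<CARD('p) ^ k}" "b \<in> {..<CARD('p) ^ k}" "a < b"
    show "?f a \<noteq> ?f b"
    proof
      assume "?f a = ?f b"
      then have "padic_p ^ Suc k dvd (1 + padic_p) ^ b - (1 + padic_p :: 'p padic_int) ^ a"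
        by (simp only: power_dvd_diff_iff_residue)
      also have "\<dots> = (1 + padic_p) ^ a * ((1 + padic_p) ^ (b - a) - 1)"
        using ab by (simp add: algebra_simps flip: power_add)
      finally have "padic_p ^ Suc k dvd ((1 + padic_p) ^ (b - a) - 1 :: 'p padic_int)"
        using dvd_mult_unit_iff'[OF one_plus_p_power_unit] by blast
      then have "CARD('p) ^ k dvd b - a" by (rule one_plus_p_power_dvd[OF assms(1)])
      then show False using ab by (auto dest: dvd_imp_le)
    qed
  qed
  have "?f ` {..<CARD('p) ^ k} \<subseteq> X"
  proof (intro image_subsetI r1)
    fix b show "padic_p dvd (1 + padic_p) ^ b - (1 :: 'p padic_int)" 
      using power_diff_1_eq[of "1 + padic_p :: 'p padic_int" b] by simp
  qed
  moreover have "card X = card (?f ` {..<CARD('p) ^ k})" 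
    unfolding X_def card_image[OF inj] by (subst card_image) (auto simp: inj_on_def nat_power_eq)
  moreover have "finite X" by (simp add: X_def)
  ultimately have "?f ` {..<CARD('p) ^ k} = X" by (simp add: card_subset_eq)
  with r1[OF assms(2)] obtain b where "residue u (Suc k) = ?f b" by auto
  then show ?thesis by (metis power_dvd_diff_iff_residue)
qed

section \<open>The algebra of non-commutative power series\<close>

lemma finite_iw_vars [simp]: "finite (iw_vars n)"
proof -
  have "finite (roots n)" by (rule finite_subset[of _ "{..<n} \<times> {..<n}"]) (auto simp: roots_def)
  then have "finite (neg_roots n)" "finite (pos_roots n)"
    by (auto intro: finite_subset simp: neg_roots_def pos_roots_def)
  moreover have "finite (simple_roots n)"
    by (rule finite_subset[of _ "{..<n} \<times> {..n}"]) (auto simp: simple_roots_def)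
  ultimately show ?thesis by (simp add: iw_vars_def)
qed

definition iw_words :: "nat \<Rightarrow> nat \<Rightarrow> iw_var list set" where
  "iw_words n m = {w. set w \<subseteq> iw_vars n \<and> length w < m}"

lemma finite_iw_words [simp]: "finite (iw_words n m)"
  unfolding iw_words_def
  by (rule finite_subset[OF _ finite_lists_length_le[OF finite_iw_vars[of n], of m]]) auto

lemma nc_algebra_simps:
  "monoid.mult (nc_algebra n) = (*)" "\<one>\<^bsub>nc_algebra n\<^esub> = 1" "\<zero>\<^bsub>nc_algebra n\<^esub> = 0"
  "ring.add (nc_algebra n) = (+)" "module.smult (nc_algebra n) = nc_smult"
  by (simp_all add: nc_algebra_def)

lemma mem_nc_algebra: "F \<in> carrier (nc_algebra n) \<longleftrightarrow> (\<forall>w. \<not> set w \<subseteq> iw_vars n \<longrightarrow> nc_coeff F w = 0)"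
  by (auto simp: nc_algebra_def)

lemma nc_algebra_closed:
  assumes "F \<in> carrier (nc_algebra n)" "H \<in> carrier (nc_algebra n)"
  shows "F + H \<in> carrier (nc_algebra n)" "F - H \<in> carrier (nc_algebra n)"
  using assms by (simp_all add: mem_nc_algebra plus_ncps.rep_eq minus_ncps.rep_eq)

lemma nc_algebra_closed1:
  assumes "F \<in> carrier (nc_algebra n)"
  shows "- F \<in> carrier (nc_algebra n)" "nc_smult c F \<in> carrier (nc_algebra n)"
  using assms by (simp_all add: mem_nc_algebra uminus_ncps.rep_eq nc_smult.rep_eq)

lemma nc_algebra_mult_closed:
  assumes "F \<in> carrier (nc_algebra n)" "H \<in> carrier (nc_algebra n)"
  shows "F * H \<in> carrier (nc_algebra n)"
  unfolding mem_nc_algebra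
proof (intro allI impI)
  fix w assume w: "\<not> set w \<subseteq> iw_vars n"
  have "nc_coeff F (take k w) * nc_coeff H (drop k w) = 0" for k
  proof -
    have "set w = set (take k w) \<union> set (drop k w)" by (metis append_take_drop_id set_append)
    then have "\<not> set (take k w) \<subseteq> iw_vars n \<or> \<not> set (drop k w) \<subseteq> iw_vars n" using w by blast
    then show ?thesis using assms unfolding mem_nc_algebra by (metis mult_zero_left mult_zero_right)
  qed
  then show "nc_coeff (F * H) w = 0" unfolding times_ncps.rep_eq by (intro sum.neutral) blast
qed

lemma nc_algebra_0_1: "0 \<in> carrier (nc_algebra n)" "1 \<in> carrier (nc_algebra n)"
  by (auto simp: mem_nc_algebra zero_ncps.rep_eq one_ncps.rep_eq)

lemma nc_var_closed: "x \<in> iw_vars n \<Longrightarrow> nc_var x \<in> carrier (nc_algebra n)"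
  by (auto simp: mem_nc_algebra nc_var.rep_eq)

lemma ring_nc_algebra: "ring (nc_algebra n :: ('p::prime_card padic_int, 'p nc_series) module)"
proof (rule ringI)
  show "abelian_group (nc_algebra n :: ('p padic_int, 'p nc_series) module)"
  proof (rule abelian_groupI)
    fix F :: "'p nc_series" assume F: "F \<in> carrier (nc_algebra n)"
    show "\<exists>y\<in>carrier (nc_algebra n). y \<oplus>\<^bsub>nc_algebra n\<^esub> F = \<zero>\<^bsub>nc_algebra n\<^esub>"
      by (rule bexI[of _ "- F"]) (simp_all add: nc_algebra_simps nc_algebra_closed1 F)
  qed (auto simp: nc_algebra_simps nc_algebra_closed nc_algebra_0_1 add_ac)
  show "Group.monoid (nc_algebra n :: ('p padic_int, 'p nc_series) module)"
    by (rule Group.monoidI) (auto simp: nc_algebra_simps nc_algebra_mult_closed nc_algebra_0_1 mult.assoc)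
qed (simp_all add: nc_algebra_simps distrib_left distrib_right)

section \<open>Topology and compactness of the power series ring\<close>

lemma nc_val_ge_iff:
  "enat m \<le> nc_val (F :: 'p::prime_card nc_series) \<longleftrightarrow> (\<forall>w. padic_p ^ (m - length w) dvd nc_coeff F w)"
proof -
  have "enat m \<le> x + enat l \<longleftrightarrow> enat (m - l) \<le> x" for x l by (cases x) auto
  then show ?thesis by (simp add: nc_val_def le_INF_iff p_power_dvd_val)
qed

lemma topspace_nc_topology [simp]: "topspace (nc_topology n) = carrier (nc_algebra n)"
proof -
  have "openin (nc_topology n) (carrier (nc_algebra n))" by (auto simp: openin_nc_topology)
  then show ?thesis by (meson openin_nc_topology openin_subset openin_topspace subset_antisym)
qed

lemma openin_nc_topology':
  "openin (nc_topology n) S \<longleftrightarrow> S \<subseteq> carrier (nc_algebra n) \<and>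
    (\<forall>F\<in>S. \<exists>m. \<forall>H\<in>carrier (nc_algebra n).
      (\<forall>w. padic_p ^ (m - length w) dvd nc_coeff H w - nc_coeff F w) \<longrightarrow> H \<in> S)"
  unfolding openin_nc_topology nc_val_ge_iff minus_ncps.rep_eq ..

text \<open>A series is the family of residues of its coefficients, so the ring is a continuous
  image of a closed subset of a product of finite discrete spaces, one for each word and
  exponent.\<close>

lemma compact_space_nc_topology: "compact_space (nc_topology n :: 'p::prime_card nc_series topology)"
proof -
  let ?q = "int CARD('p)"
  let ?S = "\<lambda>(w :: iw_var list, k). {0..<?q ^ k}"
  define X where "X = product_topology (\<lambda>i. discrete_topology (?S i)) UNIV"
  have tX: "topspace X = (\<Pi>\<^sub>E i\<in>UNIV. ?S i)" by (simp add: X_def)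
  have cX: "compact_space X"
    unfolding X_def compact_space_product_topology by (auto simp: compact_space_discrete_topology)
  have op: "openin X {x \<in> topspace X. x i = c}" for i c
  proof -
    have "continuous_map X (discrete_topology (?S i)) (\<lambda>x. x i)"
      unfolding X_def by (rule continuous_map_product_projection) simp
    from openin_continuous_map_preimage[OF this, of "{c} \<inter> ?S i"]
    have "openin X {x \<in> topspace X. x i \<in> {c} \<inter> ?S i}" by simp
    moreover have "{x \<in> topspace X. x i \<in> {c} \<inter> ?S i} = {x \<in> topspace X. x i = c}"
      unfolding tX by auto
    ultimately show ?thesis by simp
  qed
  \<comment> \<open>The compatible families. Each condition involves two coordinates only, so the
    complement is a union of basic open sets.\<close>
  define K where "K = {x \<in> topspace X. \<forall>w k. x (w, Suc k) mod ?q ^ k = x (w, k)}"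
  have "topspace X - K = (\<Union>(w, k, a, b) \<in> {(w, k, a, b). a mod ?q ^ k \<noteq> b}.
      {x \<in> topspace X. x (w, Suc k) = a} \<inter> {x \<in> topspace X. x (w, k) = b})"
    unfolding K_def by auto
  also have "openin X \<dots>" using op by (intro openin_Union) auto
  finally have "closedin X K" by (auto simp: closedin_def K_def)
  then have cK: "compactin X K" by (rule closedin_compact_space[OF cX])
  have KX: "K \<subseteq> topspace X" by (auto simp: K_def)
  define g :: "(iw_var list \<times> nat \<Rightarrow> int) \<Rightarrow> 'p nc_series" where
    "g x = Abs_ncps (\<lambda>w. if set w \<subseteq> iw_vars n then Abs_padic_int (\<lambda>k. x (w, k)) else 0)" for x
  have cg: "nc_coeff (g x) w = (if set w \<subseteq> iw_vars n then Abs_padic_int (\<lambda>k. x (w, k)) else 0)" for x w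
    by (simp add: g_def Abs_ncps_inverse)
  have res: "residue (Abs_padic_int (\<lambda>k. x (w, k)) :: 'p padic_int) k = x (w, k)" if "x \<in> K" for x w k
    using that by (subst Abs_padic_int_inverse) (auto simp: K_def)
  have gc: "g x \<in> carrier (nc_algebra n)" for x by (simp add: mem_nc_algebra cg)
  have "continuous_map (subtopology X K) (nc_topology n) g"
    unfolding continuous_map_def
  proof (intro conjI allI impI)
    show "g \<in> topspace (subtopology X K) \<rightarrow> topspace (nc_topology n)" using gc by simp
    fix U :: "'p nc_series set" assume U: "openin (nc_topology n) U"
    show "openin (subtopology X K) {x \<in> topspace (subtopology X K). g x \<in> U}"
    proof (subst openin_subopen, intro ballI)
      fix x assume "x \<in> {x \<in> topspace (subtopology X K). g x \<in> U}"
      then have x: "x \<in> K" "x \<in> topspace X" "g x \<in> U" by auto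
      obtain m where m: "\<And>H. H \<in> carrier (nc_algebra n) \<Longrightarrow>
          (\<forall>w. padic_p ^ (m - length w) dvd nc_coeff H w - nc_coeff (g x) w) \<Longrightarrow> H \<in> U"
        using U x(3) unfolding openin_nc_topology' by blast
      \<comment> \<open>Valuation at least m restricts only the coefficients of words shorter than
        m, and these only modulo p^m: finitely many coordinates.\<close>
      define T where "T = topspace X \<inter> (\<Inter>w\<in>iw_words n m. {y \<in> topspace X. y (w, m) = x (w, m)})"
      have oT: "openin X T" unfolding T_def Int_commute[of "topspace X"] by (rule openin_INT) (auto intro: op)
      have "g y \<in> U" if y: "y \<in> T \<inter> K" for y
      proof (rule m[OF gc], rule allI)
        fix w
        show "padic_p ^ (m - length w) dvd nc_coeff (g y) w - nc_coeff (g x) w"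
        proof (cases "w \<in> iw_words n m")
          case True
          then have "y (w, m) = x (w, m)" using y by (auto simp: T_def)
          then have "padic_p ^ m dvd nc_coeff (g y) w - nc_coeff (g x) w"
            using y x True by (simp add: power_dvd_diff_iff_residue cg res iw_words_def)
          then show ?thesis by (meson diff_le_self dvd_trans le_imp_power_dvd)
        qed (auto simp: iw_words_def cg)
      qed
      moreover have "x \<in> T \<inter> K" using x by (simp add: T_def)
      ultimately have "x \<in> T \<inter> K" "T \<inter> K \<subseteq> {x \<in> topspace (subtopology X K). g x \<in> U}"
        using KX by (simp_all add: subset_iff)
      moreover have "openin (subtopology X K) (T \<inter> K)" using oT by (auto simp: openin_subtopology)
      ultimately show "\<exists>T. openin (subtopology X K) T \<and> x \<in> T \<and> T \<subseteq> {x \<in> topspace (subtopology X K). g x \<in> U}"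
        by blast
    qed
  qed
  moreover have "compactin (subtopology X K) K" using cK by (simp add: compactin_subtopology)
  ultimately have "compactin (nc_topology n) (g ` K)" by (rule image_compactin[rotated])
  moreover have "g ` K = carrier (nc_algebra n)"
  proof (intro equalityI subsetI)
    fix F :: "'p nc_series" assume F: "F \<in> carrier (nc_algebra n)"
    define x where "x = (\<lambda>(w, k). residue (nc_coeff F w) k)"
    have "x \<in> K" unfolding K_def tX using residue_bounds residue_Suc by (auto simp: x_def)
    moreover have "nc_coeff F w = nc_coeff (g x) w" for w
      using F by (auto simp: cg x_def residue_inverse mem_nc_algebra)
    then have "F = g x" by (simp add: nc_coeff_inject[symmetric] fun_eq_iff)
    ultimately show "F \<in> g ` K" by blast
  qed (use gc in auto)
  ultimately show ?thesis by (simp add: compact_space_def)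
qed

lemma open_padic_cong: "open {y :: 'p::prime_card padic_int. padic_p ^ k dvd y - x}"
  unfolding open_padic_int_def
proof (intro ballI exI[of _ k] allI impI)
  fix y z assume "y \<in> {y :: 'p padic_int. padic_p ^ k dvd y - x}" "padic_p ^ k dvd z - y"
  then have "padic_p ^ k dvd (z - y) + (y - x)" by (intro dvd_add) auto
  then show "z \<in> {y. padic_p ^ k dvd y - x}" by simp
qed

instance padic_int :: (prime_card) t2_space
proof
  fix x y :: "'a padic_int" assume "x \<noteq> y"
  then obtain k where k: "\<not> padic_p ^ k dvd x - y" using padic_eqI by blast
  let ?U = "\<lambda>x :: 'a padic_int. {z. padic_p ^ k dvd z - x}"
  have "padic_p ^ k dvd x - y" if "padic_p ^ k dvd z - x" "padic_p ^ k dvd z - y" for z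
    using dvd_diff[OF that(2,1)] by simp
  then have "?U x \<inter> ?U y = {}" using k by blast
  then show "\<exists>U V. open U \<and> open V \<and> x \<in> U \<and> y \<in> V \<and> U \<inter> V = {}"
    by (intro exI[of _ "?U x"] exI[of _ "?U y"]) (simp add: open_padic_cong)
qed

section \<open>Group rings of finite groups\<close>

lemma group_ring_simps:
  "\<one>\<^bsub>group_ring H\<^esub> = (\<lambda>z. if z = \<one>\<^bsub>H\<^esub> then 1 else 0)" "\<zero>\<^bsub>group_ring H\<^esub> = (\<lambda>_. 0)"
  "ring.add (group_ring H) = (\<lambda>f g z. f z + g z)" "module.smult (group_ring H) = (\<lambda>c f z. c * f z)"
  by (simp_all add: group_ring_def)

lemma mem_group_ring:
  assumes "finite (carrier H)"
  shows "f \<in> carrier (group_ring H) \<longleftrightarrow> (\<forall>x. x \<notin> carrier H \<longrightarrow> f x = 0)"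
  using assms unfolding group_ring_def by (auto intro: finite_subset)

definition gr_basis :: "'g \<Rightarrow> 'g \<Rightarrow> 'p::prime_card padic_int" where
  "gr_basis g = (\<lambda>z. if z = g then 1 else 0)"

lemma group_ring_map_eq:
  assumes "finite (carrier H)" "f \<in> carrier (group_ring H)"
  shows "group_ring_map q f z = (\<Sum>x\<in>carrier H. if q x = z then f x else 0)"
proof -
  have "(\<Sum>x\<in>{x. f x \<noteq> 0 \<and> q x = z}. f x) = (\<Sum>x\<in>{x\<in>carrier H. q x = z}. f x)"
    using assms by (intro sum.mono_neutral_left) (auto simp: mem_group_ring)
  also have "\<dots> = (\<Sum>x\<in>carrier H. if q x = z then f x else 0)" using assms(1) by (rule sum.inter_filter)
  finally show ?thesis by (simp add: group_ring_map_def)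
qed

locale finite_group = group H for H :: "('g, 'x) monoid_scheme" (structure) +
  assumes fin: "finite (carrier H)"
begin

text \<open>The sum over factorizations of z becomes a convolution over the whole group, a form
  independent of the supports of f and g.\<close>

lemma group_ring_mult:
  assumes "f \<in> carrier (group_ring H)" "g \<in> carrier (group_ring H)"
  shows "(f \<otimes>\<^bsub>group_ring H\<^esub> g) z = (if z \<in> carrier H then \<Sum>x\<in>carrier H. f x * g (inv x \<otimes> z) else 0)"
proof -
  let ?S = "{(x, y). f x \<noteq> 0 \<and> g y \<noteq> 0 \<and> x \<otimes> y = z}"
  have f: "x \<in> carrier H" if "f x \<noteq> 0" for x using assms(1) that fin by (auto simp: mem_group_ring)
  have g: "x \<in> carrier H" if "g x \<noteq> 0" for x using assms(2) that fin by (auto simp: mem_group_ring)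
  have m: "(f \<otimes>\<^bsub>group_ring H\<^esub> g) z = (\<Sum>(x, y)\<in>?S. f x * g y)" by (simp add: group_ring_def)
  show ?thesis
  proof (cases "z \<in> carrier H")
    case False
    then have "?S = {}" using f g by auto
    then show ?thesis unfolding m using False by (simp only: sum.empty if_False)
  next
    case True
    have inv1: "inv x \<otimes> (x \<otimes> y) = y" if "x \<in> carrier H" "y \<in> carrier H" for x y
      using that by (simp add: m_assoc[symmetric])
    have inv2: "x \<otimes> (inv x \<otimes> z) = z" if "x \<in> carrier H" for x
      using that True by (simp add: m_assoc[symmetric])
    have "(\<Sum>(x, y)\<in>?S. f x * g y) = (\<Sum>x\<in>{x \<in> carrier H. f x \<noteq> 0 \<and> g (inv x \<otimes> z) \<noteq> 0}. f x * g (inv x \<otimes> z))"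
      by (rule sum.reindex_bij_witness[of _ "\<lambda>x. (x, inv x \<otimes> z)" fst]) (auto simp: inv1 inv2 f g)
    also have "\<dots> = (\<Sum>x\<in>carrier H. f x * g (inv x \<otimes> z))"
      using fin by (intro sum.mono_neutral_left) auto
    finally show ?thesis using m True by simp
  qed
qed

lemma group_ring_closed:
  assumes "f \<in> carrier (group_ring H)" "g \<in> carrier (group_ring H)"
  shows "f \<otimes>\<^bsub>group_ring H\<^esub> g \<in> carrier (group_ring H)"
    "f \<oplus>\<^bsub>group_ring H\<^esub> g \<in> carrier (group_ring H)"
    "c \<odot>\<^bsub>group_ring H\<^esub> f \<in> carrier (group_ring H)"
    "\<one>\<^bsub>group_ring H\<^esub> \<in> carrier (group_ring H)" "\<zero>\<^bsub>group_ring H\<^esub> \<in> carrier (group_ring H)"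
  using assms by (auto simp: mem_group_ring[OF fin] group_ring_mult group_ring_simps)

lemma gr_basis_closed: "x \<in> carrier H \<Longrightarrow> gr_basis x \<in> carrier (group_ring H)"
  by (auto simp: mem_group_ring[OF fin] gr_basis_def)

text \<open>Right multiplication by a group element translates the argument by its inverse. Products
  of elements g - 1 therefore act on functions as iterated differences.\<close>

lemma group_ring_mult_basis:
  assumes f: "f \<in> carrier (group_ring H)" and g: "g \<in> carrier H"
  shows "(f \<otimes>\<^bsub>group_ring H\<^esub> gr_basis g) z = (if z \<in> carrier H then f (z \<otimes> inv g) else 0)"
proof (cases "z \<in> carrier H")
  case True
  have "inv x \<otimes> z = g \<longleftrightarrow> x = z \<otimes> inv g" if x: "x \<in> carrier H" for x
  proof
    assume e: "inv x \<otimes> z = g"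
    have "z = x \<otimes> (inv x \<otimes> z)" using x True by (simp add: m_assoc[symmetric])
    then have "z = x \<otimes> g" using e by simp
    then show "x = z \<otimes> inv g" using x g by (simp add: m_assoc)
  next
    assume e: "x = z \<otimes> inv g"
    then show "inv x \<otimes> z = g" using g True by (simp add: inv_mult_group m_assoc)
  qed
  then have "(\<Sum>x\<in>carrier H. f x * gr_basis g (inv x \<otimes> z)) = (\<Sum>x\<in>carrier H. if x = z \<otimes> inv g then f x else 0)"
    by (intro sum.cong refl) (simp add: gr_basis_def)
  also have "\<dots> = f (z \<otimes> inv g)" using True g by (simp add: sum.delta[OF fin])
  finally show ?thesis using True f g by (simp add: group_ring_mult gr_basis_closed)
qed (use f g in \<open>simp add: group_ring_mult gr_basis_closed\<close>)

lemma sum_translate: "y \<in> carrier H \<Longrightarrow> (\<Sum>x\<in>carrier H. f x) = (\<Sum>x\<in>carrier H. f (y \<otimes> x))"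
  by (rule sum.reindex_bij_witness[of _ "\<lambda>x. y \<otimes> x" "\<lambda>x. inv y \<otimes> x"]) (simp_all add: m_assoc[symmetric])

lemma ring_group_ring: "ring (group_ring H :: ('p::prime_card padic_int, 'g \<Rightarrow> 'p padic_int) module)"
proof (rule ringI)
  show "abelian_group (group_ring H :: ('p padic_int, 'g \<Rightarrow> 'p padic_int) module)"
  proof (rule abelian_groupI)
    fix f :: "'g \<Rightarrow> 'p padic_int" assume f: "f \<in> carrier (group_ring H)"
    show "\<exists>y\<in>carrier (group_ring H). y \<oplus>\<^bsub>group_ring H\<^esub> f = \<zero>\<^bsub>group_ring H\<^esub>"
      by (rule bexI[of _ "\<lambda>z. - f z"]) (use f in \<open>simp_all add: group_ring_simps mem_group_ring[OF fin]\<close>)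
  qed (auto simp: group_ring_simps add_ac mem_group_ring[OF fin])
  show "Group.monoid (group_ring H :: ('p padic_int, 'g \<Rightarrow> 'p padic_int) module)"
  proof (rule Group.monoidI)
    fix f g h :: "'g \<Rightarrow> 'p padic_int"
    assume c: "f \<in> carrier (group_ring H)" "g \<in> carrier (group_ring H)" "h \<in> carrier (group_ring H)"
    show "f \<otimes>\<^bsub>group_ring H\<^esub> g \<otimes>\<^bsub>group_ring H\<^esub> h = f \<otimes>\<^bsub>group_ring H\<^esub> (g \<otimes>\<^bsub>group_ring H\<^esub> h)"
    proof
      fix z
      show "(f \<otimes>\<^bsub>group_ring H\<^esub> g \<otimes>\<^bsub>group_ring H\<^esub> h) z = (f \<otimes>\<^bsub>group_ring H\<^esub> (g \<otimes>\<^bsub>group_ring H\<^esub> h)) z"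
      proof (cases "z \<in> carrier H")
        case z: True
        have "(\<Sum>x\<in>carrier H. (\<Sum>y\<in>carrier H. f y * g (inv y \<otimes> x)) * h (inv x \<otimes> z))
            = (\<Sum>y\<in>carrier H. \<Sum>x\<in>carrier H. f y * g (inv y \<otimes> x) * h (inv x \<otimes> z))"
          unfolding sum_distrib_right by (rule sum.swap)
        also have "\<dots> = (\<Sum>y\<in>carrier H. \<Sum>x\<in>carrier H. f y * g x * h (inv x \<otimes> (inv y \<otimes> z)))"
        proof (rule sum.cong[OF refl])
          fix y assume y: "y \<in> carrier H"
          show "(\<Sum>x\<in>carrier H. f y * g (inv y \<otimes> x) * h (inv x \<otimes> z)) = (\<Sum>x\<in>carrier H. f y * g x * h (inv x \<otimes> (inv y \<otimes> z)))"
            by (subst sum_translate[OF y], rule sum.cong[OF refl])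
              (use y z in \<open>simp add: m_assoc[symmetric] inv_mult_group\<close>)
        qed
        also have "\<dots> = (\<Sum>y\<in>carrier H. f y * (\<Sum>x\<in>carrier H. g x * h (inv x \<otimes> (inv y \<otimes> z))))"
          by (simp add: sum_distrib_left mult.assoc)
        finally show ?thesis using c z by (simp add: group_ring_mult group_ring_closed)
      qed (use c in \<open>simp add: group_ring_mult group_ring_closed\<close>)
    qed
  next
    fix f :: "'g \<Rightarrow> 'p padic_int" assume f: "f \<in> carrier (group_ring H)"
    have o: "\<one>\<^bsub>group_ring H\<^esub> = gr_basis \<one>" by (simp add: group_ring_simps gr_basis_def)
    show "f \<otimes>\<^bsub>group_ring H\<^esub> \<one>\<^bsub>group_ring H\<^esub> = f"
    proof
      fix z show "(f \<otimes>\<^bsub>group_ring H\<^esub> \<one>\<^bsub>group_ring H\<^esub>) z = f z"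
        unfolding o group_ring_mult_basis[OF f one_closed] using f by (auto simp: mem_group_ring[OF fin])
    qed
    show "\<one>\<^bsub>group_ring H\<^esub> \<otimes>\<^bsub>group_ring H\<^esub> f = f"
    proof
      fix z
      have "(\<Sum>x\<in>carrier H. gr_basis \<one> x * f (inv x \<otimes> z)) = f z" if z: "z \<in> carrier H"
      proof -
        have "(\<Sum>x\<in>carrier H. gr_basis \<one> x * f (inv x \<otimes> z)) = (\<Sum>x\<in>carrier H. if x = \<one> then f z else 0)"
          using z by (intro sum.cong refl) (simp add: gr_basis_def)
        then show ?thesis by (simp add: sum.delta[OF fin])
      qed
      then show "(\<one>\<^bsub>group_ring H\<^esub> \<otimes>\<^bsub>group_ring H\<^esub> f) z = f z"
        using f unfolding o by (simp add: group_ring_mult gr_basis_closed) (auto simp: mem_group_ring[OF fin])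
    qed
  qed (use fin in \<open>auto simp: group_ring_closed mem_group_ring group_ring_simps group_ring_mult\<close>)
next
  fix f g h :: "'g \<Rightarrow> 'p padic_int"
  assume c: "f \<in> carrier (group_ring H)" "g \<in> carrier (group_ring H)" "h \<in> carrier (group_ring H)"
  show "(f \<oplus>\<^bsub>group_ring H\<^esub> g) \<otimes>\<^bsub>group_ring H\<^esub> h
      = (f \<otimes>\<^bsub>group_ring H\<^esub> h) \<oplus>\<^bsub>group_ring H\<^esub> (g \<otimes>\<^bsub>group_ring H\<^esub> h)"
    by (rule ext, subst group_ring_mult[OF group_ring_closed(2)[OF c(1,2)] c(3)])
      (simp add: group_ring_simps(3) group_ring_mult c distrib_right sum.distrib)
  show "h \<otimes>\<^bsub>group_ring H\<^esub> (f \<oplus>\<^bsub>group_ring H\<^esub> g)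
      = (h \<otimes>\<^bsub>group_ring H\<^esub> f) \<oplus>\<^bsub>group_ring H\<^esub> (h \<otimes>\<^bsub>group_ring H\<^esub> g)"
    by (rule ext, subst group_ring_mult[OF c(3) group_ring_closed(2)[OF c(1,2)]])
      (simp add: group_ring_simps(3) group_ring_mult c distrib_left sum.distrib)
qed

text \<open>Translating the inner sum by x turns the condition q u = z into one on q v alone; the
  outer sum is then grouped by the fibres of q.\<close>

lemma group_ring_map_mult:
  assumes Q: "finite_group Q" and q: "q \<in> hom H Q"
    and c: "f \<in> carrier (group_ring H)" "g \<in> carrier (group_ring H)"
  shows "group_ring_map q (f \<otimes>\<^bsub>group_ring H\<^esub> g) = group_ring_map q f \<otimes>\<^bsub>group_ring Q\<^esub> group_ring_map q g"
proof
  fix z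
  interpret Q: finite_group Q by (rule Q)
  interpret q: group_hom H Q q by unfold_locales (rule q)
  have m: "group_ring_map q f \<in> carrier (group_ring Q)" if "f \<in> carrier (group_ring H)" for f
    unfolding mem_group_ring[OF Q.fin] group_ring_map_eq[OF fin that]
    by (intro allI impI sum.neutral) auto
  show "group_ring_map q (f \<otimes>\<^bsub>group_ring H\<^esub> g) z = (group_ring_map q f \<otimes>\<^bsub>group_ring Q\<^esub> group_ring_map q g) z"
  proof (cases "z \<in> carrier Q")
    case z: True
    have "group_ring_map q (f \<otimes>\<^bsub>group_ring H\<^esub> g) z
        = (\<Sum>u\<in>carrier H. \<Sum>x\<in>carrier H. if q u = z then f x * g (inv x \<otimes> u) else 0)"
      using c by (auto simp: group_ring_map_eq[OF fin] group_ring_closed group_ring_mult intro!: sum.cong)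
    also have "\<dots> = (\<Sum>x\<in>carrier H. \<Sum>u\<in>carrier H. if q u = z then f x * g (inv x \<otimes> u) else 0)" by (rule sum.swap)
    also have "\<dots> = (\<Sum>x\<in>carrier H. \<Sum>v\<in>carrier H. if q v = inv\<^bsub>Q\<^esub> (q x) \<otimes>\<^bsub>Q\<^esub> z then f x * g v else 0)"
    proof (rule sum.cong[OF refl])
      fix x assume x: "x \<in> carrier H"
      have "q x \<otimes>\<^bsub>Q\<^esub> q v = z \<longleftrightarrow> q v = inv\<^bsub>Q\<^esub> (q x) \<otimes>\<^bsub>Q\<^esub> z" if v: "v \<in> carrier H" for v
      proof
        assume "q x \<otimes>\<^bsub>Q\<^esub> q v = z"
        then show "q v = inv\<^bsub>Q\<^esub> (q x) \<otimes>\<^bsub>Q\<^esub> z" using x v by (auto simp: Q.m_assoc[symmetric] simp del: q.hom_inv)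
      next
        assume "q v = inv\<^bsub>Q\<^esub> (q x) \<otimes>\<^bsub>Q\<^esub> z"
        then show "q x \<otimes>\<^bsub>Q\<^esub> q v = z" using x v z by (simp add: Q.m_assoc[symmetric])
      qed
      then show "(\<Sum>u\<in>carrier H. if q u = z then f x * g (inv x \<otimes> u) else 0)
          = (\<Sum>v\<in>carrier H. if q v = inv\<^bsub>Q\<^esub> (q x) \<otimes>\<^bsub>Q\<^esub> z then f x * g v else 0)"
        by (subst sum_translate[OF x], intro sum.cong refl) (use x in \<open>simp add: m_assoc[symmetric]\<close>)
    qed
    also have "\<dots> = (\<Sum>x\<in>carrier H. f x * group_ring_map q g (inv\<^bsub>Q\<^esub> (q x) \<otimes>\<^bsub>Q\<^esub> z))"
      using c by (auto simp: group_ring_map_eq[OF fin] sum_distrib_left intro!: sum.cong)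
    also have "\<dots> = (\<Sum>x\<in>carrier H. \<Sum>y\<in>carrier Q. if q x = y then f x * group_ring_map q g (inv\<^bsub>Q\<^esub> y \<otimes>\<^bsub>Q\<^esub> z) else 0)"
      by (intro sum.cong refl) (simp add: sum.delta'[OF Q.fin])
    also have "\<dots> = (\<Sum>y\<in>carrier Q. \<Sum>x\<in>carrier H. if q x = y then f x * group_ring_map q g (inv\<^bsub>Q\<^esub> y \<otimes>\<^bsub>Q\<^esub> z) else 0)"
      by (rule sum.swap)
    also have "\<dots> = (\<Sum>y\<in>carrier Q. group_ring_map q f y * group_ring_map q g (inv\<^bsub>Q\<^esub> y \<otimes>\<^bsub>Q\<^esub> z))"
      using c by (auto simp: group_ring_map_eq[OF fin] sum_distrib_right intro!: sum.cong)
    finally show ?thesis using z by (simp only: Q.group_ring_mult[OF m[OF c(1)] m[OF c(2)]] if_True)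
  next
    case False
    then show ?thesis
      using m[OF group_ring_closed(1)[OF c]] Q.fin
      by (simp add: Q.group_ring_mult[OF m[OF c(1)] m[OF c(2)]] mem_group_ring)
  qed
qed

end

section \<open>Filtrations of the Iwahori subgroup\<close>

lemma mat_mult_entry:
  assumes "A \<in> carrier_mat n n" "B \<in> carrier_mat n n" "i < n" "j < n"
  shows "(A * B) $$ (i, j) = (\<Sum>k<n. A $$ (i, k) * B $$ (k, j))"
  using assms by (auto simp: scalar_prod_def lessThan_atLeast0)

lemma mem_iwahori:
  "A \<in> carrier (iwahori n) \<longleftrightarrow> A \<in> carrier_mat n n \<and> det A = 1 \<and>
    (\<forall>i<n. \<forall>j<n. (j < i \<longrightarrow> padic_p dvd A $$ (i, j)) \<and> (i = j \<longrightarrow> padic_p dvd A $$ (i, j) - 1))"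
  by (auto simp: iwahori_def SL_def)

lemma iwahori_simps: "monoid.mult (iwahori n) = (*)" "\<one>\<^bsub>iwahori n\<^esub> = 1\<^sub>m n"
  by (simp_all add: iwahori_def SL_def)

lemma iwahori_carrier_mat: "A \<in> carrier (iwahori n) \<Longrightarrow> A \<in> carrier_mat n n"
  by (simp add: mem_iwahori)

lemma det_1_inverse:
  assumes "A \<in> carrier_mat n n" "det A = (1 :: 'a::comm_ring_1)"
  shows "adj_mat A \<in> carrier_mat n n" "A * adj_mat A = 1\<^sub>m n" "adj_mat A * A = 1\<^sub>m n" "det (adj_mat A) = 1"
proof -
  show a: "adj_mat A \<in> carrier_mat n n" "A * adj_mat A = 1\<^sub>m n" "adj_mat A * A = 1\<^sub>m n"
    using adj_mat[OF assms(1)] assms(2) by (auto intro!: eq_matI)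
  have "det A * det (adj_mat A) = 1" using det_mult[OF assms(1) a(1)] a(2) by simp
  then show "det (adj_mat A) = 1" using assms(2) by simp
qed

lemma group_SL: "group (SL n)"
proof (rule groupI)
  fix A :: "'a padic_int mat" assume "A \<in> carrier (SL n)"
  then have A: "A \<in> carrier_mat n n" "det A = 1" by (auto simp: SL_def)
  show "\<exists>B\<in>carrier (SL n). B \<otimes>\<^bsub>SL n\<^esub> A = \<one>\<^bsub>SL n\<^esub>"
    using det_1_inverse[OF A] by (intro bexI[of _ "adj_mat A"]) (auto simp: SL_def)
qed (auto simp: SL_def det_mult)

lemma iwahori_mult_closed:
  assumes A: "A \<in> carrier (iwahori n)" and B: "B \<in> carrier (iwahori n)"
  shows "A * B \<in> carrier (iwahori n)"
proof -
  have Ac: "A \<in> carrier_mat n n" and Bc: "B \<in> carrier_mat n n" using A B by (simp_all add: mem_iwahori)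
  have d: "padic_p dvd A $$ (i, k) * B $$ (k, j)" if "i < n" "j < n" "k < n" "k < i \<or> j < k" for i j k
    using A B that unfolding mem_iwahori by (meson dvd_mult dvd_mult2)
  have "padic_p dvd (A * B) $$ (i, j)" if "i < n" "j < n" "j < i" for i j
    unfolding mat_mult_entry[OF Ac Bc that(1,2)] using that by (intro dvd_sum d) auto
  moreover have "padic_p dvd (A * B) $$ (i, i) - 1" if i: "i < n" for i
  proof -
    have "(A * B) $$ (i, i) - 1 = (\<Sum>k\<in>{..<n} - {i}. A $$ (i, k) * B $$ (k, i)) +
        ((A $$ (i, i) - 1) * B $$ (i, i) + (B $$ (i, i) - 1))"
      unfolding mat_mult_entry[OF Ac Bc i i] using i by (simp add: sum.remove[of _ i] algebra_simps)
    also have "padic_p dvd \<dots>"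
      using A B i by (intro dvd_add dvd_sum dvd_mult2 d) (auto simp: mem_iwahori)
    finally show ?thesis .
  qed
  ultimately show ?thesis using A B by (auto simp: mem_iwahori det_mult)
qed

lemma iwahori_one_closed: "1\<^sub>m n \<in> carrier (iwahori n)"
  by (auto simp: mem_iwahori)

text \<open>The equation A B = 1 is solved row by row, from the last row upwards, for the entries of
  B on and to the left of the diagonal; this avoids minors.\<close>

lemma iwahori_inverse:
  assumes A: "A \<in> carrier (iwahori n)"
  shows "adj_mat A \<in> carrier (iwahori n)"
proof -
  have Ac: "A \<in> carrier_mat n n" "det A = 1" using A by (auto simp: mem_iwahori)
  define B where "B = adj_mat A"
  have B: "B \<in> carrier_mat n n" "A * B = 1\<^sub>m n" "det B = 1"
    using det_1_inverse[OF Ac] by (simp_all add: B_def)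
  have *: "padic_p dvd B $$ (i, j) - (if i = j then 1 else 0)" if "i < n" "j < n" "j \<le> i" for i j
    using that
  proof (induction "n - i" arbitrary: i rule: less_induct)
    case less
    have "(if i = j then 1 else 0) = (\<Sum>k<n. A $$ (i, k) * B $$ (k, j))"
      using mat_mult_entry[OF Ac(1) B(1) less.prems(1,2)] less.prems by (simp add: B(2))
    also have "\<dots> = A $$ (i, i) * B $$ (i, j) + (\<Sum>k\<in>{..<n} - {i}. A $$ (i, k) * B $$ (k, j))"
      using less.prems by (simp add: sum.remove[of _ i])
    finally have "B $$ (i, j) - (if i = j then 1 else 0) =
        - ((A $$ (i, i) - 1) * B $$ (i, j) + (\<Sum>k\<in>{..<n} - {i}. A $$ (i, k) * B $$ (k, j)))"
      by (simp add: algebra_simps)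
    \<comment> \<open>To the left of the diagonal A is divisible by p. To the right, k > i is a row
      of B covered by the induction hypothesis, and k differs from j because j <= i.\<close>
    moreover have "padic_p dvd A $$ (i, k) * B $$ (k, j)" if k: "k \<in> {..<n} - {i}" for k
    proof (cases "k < i")
      case True
      then show ?thesis using A less.prems by (intro dvd_mult2) (auto simp: mem_iwahori)
    next
      case False
      then have "padic_p dvd B $$ (k, j) - (if k = j then 1 else 0)" "k \<noteq> j"
        using k less.prems less.hyps[of k] by auto
      then show ?thesis by simp
    qed
    moreover have "padic_p dvd A $$ (i, i) - 1" using A less.prems by (auto simp: mem_iwahori)
    moreover from calculation(2) have "padic_p dvd (\<Sum>k\<in>{..<n} - {i}. A $$ (i, k) * B $$ (k, j))"
      by (rule dvd_sum)
    ultimately show ?case by (simp only: dvd_minus_iff) (intro dvd_add dvd_mult2)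
  qed
  have "padic_p dvd B $$ (i, j)" if "i < n" "j < i" for i j using *[of i j] that by simp
  moreover have "padic_p dvd B $$ (i, i) - 1" if "i < n" for i using *[of i i] that by simp
  ultimately show ?thesis unfolding B_def[symmetric] mem_iwahori using B by auto
qed

lemma group_iwahori: "group (iwahori n :: 'p::prime_card padic_int mat monoid)"
proof (rule groupI)
  fix A :: "'p padic_int mat" assume A: "A \<in> carrier (iwahori n)"
  then show "\<exists>B\<in>carrier (iwahori n). B \<otimes>\<^bsub>iwahori n\<^esub> A = \<one>\<^bsub>iwahori n\<^esub>"
    using det_1_inverse[of A n] iwahori_inverse[OF A]
    by (intro bexI[of _ "adj_mat A"]) (auto simp: iwahori_simps mem_iwahori)
qed (auto simp: iwahori_simps iwahori_mult_closed iwahori_one_closed left_mult_one_mat[OF iwahori_carrier_mat]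
  intro!: assoc_mult_mat[of _ n n _ n _ n] iwahori_carrier_mat)

lemma iwahori_inv:
  assumes A: "A \<in> carrier (iwahori n)"
  shows "inv\<^bsub>iwahori n\<^esub> A \<in> carrier (iwahori n)" "A * inv\<^bsub>iwahori n\<^esub> A = 1\<^sub>m n" "inv\<^bsub>iwahori n\<^esub> A * A = 1\<^sub>m n"
  using group.inv_closed[OF group_iwahori A] group.r_inv[OF group_iwahori A] group.l_inv[OF group_iwahori A]
  by (simp_all add: iwahori_simps)

text \<open>
  Filtration of the matrices by \<open>n\<close> times the weight (\<open>1\<close> for a simple root, \<open>n\<close> for \<open>p\<close>), refined by the
  row index so that consecutive steps differ in at most one matrix entry.
\<close>

definition deep_entry :: "nat \<Rightarrow> int \<Rightarrow> nat \<Rightarrow> nat \<Rightarrow> 'p::prime_card padic_int \<Rightarrow> bool" where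
  "deep_entry n t r c x \<longleftrightarrow> (\<exists>a. padic_p ^ a dvd x \<and> t \<le> int n * (int n * int a + int c - int r) + int r)"

definition deep :: "nat \<Rightarrow> int \<Rightarrow> 'p::prime_card padic_int mat \<Rightarrow> bool" where
  "deep n t X \<longleftrightarrow> (\<forall>r<n. \<forall>c<n. deep_entry n t r c (X $$ (r, c)))"

lemma deep_entry_add:
  assumes "deep_entry n t r c x" "deep_entry n t r c y"
  shows "deep_entry n t r c (x + y)"
proof -
  obtain a b where ab: "padic_p ^ a dvd x" "t \<le> int n * (int n * int a + int c - int r) + int r"
     "padic_p ^ b dvd y" "t \<le> int n * (int n * int b + int c - int r) + int r"
    using assms unfolding deep_entry_def by blast
  have "padic_p ^ min a b dvd x + y"
    using ab by (intro dvd_add) (meson dvd_trans le_imp_power_dvd min.cobounded1 min.cobounded2)+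
  moreover have "t \<le> int n * (int n * int (min a b) + int c - int r) + int r"
    using ab by (cases "a \<le> b") (auto simp: min_def)
  ultimately show ?thesis unfolding deep_entry_def by blast
qed

text \<open>Zero is divisible by every power of p; the exponent |t| + r + n r outweighs both t and
  the negative term - n r.\<close>

lemma deep_entry_0 [simp]:
  assumes "n > 0" shows "deep_entry n t r c 0"
proof -
  have "t \<le> int n * (int n * int (nat \<bar>t\<bar> + r + n * r) + int c - int r) + int r"
  proof -
    have "\<bar>t\<bar> + int r + int n * int r \<le> int n * (\<bar>t\<bar> + int r + int n * int r)"
      using assms mult_right_mono[of 1 "int n" "\<bar>t\<bar> + int r + int n * int r"] by simp
    also have "\<dots> \<le> int n * (int n * (\<bar>t\<bar> + int r + int n * int r))"
      using assms mult_right_mono[of 1 "int n" "int n * (\<bar>t\<bar> + int r + int n * int r)"] by simp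
    finally have "\<bar>t\<bar> + int r + int n * int r \<le> int n * (int n * (\<bar>t\<bar> + int r + int n * int r))" .
    moreover have "t \<le> \<bar>t\<bar>" "0 \<le> int n * int c" by auto
    moreover have "int n * (int n * int (nat \<bar>t\<bar> + r + n * r) + int c - int r) + int r
        = int n * (int n * (\<bar>t\<bar> + int r + int n * int r)) + int n * int c - int n * int r + int r"
      by (simp add: right_diff_distrib distrib_left)
    ultimately show ?thesis by linarith
  qed
  then show ?thesis unfolding deep_entry_def by (meson dvd_0_right)
qed

lemma deep_entry_sum: "n > 0 \<Longrightarrow> (\<And>k. k \<in> K \<Longrightarrow> deep_entry n t r c (f k)) \<Longrightarrow> deep_entry n t r c (sum f K)"
  by (induction K rule: infinite_finite_induct) (auto intro: deep_entry_add)

lemma deep_entry_minus: "deep_entry n t r c (- x) \<longleftrightarrow> deep_entry n t r c x"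
  by (simp add: deep_entry_def)

lemma deep_entry_mono: "deep_entry n t r c x \<Longrightarrow> s \<le> t \<Longrightarrow> deep_entry n s r c x"
  unfolding deep_entry_def by (meson order_trans)

lemma deep_mono: "deep n t X \<Longrightarrow> s \<le> t \<Longrightarrow> deep n s X"
  unfolding deep_def using deep_entry_mono[of n t _ _ _ s] by blast

lemma deep_add: "deep n t X \<Longrightarrow> deep n t Y \<Longrightarrow> X \<in> carrier_mat n n \<Longrightarrow> Y \<in> carrier_mat n n \<Longrightarrow> deep n t (X + Y)"
  unfolding deep_def by (simp add: deep_entry_add)

lemma deep_uminus: "deep n t X \<Longrightarrow> X \<in> carrier_mat n n \<Longrightarrow> deep n t (- X)"
  unfolding deep_def by (auto simp: deep_entry_minus)

text \<open>The radical of the Iwahori order: exactly the matrices all of whose entries have weight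
  at least 1.\<close>

definition in_rad :: "nat \<Rightarrow> 'p::prime_card padic_int mat \<Rightarrow> bool" where
  "in_rad n Y \<longleftrightarrow> Y \<in> carrier_mat n n \<and> (\<forall>r<n. \<forall>c<n. c \<le> r \<longrightarrow> padic_p dvd Y $$ (r, c))"

text \<open>A factor of weight at least 1 raises the weight, which the level counts n-fold, while
  the row index in the refinement changes by less than n. The level therefore grows by at least
  1.\<close>

lemma deep_mult_rad:
  assumes X: "deep n t X" "X \<in> carrier_mat n n" and Y: "in_rad n Y"
  shows "deep n (t + 1) (X * Y)" "deep n (t + 1) (Y * X)"
proof -
  have Yc: "Y \<in> carrier_mat n n" using Y by (simp add: in_rad_def)
  have w: "\<exists>b. padic_p ^ b dvd Y $$ (r, c) \<and> int n * int b + int c - int r \<ge> 1" if "r < n" "c < n" for r c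
  proof (cases "c \<le> r")
    case True
    then show ?thesis using Y that by (intro exI[of _ 1]) (auto simp: in_rad_def)
  qed (auto intro!: exI[of _ 0])
  have m: "deep_entry n (t + 1) r c (X $$ (r, s) * Y $$ (s, c))"
      "deep_entry n (t + 1) r c (Y $$ (r, s) * X $$ (s, c))" if i: "r < n" "c < n" "s < n" for r c s
  proof -
    obtain a b where ab: "padic_p ^ a dvd X $$ (r, s)" "t \<le> int n * (int n * int a + int s - int r) + int r"
        "padic_p ^ b dvd Y $$ (s, c)" "int n * int b + int c - int s \<ge> 1"
      using X(1) w[OF i(3,2)] i unfolding deep_def deep_entry_def by blast
    have "int n * 1 \<le> int n * (int n * int b + int c - int s)" using ab(4) by (intro mult_left_mono) auto
    then have "t + 1 \<le> int n * (int n * int (a + b) + int c - int r) + int r"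
      using ab(2) i by (simp add: algebra_simps)
    moreover have "padic_p ^ (a + b) dvd X $$ (r, s) * Y $$ (s, c)"
      unfolding power_add using ab by (intro mult_dvd_mono)
    ultimately show "deep_entry n (t + 1) r c (X $$ (r, s) * Y $$ (s, c))" unfolding deep_entry_def by blast
  next
    obtain a b where ab: "padic_p ^ a dvd X $$ (s, c)" "t \<le> int n * (int n * int a + int c - int s) + int s"
        "padic_p ^ b dvd Y $$ (r, s)" "int n * int b + int s - int r \<ge> 1"
      using X(1) w[OF i(1,3)] i unfolding deep_def deep_entry_def by blast
    have "int n * 1 \<le> int n * (int n * int b + int s - int r)" using ab(4) by (intro mult_left_mono) auto
    then have "t + 1 \<le> int n * (int n * int (b + a) + int c - int r) + int r"
      using ab(2) i by (simp add: algebra_simps)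
    moreover have "padic_p ^ (b + a) dvd Y $$ (r, s) * X $$ (s, c)"
      unfolding power_add using ab by (intro mult_dvd_mono)
    ultimately show "deep_entry n (t + 1) r c (Y $$ (r, s) * X $$ (s, c))" unfolding deep_entry_def by blast
  qed
  show "deep n (t + 1) (X * Y)" "deep n (t + 1) (Y * X)"
    unfolding deep_def using m by (auto simp: mat_mult_entry[OF X(2) Yc] mat_mult_entry[OF Yc X(2)] simp del: index_mult_mat
      intro!: deep_entry_sum)
qed

lemma minus_one_carrier_mat [simp]: "A - 1\<^sub>m n \<in> carrier_mat n n"
  by (rule minus_carrier_mat[OF one_carrier_mat])

text \<open>The product term lies one level deeper than either deviation, so the deviation from 1 is
  additive to first order.\<close>

lemma mult_minus_one:
  fixes A B :: "'a::comm_ring_1 mat"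
  assumes "A \<in> carrier_mat n n" "B \<in> carrier_mat n n"
  shows "A * B - 1\<^sub>m n = (A - 1\<^sub>m n) * (B - 1\<^sub>m n) + ((A - 1\<^sub>m n) + (B - 1\<^sub>m n))"
proof -
  have "(A - 1\<^sub>m n) * (B - 1\<^sub>m n) = A * (B - 1\<^sub>m n) - 1\<^sub>m n * (B - 1\<^sub>m n)"
    using assms by (intro minus_mult_distrib_mat[of _ n n _ _ n]) auto
  also have "A * (B - 1\<^sub>m n) = A * B - A * 1\<^sub>m n"
    using assms by (intro mult_minus_distrib_mat[of _ n n _ n]) auto
  finally have "(A - 1\<^sub>m n) * (B - 1\<^sub>m n) = A * B - A - (B - 1\<^sub>m n)" using assms by simp
  moreover have "A * B \<in> carrier_mat n n" using assms by simp
  ultimately show ?thesis using assms by (intro eq_matI) (auto simp del: index_mult_mat(1))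
qed

lemma iwahori_minus_one: "A \<in> carrier (iwahori n) \<Longrightarrow> in_rad n (A - 1\<^sub>m n)"
  unfolding in_rad_def by (auto simp: mem_iwahori)

lemma deep_mult_iwahori:
  assumes X: "deep n t X" "X \<in> carrier_mat n n" and A: "A \<in> carrier (iwahori n)"
  shows "deep n t (X * A)" "deep n t (A * X)"
proof -
  have Ac: "A \<in> carrier_mat n n" using A by (rule iwahori_carrier_mat)
  have "X * (A - 1\<^sub>m n) + X = X * A" "(A - 1\<^sub>m n) * X + X = A * X"
  proof -
    have "X * (A - 1\<^sub>m n) = X * A - X * 1\<^sub>m n"
      using X Ac by (intro mult_minus_distrib_mat[of _ n n _ n]) auto
    moreover have "(A - 1\<^sub>m n) * X = A * X - 1\<^sub>m n * X"
      using X Ac by (intro minus_mult_distrib_mat[of _ n n _ _ n]) auto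
    moreover have "X * A \<in> carrier_mat n n" "A * X \<in> carrier_mat n n" using X Ac by auto
    ultimately show "X * (A - 1\<^sub>m n) + X = X * A" "(A - 1\<^sub>m n) * X + X = A * X"
      using X Ac by (auto intro!: eq_matI simp del: index_mult_mat(1))
  qed
  moreover have "deep n t (X * (A - 1\<^sub>m n) + X)" "deep n t ((A - 1\<^sub>m n) * X + X)"
    using deep_mono[OF deep_mult_rad(1)[OF X iwahori_minus_one[OF A]], of t]
      deep_mono[OF deep_mult_rad(2)[OF X iwahori_minus_one[OF A]], of t] X Ac
    by (auto intro!: deep_add mult_carrier_mat[of _ n n])
  ultimately show "deep n t (X * A)" "deep n t (A * X)" by simp_all
qed

definition deep_subgroup :: "nat \<Rightarrow> int \<Rightarrow> 'p::prime_card padic_int mat set" where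
  "deep_subgroup n t = {A \<in> carrier (iwahori n). deep n t (A - 1\<^sub>m n)}"

lemma deep_subgroup_mult:
  assumes "A \<in> deep_subgroup n t" "B \<in> deep_subgroup n t"
  shows "A * B \<in> deep_subgroup n t"
proof -
  have A: "A \<in> carrier (iwahori n)" "deep n t (A - 1\<^sub>m n)" "A \<in> carrier_mat n n" 
    and B: "B \<in> carrier (iwahori n)" "deep n t (B - 1\<^sub>m n)" "B \<in> carrier_mat n n"
    using assms by (auto simp: deep_subgroup_def iwahori_carrier_mat)
  have "deep n t ((A - 1\<^sub>m n) * (B - 1\<^sub>m n))"
    by (rule deep_mono[OF deep_mult_rad(1)[OF A(2) _ iwahori_minus_one[OF B(1)]]]) (simp_all add: A B)
  then show ?thesis unfolding deep_subgroup_def using A B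
    by (auto simp: iwahori_mult_closed mult_minus_one[OF A(3) B(3)] intro!: deep_add)
qed

text \<open>Multiplication by elements of G on either side preserves each level. Inverses and
  conjugates reduce to this, since their deviations from 1 are - B (A - 1) and g (A - 1) h.\<close>

lemma deep_subgroup_normal:
  assumes "n > 0"
  shows "deep_subgroup n t \<lhd> iwahori n"
proof -
  interpret G: group "iwahori n" by (rule group_iwahori)
  have inv: "inv\<^bsub>iwahori n\<^esub> A \<in> deep_subgroup n t" if A: "A \<in> deep_subgroup n t" for A
  proof -
    have A': "A \<in> carrier (iwahori n)" "deep n t (A - 1\<^sub>m n)" "A \<in> carrier_mat n n"
      using A by (auto simp: deep_subgroup_def iwahori_carrier_mat)
    define B where "B = inv\<^bsub>iwahori n\<^esub> A"
    have B: "B \<in> carrier (iwahori n)" "B * A = 1\<^sub>m n" "B \<in> carrier_mat n n"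
      using iwahori_inv[OF A'(1)] iwahori_carrier_mat by (auto simp: B_def)
    have "B * (A - 1\<^sub>m n) = B * A - B * 1\<^sub>m n"
      using A' B by (intro mult_minus_distrib_mat[of _ n n _ n]) auto
    then have "B * (A - 1\<^sub>m n) = 1\<^sub>m n - B" using B by simp
    then have "B - 1\<^sub>m n = - (B * (A - 1\<^sub>m n))" using B(3) by (intro eq_matI) (simp_all del: index_mult_mat)
    moreover have "deep n t (- (B * (A - 1\<^sub>m n)))"
      using A' B by (intro deep_uminus deep_mult_iwahori(2)) auto
    ultimately show ?thesis using B by (simp add: deep_subgroup_def B_def)
  qed
  have "subgroup (deep_subgroup n t) (iwahori n)"
  proof (rule G.subgroupI)
    show "deep_subgroup n t \<subseteq> carrier (iwahori n)" by (auto simp: deep_subgroup_def)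
    have "1\<^sub>m n \<in> deep_subgroup n t"
      unfolding deep_subgroup_def deep_def using iwahori_one_closed assms by simp
    then show "deep_subgroup n t \<noteq> {}" by blast
    show "A \<otimes>\<^bsub>iwahori n\<^esub> B \<in> deep_subgroup n t" if "A \<in> deep_subgroup n t" "B \<in> deep_subgroup n t" for A B
      using deep_subgroup_mult[OF that] by (simp add: iwahori_simps)
  qed (rule inv)
  moreover have "g \<otimes>\<^bsub>iwahori n\<^esub> A \<otimes>\<^bsub>iwahori n\<^esub> inv\<^bsub>iwahori n\<^esub> g \<in> deep_subgroup n t"
    if g: "g \<in> carrier (iwahori n)" and A: "A \<in> deep_subgroup n t" for g A
  proof -
    have A': "A \<in> carrier (iwahori n)" "deep n t (A - 1\<^sub>m n)" "A \<in> carrier_mat n n"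
      using A by (auto simp: deep_subgroup_def iwahori_carrier_mat)
    define h where "h = inv\<^bsub>iwahori n\<^esub> g"
    have h: "h \<in> carrier (iwahori n)" "g * h = 1\<^sub>m n" "h \<in> carrier_mat n n" "g \<in> carrier_mat n n"
      using iwahori_inv[OF g] iwahori_carrier_mat[OF g] iwahori_carrier_mat[OF iwahori_inv(1)[OF g]]
      by (simp_all add: h_def)
    have "g * (A - 1\<^sub>m n) = g * A - g * 1\<^sub>m n"
      using A' h by (intro mult_minus_distrib_mat[of _ n n _ n]) auto
    moreover have "(g * A - g * 1\<^sub>m n) * h = g * A * h - g * 1\<^sub>m n * h"
      using A' h by (intro minus_mult_distrib_mat[of _ n n _ _ n]) auto
    moreover have "g * 1\<^sub>m n * h = 1\<^sub>m n" using h by simp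
    ultimately have e: "g * (A - 1\<^sub>m n) * h = g * A * h - 1\<^sub>m n" by simp
    have "A - 1\<^sub>m n \<in> carrier_mat n n" by simp
    then have "deep n t (g * (A - 1\<^sub>m n) * h)"
      using deep_mult_iwahori(1)[OF deep_mult_iwahori(2)[OF A'(2) _ g] _ h(1)] h A' by simp
    moreover have "g * A * h \<in> carrier (iwahori n)" using g A' h by (intro iwahori_mult_closed)
    ultimately show ?thesis unfolding deep_subgroup_def iwahori_simps h_def[symmetric] e by simp
  qed
  ultimately show ?thesis unfolding G.normal_inv_iff by (intro conjI ballI)
qed

section \<open>Open subgroups and finite quotients\<close>

lemma openin_iwahori_topology:
  fixes S :: "'p::prime_card padic_int mat set"
  shows "openin (iwahori_topology n) S \<longleftrightarrow> S \<subseteq> carrier (iwahori n) \<and>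
    (\<forall>A\<in>S. \<exists>k. \<forall>B\<in>carrier (iwahori n).
      (\<forall>i<n. \<forall>j<n. padic_p ^ k dvd B $$ (i, j) - A $$ (i, j)) \<longrightarrow> B \<in> S)" (is "_ \<longleftrightarrow> ?R")
proof -
  let ?G = "carrier (iwahori n) :: 'p padic_int mat set"
  let ?I = "{..<n} \<times> {..<n}"
  let ?f = "\<lambda>A :: 'p padic_int mat. restrict (\<lambda>ij. A $$ ij) ?I"
  let ?T = "product_topology (\<lambda>_. euclidean :: 'p padic_int topology) ?I"
  have o: "openin (iwahori_topology n) S \<longleftrightarrow> (\<exists>U. openin ?T U \<and> S = ?f -` U \<inter> ?G)"
    unfolding iwahori_topology_def openin_pullback_topology ..
  show ?thesis
  proof
    assume "openin (iwahori_topology n) S"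
    then obtain U where U: "openin ?T U" "S = ?f -` U \<inter> ?G" using o by blast
    have "\<exists>k. \<forall>B\<in>?G. (\<forall>i<n. \<forall>j<n. padic_p ^ k dvd B $$ (i, j) - A $$ (i, j)) \<longrightarrow> B \<in> S" if A: "A \<in> S" for A
    proof -
      have "?f A \<in> U" using A U by auto
      then obtain W where W: "\<And>i. i \<in> ?I \<Longrightarrow> open (W i)" "?f A \<in> Pi\<^sub>E ?I W" "Pi\<^sub>E ?I W \<subseteq> U"
        using U(1) unfolding openin_product_topology_alt by (metis (no_types, lifting) open_openin)
      have "\<exists>k. \<forall>y. padic_p ^ k dvd y - A $$ i \<longrightarrow> y \<in> W i" if i: "i \<in> ?I" for i
        using W(1)[OF i] W(2) i unfolding open_padic_int_def by (auto simp: PiE_iff)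
      then obtain k where k: "\<And>i y. i \<in> ?I \<Longrightarrow> padic_p ^ k i dvd y - A $$ i \<Longrightarrow> y \<in> W i" by metis
      define K where "K = Max (insert 0 (k ` ?I))"
      have K: "k i \<le> K" if "i \<in> ?I" for i unfolding K_def using that by (intro Max_ge) auto
      have "B \<in> S" if B: "B \<in> ?G" "\<forall>i<n. \<forall>j<n. padic_p ^ K dvd B $$ (i, j) - A $$ (i, j)" for B
      proof -
        have "B $$ i \<in> W i" if i: "i \<in> ?I" for i
        proof (rule k[OF i])
          have "padic_p ^ K dvd B $$ i - A $$ i" using B(2) i by (cases i) auto
          then show "padic_p ^ k i dvd B $$ i - A $$ i" by (rule dvd_trans[OF le_imp_power_dvd[OF K[OF i]]])
        qed
        then have "?f B \<in> Pi\<^sub>E ?I W" by auto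
        then have "?f B \<in> U" using W(3) by blast
        then show ?thesis using B(1) unfolding U(2) by (intro IntI vimageI2)
      qed
      then show ?thesis by blast
    qed
    then show ?R using U(2) by blast
  next
    assume R: ?R
    then obtain k where k: "\<And>A B. A \<in> S \<Longrightarrow> B \<in> ?G \<Longrightarrow>
        (\<forall>i<n. \<forall>j<n. padic_p ^ k A dvd B $$ (i, j) - A $$ (i, j)) \<Longrightarrow> B \<in> S" by metis
    define W where "W A = Pi\<^sub>E ?I (\<lambda>i. {y. padic_p ^ k A dvd y - A $$ i})" for A
    define U where "U = (\<Union>A\<in>S. W A)"
    have "openin ?T (W A)" for A
      unfolding W_def openin_PiE_gen by (simp add: open_padic_cong)
    then have "openin ?T U" unfolding U_def by blast
    moreover have "S = ?f -` U \<inter> ?G"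
    proof (intro equalityI subsetI)
      fix A assume "A \<in> S"
      then have "?f A \<in> W A" by (auto simp: W_def)
      then show "A \<in> ?f -` U \<inter> ?G" using \<open>A \<in> S\<close> R by (auto simp: U_def)
    next
      fix B assume "B \<in> ?f -` U \<inter> ?G"
      then obtain A where A: "A \<in> S" "?f B \<in> W A" "B \<in> ?G" by (auto simp: U_def)
      have "padic_p ^ k A dvd B $$ (i, j) - A $$ (i, j)" if "i < n" "j < n" for i j
        using A(2) that unfolding W_def PiE_iff by auto
      then show "B \<in> S" using k A by blast
    qed
    ultimately show "openin (iwahori_topology n) S" using o by blast
  qed
qed

text \<open>The elements whose deviation from 1 has weight greater than n k. The exponents k above
  the diagonal and k + 1 elsewhere are those attained by the p^k-th powers of the
  generators.\<close>

definition cong_subgroup :: "nat \<Rightarrow> nat \<Rightarrow> 'p::prime_card padic_int mat set" where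
  "cong_subgroup n k = {A \<in> carrier (iwahori n). \<forall>i<n. \<forall>j<n.
     padic_p ^ (if i < j then k else Suc k) dvd (A - 1\<^sub>m n) $$ (i, j)}"

text \<open>Since the row index stays below n, level n (n k + 1) amounts to weight at least n k + 1.
  Normality is then inherited from \<open>deep_subgroup\<close>.\<close>

lemma cong_subgroup_deep:
  "cong_subgroup n k = (deep_subgroup n (int n * (int n * int k + 1)) :: 'p::prime_card padic_int mat set)"
proof -
  have "deep_entry n (int n * (int n * int k + 1)) r c x \<longleftrightarrow> padic_p ^ (if r < c then k else Suc k) dvd x"
    if rc: "r < n" "c < n" for r c and x :: "'p padic_int"
  proof
    assume "deep_entry n (int n * (int n * int k + 1)) r c x"
    then obtain a where a: "padic_p ^ a dvd x" "int n * (int n * int k + 1) \<le> int n * (int n * int a + int c - int r) + int r"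
      unfolding deep_entry_def by blast
    have "int n * (int n * int k) < int n * (int n * int a + int c - int r)"
      using a(2) rc by (simp only: distrib_left mult_1_right)
    then have b: "int n * int k < int n * int a + int c - int r" using rc by simp
    have "(if r < c then k else Suc k) \<le> a"
    proof (cases "r < c")
      case True
      have "int n * int k < int n * (int a + 1)" using b rc by (simp add: distrib_left)
      then show ?thesis using True rc by simp
    next
      case False
      then have "int n * int k < int n * int a" using b by simp
      then show ?thesis using False rc by simp
    qed
    then show "padic_p ^ (if r < c then k else Suc k) dvd x" using a(1) by (meson dvd_trans le_imp_power_dvd)
  next
    assume d: "padic_p ^ (if r < c then k else Suc k) dvd x"
    have "int n * (int n * int k + 1) \<le> int n * (int n * int (if r < c then k else Suc k) + int c - int r)"
      using rc by (intro mult_left_mono) (auto simp: distrib_left)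
    with d show "deep_entry n (int n * (int n * int k + 1)) r c x" unfolding deep_entry_def by (intro exI conjI) auto
  qed
  then show ?thesis unfolding cong_subgroup_def deep_subgroup_def deep_def by auto
qed

lemma cong_subgroup_open_normal:
  assumes "n > 0"
  shows "(cong_subgroup n k :: 'p::prime_card padic_int mat set) \<in> open_normal_subgroups n"
proof -
  have "openin (iwahori_topology n) (cong_subgroup n k :: 'p padic_int mat set)"
    unfolding openin_iwahori_topology
  proof (intro conjI ballI)
    fix A :: "'p padic_int mat" assume A: "A \<in> cong_subgroup n k"
    have "B \<in> cong_subgroup n k" if B: "B \<in> carrier (iwahori n)"
        "\<forall>i<n. \<forall>j<n. padic_p ^ Suc k dvd B $$ (i, j) - A $$ (i, j)" for B
      unfolding cong_subgroup_def
    proof (intro CollectI conjI allI impI B(1))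
      fix i j assume ij: "i < n" "j < n"
      have "A \<in> carrier (iwahori n)" using A unfolding cong_subgroup_def by blast
      then have Am: "A \<in> carrier_mat n n" "B \<in> carrier_mat n n" using B(1) by (simp_all add: iwahori_carrier_mat)
      have "padic_p ^ (if i < j then k else Suc k) dvd B $$ (i, j) - A $$ (i, j)"
        by (rule dvd_trans[OF le_imp_power_dvd B(2)[rule_format, OF ij]]) simp
      moreover have "padic_p ^ (if i < j then k else Suc k) dvd (A - 1\<^sub>m n) $$ (i, j)"
        using A ij unfolding cong_subgroup_def by blast
      moreover have "(B - 1\<^sub>m n) $$ (i, j) = (B $$ (i, j) - A $$ (i, j)) + (A - 1\<^sub>m n) $$ (i, j)"
        using ij Am by simp
      ultimately show "padic_p ^ (if i < j then k else Suc k) dvd (B - 1\<^sub>m n) $$ (i, j)"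
        by (metis dvd_add)
    qed
    then show "\<exists>k'. \<forall>B\<in>carrier (iwahori n). (\<forall>i<n. \<forall>j<n. padic_p ^ k' dvd B $$ (i, j) - A $$ (i, j)) \<longrightarrow> B \<in> cong_subgroup n k"
      by blast
  qed (auto simp: cong_subgroup_def)
  moreover have "(cong_subgroup n k :: 'p padic_int mat set) \<lhd> iwahori n"
    unfolding cong_subgroup_deep by (rule deep_subgroup_normal[OF assms])
  ultimately show ?thesis unfolding open_normal_subgroups_def by blast
qed

text \<open>The congruence subgroups are cofinal, so everything may be tested at the levels indexed
  by k.\<close>

lemma open_normal_contains_cong:
  assumes "N \<in> open_normal_subgroups n"
  shows "\<exists>k. cong_subgroup n k \<subseteq> N"
proof -
  have N: "N \<lhd> iwahori n" "openin (iwahori_topology n) N" using assms by (auto simp: open_normal_subgroups_def)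
  have "1\<^sub>m n \<in> N" using subgroup.one_closed[OF normal_imp_subgroup[OF N(1)]] by (simp add: iwahori_simps)
  then obtain k where k: "\<And>B. B \<in> carrier (iwahori n) \<Longrightarrow>
      (\<forall>i<n. \<forall>j<n. padic_p ^ k dvd B $$ (i, j) - 1\<^sub>m n $$ (i, j)) \<Longrightarrow> B \<in> N"
    using N(2) unfolding openin_iwahori_topology by blast
  have "B \<in> N" if B: "B \<in> cong_subgroup n k" for B
  proof (rule k)
    show "B \<in> carrier (iwahori n)" using B by (simp add: cong_subgroup_def)
    then have Bm: "B \<in> carrier_mat n n" by (rule iwahori_carrier_mat)
    show "\<forall>i<n. \<forall>j<n. padic_p ^ k dvd B $$ (i, j) - 1\<^sub>m n $$ (i, j)"
    proof (intro allI impI)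
      fix i j assume ij: "i < n" "j < n"
      have "padic_p ^ (if i < j then k else Suc k) dvd (B - 1\<^sub>m n) $$ (i, j)"
        using B ij unfolding cong_subgroup_def by blast
      then have "padic_p ^ k dvd (B - 1\<^sub>m n) $$ (i, j)" by (rule dvd_trans[OF le_imp_power_dvd, rotated]) simp
      then show "padic_p ^ k dvd B $$ (i, j) - 1\<^sub>m n $$ (i, j)" using ij Bm by simp
    qed
  qed
  then show ?thesis by blast
qed

lemma cong_subgroup_antimono:
  assumes "k \<le> l" shows "cong_subgroup n l \<subseteq> cong_subgroup n k"
proof
  fix A assume A: "A \<in> cong_subgroup n l"
  have "padic_p ^ (if i < j then k else Suc k) dvd (A - 1\<^sub>m n) $$ (i, j)" if "i < n" "j < n" for i j
  proof (rule dvd_trans[OF le_imp_power_dvd])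
    show "padic_p ^ (if i < j then l else Suc l) dvd (A - 1\<^sub>m n) $$ (i, j)"
      using A that unfolding cong_subgroup_def by blast
  qed (use assms in simp)
  then show "A \<in> cong_subgroup n k" using A unfolding cong_subgroup_def by blast
qed

text \<open>If N contains all elements of G congruent to 1 modulo p^k, the entries modulo p^k
  determine the coset, and there are finitely many such matrices of residues.\<close>

lemma finite_iwahori_quotient:
  assumes N: "N \<in> (open_normal_subgroups n :: 'p::prime_card padic_int mat set set)"
  shows "finite (carrier (iwahori n Mod N))"
proof -
  have Nn: "N \<lhd> iwahori n" using N by (simp add: open_normal_subgroups_def)
  have Ns: "subgroup N (iwahori n)" by (rule normal_imp_subgroup[OF Nn])
  let ?G = "carrier (iwahori n) :: 'p padic_int mat set"
  have oN: "openin (iwahori_topology n) N" using N by (simp add: open_normal_subgroups_def)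
  have "1\<^sub>m n \<in> N" using subgroup.one_closed[OF Ns] by (simp add: iwahori_simps)
  then obtain k where k: "\<And>B. B \<in> ?G \<Longrightarrow>
      (\<forall>i<n. \<forall>j<n. padic_p ^ k dvd B $$ (i, j) - 1\<^sub>m n $$ (i, j)) \<Longrightarrow> B \<in> N"
    using oN unfolding openin_iwahori_topology by blast
  define \<rho> where "\<rho> A = restrict (\<lambda>ij. residue (A $$ ij) k) ({..<n} \<times> {..<n})" for A :: "'p padic_int mat"
  have fin: "finite (\<rho> ` ?G)"
  proof (rule finite_subset)
    show "\<rho> ` ?G \<subseteq> (\<Pi>\<^sub>E ij\<in>{..<n} \<times> {..<n}. {0..<int CARD('p) ^ k})"
      unfolding \<rho>_def by (intro image_subsetI restrict_PiE_iff[THEN iffD2] ballI) (simp add: residue_bounds)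
  qed (auto intro: finite_PiE)
  have "N #>\<^bsub>iwahori n\<^esub> A = N #>\<^bsub>iwahori n\<^esub> B" if AB: "A \<in> ?G" "B \<in> ?G" "\<rho> A = \<rho> B" for A B
  proof -
    have c: "A \<in> carrier_mat n n" "B \<in> carrier_mat n n" using AB by (auto intro: iwahori_carrier_mat)
    define C where "C = inv\<^bsub>iwahori n\<^esub> B"
    have C: "C \<in> ?G" "B * C = 1\<^sub>m n" "C \<in> carrier_mat n n"
      using iwahori_inv[OF AB(2)] iwahori_carrier_mat[OF iwahori_inv(1)[OF AB(2)]] by (simp_all add: C_def)
    have "padic_p ^ k dvd (A * C) $$ (i, j) - 1\<^sub>m n $$ (i, j)" if ij: "i < n" "j < n" for i j
    proof -
      have "(A * C) $$ (i, j) - (B * C) $$ (i, j) = (\<Sum>l<n. (A $$ (i, l) - B $$ (i, l)) * C $$ (l, j))"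
        unfolding mat_mult_entry[OF c(1) C(3) ij] mat_mult_entry[OF c(2) C(3) ij]
        by (simp only: sum_subtractf[symmetric] left_diff_distrib)
      also have "padic_p ^ k dvd \<dots>"
      proof (intro dvd_sum dvd_mult2)
        fix l assume "l \<in> {..<n}"
        then show "padic_p ^ k dvd A $$ (i, l) - B $$ (i, l)"
          using fun_cong[OF AB(3), of "(i, l)"] ij by (simp add: \<rho>_def power_dvd_diff_iff_residue)
      qed
      finally show ?thesis by (simp only: C(2))
    qed
    then have "A * C \<in> N" using AB C by (intro k) (auto intro: iwahori_mult_closed)
    moreover have "C * B = 1\<^sub>m n" unfolding C_def using iwahori_inv[OF AB(2)] by simp
    then have "A = A * C * B" using c C assoc_mult_mat[of A n n C n B n] by simp
    ultimately have "A \<in> N #>\<^bsub>iwahori n\<^esub> B" unfolding r_coset_def iwahori_simps by blast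
    then show ?thesis using group.repr_independence[OF group_iwahori _ AB(2) Ns] by metis
  qed
  then have "(\<lambda>A. N #>\<^bsub>iwahori n\<^esub> A) ` ?G \<subseteq> (\<lambda>r. N #>\<^bsub>iwahori n\<^esub> (SOME A. A \<in> ?G \<and> \<rho> A = r)) ` (\<rho> ` ?G)"
  proof (intro image_subsetI)
    fix A assume A: "A \<in> ?G"
    assume *: "\<And>A B. A \<in> ?G \<Longrightarrow> B \<in> ?G \<Longrightarrow> \<rho> A = \<rho> B \<Longrightarrow> N #>\<^bsub>iwahori n\<^esub> A = N #>\<^bsub>iwahori n\<^esub> B"
    have "(SOME B. B \<in> ?G \<and> \<rho> B = \<rho> A) \<in> ?G \<and> \<rho> (SOME B. B \<in> ?G \<and> \<rho> B = \<rho> A) = \<rho> A"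
      by (rule someI[of _ A]) (simp add: A)
    then have "N #>\<^bsub>iwahori n\<^esub> A = N #>\<^bsub>iwahori n\<^esub> (SOME B. B \<in> ?G \<and> \<rho> B = \<rho> A)" using A by (intro *) auto
    then show "N #>\<^bsub>iwahori n\<^esub> A \<in> (\<lambda>r. N #>\<^bsub>iwahori n\<^esub> (SOME A. A \<in> ?G \<and> \<rho> A = r)) ` (\<rho> ` ?G)" using A by auto
  qed
  then have "finite ((\<lambda>A. N #>\<^bsub>iwahori n\<^esub> A) ` ?G)" using fin by (meson finite_imageI finite_subset)
  moreover have "carrier (iwahori n Mod N) = (\<lambda>A. N #>\<^bsub>iwahori n\<^esub> A) ` ?G"
    by (auto simp: FactGroup_def RCOSETS_def)
  ultimately show ?thesis by simp
qed

section \<open>Iterated differences\<close>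

text \<open>The right translation action of the product of the \<open>g - 1\<close> on functions.\<close>

fun delta :: "'a::semiring_0 mat list \<Rightarrow> ('a mat \<Rightarrow> 'b::ab_group_add) \<Rightarrow> 'a mat \<Rightarrow> 'b" where
  "delta [] f = f"
| "delta (g # gs) f = (\<lambda>y. delta gs f (y * g) - delta gs f y)"

lemma delta_append: "delta (u @ v) f = delta u (delta v f)"
  by (induction u) simp_all

text \<open>Pascal's rule for the coefficients of (h - 1)^m, when one more factor h - 1 is
  multiplied in.\<close>

lemma alternating_binomial_step:
  fixes F :: "nat \<Rightarrow> 'a::comm_ring_1"
  shows "(\<Sum>i\<le>m. (- 1) ^ (m - i) * of_nat (m choose i) * F (Suc i)) - (\<Sum>i\<le>m. (- 1) ^ (m - i) * of_nat (m choose i) * F i)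
    = (\<Sum>i\<le>Suc m. (- 1) ^ (Suc m - i) * of_nat (Suc m choose i) * F i)"
proof -
  \<comment> \<open>Natural subtraction stalls at i = m, but there the binomial coefficient is
    0.\<close>
  have e: "(- 1) ^ (m - i) * of_nat (m choose Suc i) = - ((- 1) ^ (m - Suc i) * of_nat (m choose Suc i) :: 'a)" if "i \<le> m" for i
  proof (cases "i = m")
    case False
    then have "m - i = Suc (m - Suc i)" using that by simp
    then show ?thesis by simp
  qed (simp add: binomial_eq_0)
  have "(\<Sum>i\<le>m. (- 1) ^ (m - i) * of_nat (m choose i) * F i)
      = (\<Sum>i\<le>Suc m. (- 1) ^ (m - i) * of_nat (m choose i) * F i)" by (simp add: binomial_eq_0)
  also have "\<dots> = (- 1) ^ m * F 0 + (\<Sum>i\<le>m. (- 1) ^ (m - Suc i) * of_nat (m choose Suc i) * F (Suc i))"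
    by (subst sum.atMost_Suc_shift) simp
  finally have 1: "(\<Sum>i\<le>m. (- 1) ^ (m - i) * of_nat (m choose i) * F i)
      = (- 1) ^ m * F 0 + (\<Sum>i\<le>m. (- 1) ^ (m - Suc i) * of_nat (m choose Suc i) * F (Suc i))" .
  have "(\<Sum>i\<le>Suc m. (- 1) ^ (Suc m - i) * of_nat (Suc m choose i) * F i)
      = - ((- 1) ^ m * F 0) + (\<Sum>i\<le>m. (- 1) ^ (m - i) * of_nat (m choose i) * F (Suc i) + (- 1) ^ (m - i) * of_nat (m choose Suc i) * F (Suc i))"
    by (subst sum.atMost_Suc_shift) (simp add: distrib_left distrib_right)
  also have "\<dots> = - ((- 1) ^ m * F 0) + (\<Sum>i\<le>m. (- 1) ^ (m - i) * of_nat (m choose i) * F (Suc i)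
      - (- 1) ^ (m - Suc i) * of_nat (m choose Suc i) * F (Suc i))"
    using e by (intro arg_cong2[where f = "(+)"] sum.cong refl) simp
  finally show ?thesis unfolding 1 by (simp add: sum_subtractf)
qed

lemma delta_replicate:
  "delta (replicate m h) f y = (\<Sum>i\<le>m. (- 1) ^ (m - i) * of_nat (m choose i) * (f (((\<lambda>x. x * h) ^^ i) y) :: 'a::comm_ring_1))"
proof (induction m arbitrary: y)
  case (Suc m)
  have "delta (replicate (Suc m) h) f y = delta (replicate m h) f (y * h) - delta (replicate m h) f y" by simp
  also have "delta (replicate m h) f (y * h) = (\<Sum>i\<le>m. (- 1) ^ (m - i) * of_nat (m choose i) * f (((\<lambda>x. x * h) ^^ Suc i) y))"
    unfolding Suc.IH by (simp add: funpow_swap1[of "\<lambda>x. x * h"])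
  finally show ?case unfolding Suc.IH[of y] alternating_binomial_step[of m "\<lambda>i. f (((\<lambda>x. x * h) ^^ i) y)"] .
qed simp

lemma prime_power_dvd_choose:
  assumes "prime (q :: nat)" "0 < i" "i < q ^ k"
  shows "q dvd (q ^ k choose i)"
proof (rule ccontr)
  assume nd: "\<not> q dvd (q ^ k choose i)"
  then have "coprime (q ^ k) (q ^ k choose i)" using assms(1) by (simp add: prime_imp_coprime)
  moreover have "i * (q ^ k choose i) = q ^ k * ((q ^ k - 1) choose (i - 1))"
    using assms times_binomial_minus1_eq[of i "q ^ k"] by simp
  then have "q ^ k dvd i * (q ^ k choose i)" by simp
  ultimately have "q ^ k dvd i" by (simp add: coprime_dvd_mult_left_iff)
  then show False using assms by (auto dest: dvd_imp_le)
qed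

text \<open>In characteristic p, (h - 1)^q = h^q - 1 for a power q of p; the sign of the constant
  term is right because q is odd.\<close>

lemma delta_replicate_prime_power:
  fixes f :: "'a::semiring_0 mat \<Rightarrow> 'p::prime_card padic_int"
  assumes "CARD('p) > 2"
  shows "padic_p dvd delta (replicate (CARD('p) ^ k) h) f y - (f (((\<lambda>x. x * h) ^^ (CARD('p) ^ k)) y) - f y)"
proof -
  let ?q = "CARD('p) ^ k"
  let ?F = "\<lambda>i. (- 1) ^ (?q - i) * of_nat (?q choose i) * f (((\<lambda>x. x * h) ^^ i) y)"
  have "odd ?q" using assms prime_odd_nat[OF prime_card[where 'a='p]] by simp
  have "?q > 0" by simp
  have "{..?q} = insert 0 (insert ?q {0<..<?q})" by auto
  then have "sum ?F {..?q} = ?F 0 + (?F ?q + sum ?F {0<..<?q})" using \<open>?q > 0\<close>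
    by (subst \<open>{..?q} = _\<close>) (subst sum.insert, simp_all)
  also have "\<dots> = (f (((\<lambda>x. x * h) ^^ ?q) y) - f y) + sum ?F {0<..<?q}" using \<open>odd ?q\<close> by simp
  finally have "delta (replicate ?q h) f y - (f (((\<lambda>x. x * h) ^^ ?q) y) - f y) = sum ?F {0<..<?q}"
    unfolding delta_replicate by simp
  moreover have "padic_p dvd ?F i" if "i \<in> {0<..<?q}" for i
  proof -
    have "CARD('p) dvd (?q choose i)" using that prime_card[where 'a='p] by (intro prime_power_dvd_choose) auto
    then obtain c where "(?q choose i) = CARD('p) * c" by (elim dvdE)
    then have "padic_p dvd (of_nat (?q choose i) :: 'p padic_int)" by (simp add: padic_p_def)
    then show ?thesis by (metis dvd_mult dvd_mult2)
  qed
  then have "padic_p dvd sum ?F {0<..<?q}" by (rule dvd_sum)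
  ultimately show ?thesis by (simp only:)
qed

section \<open>Steps of the filtration and nilpotency modulo p\<close>

lemma funpow_mult_right:
  assumes "y \<in> carrier (iwahori n)" "h \<in> carrier (iwahori n)"
  shows "((\<lambda>x. x * h) ^^ i) y = y * (h [^]\<^bsub>iwahori n\<^esub> i)"
proof (induction i)
  case 0
  show ?case using right_mult_one_mat[OF iwahori_carrier_mat[OF assms(1)]] by (simp add: iwahori_simps)
next
  case (Suc i)
  interpret G: group "iwahori n" by (rule group_iwahori)
  have "h [^]\<^bsub>iwahori n\<^esub> i \<in> carrier (iwahori n)" using assms by simp
  then show ?case using Suc assms
    by (simp add: G.nat_pow_Suc iwahori_simps assoc_mult_mat[of _ n n _ n _ n] iwahori_carrier_mat)
qed

lemma deep_subgroup_pow:
  assumes "n > 0" "h \<in> deep_subgroup n t"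
  shows "h [^]\<^bsub>iwahori n\<^esub> (i :: nat) \<in> deep_subgroup n t"
proof (induction i)
  case 0
  show ?case using subgroup.one_closed[OF normal_imp_subgroup[OF deep_subgroup_normal[OF assms(1), of t]]] by simp
next
  case (Suc i)
  interpret G: group "iwahori n" by (rule group_iwahori)
  show ?case using deep_subgroup_mult[OF Suc assms(2)] by (simp add: G.nat_pow_Suc iwahori_simps)
qed

text \<open>Consecutive subgroups have a cyclic quotient of order 1 or p. The level n (n a + c - r)
  + r determines r, c and a, so passing from t to t + 1 affects a single power of p in a single
  entry, and this entry is additive on the quotient.\<close>

lemma deep_subgroup_step:
  assumes n: "n > 0"
  shows "\<exists>h0\<in>(deep_subgroup n t :: 'p::prime_card padic_int mat set).
    (\<forall>h\<in>deep_subgroup n t. \<exists>m::nat. h * (h0 [^]\<^bsub>iwahori n\<^esub> m) \<in> deep_subgroup n (t + 1)) \<and>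
    h0 [^]\<^bsub>iwahori n\<^esub> CARD('p) \<in> deep_subgroup n (t + 1)"
proof -
  interpret G: group "iwahori n :: 'p padic_int mat monoid" by (rule group_iwahori)
  let ?H = "deep_subgroup n t :: 'p padic_int mat set" and ?H' = "deep_subgroup n (t + 1) :: 'p padic_int mat set"
  let ?v = "\<lambda>r c a. int n * (int n * int a + int c - int r) + int r"
  have one: "1\<^sub>m n \<in> deep_subgroup n s" for s
    using n unfolding deep_subgroup_def deep_def by (simp add: iwahori_one_closed)
  have cm: "A \<in> carrier_mat n n" if "A \<in> ?H" for A using that by (simp add: deep_subgroup_def iwahori_carrier_mat)
  show ?thesis
  proof (cases "?H \<subseteq> ?H'")
    \<comment> \<open>No jump at this level: h0 = 1 will do.\<close>
    case True
    have "h * (1\<^sub>m n [^]\<^bsub>iwahori n\<^esub> (0 :: nat)) \<in> ?H'" if "h \<in> ?H" for h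
      using that True cm[OF that] by (auto simp: iwahori_simps)
    moreover have "1\<^sub>m n [^]\<^bsub>iwahori n\<^esub> CARD('p) \<in> ?H'" using one deep_subgroup_pow[OF n] by blast
    ultimately show ?thesis using one by blast
  next
    case False
    then obtain h0 where h0: "h0 \<in> ?H" "h0 \<notin> ?H'" by blast
    \<comment> \<open>Some entry of h0 sits exactly at level t; its position and exponent are the
      only ones with that level.\<close>
    then obtain r c where rc: "r < n" "c < n" "\<not> deep_entry n (t + 1) r c ((h0 - 1\<^sub>m n) $$ (r, c))"
      unfolding deep_subgroup_def deep_def by blast
    moreover have "deep_entry n t r c ((h0 - 1\<^sub>m n) $$ (r, c))"
      using h0 rc unfolding deep_subgroup_def deep_def by blast
    ultimately obtain a where a0: "padic_p ^ a dvd (h0 - 1\<^sub>m n) $$ (r, c)" "t \<le> ?v r c a" "\<not> t + 1 \<le> ?v r c a"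
      unfolding deep_entry_def by blast
    then have a: "padic_p ^ a dvd (h0 - 1\<^sub>m n) $$ (r, c)" "?v r c a = t" by simp_all
    have npos: "int n * int n > 0" using n by simp
    have v: "?v r c b = t + int n * int n * (int b - int a)" for b using a(2) by (simp add: algebra_simps)
    define e where "e A = (A - 1\<^sub>m n) $$ (r, c)" for A :: "'p padic_int mat"
    have e1: "padic_p ^ a dvd e A" if A: "A \<in> ?H" for A
    proof -
      obtain b where b: "padic_p ^ b dvd e A" "t \<le> ?v r c b"
        using A rc unfolding deep_subgroup_def deep_def deep_entry_def e_def by blast
      then have "0 \<le> int n * int n * (int b - int a)" unfolding v by simp
      then have "a \<le> b" using npos by (simp add: zero_le_mult_iff)
      then show ?thesis using b(1) by (meson dvd_trans le_imp_power_dvd)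
    qed
    have mem: "A \<in> ?H'" if A: "A \<in> ?H" "padic_p ^ Suc a dvd e A" for A
    proof -
      have "deep_entry n (t + 1) r' c' ((A - 1\<^sub>m n) $$ (r', c'))" if rc': "r' < n" "c' < n" for r' c'
      proof -
        obtain b where b: "padic_p ^ b dvd (A - 1\<^sub>m n) $$ (r', c')" "t \<le> ?v r' c' b"
          using A rc' unfolding deep_subgroup_def deep_def deep_entry_def by blast
        show ?thesis
        proof (cases "t = ?v r' c' b")
          case False
          then have "t + 1 \<le> ?v r' c' b" using b(2) by simp
          then show ?thesis using b(1) unfolding deep_entry_def by blast
        next
          case True
          then have eq: "?v r' c' b = ?v r c a" using a(2) by simp
          \<comment> \<open>The level modulo n gives the row; after cancelling it, n b + c' modulo n
            gives the column.\<close>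
          then have "?v r' c' b mod int n = ?v r c a mod int n" by simp
          then have "int r' mod int n = int r mod int n" by simp
          then have r: "r' = r" using rc rc' by simp
          then have eq2: "int n * int b + int c' = int n * int a + int c" using eq n by simp
          then have "(int n * int b + int c') mod int n = (int n * int a + int c) mod int n" by simp
          then have c: "c' = c" using rc rc' by simp
          have "t + 1 \<le> ?v r c (Suc a)" unfolding v using npos by simp
          then show ?thesis using A(2) unfolding deep_entry_def e_def r c by blast
        qed
      qed
      then show ?thesis using A(1) unfolding deep_subgroup_def deep_def by blast
    qed
    have add: "padic_p ^ Suc a dvd e (A * B) - (e A + e B)" if AB: "A \<in> ?H" "B \<in> ?H" for A B
    proof -
      have c: "A \<in> carrier_mat n n" "B \<in> carrier_mat n n" using AB cm by auto
      have "e (A * B) - (e A + e B) = ((A - 1\<^sub>m n) * (B - 1\<^sub>m n)) $$ (r, c)"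
        unfolding e_def mult_minus_one[OF c] using rc c by (simp del: index_mult_mat(1))
      moreover have "deep n (t + 1) ((A - 1\<^sub>m n) * (B - 1\<^sub>m n))"
        using AB by (intro deep_mult_rad iwahori_minus_one) (auto simp: deep_subgroup_def)
      ultimately obtain b where b: "padic_p ^ b dvd e (A * B) - (e A + e B)" "t + 1 \<le> ?v r c b"
        using rc unfolding deep_def deep_entry_def by metis
      then have "0 < int n * int n * (int b - int a)" unfolding v by simp
      then have "Suc a \<le> b" using npos by (simp add: zero_less_mult_iff)
      then show ?thesis using b(1) by (meson dvd_trans le_imp_power_dvd)
    qed
    have pow: "padic_p ^ Suc a dvd e (h0 [^]\<^bsub>iwahori n\<^esub> m) - of_nat m * e h0" for m :: nat
    proof (induction m)
      case 0
      show ?case using rc by (simp add: e_def iwahori_simps)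
    next
      case (Suc m)
      have "e (h0 [^]\<^bsub>iwahori n\<^esub> Suc m) - of_nat (Suc m) * e h0
        = (e (h0 [^]\<^bsub>iwahori n\<^esub> m * h0) - (e (h0 [^]\<^bsub>iwahori n\<^esub> m) + e h0)) + (e (h0 [^]\<^bsub>iwahori n\<^esub> m) - of_nat m * e h0)"
        by (simp add: G.nat_pow_Suc iwahori_simps distrib_right)
      then show ?case using dvd_add[OF add[OF deep_subgroup_pow[OF n h0(1)] h0(1), of m] Suc] by simp
    qed
    obtain u where u: "e h0 = padic_p ^ a * u" using e1[OF h0(1)] by (elim dvdE)
    have "\<not> padic_p ^ Suc a dvd e h0" using mem[OF h0(1)] h0(2) by blast
    then have "\<not> padic_p dvd u" unfolding u by (auto simp: mult.commute mult_dvd_mono)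
    then obtain u' where u': "1 = u * u'" using padic_unit_iff by (metis dvdE)
    \<comment> \<open>The entry of h0 is p^a times a unit, so a suitable multiple of it cancels the
      p^a-digit of the entry of h.\<close>
    have "\<exists>m::nat. h * (h0 [^]\<^bsub>iwahori n\<^esub> m) \<in> ?H'" if h: "h \<in> ?H" for h
    proof -
      obtain z where z: "e h = padic_p ^ a * z" using e1[OF h] by (elim dvdE)
      obtain m where m: "padic_p ^ 1 dvd - (z * u') - of_nat m" using padic_approx_nat by blast
      have "z + of_nat m * u = - u * (- (z * u') - of_nat m)" using u' by (simp add: algebra_simps)
      then have "padic_p dvd z + of_nat m * u" using m by (simp only: power_one_right dvd_mult)
      then have "padic_p ^ Suc a dvd padic_p ^ a * (z + of_nat m * u)" by (simp add: mult_dvd_mono mult.commute)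
      also have "\<dots> = e h + of_nat m * e h0" by (simp add: z u algebra_simps)
      finally have S: "padic_p ^ Suc a dvd e h + of_nat m * e h0" .
      from dvd_add[OF add[OF h deep_subgroup_pow[OF n h0(1)], of m] dvd_add[OF pow[of m] S]]
      have "padic_p ^ Suc a dvd e (h * (h0 [^]\<^bsub>iwahori n\<^esub> m))" by (simp add: algebra_simps)
      then show ?thesis using mem[OF deep_subgroup_mult[OF h deep_subgroup_pow[OF n h0(1)]]] by blast
    qed
    moreover have "h0 [^]\<^bsub>iwahori n\<^esub> CARD('p) \<in> ?H'"
    proof (rule mem[OF deep_subgroup_pow[OF n h0(1)]])
      have "padic_p ^ Suc a dvd of_nat CARD('p) * e h0" unfolding u padic_p_def[symmetric] by simp
      from dvd_add[OF pow[of "CARD('p)"] this] show "padic_p ^ Suc a dvd e (h0 [^]\<^bsub>iwahori n\<^esub> CARD('p))" by simp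
    qed
    ultimately show ?thesis using h0(1) by blast
  qed
qed

text \<open>Invariance modulo \<open>p\<close> under a step of the filtration; \<open>delta\<close> of elements of the group improves it by one
  step after boundedly many differences.\<close>

definition p_invariant :: "nat \<Rightarrow> int \<Rightarrow> ('p::prime_card padic_int mat \<Rightarrow> 'p padic_int) \<Rightarrow> bool" where
  "p_invariant n t f \<longleftrightarrow> (\<forall>y\<in>carrier (iwahori n). \<forall>h\<in>deep_subgroup n t. padic_p dvd f (y * h) - f y)"

definition p_congruent :: "nat \<Rightarrow> ('p::prime_card padic_int mat \<Rightarrow> 'p padic_int) \<Rightarrow> ('p padic_int mat \<Rightarrow> 'p padic_int) \<Rightarrow> bool" where
  "p_congruent n f g \<longleftrightarrow> (\<forall>y\<in>carrier (iwahori n). padic_p dvd f y - g y)"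

lemma p_congruent_refl: "p_congruent n f f"
  by (simp add: p_congruent_def)

lemma p_congruent_trans: "p_congruent n f g \<Longrightarrow> p_congruent n g h \<Longrightarrow> p_congruent n f h"
  unfolding p_congruent_def by (metis (no_types, lifting) diff_add_cancel add_diff_eq dvd_add)

lemma p_congruent_delta:
  assumes "p_congruent n f g" "set gs \<subseteq> carrier (iwahori n)"
  shows "p_congruent n (delta gs f) (delta gs g)"
  using assms(2)
proof (induction gs)
  case (Cons h gs)
  have "padic_p dvd (delta gs f (y * h) - delta gs f y) - (delta gs g (y * h) - delta gs g y)"
    if "y \<in> carrier (iwahori n)" for y
  proof -
    have "y * h \<in> carrier (iwahori n)" using that Cons.prems by (auto intro: iwahori_mult_closed)
    moreover have "p_congruent n (delta gs f) (delta gs g)" using Cons by simp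
    ultimately have "padic_p dvd delta gs f (y * h) - delta gs g (y * h)" "padic_p dvd delta gs f y - delta gs g y"
      using that unfolding p_congruent_def by blast+
    then have "padic_p dvd (delta gs f (y * h) - delta gs g (y * h)) - (delta gs f y - delta gs g y)"
      by (rule dvd_diff)
    then show ?thesis by (simp add: algebra_simps)
  qed
  then show ?case by (simp add: p_congruent_def)
qed (use assms(1) in simp)

text \<open>Normality lets h be moved across g; for this reason differences of an N-invariant
  function are again N-invariant.\<close>

lemma delta_invariant_step:
  assumes N: "N \<lhd> iwahori n" and g: "g \<in> carrier (iwahori n)" and y: "y \<in> carrier (iwahori n)" and h: "h \<in> N"
  shows "\<exists>h'\<in>N. y * h * g = y * g * h'"
proof -
  interpret G: group "iwahori n" by (rule group_iwahori)
  interpret N: normal N "iwahori n" by (rule N)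
  have hc: "h \<in> carrier (iwahori n)" using h N.subset by blast
  have "inv\<^bsub>iwahori n\<^esub> g \<otimes>\<^bsub>iwahori n\<^esub> h \<otimes>\<^bsub>iwahori n\<^esub> g \<in> N" by (rule N.inv_op_closed1[OF g h])
  moreover have "y \<otimes>\<^bsub>iwahori n\<^esub> h \<otimes>\<^bsub>iwahori n\<^esub> g
      = y \<otimes>\<^bsub>iwahori n\<^esub> g \<otimes>\<^bsub>iwahori n\<^esub> (inv\<^bsub>iwahori n\<^esub> g \<otimes>\<^bsub>iwahori n\<^esub> h \<otimes>\<^bsub>iwahori n\<^esub> g)"
  proof -
    have "g \<otimes>\<^bsub>iwahori n\<^esub> (inv\<^bsub>iwahori n\<^esub> g \<otimes>\<^bsub>iwahori n\<^esub> (h \<otimes>\<^bsub>iwahori n\<^esub> g)) = h \<otimes>\<^bsub>iwahori n\<^esub> g"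
      using g hc by (simp only: G.m_assoc[symmetric] G.inv_closed G.m_closed G.r_inv G.l_one)
    then show ?thesis using y g hc by (simp add: G.m_assoc)
  qed
  ultimately show ?thesis by (auto simp: iwahori_simps)
qed

lemma p_invariant_delta:
  assumes n: "n > 0" and f: "p_invariant n t f" and gs: "set gs \<subseteq> carrier (iwahori n)"
  shows "p_invariant n t (delta gs f)"
  using gs
proof (induction gs)
  case (Cons g gs)
  have IH: "p_invariant n t (delta gs f)" using Cons by simp
  have "padic_p dvd delta (g # gs) f (y * h) - delta (g # gs) f y"
    if y: "y \<in> carrier (iwahori n)" and h: "h \<in> deep_subgroup n t" for y h
  proof -
    have g: "g \<in> carrier (iwahori n)" using Cons.prems by simp
    obtain h' where h': "h' \<in> deep_subgroup n t" "y * h * g = y * g * h'"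
      using delta_invariant_step[OF deep_subgroup_normal[OF n] g y h] by blast
    have "padic_p dvd delta gs f (y * g * h') - delta gs f (y * g)"
      using IH h' iwahori_mult_closed[OF y g] unfolding p_invariant_def by blast
    moreover have "padic_p dvd delta gs f (y * h) - delta gs f y" using IH y h unfolding p_invariant_def by blast
    ultimately have "padic_p dvd (delta gs f (y * g * h') - delta gs f (y * g)) - (delta gs f (y * h) - delta gs f y)"
      by (rule dvd_diff)
    then show ?thesis by (simp add: h' algebra_simps)
  qed
  then show ?case unfolding p_invariant_def by blast
qed (use f in simp)

text \<open>Each step of the filtration is central modulo the next: h0 g - g h0 is the difference of
  the two products of h0 - 1 with g - 1, and both lie one level deeper.\<close>

lemma deep_commute:
  assumes n: "n > 0" and h0: "h0 \<in> deep_subgroup n t" and g: "g \<in> carrier (iwahori n)" and y: "y \<in> carrier (iwahori n)"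
  shows "\<exists>c\<in>deep_subgroup n (t + 1). y * h0 * g = y * g * h0 * c"
proof -
  interpret G: group "iwahori n" by (rule group_iwahori)
  have h: "h0 \<in> carrier (iwahori n)" "deep n t (h0 - 1\<^sub>m n)" using h0 by (auto simp: deep_subgroup_def)
  have c1: "h0 \<in> carrier_mat n n" "g \<in> carrier_mat n n" using h g by (auto intro: iwahori_carrier_mat)
  define k where "k = inv\<^bsub>iwahori n\<^esub> (g * h0)"
  have gh: "g * h0 \<in> carrier (iwahori n)" using g h by (intro iwahori_mult_closed)
  have k: "k \<in> carrier (iwahori n)" "(g * h0) * k = 1\<^sub>m n" "k * (g * h0) = 1\<^sub>m n"
    using iwahori_inv[OF gh] by (simp_all add: k_def)
  have kc: "k \<in> carrier_mat n n" using k(1) by (rule iwahori_carrier_mat)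
  define c where "c = k * (h0 * g)"
  have hg: "h0 * g \<in> carrier (iwahori n)" using g h by (intro iwahori_mult_closed)
  have cG: "c \<in> carrier (iwahori n)" unfolding c_def by (rule iwahori_mult_closed[OF k(1) hg])
  have "c - 1\<^sub>m n = k * (h0 * g - g * h0)"
    unfolding c_def k(3)[symmetric] using kc c1 by (intro mult_minus_distrib_mat[symmetric, of _ n n _ n]) auto
  also have "h0 * g - g * h0 = (h0 - 1\<^sub>m n) * (g - 1\<^sub>m n) + - ((g - 1\<^sub>m n) * (h0 - 1\<^sub>m n))"
  proof -
    have m: "h0 * g = (h0 * g - 1\<^sub>m n) + 1\<^sub>m n" "g * h0 = (g * h0 - 1\<^sub>m n) + 1\<^sub>m n"
      using c1 by (auto intro!: eq_matI simp del: index_mult_mat(1))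
    have "(h0 - 1\<^sub>m n) * (g - 1\<^sub>m n) \<in> carrier_mat n n" "(g - 1\<^sub>m n) * (h0 - 1\<^sub>m n) \<in> carrier_mat n n"
      by (auto intro!: mult_carrier_mat[of _ n n])
    then show ?thesis using c1
      by (subst m(1), subst m(2), unfold mult_minus_one[OF c1] mult_minus_one[OF c1(2,1)])
        (auto intro!: eq_matI simp del: index_mult_mat(1))
  qed
  finally have e: "c - 1\<^sub>m n = k * ((h0 - 1\<^sub>m n) * (g - 1\<^sub>m n) + - ((g - 1\<^sub>m n) * (h0 - 1\<^sub>m n)))" .
  have "deep n (t + 1) (c - 1\<^sub>m n)"
    unfolding e using h k(1) iwahori_minus_one[OF g]
    by (intro deep_mult_iwahori deep_add deep_uminus deep_mult_rad) (auto intro!: mult_carrier_mat[of _ n n] add_carrier_mat uminus_carrier_mat)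
  then have "c \<in> deep_subgroup n (t + 1)" using cG by (simp add: deep_subgroup_def)
  moreover have "y \<otimes>\<^bsub>iwahori n\<^esub> h0 \<otimes>\<^bsub>iwahori n\<^esub> g = y \<otimes>\<^bsub>iwahori n\<^esub> g \<otimes>\<^bsub>iwahori n\<^esub> h0 \<otimes>\<^bsub>iwahori n\<^esub> c"
  proof -
    have "(g \<otimes>\<^bsub>iwahori n\<^esub> h0) \<otimes>\<^bsub>iwahori n\<^esub> (inv\<^bsub>iwahori n\<^esub> (g \<otimes>\<^bsub>iwahori n\<^esub> h0) \<otimes>\<^bsub>iwahori n\<^esub> (h0 \<otimes>\<^bsub>iwahori n\<^esub> g)) = h0 \<otimes>\<^bsub>iwahori n\<^esub> g"
      using g h by (simp only: G.m_assoc[symmetric] G.inv_closed G.m_closed G.r_inv G.l_one)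
    then have "(g \<otimes>\<^bsub>iwahori n\<^esub> h0) \<otimes>\<^bsub>iwahori n\<^esub> c = h0 \<otimes>\<^bsub>iwahori n\<^esub> g" by (simp add: c_def k_def iwahori_simps)
    then show ?thesis using y g h cG by (simp add: G.m_assoc)
  qed
  ultimately show ?thesis by (auto simp: iwahori_simps)
qed

text \<open>Since h0 is central modulo the next subgroup, under which f is invariant modulo p, the
  operator h0 - 1 can be moved past any other difference.\<close>

lemma p_congruent_commute:
  assumes n: "n > 0" and h0: "h0 \<in> deep_subgroup n t" and f: "p_invariant n (t + 1) f" and gs: "set gs \<subseteq> carrier (iwahori n)"
  shows "p_congruent n (delta (h0 # gs) f) (delta (gs @ [h0]) f)"
  using gs
proof (induction gs)
  case (Cons g gs)
  let ?F = "delta gs f"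
  have h: "h0 \<in> carrier (iwahori n)" using h0 by (auto simp: deep_subgroup_def)
  have g: "g \<in> carrier (iwahori n)" using Cons.prems by simp
  have F: "p_invariant n (t + 1) ?F" using p_invariant_delta[OF n f] Cons.prems by simp
  have "padic_p dvd delta (h0 # g # gs) f y - delta [g] (delta (h0 # gs) f) y" if y: "y \<in> carrier (iwahori n)" for y
  proof -
    obtain c where c: "c \<in> deep_subgroup n (t + 1)" "y * h0 * g = y * g * h0 * c"
      using deep_commute[OF n h0 g y] by blast
    have "y * g * h0 \<in> carrier (iwahori n)" using y g h by (intro iwahori_mult_closed)
    then have "padic_p dvd ?F (y * g * h0 * c) - ?F (y * g * h0)" using F c unfolding p_invariant_def by blast
    then show ?thesis by (simp add: c(2) algebra_simps)
  qed
  then have "p_congruent n (delta (h0 # g # gs) f) (delta [g] (delta (h0 # gs) f))" by (simp add: p_congruent_def)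
  moreover have "p_congruent n (delta [g] (delta (h0 # gs) f)) (delta [g] (delta (gs @ [h0]) f))"
    using Cons g by (intro p_congruent_delta) auto
  ultimately show ?case by (simp only: delta_append[symmetric] append.simps) (rule p_congruent_trans)
qed (simp add: p_congruent_refl)

lemma p_congruent_commute_replicate:
  assumes n: "n > 0" and h0: "h0 \<in> deep_subgroup n t" and f: "p_invariant n (t + 1) f" and gs: "set gs \<subseteq> carrier (iwahori n)"
  shows "p_congruent n (delta (replicate s h0 @ gs) f) (delta (gs @ replicate s h0) f)"
proof (induction s)
  case 0
  show ?case by (simp add: p_congruent_refl)
next
  case (Suc s)
  have h: "h0 \<in> carrier (iwahori n)" using h0 by (auto simp: deep_subgroup_def)
  have "p_congruent n (delta [h0] (delta (replicate s h0 @ gs) f)) (delta [h0] (delta (gs @ replicate s h0) f))"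
    using Suc h by (intro p_congruent_delta) auto
  moreover have "p_congruent n (delta (h0 # gs) (delta (replicate s h0) f)) (delta (gs @ [h0]) (delta (replicate s h0) f))"
    using h by (intro p_congruent_commute[OF n h0 p_invariant_delta[OF n f] gs]) auto
  ultimately have "p_congruent n (delta [h0] (delta (replicate s h0 @ gs) f)) (delta (gs @ [h0]) (delta (replicate s h0) f))"
    by (simp only: delta_append[symmetric] append.simps append_assoc) (rule p_congruent_trans)
  then show ?case by (simp only: delta_append[symmetric] append.simps append_assoc replicate_Suc)
qed

definition p_nilpotent :: "nat \<Rightarrow> nat \<Rightarrow> ('p::prime_card padic_int mat \<Rightarrow> 'p padic_int) \<Rightarrow> bool" where
  "p_nilpotent n l f \<longleftrightarrow> (\<forall>gs. set gs \<subseteq> carrier (iwahori n) \<and> l \<le> length gs \<longrightarrow> p_congruent n (delta gs f) (\<lambda>_. 0))"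

lemma delta_zero: "delta gs (\<lambda>_. 0) = (\<lambda>_. 0)"
  by (induction gs) auto

lemma p_nilpotent_0: "p_congruent n f (\<lambda>_. 0) \<Longrightarrow> p_nilpotent n 0 f"
  unfolding p_nilpotent_def using p_congruent_delta[of n f "\<lambda>_. 0"] by (simp add: delta_zero)

lemma p_invariant_all_imp_p_congruent:
  assumes "\<And>y. y \<in> carrier (iwahori n) \<Longrightarrow> padic_p dvd f (y * g) - f y"
  shows "p_congruent n (delta [g] f) (\<lambda>_. 0)"
  using assms by (simp add: p_congruent_def)

text \<open>If h0 - 1 kills f, then f is invariant under the larger subgroup and l differences kill
  it. In general (h0 - 1)^p kills f, and each block of l differences, moved past the powers of h0 -
  1, uses up one of these p factors.\<close>

lemma p_nilpotent_step:
  fixes f :: "'p::prime_card padic_int mat \<Rightarrow> 'p padic_int"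
  assumes n: "n > 0" and p: "CARD('p) > 2"
    and IH: "\<And>f :: 'p padic_int mat \<Rightarrow> 'p padic_int. p_invariant n t f \<Longrightarrow> p_nilpotent n l f" and f: "p_invariant n (t + 1) f"
  shows "p_nilpotent n (CARD('p) * l) f"
proof -
  obtain h0 :: "'p padic_int mat" where h0: "h0 \<in> deep_subgroup n t"
      "\<And>h. h \<in> deep_subgroup n t \<Longrightarrow> \<exists>m::nat. h * (h0 [^]\<^bsub>iwahori n\<^esub> m) \<in> deep_subgroup n (t + 1)"
      "h0 [^]\<^bsub>iwahori n\<^esub> CARD('p) \<in> deep_subgroup n (t + 1)"
    using deep_subgroup_step[OF n, of t] by blast
  have hG: "h0 \<in> carrier (iwahori n)" using h0(1) by (auto simp: deep_subgroup_def)
  \<comment> \<open>Every element of the larger subgroup lies in the smaller one up to a power of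
    h0.\<close>
  have inv: "p_invariant n t f" if f: "p_invariant n (t + 1) f" and d: "p_congruent n (delta [h0] f) (\<lambda>_. 0)"
    for f :: "'p padic_int mat \<Rightarrow> 'p padic_int"
    unfolding p_invariant_def
  proof (intro ballI)
    fix y h :: "'p padic_int mat" assume y: "y \<in> carrier (iwahori n)" and h: "h \<in> deep_subgroup n t"
    have hc: "h \<in> carrier (iwahori n)" using h by (auto simp: deep_subgroup_def)
    have yh: "y * h \<in> carrier (iwahori n)" using y hc by (rule iwahori_mult_closed)
    have pw: "padic_p dvd f (z * (h0 [^]\<^bsub>iwahori n\<^esub> m)) - f z" if z: "z \<in> carrier (iwahori n)" for z and m :: nat
    proof (induction m)
      case 0
      show ?case using right_mult_one_mat[OF iwahori_carrier_mat[OF z]] by (simp add: iwahori_simps)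
    next
      case (Suc m)
      interpret G: group "iwahori n" by (rule group_iwahori)
      have hm: "h0 [^]\<^bsub>iwahori n\<^esub> m \<in> carrier (iwahori n)" using hG by simp
      have zm: "z * (h0 [^]\<^bsub>iwahori n\<^esub> m) \<in> carrier (iwahori n)" using z hm by (rule iwahori_mult_closed)
      have "padic_p dvd f (z * (h0 [^]\<^bsub>iwahori n\<^esub> m) * h0) - f (z * (h0 [^]\<^bsub>iwahori n\<^esub> m))"
        using d zm by (simp add: p_congruent_def)
      from dvd_add[OF this Suc] have "padic_p dvd f (z * (h0 [^]\<^bsub>iwahori n\<^esub> m) * h0) - f z" by simp
      moreover have "z * (h0 [^]\<^bsub>iwahori n\<^esub> m) * h0 = z * (h0 [^]\<^bsub>iwahori n\<^esub> Suc m)"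
        using G.m_assoc[OF z hm hG] by (simp add: G.nat_pow_Suc iwahori_simps)
      ultimately show ?case by simp
    qed
    obtain m :: nat where m: "h * (h0 [^]\<^bsub>iwahori n\<^esub> m) \<in> deep_subgroup n (t + 1)" using h0(2)[OF h] by blast
    have "h0 [^]\<^bsub>iwahori n\<^esub> m \<in> carrier (iwahori n)" by (rule monoid.nat_pow_closed[OF group.is_monoid[OF group_iwahori] hG])
    then have as: "y * h * (h0 [^]\<^bsub>iwahori n\<^esub> m) = y * (h * (h0 [^]\<^bsub>iwahori n\<^esub> m))"
      using monoid.m_assoc[OF group.is_monoid[OF group_iwahori] y hc] by (simp add: iwahori_simps)
    have "padic_p dvd f (y * (h * (h0 [^]\<^bsub>iwahori n\<^esub> m))) - f y" using f y m unfolding p_invariant_def by blast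
    from dvd_diff[OF this pw[OF yh, of m]] show "padic_p dvd f (y * h) - f y" by (simp add: as)
  qed
  have main: "p_nilpotent n (s * l) f" if "p_invariant n (t + 1) f" "p_congruent n (delta (replicate s h0) f) (\<lambda>_. 0)"
    for s and f :: "'p padic_int mat \<Rightarrow> 'p padic_int"
    using that
  proof (induction s arbitrary: f)
    case 0
    then show ?case using p_nilpotent_0 by simp
  next
    case (Suc s)
    have hs: "set (replicate s h0) \<subseteq> carrier (iwahori n)" using hG by auto
    have "p_nilpotent n l (delta (replicate s h0) f)"
      using Suc.prems by (intro IH inv p_invariant_delta[OF n _ hs]) (auto simp: delta_append[symmetric])
    show ?case unfolding p_nilpotent_def
    proof (intro allI impI)
      fix gs :: "'p padic_int mat list" assume gs: "set gs \<subseteq> carrier (iwahori n) \<and> Suc s * l \<le> length gs"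
      define u where "u = take (length gs - l) gs"
      define v where "v = drop (length gs - l) gs"
      have uv: "gs = u @ v" "length v = l" "s * l \<le> length u" using gs by (auto simp: u_def v_def)
      have uvG: "set u \<subseteq> carrier (iwahori n)" "set v \<subseteq> carrier (iwahori n)" using gs uv(1) by auto
      have "p_congruent n (delta (v @ replicate s h0) f) (\<lambda>_. 0)"
        using \<open>p_nilpotent n l (delta (replicate s h0) f)\<close> uv uvG unfolding p_nilpotent_def delta_append by simp
      with p_congruent_commute_replicate[OF n h0(1) Suc.prems(1) uvG(2), of s]
      have "p_congruent n (delta (replicate s h0) (delta v f)) (\<lambda>_. 0)"
        unfolding delta_append[symmetric] by (rule p_congruent_trans)
      then have "p_nilpotent n (s * l) (delta v f)" using Suc.IH p_invariant_delta[OF n Suc.prems(1) uvG(2)] by blast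
      then show "p_congruent n (delta gs f) (\<lambda>_. 0)" using uv uvG unfolding p_nilpotent_def by (simp add: delta_append)
    qed
  qed
  have "padic_p dvd delta (replicate CARD('p) h0) f y" if y: "y \<in> carrier (iwahori n)" for y
  proof -
    have "padic_p dvd delta (replicate CARD('p) h0) f y - (f (y * (h0 [^]\<^bsub>iwahori n\<^esub> CARD('p))) - f y)"
      using delta_replicate_prime_power[OF p, of 1 h0 f y] by (simp add: funpow_mult_right[OF y hG])
    moreover have "padic_p dvd f (y * (h0 [^]\<^bsub>iwahori n\<^esub> CARD('p))) - f y"
      using f y h0(3) unfolding p_invariant_def by blast
    ultimately show ?thesis by (metis diff_add_cancel dvd_add)
  qed
  then show ?thesis using main[OF f] by (simp add: p_congruent_def)
qed

text \<open>At level 0 the subgroup is all of G, so an invariant function is constant modulo p and a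
  single difference kills it. Each further level multiplies the bound by p.\<close>

lemma deep_null:
  assumes n: "n > 0" and p: "CARD('p::prime_card) > 2"
  shows "\<exists>l. \<forall>f :: 'p padic_int mat \<Rightarrow> 'p padic_int. p_invariant n (int t) f \<longrightarrow> p_nilpotent n l f"
proof (induction t)
  case 0
  have d0: "A \<in> deep_subgroup n 0" if A: "A \<in> carrier (iwahori n)" for A :: "'p padic_int mat"
    unfolding deep_subgroup_def deep_def
  proof (intro CollectI conjI allI impI A)
    fix r c assume rc: "r < n" "c < n"
    show "deep_entry n 0 r c ((A - 1\<^sub>m n) $$ (r, c))"
    proof (cases "c \<le> r")
      case True
      then have "padic_p ^ 1 dvd (A - 1\<^sub>m n) $$ (r, c)" using iwahori_minus_one[OF A] rc by (simp add: in_rad_def)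
      moreover have "0 \<le> int n * (int n * int 1 + int c - int r) + int r"
      proof -
        have "0 \<le> int n * 1 + int c - int r" using rc by simp
        then show ?thesis using mult_nonneg_nonneg[of "int n" "int n * 1 + int c - int r"] by simp
      qed
      ultimately show ?thesis unfolding deep_entry_def by blast
    next
      case False
      then show ?thesis unfolding deep_entry_def by (intro exI[of _ 0]) auto
    qed
  qed
  have "p_nilpotent n 1 f" if f: "p_invariant n 0 f" for f :: "'p padic_int mat \<Rightarrow> 'p padic_int"
    unfolding p_nilpotent_def
  proof (intro allI impI)
    fix gs :: "'p padic_int mat list" assume gs: "set gs \<subseteq> carrier (iwahori n) \<and> 1 \<le> length gs"
    \<comment> \<open>The last element of the list acts first.\<close>
    then obtain u g where u: "gs = u @ [g]" by (cases gs rule: rev_cases) auto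
    have "p_congruent n (delta [g] f) (\<lambda>_. 0)"
      using f gs d0 u unfolding p_invariant_def by (intro p_invariant_all_imp_p_congruent) auto
    from p_congruent_delta[OF this, of u] show "p_congruent n (delta gs f) (\<lambda>_. 0)" using gs by (simp add: u delta_append delta_zero)
  qed
  then show ?case by auto
next
  case (Suc t)
  then obtain l where "\<And>f :: 'p padic_int mat \<Rightarrow> 'p padic_int. p_invariant n (int t) f \<Longrightarrow> p_nilpotent n l f" by blast
  from p_nilpotent_step[OF n p this, of "int t"] show ?case by (auto simp: add.commute)
qed

text \<open>Long iterated differences of a locally constant function are divisible by high powers of \<open>p\<close>: the
  augmentation ideal of the group ring of a finite \<open>p\<close>-group is nilpotent modulo \<open>p\<close>.\<close>

lemma delta_nilpotent:
  assumes n: "n > 0" and p: "CARD('p::prime_card) > 2" and N: "N \<in> (open_normal_subgroups n :: 'p padic_int mat set set)"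
  shows "\<exists>l. \<forall>f :: 'p padic_int mat \<Rightarrow> 'p padic_int.
    (\<forall>y\<in>carrier (iwahori n). \<forall>h\<in>N. f (y * h) = f y) \<longrightarrow>
    (\<forall>gs. set gs \<subseteq> carrier (iwahori n) \<and> l \<le> length gs \<longrightarrow> (\<forall>y\<in>carrier (iwahori n). padic_p ^ k dvd delta gs f y))"
proof -
  have Nn: "N \<lhd> iwahori n" using N by (simp add: open_normal_subgroups_def)
  obtain k0 where k0: "cong_subgroup n k0 \<subseteq> N" using open_normal_contains_cong[OF N] by blast
  obtain l where l: "\<And>f :: 'p padic_int mat \<Rightarrow> 'p padic_int. p_invariant n (int (n * (n * k0 + 1))) f \<Longrightarrow> p_nilpotent n l f"
    using deep_null[OF n p] by blast
  have inv: "p_invariant n (int (n * (n * k0 + 1))) f" if "\<forall>y\<in>carrier (iwahori n). \<forall>h\<in>N. f (y * h) = f y"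
    for f :: "'p padic_int mat \<Rightarrow> 'p padic_int"
  proof -
    have "deep_subgroup n (int (n * (n * k0 + 1))) \<subseteq> N"
      using k0 unfolding cong_subgroup_deep by (simp only: of_nat_mult of_nat_add of_nat_1)
    then show ?thesis using that unfolding p_invariant_def by (simp add: subset_iff)
  qed
  show ?thesis
  proof (induction k)
    case (Suc k)
    then obtain l' where l': "\<And>f :: 'p padic_int mat \<Rightarrow> 'p padic_int. \<And>gs y.
        (\<forall>y\<in>carrier (iwahori n). \<forall>h\<in>N. f (y * h) = f y) \<Longrightarrow> set gs \<subseteq> carrier (iwahori n) \<Longrightarrow> l' \<le> length gs \<Longrightarrow>
        y \<in> carrier (iwahori n) \<Longrightarrow> padic_p ^ k dvd delta gs f y" by blast
    have "padic_p ^ Suc k dvd delta gs f y"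
      if f: "\<forall>y\<in>carrier (iwahori n). \<forall>h\<in>N. f (y * h) = f y" and gs: "set gs \<subseteq> carrier (iwahori n)" "l' + l \<le> length gs"
        and y: "y \<in> carrier (iwahori n)" for f :: "'p padic_int mat \<Rightarrow> 'p padic_int" and gs y
    proof -
      define u where "u = take l' gs"
      define v where "v = drop l' gs"
      have uv: "gs = u @ v" "l \<le> length v" "l' \<le> length u" using gs by (auto simp: u_def v_def)
      have uvG: "set u \<subseteq> carrier (iwahori n)" "set v \<subseteq> carrier (iwahori n)" using gs uv(1) by auto
      \<comment> \<open>The differences along v, which act first, produce p f0 with f0 again
        N-invariant; those along u gain p^k on f0 by induction.\<close>
      have "p_congruent n (delta v f) (\<lambda>_. 0)" using l[OF inv[OF f]] uv uvG unfolding p_nilpotent_def by blast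
      then have "\<forall>y. \<exists>z. y \<in> carrier (iwahori n) \<longrightarrow> delta v f y = padic_p * z" by (auto simp: p_congruent_def dvd_def)
      then obtain f0 where f0: "\<And>y. y \<in> carrier (iwahori n) \<Longrightarrow> delta v f y = padic_p * f0 y" by metis
      have "f0 (y * h) = f0 y" if y: "y \<in> carrier (iwahori n)" and h: "h \<in> N" for y h
      proof -
        have hc: "h \<in> carrier (iwahori n)" using h normal_imp_subgroup[OF Nn] subgroup.subset by blast
        have "delta v f (y * h) = delta v f y"
          using uvG(2) y h
        proof (induction v arbitrary: y h)
          case (Cons g v)
          then obtain h' where h': "h' \<in> N" "y * h * g = y * g * h'"
            using delta_invariant_step[OF Nn, of g y h] by auto
          have "y * g \<in> carrier (iwahori n)" using Cons.prems by (auto intro: iwahori_mult_closed)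
          then have "delta v f (y * g * h') = delta v f (y * g)" "delta v f (y * h) = delta v f y"
            using Cons.IH[of "y * g" h'] Cons.IH[of y h] Cons.prems h' by auto
          then show ?case by (simp add: h'(2))
        qed (use f in auto)
        then have "padic_p * f0 (y * h) = padic_p * f0 y" using f0 y iwahori_mult_closed[OF y hc] by metis
        then show ?thesis by simp
      qed
      then have "padic_p ^ k dvd delta u f0 y" using l' uv uvG y by blast
      moreover have "delta u (delta v f) y = padic_p * delta u f0 y"
        using uvG(1) y
      proof (induction u arbitrary: y)
        case (Cons g u)
        then have "y * g \<in> carrier (iwahori n)" by (auto intro: iwahori_mult_closed)
        then show ?case using Cons by (simp add: right_diff_distrib)
      qed (use f0 in auto)
      ultimately show ?thesis by (simp add: uv(1) delta_append mult_dvd_mono)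
    qed
    then show ?case by blast
  qed auto
qed

section \<open>The Iwasawa algebra\<close>

lemma delta_cong:
  assumes "\<And>y. y \<in> carrier (iwahori n) \<Longrightarrow> f y = g y" "set gs \<subseteq> carrier (iwahori n)" "y \<in> carrier (iwahori n)"
  shows "delta gs f y = delta gs g y"
  using assms(2,3)
proof (induction gs arbitrary: y)
  case (Cons h gs)
  then have "y * h \<in> carrier (iwahori n)" by (auto intro: iwahori_mult_closed)
  then show ?case using Cons by simp
qed (use assms(1) in simp)

lemma (in finite_group) group_ring_map_add:
  assumes "f \<in> carrier (group_ring H)" "g \<in> carrier (group_ring H)"
  shows "group_ring_map q (f \<oplus>\<^bsub>group_ring H\<^esub> g) z = group_ring_map q f z + group_ring_map q g z"
  unfolding group_ring_map_eq[OF fin assms(1)] group_ring_map_eq[OF fin assms(2)]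
    group_ring_map_eq[OF fin group_ring_closed(2)[OF assms]] sum.distrib[symmetric]
  by (intro sum.cong refl) (simp add: group_ring_simps)

lemma (in finite_group) group_ring_map_basis:
  assumes "g \<in> carrier H"
  shows "group_ring_map q (gr_basis g) = gr_basis (q g)"
proof
  fix z
  have "(\<Sum>x\<in>carrier H. if q x = z then gr_basis g x else 0) = (\<Sum>x\<in>carrier H. if x = g then (if q g = z then 1 else 0) else 0)"
    by (intro sum.cong refl) (auto simp: gr_basis_def)
  also have "\<dots> = gr_basis (q g) z" using assms by (auto simp: sum.delta[OF fin] gr_basis_def)
  finally show "group_ring_map q (gr_basis g) z = gr_basis (q g) z"
    by (simp only: group_ring_map_eq[OF fin gr_basis_closed[OF assms]])
qed

text \<open>These rules would unfold products and unit of the quotient into operations on sets; the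
  calculations below use representatives.\<close>

declare mult_FactGroup [simp del] one_FactGroup [simp del]

locale iwasawa_setup =
  fixes n :: nat and ptype :: "'p::prime_card itself"
  assumes n_ge: "n \<ge> 2" and p_gt: "CARD('p) > n + 1"
begin

abbreviation G :: "'p padic_int mat monoid" where "G \<equiv> iwahori n"
abbreviation ONS :: "'p padic_int mat set set" where "ONS \<equiv> open_normal_subgroups n"
abbreviation T :: "'p padic_int mat set \<Rightarrow> ('p padic_int, 'p padic_int mat set \<Rightarrow> 'p padic_int) module"
  where "T N \<equiv> group_ring (G Mod N)"
abbreviation L :: "('p padic_int, 'p iwasawa) module" where "L \<equiv> iwasawa_algebra n"
abbreviation A :: "('p padic_int, 'p nc_series) module" where "A \<equiv> nc_algebra n"
abbreviation coset :: "'p padic_int mat set \<Rightarrow> 'p padic_int mat \<Rightarrow> 'p padic_int mat set"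
  where "coset N g \<equiv> N #>\<^bsub>iwahori n\<^esub> g"

lemma n_pos: "n > 0" using n_ge by simp
lemma p_gt2: "CARD('p) > 2" using n_ge p_gt by simp

lemma group_G: "group G" by (rule group_iwahori)

lemma ONS_normal: "N \<in> ONS \<Longrightarrow> N \<lhd> G" by (simp add: open_normal_subgroups_def)

lemma Q_finite_group: "N \<in> ONS \<Longrightarrow> finite_group (G Mod N)"
  unfolding finite_group_def finite_group_axioms_def
  using normal.factorgroup_is_group[OF ONS_normal] finite_iwahori_quotient by blast

lemma carrier_Q: "carrier (G Mod N) = (coset N) ` carrier G"
  by (auto simp: FactGroup_def RCOSETS_def)

lemma coset_in_Q: "g \<in> carrier G \<Longrightarrow> coset N g \<in> carrier (G Mod N)"
  unfolding carrier_Q by blast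

lemma coset_mult:
  assumes "N \<in> ONS" "g \<in> carrier G" "h \<in> carrier G"
  shows "coset N g \<otimes>\<^bsub>G Mod N\<^esub> coset N h = coset N (g * h)"
  using normal.rcos_sum[OF ONS_normal[OF assms(1)] assms(2,3)] by (simp add: FactGroup_def iwahori_simps)

lemma coset_one: "\<one>\<^bsub>G Mod N\<^esub> = coset N (1\<^sub>m n)" if "N \<in> ONS"
proof -
  interpret N: normal N G by (rule ONS_normal[OF that])
  have "N \<subseteq> carrier G" by (rule N.subset)
  then show ?thesis using group.coset_mult_one[OF group_G, of N] by (simp add: FactGroup_def iwahori_simps)
qed

lemma coset_inv:
  assumes "N \<in> ONS" "g \<in> carrier G"
  shows "inv\<^bsub>G Mod N\<^esub> coset N g = coset N (inv\<^bsub>G\<^esub> g)"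
proof -
  interpret Q: finite_group "G Mod N" by (rule Q_finite_group[OF assms(1)])
  have i: "inv\<^bsub>G\<^esub> g \<in> carrier G" "inv\<^bsub>G\<^esub> g * g = 1\<^sub>m n" using iwahori_inv[OF assms(2)] by auto
  have "coset N (inv\<^bsub>G\<^esub> g) \<otimes>\<^bsub>G Mod N\<^esub> coset N g = \<one>\<^bsub>G Mod N\<^esub>"
    by (simp only: coset_mult[OF assms(1) i(1) assms(2)] i(2) coset_one[OF assms(1)])
  then show ?thesis by (rule Q.inv_equality[OF _ coset_in_Q[OF assms(2)] coset_in_Q[OF i(1)]])
qed

text \<open>Right cosets of a normal subgroup are left cosets, so h^-1 may stand on the left, the
  form that matches right translation of functions.\<close>

lemma coset_eq_iff:
  assumes "N \<in> ONS" "g \<in> carrier G" "h \<in> carrier G"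
  shows "coset N g = coset N h \<longleftrightarrow> inv\<^bsub>G\<^esub> h * g \<in> N"
proof -
  interpret G: group G by (rule group_G)
  interpret N: normal N G by (rule ONS_normal[OF assms(1)])
  have h: "inv\<^bsub>G\<^esub> h \<in> carrier G" using assms by simp
  have "inv\<^bsub>G\<^esub> h \<otimes>\<^bsub>G\<^esub> (g \<otimes>\<^bsub>G\<^esub> inv\<^bsub>G\<^esub> h) \<otimes>\<^bsub>G\<^esub> h = inv\<^bsub>G\<^esub> h \<otimes>\<^bsub>G\<^esub> g"
    using assms by (simp add: G.m_assoc)
  moreover have "h \<otimes>\<^bsub>G\<^esub> (inv\<^bsub>G\<^esub> h \<otimes>\<^bsub>G\<^esub> g) \<otimes>\<^bsub>G\<^esub> inv\<^bsub>G\<^esub> h = g \<otimes>\<^bsub>G\<^esub> inv\<^bsub>G\<^esub> h"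
    using assms by (simp add: G.m_assoc[symmetric])
  ultimately have "inv\<^bsub>G\<^esub> h \<otimes>\<^bsub>G\<^esub> g \<in> N \<longleftrightarrow> g \<otimes>\<^bsub>G\<^esub> inv\<^bsub>G\<^esub> h \<in> N"
    using N.inv_op_closed1[OF assms(3), of "g \<otimes>\<^bsub>G\<^esub> inv\<^bsub>G\<^esub> h"] N.inv_op_closed2[OF assms(3), of "inv\<^bsub>G\<^esub> h \<otimes>\<^bsub>G\<^esub> g"] by auto
  moreover have "coset N g = coset N h \<longleftrightarrow> g \<otimes>\<^bsub>G\<^esub> inv\<^bsub>G\<^esub> h \<in> N"
    using N.rcos_module[OF group_G assms(3,2)] G.repr_independence[OF _ assms(3) N.is_subgroup, of g]
      G.rcos_self[OF assms(2) N.is_subgroup] by metis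
  ultimately show ?thesis by (simp add: iwahori_simps)
qed

lemma coset_absorb:
  assumes "N \<in> ONS" "g \<in> carrier G" "h \<in> N"
  shows "coset N (g * h) = coset N g"
proof -
  interpret G: group G by (rule group_G)
  interpret N: normal N G by (rule ONS_normal[OF assms(1)])
  have h: "h \<in> carrier G" using assms(3) N.subset by blast
  have "inv\<^bsub>G\<^esub> g \<otimes>\<^bsub>G\<^esub> (g \<otimes>\<^bsub>G\<^esub> h) = h" using assms h by (simp add: G.m_assoc[symmetric])
  then show ?thesis
    unfolding coset_eq_iff[OF assms(1) iwahori_mult_closed[OF assms(2) h] assms(2)] using assms(3) by (simp add: iwahori_simps)
qed

lemma coset_transition:
  assumes "N \<in> ONS" "M \<in> ONS" "N \<subseteq> M" "g \<in> carrier G"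
  shows "M <#>\<^bsub>G\<^esub> coset N g = coset M g"
proof -
  interpret G: group G by (rule group_G)
  interpret N: normal N G by (rule ONS_normal[OF assms(1)])
  interpret M: normal M G by (rule ONS_normal[OF assms(2)])
  show ?thesis
  proof (intro equalityI subsetI)
    fix x assume "x \<in> M <#>\<^bsub>G\<^esub> coset N g"
    then obtain m h where mh: "m \<in> M" "h \<in> N" "x = m \<otimes>\<^bsub>G\<^esub> (h \<otimes>\<^bsub>G\<^esub> g)"
      by (auto simp: set_mult_def r_coset_def)
    then have "x = (m \<otimes>\<^bsub>G\<^esub> h) \<otimes>\<^bsub>G\<^esub> g" "m \<otimes>\<^bsub>G\<^esub> h \<in> M"
      using assms N.subset M.subset G.m_assoc[of m h g] by (auto intro: M.m_closed)
    then show "x \<in> coset M g" by (auto simp: r_coset_def)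
  next
    fix x assume "x \<in> coset M g"
    then obtain m where m: "m \<in> M" "x = m \<otimes>\<^bsub>G\<^esub> (\<one>\<^bsub>G\<^esub> \<otimes>\<^bsub>G\<^esub> g)" using assms(4) by (auto simp: r_coset_def)
    then show "x \<in> M <#>\<^bsub>G\<^esub> coset N g" unfolding set_mult_def r_coset_def using N.one_closed by blast
  qed
qed

lemma transition_hom:
  assumes "N \<in> ONS" "M \<in> ONS" "N \<subseteq> M"
  shows "(\<lambda>C. M <#>\<^bsub>G\<^esub> C) \<in> hom (G Mod N) (G Mod M)"
proof (rule homI)
  show "M <#>\<^bsub>G\<^esub> x \<in> carrier (G Mod M)" if "x \<in> carrier (G Mod N)" for x
    using that by (auto simp: carrier_Q coset_transition[OF assms])
  show "M <#>\<^bsub>G\<^esub> (x \<otimes>\<^bsub>G Mod N\<^esub> y) = (M <#>\<^bsub>G\<^esub> x) \<otimes>\<^bsub>G Mod M\<^esub> (M <#>\<^bsub>G\<^esub> y)"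
    if "x \<in> carrier (G Mod N)" "y \<in> carrier (G Mod N)" for x y
    using that by (auto simp: carrier_Q coset_transition[OF assms] coset_mult assms iwahori_mult_closed)
qed

lemma L_simps:
  "x \<otimes>\<^bsub>L\<^esub> y = (\<lambda>N\<in>ONS. x N \<otimes>\<^bsub>T N\<^esub> y N)" "\<one>\<^bsub>L\<^esub> = (\<lambda>N\<in>ONS. \<one>\<^bsub>T N\<^esub>)"
  "\<zero>\<^bsub>L\<^esub> = (\<lambda>N\<in>ONS. \<zero>\<^bsub>T N\<^esub>)" "x \<oplus>\<^bsub>L\<^esub> y = (\<lambda>N\<in>ONS. x N \<oplus>\<^bsub>T N\<^esub> y N)"
  "c \<odot>\<^bsub>L\<^esub> x = (\<lambda>N\<in>ONS. c \<odot>\<^bsub>T N\<^esub> x N)"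
  by (simp_all add: iwasawa_algebra_def Let_def)

lemma mem_L: "x \<in> carrier L \<longleftrightarrow> x \<in> extensional ONS \<and> (\<forall>N\<in>ONS. x N \<in> carrier (T N)) \<and>
    (\<forall>N\<in>ONS. \<forall>M\<in>ONS. N \<subseteq> M \<longrightarrow> group_ring_map (\<lambda>C. M <#>\<^bsub>G\<^esub> C) (x N) = x M)"
  unfolding iwasawa_algebra_def Let_def by (simp add: PiE_iff conj_commute conj_left_commute)

lemma L_ext: "x \<in> carrier L \<Longrightarrow> y \<in> carrier L \<Longrightarrow> (\<And>N. N \<in> ONS \<Longrightarrow> x N = y N) \<Longrightarrow> x = y"
  unfolding mem_L by (rule extensionalityI[of x ONS y]) simp_all

lemma L_closed:
  assumes x: "x \<in> carrier L" and y: "y \<in> carrier L"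
  shows "x \<otimes>\<^bsub>L\<^esub> y \<in> carrier L" "x \<oplus>\<^bsub>L\<^esub> y \<in> carrier L"
proof -
  have c: "x N \<in> carrier (T N)" "y N \<in> carrier (T N)" if "N \<in> ONS" for N using x y that by (auto simp: mem_L)
  have m: "group_ring_map (\<lambda>C. M <#>\<^bsub>G\<^esub> C) (x N) = x M" "group_ring_map (\<lambda>C. M <#>\<^bsub>G\<^esub> C) (y N) = y M"
    if "N \<in> ONS" "M \<in> ONS" "N \<subseteq> M" for N M using x y that by (auto simp: mem_L)
  show "x \<otimes>\<^bsub>L\<^esub> y \<in> carrier L"
    unfolding mem_L L_simps
    using c m by (auto simp: finite_group.group_ring_closed[OF Q_finite_group]
        finite_group.group_ring_map_mult[OF Q_finite_group Q_finite_group transition_hom])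
  show "x \<oplus>\<^bsub>L\<^esub> y \<in> carrier L"
    unfolding mem_L L_simps
  proof (intro conjI ballI impI)
    fix N assume N: "N \<in> ONS"
    show "(\<lambda>N\<in>ONS. x N \<oplus>\<^bsub>T N\<^esub> y N) N \<in> carrier (T N)"
      using N finite_group.group_ring_closed(2)[OF Q_finite_group[OF N] c(1)[OF N] c(2)[OF N]] by simp
    fix M assume M: "M \<in> ONS" and NM: "N \<subseteq> M"
    show "group_ring_map (\<lambda>C. M <#>\<^bsub>G\<^esub> C) ((\<lambda>N\<in>ONS. x N \<oplus>\<^bsub>T N\<^esub> y N) N) = (\<lambda>N\<in>ONS. x N \<oplus>\<^bsub>T N\<^esub> y N) M"
    proof
      fix z
      show "group_ring_map (\<lambda>C. M <#>\<^bsub>G\<^esub> C) ((\<lambda>N\<in>ONS. x N \<oplus>\<^bsub>T N\<^esub> y N) N) z = (\<lambda>N\<in>ONS. x N \<oplus>\<^bsub>T N\<^esub> y N) M z"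
        using N M finite_group.group_ring_map_add[OF Q_finite_group[OF N] c(1)[OF N] c(2)[OF N], of "\<lambda>C. M <#>\<^bsub>G\<^esub> C" z]
        by (simp add: m[OF N M NM]) (simp add: group_ring_simps(3))
    qed
  qed simp
qed

lemma iwasawa_of_eq: "iwasawa_of n g = (\<lambda>N\<in>ONS. gr_basis (coset N g))"
  by (auto simp: iwasawa_of_def gr_basis_def fun_eq_iff)

lemma iwasawa_of_closed: "g \<in> carrier G \<Longrightarrow> iwasawa_of n g \<in> carrier L"
  unfolding mem_L iwasawa_of_eq
  by (auto simp: finite_group.gr_basis_closed[OF Q_finite_group] coset_in_Q coset_transition
      finite_group.group_ring_map_basis[OF Q_finite_group])

lemma one_L: "\<one>\<^bsub>L\<^esub> = iwasawa_of n (1\<^sub>m n)"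
  unfolding iwasawa_of_eq L_simps by (intro restrict_ext) (auto simp: group_ring_simps gr_basis_def coset_one)

lemma one_L_closed: "\<one>\<^bsub>L\<^esub> \<in> carrier L"
  unfolding one_L by (intro iwasawa_of_closed iwahori_one_closed)

lemma smult_L_closed:
  assumes x: "x \<in> carrier L"
  shows "c \<odot>\<^bsub>L\<^esub> x \<in> carrier L"
proof -
  have c: "x N \<in> carrier (T N)" if "N \<in> ONS" for N using x that by (auto simp: mem_L)
  have "group_ring_map (\<lambda>C. M <#>\<^bsub>G\<^esub> C) (c \<odot>\<^bsub>T N\<^esub> x N) = c \<odot>\<^bsub>T M\<^esub> x M"
    if NM: "N \<in> ONS" "M \<in> ONS" "N \<subseteq> M" for N M
  proof
    fix z
    interpret Q: finite_group "G Mod N" by (rule Q_finite_group[OF NM(1)])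
    have "group_ring_map (\<lambda>C. M <#>\<^bsub>G\<^esub> C) (c \<odot>\<^bsub>T N\<^esub> x N) z = c * group_ring_map (\<lambda>C. M <#>\<^bsub>G\<^esub> C) (x N) z"
      unfolding group_ring_map_eq[OF Q.fin c[OF NM(1)]] group_ring_map_eq[OF Q.fin Q.group_ring_closed(3)[OF c[OF NM(1)] c[OF NM(1)]]]
        sum_distrib_left by (intro sum.cong refl) (simp add: group_ring_simps)
    then show "group_ring_map (\<lambda>C. M <#>\<^bsub>G\<^esub> C) (c \<odot>\<^bsub>T N\<^esub> x N) z = (c \<odot>\<^bsub>T M\<^esub> x M) z"
      using x NM by (simp add: mem_L group_ring_simps)
  qed
  moreover have "c \<odot>\<^bsub>T N\<^esub> x N \<in> carrier (T N)" if "N \<in> ONS" for N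
    by (rule finite_group.group_ring_closed(3)[OF Q_finite_group[OF that] c[OF that] c[OF that]])
  ultimately show ?thesis unfolding mem_L L_simps by simp
qed

lemma L_ring: "ring L"
proof -
  have R: "ring (T N)" if "N \<in> ONS" for N using finite_group.ring_group_ring[OF Q_finite_group[OF that]] .
  have c: "x N \<in> carrier (T N)" if "x \<in> carrier L" "N \<in> ONS" for x N using that by (auto simp: mem_L)
  have z: "\<zero>\<^bsub>L\<^esub> = 0 \<odot>\<^bsub>L\<^esub> \<one>\<^bsub>L\<^esub>" by (auto simp: L_simps group_ring_simps)
  have r: "(\<lambda>N\<in>ONS. x N) = x" if "x \<in> carrier L" for x using that by (auto simp: mem_L extensional_restrict)
  show ?thesis
  proof (rule ringI)
    show "abelian_group L"
    proof (rule abelian_groupI)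
      show "\<zero>\<^bsub>L\<^esub> \<in> carrier L" unfolding z by (intro smult_L_closed one_L_closed)
      fix x assume x: "x \<in> carrier L"
      show "\<exists>y\<in>carrier L. y \<oplus>\<^bsub>L\<^esub> x = \<zero>\<^bsub>L\<^esub>"
        by (rule bexI[OF _ smult_L_closed[OF x, of "- 1"]]) (auto simp: L_simps group_ring_simps)
      show "\<zero>\<^bsub>L\<^esub> \<oplus>\<^bsub>L\<^esub> x = x" using r[OF x] by (simp add: L_simps group_ring_simps cong: restrict_cong)
    qed (auto simp: L_closed, auto simp: L_simps group_ring_simps add_ac cong: restrict_cong)
    show "Group.monoid L"
    proof (rule Group.monoidI)
      fix x y z assume xyz: "x \<in> carrier L" "y \<in> carrier L" "z \<in> carrier L"
      show "x \<otimes>\<^bsub>L\<^esub> y \<otimes>\<^bsub>L\<^esub> z = x \<otimes>\<^bsub>L\<^esub> (y \<otimes>\<^bsub>L\<^esub> z)"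
        unfolding L_simps using c[OF xyz(1)] c[OF xyz(2)] c[OF xyz(3)]
        by (intro restrict_ext) (simp add: monoid.m_assoc[OF ring.is_monoid[OF R]])
    next
      fix x assume x: "x \<in> carrier L"
      have "\<one>\<^bsub>L\<^esub> \<otimes>\<^bsub>L\<^esub> x = (\<lambda>N\<in>ONS. x N)"
        unfolding L_simps using c[OF x] by (intro restrict_ext) (simp add: monoid.l_one[OF ring.is_monoid[OF R]])
      then show "\<one>\<^bsub>L\<^esub> \<otimes>\<^bsub>L\<^esub> x = x" using r[OF x] by simp
      have "x \<otimes>\<^bsub>L\<^esub> \<one>\<^bsub>L\<^esub> = (\<lambda>N\<in>ONS. x N)"
        unfolding L_simps using c[OF x] by (intro restrict_ext) (simp add: monoid.r_one[OF ring.is_monoid[OF R]])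
      then show "x \<otimes>\<^bsub>L\<^esub> \<one>\<^bsub>L\<^esub> = x" using r[OF x] by simp
    qed (auto simp: L_closed one_L_closed)
  next
    fix x y z assume xyz: "x \<in> carrier L" "y \<in> carrier L" "z \<in> carrier L"
    show "(x \<oplus>\<^bsub>L\<^esub> y) \<otimes>\<^bsub>L\<^esub> z = x \<otimes>\<^bsub>L\<^esub> z \<oplus>\<^bsub>L\<^esub> y \<otimes>\<^bsub>L\<^esub> z"
      unfolding L_simps using c[OF xyz(1)] c[OF xyz(2)] c[OF xyz(3)]
      by (intro restrict_ext) (simp add: ring.ring_simprules(13)[OF R])
    show "z \<otimes>\<^bsub>L\<^esub> (x \<oplus>\<^bsub>L\<^esub> y) = z \<otimes>\<^bsub>L\<^esub> x \<oplus>\<^bsub>L\<^esub> z \<otimes>\<^bsub>L\<^esub> y"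
      unfolding L_simps using c[OF xyz(1)] c[OF xyz(2)] c[OF xyz(3)]
      by (intro restrict_ext) (simp add: ring.ring_simprules(23)[OF R])
  qed
qed

text \<open>The additive inverse in the record is only characterized by its property; identifying it
  with the multiple by - 1 makes its entries computable.\<close>

lemma L_minus:
  assumes x: "x \<in> carrier L" and y: "y \<in> carrier L" and N: "N \<in> ONS"
  shows "(x \<ominus>\<^bsub>L\<^esub> y) N = (\<lambda>C. x N C - y N C)"
proof -
  interpret R: ring L by (rule L_ring)
  have "\<ominus>\<^bsub>L\<^esub> y = (- 1) \<odot>\<^bsub>L\<^esub> y"
    by (rule R.minus_equality) (auto simp: y smult_L_closed, auto simp: L_simps group_ring_simps)
  then show ?thesis using N by (simp add: a_minus_def L_simps group_ring_simps)
qed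

end

section \<open>The natural map\<close>

context iwasawa_setup
begin

section \<open>Values of letters and words\<close>

fun gen :: "iw_var \<Rightarrow> 'p padic_int mat" where
  "gen (U_var \<beta>) = x_mat n \<beta> padic_p"
| "gen (W_var \<delta>) = h_mat n \<delta> (1 + padic_p)"
| "gen (V_var \<alpha>) = x_mat n \<alpha> 1"

lemma x_mat_entry: "i < n \<Longrightarrow> j < n \<Longrightarrow> x_mat n \<alpha> t $$ (i, j) = (if i = j then 1 else 0) + (if (i, j) = \<alpha> then t else 0)"
  by (auto simp: x_mat_def)

lemma x_mat_carrier [simp]: "x_mat n \<alpha> t \<in> carrier_mat n n"
  by (simp add: x_mat_def)

lemma h_mat_carrier [simp]: "h_mat n \<delta> u \<in> carrier_mat n n"
  by (simp add: h_mat_def)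

lemma prod_list_diag_one:
  assumes "X \<in> carrier_mat n n" "\<And>i. i < n \<Longrightarrow> X $$ (i, i) = (1 :: 'p padic_int)"
  shows "prod_list (diag_mat X) = 1"
proof -
  have "diag_mat X = map (\<lambda>i. 1) [0..<n]" using assms by (auto simp: diag_mat_def)
  moreover have "prod_list (map (\<lambda>i. 1 :: 'p padic_int) xs) = 1" for xs :: "nat list" by (induction xs) auto
  ultimately show ?thesis by simp
qed

lemma det_x_mat:
  assumes "\<alpha> \<in> roots n"
  shows "det (x_mat n \<alpha> t :: 'p padic_int mat) = 1"
proof -
  obtain i j where ij: "\<alpha> = (i, j)" "i < n" "j < n" "i \<noteq> j" using assms by (auto simp: roots_def)
  have d: "prod_list (diag_mat (x_mat n \<alpha> t :: 'p padic_int mat)) = 1"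
    by (rule prod_list_diag_one) (use ij in \<open>auto simp: x_mat_entry\<close>)
  show ?thesis
  proof (cases "i < j")
    case True
    have "upper_triangular (x_mat n \<alpha> t :: 'p padic_int mat)"
      unfolding upper_triangular_def using True ij by (auto simp: x_mat_def)
    then show ?thesis using det_upper_triangular[OF _ x_mat_carrier] d by metis
  next
    case False
    have "x_mat n \<alpha> t $$ (a, b) = (0 :: 'p padic_int)" if "a < b" "b < n" for a b
      using False ij that by (auto simp: x_mat_entry)
    then show ?thesis using det_lower_triangular[OF _ x_mat_carrier] d by metis
  qed
qed

lemma unit_inverse: "(u :: 'p padic_int) dvd 1 \<Longrightarrow> u * (1 div u) = 1"
  by (elim dvdE) (metis mult_not_zero nonzero_mult_div_cancel_left one_neq_zero)

lemma det_h_mat: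
  assumes "\<delta> \<in> simple_roots n" "(u :: 'p padic_int) dvd 1"
  shows "det (h_mat n \<delta> u) = 1"
proof -
  obtain c where c: "\<delta> = (c, c + 1)" "c + 1 < n" using assms(1) by (auto simp: simple_roots_def)
  have "det (h_mat n \<delta> u) = prod_list (diag_mat (h_mat n \<delta> u))"
    by (rule det_upper_triangular[OF _ h_mat_carrier]) (auto simp: upper_triangular_def h_mat_def)
  also have "diag_mat (h_mat n \<delta> u) = map (\<lambda>i. if i = c then u else if i = c + 1 then 1 div u else 1) [0..<n]"
    by (simp add: diag_mat_def h_mat_def c(1))
  also have "prod_list \<dots> = (\<Prod>i<n. if i = c then u else if i = c + 1 then 1 div u else 1)"
    by (subst prod.distinct_set_conv_list[OF distinct_upt, symmetric]) (simp add: atLeast0LessThan)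
  also have "\<dots> = (\<Prod>i\<in>{c, c + 1}. if i = c then u else if i = c + 1 then 1 div u else 1)"
    using c by (intro prod.mono_neutral_right) auto
  also have "\<dots> = 1" using unit_inverse[OF assms(2)] by simp
  finally show ?thesis .
qed

lemma one_plus_p_unit: "1 + padic_p dvd (1 :: 'p padic_int)"
  using one_plus_p_power_unit[of 1] by simp

lemma x_mat_in_G:
  assumes "\<alpha> \<in> roots n" "fst \<alpha> > snd \<alpha> \<longrightarrow> padic_p dvd t"
  shows "x_mat n \<alpha> t \<in> carrier G"
proof -
  obtain i j where ij: "\<alpha> = (i, j)" "i < n" "j < n" "i \<noteq> j" using assms by (auto simp: roots_def)
  show ?thesis unfolding mem_iwahori using ij assms det_x_mat[OF assms(1)] by (auto simp: x_mat_entry)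
qed

lemma h_mat_in_G:
  assumes "\<delta> \<in> simple_roots n" "padic_p dvd (u - 1 :: 'p padic_int)"
  shows "h_mat n \<delta> u \<in> carrier G"
proof -
  have "\<not> padic_p dvd u" using assms(2) not_p_dvd_1 dvd_diff[of padic_p u "u - 1"] by auto
  then have u: "u dvd 1" by (simp add: padic_unit_iff)
  have "padic_p dvd 1 div u - 1"
  proof -
    have "1 div u - 1 = - (1 div u) * (u - 1)" using unit_inverse[OF u] by (simp add: algebra_simps)
    then show ?thesis using assms(2) by (simp only: dvd_mult)
  qed
  then show ?thesis unfolding mem_iwahori using assms det_h_mat[OF assms(1) u] by (auto simp: h_mat_def)
qed

lemma gen_in_G: "l \<in> iw_vars n \<Longrightarrow> gen l \<in> carrier G"
  by (auto simp: iw_vars_def neg_roots_def pos_roots_def intro!: x_mat_in_G h_mat_in_G)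

definition letter :: "iw_var \<Rightarrow> 'p iwasawa" where
  "letter l = iwasawa_of n (gen l) \<ominus>\<^bsub>L\<^esub> \<one>\<^bsub>L\<^esub>"

fun word_elt :: "iw_var list \<Rightarrow> 'p iwasawa" where
  "word_elt [] = \<one>\<^bsub>L\<^esub>"
| "word_elt (l # w) = letter l \<otimes>\<^bsub>L\<^esub> word_elt w"

lemma letter_closed: "l \<in> iw_vars n \<Longrightarrow> letter l \<in> carrier L"
proof -
  interpret R: ring L by (rule L_ring)
  show "l \<in> iw_vars n \<Longrightarrow> letter l \<in> carrier L"
    unfolding letter_def by (intro R.minus_closed iwasawa_of_closed gen_in_G R.one_closed)
qed

lemma word_elt_closed: "set w \<subseteq> iw_vars n \<Longrightarrow> word_elt w \<in> carrier L"
  by (induction w) (auto simp: one_L_closed letter_closed L_closed)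

lemma word_elt_append: "set u \<subseteq> iw_vars n \<Longrightarrow> set v \<subseteq> iw_vars n \<Longrightarrow> word_elt (u @ v) = word_elt u \<otimes>\<^bsub>L\<^esub> word_elt v"
proof -
  interpret R: ring L by (rule L_ring)
  show "set u \<subseteq> iw_vars n \<Longrightarrow> set v \<subseteq> iw_vars n \<Longrightarrow> word_elt (u @ v) = word_elt u \<otimes>\<^bsub>L\<^esub> word_elt v"
    by (induction u) (auto simp: word_elt_closed letter_closed R.m_assoc)
qed

lemma mult_of_entry:
  assumes x: "x \<in> carrier L" and N: "N \<in> ONS" and y: "y \<in> carrier G" and g: "g \<in> carrier G"
  shows "(x \<otimes>\<^bsub>L\<^esub> iwasawa_of n g) N (coset N y) = x N (coset N (y * inv\<^bsub>G\<^esub> g))"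
proof -
  have xN: "x N \<in> carrier (T N)" using x N by (simp add: mem_L)
  have i: "inv\<^bsub>G\<^esub> g \<in> carrier G" using iwahori_inv[OF g] by simp
  have "(x \<otimes>\<^bsub>L\<^esub> iwasawa_of n g) N (coset N y) = (x N \<otimes>\<^bsub>T N\<^esub> gr_basis (coset N g)) (coset N y)"
    using N by (simp add: L_simps iwasawa_of_eq)
  also have "\<dots> = x N (coset N y \<otimes>\<^bsub>G Mod N\<^esub> inv\<^bsub>G Mod N\<^esub> coset N g)"
    using finite_group.group_ring_mult_basis[OF Q_finite_group[OF N] xN coset_in_Q[OF g]] coset_in_Q[OF y] by simp
  also have "\<dots> = x N (coset N (y * inv\<^bsub>G\<^esub> g))" by (simp only: coset_inv[OF N g] coset_mult[OF N y i])
  finally show ?thesis .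
qed

lemma mult_letter_entry:
  assumes x: "x \<in> carrier L" and N: "N \<in> ONS" and y: "y \<in> carrier G" and l: "l \<in> iw_vars n"
  shows "(x \<otimes>\<^bsub>L\<^esub> letter l) N (coset N y) = x N (coset N (y * inv\<^bsub>G\<^esub> gen l)) - x N (coset N y)"
proof -
  interpret R: ring L by (rule L_ring)
  have c: "iwasawa_of n (gen l) \<in> carrier L" using l by (intro iwasawa_of_closed gen_in_G)
  have "x \<otimes>\<^bsub>L\<^esub> letter l = x \<otimes>\<^bsub>L\<^esub> iwasawa_of n (gen l) \<ominus>\<^bsub>L\<^esub> x"
    unfolding letter_def using x c by (simp add: R.minus_eq R.r_distr R.r_minus)
  then show ?thesis using mult_of_entry[OF x N y gen_in_G[OF l]] L_minus[OF L_closed(1)[OF x c] x N] by simp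
qed

text \<open>Right multiplication by g translates by g^-1, hence the inverses. The first letter of w
  is multiplied in first, and \<open>delta\<close> applies the last element of its list first, hence
  the reversal.\<close>

lemma mult_word_elt_entry:
  assumes x: "x \<in> carrier L" and N: "N \<in> ONS" and y: "y \<in> carrier G" and w: "set w \<subseteq> iw_vars n"
  shows "(x \<otimes>\<^bsub>L\<^esub> word_elt w) N (coset N y) = delta (rev (map (\<lambda>l. inv\<^bsub>G\<^esub> gen l) w)) (\<lambda>y. x N (coset N y)) y"
  using w x y
proof (induction w arbitrary: x y)
  case Nil
  interpret R: ring L by (rule L_ring)
  show ?case using Nil by simp
next
  case (Cons l w)
  interpret R: ring L by (rule L_ring)
  let ?gs = "rev (map (\<lambda>l. inv\<^bsub>G\<^esub> gen l) w)"
  have l: "l \<in> iw_vars n" and w: "set w \<subseteq> iw_vars n" using Cons.prems by auto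
  have gs: "set ?gs \<subseteq> carrier G" using w gen_in_G iwahori_inv(1) by auto
  have "x \<otimes>\<^bsub>L\<^esub> word_elt (l # w) = (x \<otimes>\<^bsub>L\<^esub> letter l) \<otimes>\<^bsub>L\<^esub> word_elt w"
    using Cons.prems l w by (simp add: R.m_assoc letter_closed word_elt_closed)
  then have "(x \<otimes>\<^bsub>L\<^esub> word_elt (l # w)) N (coset N y) = delta ?gs (\<lambda>y. (x \<otimes>\<^bsub>L\<^esub> letter l) N (coset N y)) y"
    using Cons.IH[OF w L_closed(1)[OF Cons.prems(2) letter_closed[OF l]] Cons.prems(3)] by simp
  also have "\<dots> = delta ?gs (delta [inv\<^bsub>G\<^esub> gen l] (\<lambda>y. x N (coset N y))) y"
    using mult_letter_entry[OF Cons.prems(2) N _ l] by (intro delta_cong[OF _ gs Cons.prems(3)]) simp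
  also have "\<dots> = delta (rev (map (\<lambda>l. inv\<^bsub>G\<^esub> gen l) (l # w))) (\<lambda>y. x N (coset N y)) y"
    by (simp only: delta_append[symmetric] list.map rev.simps)
  finally show ?case .
qed

lemma word_elt_outside: "set w \<subseteq> iw_vars n \<Longrightarrow> N \<in> ONS \<Longrightarrow> C \<notin> carrier (G Mod N) \<Longrightarrow> word_elt w N C = 0"
  using word_elt_closed[of w] finite_group.fin[OF Q_finite_group[of N]] by (auto simp: mem_L mem_group_ring)

text \<open>Writing a word as 1 times the word turns its coefficients into iterated differences of
  the indicator function of the trivial coset.\<close>

lemma word_elt_nilpotent:
  assumes N: "N \<in> ONS"
  shows "\<exists>m. \<forall>w C. set w \<subseteq> iw_vars n \<and> m \<le> length w \<longrightarrow> padic_p ^ k dvd word_elt w N C"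
proof -
  obtain m where m: "\<And>(f :: 'p padic_int mat \<Rightarrow> 'p padic_int) gs y. \<forall>y\<in>carrier G. \<forall>h\<in>N. f (y * h) = f y \<Longrightarrow>
      set gs \<subseteq> carrier G \<Longrightarrow> m \<le> length gs \<Longrightarrow> y \<in> carrier G \<Longrightarrow> padic_p ^ k dvd delta gs f y"
    using delta_nilpotent[OF n_pos p_gt2 N, of k] by blast
  have "padic_p ^ k dvd word_elt w N C" if w: "set w \<subseteq> iw_vars n" "m \<le> length w" for w C
  proof (cases "C \<in> carrier (G Mod N)")
    case True
    then obtain y where y: "y \<in> carrier G" "C = coset N y" by (auto simp: carrier_Q)
    interpret R: ring L by (rule L_ring)
    have "word_elt w N C = (\<one>\<^bsub>L\<^esub> \<otimes>\<^bsub>L\<^esub> word_elt w) N (coset N y)" using word_elt_closed[OF w(1)] y by simp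
    also have "\<dots> = delta (rev (map (\<lambda>l. inv\<^bsub>G\<^esub> gen l) w)) (\<lambda>y. \<one>\<^bsub>L\<^esub> N (coset N y)) y"
      by (rule mult_word_elt_entry[OF one_L_closed N y(1) w(1)])
    also have "padic_p ^ k dvd \<dots>"
      using w y gen_in_G iwahori_inv(1) coset_absorb[OF N] by (intro m) auto
    finally show ?thesis .
  qed (simp add: word_elt_outside[OF w(1) N])
  then show ?thesis by blast
qed

section \<open>Convergence of the evaluation\<close>

definition word_bound :: "'p padic_int mat set \<Rightarrow> nat \<Rightarrow> nat" where
  "word_bound N k = (SOME m. \<forall>w C. set w \<subseteq> iw_vars n \<and> m \<le> length w \<longrightarrow> padic_p ^ k dvd word_elt w N C)"

lemma word_bound: "N \<in> ONS \<Longrightarrow> set w \<subseteq> iw_vars n \<Longrightarrow> word_bound N k \<le> length w \<Longrightarrow> padic_p ^ k dvd word_elt w N C"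
  using someI_ex[OF word_elt_nilpotent[of N k]] unfolding word_bound_def by blast

definition partial_sum :: "'p nc_series \<Rightarrow> nat \<Rightarrow> 'p padic_int mat set \<Rightarrow> 'p padic_int mat set \<Rightarrow> 'p padic_int" where
  "partial_sum F m N C = (\<Sum>w\<in>iw_words n m. nc_coeff F w * word_elt w N C)"

lemma partial_sum_cong:
  assumes "N \<in> ONS" "m \<ge> word_bound N k"
  shows "padic_p ^ k dvd partial_sum F m N C - partial_sum F (word_bound N k) N C"
proof -
  have "iw_words n (word_bound N k) \<subseteq> iw_words n m" using assms by (auto simp: iw_words_def)
  then have "partial_sum F m N C - partial_sum F (word_bound N k) N C = (\<Sum>w\<in>iw_words n m - iw_words n (word_bound N k). nc_coeff F w * word_elt w N C)"
    unfolding partial_sum_def by (simp add: sum_diff)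
  also have "padic_p ^ k dvd \<dots>"
    by (intro dvd_sum dvd_mult word_bound[OF assms(1)]) (auto simp: iw_words_def)
  finally show ?thesis .
qed

text \<open>The p-adic limit of the partial sums, coset by coset. It is specified together with its
  rate of convergence, which makes it unique and turns every later identity into a congruence
  between partial sums.\<close>

definition phi :: "'p nc_series \<Rightarrow> 'p iwasawa" where
  "phi F = (\<lambda>N\<in>ONS. \<lambda>C. SOME y. \<forall>k. \<forall>m\<ge>word_bound N k. padic_p ^ k dvd y - partial_sum F m N C)"

lemma phi_cong:
  assumes "N \<in> ONS" "m \<ge> word_bound N k"
  shows "padic_p ^ k dvd phi F N C - partial_sum F m N C"
proof -
  have "\<exists>y. \<forall>k. \<forall>m\<ge>word_bound N k. padic_p ^ k dvd y - partial_sum F m N C"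
    by (rule padic_Cauchy_limit) (rule partial_sum_cong[OF assms(1)])
  from someI_ex[OF this] show ?thesis using assms by (simp add: phi_def)
qed

text \<open>One sufficiently long partial sum for each k is enough, so the length of the truncation
  can be adapted to the identity at hand.\<close>

lemma phi_eqI:
  assumes N: "N \<in> ONS" and y: "\<And>k. \<exists>m\<ge>word_bound N k. padic_p ^ k dvd y - partial_sum F m N C"
  shows "phi F N C = y"
proof (rule padic_eqI)
  fix k
  obtain m where m: "m \<ge> word_bound N k" "padic_p ^ k dvd y - partial_sum F m N C" using y by blast
  from dvd_diff[OF phi_cong[OF N m(1), of F C] m(2)] show "padic_p ^ k dvd phi F N C - y" by simp
qed

end

lemma ncps_eqI: "(\<And>w. nc_coeff F w = nc_coeff H w) \<Longrightarrow> F = H"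
  by (simp add: nc_coeff_inject[symmetric] fun_eq_iff)

lemma coeff_var_mult:
  "nc_coeff (nc_var l * F) v = (if v \<noteq> [] \<and> hd v = l then nc_coeff F (tl v) else 0)"
proof (cases v)
  case (Cons a v')
  have "nc_coeff (nc_var l * F) v = (\<Sum>k\<le>length v. (if take k v = [l] then 1 else 0) * nc_coeff F (drop k v))"
    by (simp add: times_ncps.rep_eq nc_var.rep_eq)
  also have "\<dots> = (\<Sum>k\<in>{1}. (if take k v = [l] then 1 else 0) * nc_coeff F (drop k v))"
  proof (rule sum.mono_neutral_right)
    show "\<forall>k\<in>{..length v} - {1}. (if take k v = [l] then 1 else 0) * nc_coeff F (drop k v) = 0"
    proof
      fix k assume k: "k \<in> {..length v} - {1}"
      have "length (take k v) = k" using k by auto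
      then have "take k v \<noteq> [l]" using k by (metis DiffD2 One_nat_def insertI1 length_Cons list.size(3))
      then show "(if take k v = [l] then 1 else 0) * nc_coeff F (drop k v) = 0" by simp
    qed
  qed (use Cons in auto)
  finally show ?thesis using Cons by simp
qed (simp add: times_ncps.rep_eq nc_var.rep_eq)

definition nc_mono :: "'v list \<Rightarrow> ('v, 'a::comm_ring_1) ncps" where
  "nc_mono w = Abs_ncps (\<lambda>v. if v = w then 1 else 0)"

lemma coeff_mono: "nc_coeff (nc_mono w) v = (if v = w then 1 else 0)"
  by (simp add: nc_mono_def Abs_ncps_inverse)

lemma mono_Nil: "nc_mono [] = 1"
  by (rule ncps_eqI) (simp add: coeff_mono one_ncps.rep_eq)

lemma mono_Cons: "nc_mono (l # w) = nc_var l * nc_mono w"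
  by (rule ncps_eqI) (auto simp: coeff_mono coeff_var_mult neq_Nil_conv)

lemma var_power: "nc_var l ^ r = nc_mono (replicate r l)"
  by (induction r) (simp_all add: mono_Nil mono_Cons)

lemma mono_closed: "set w \<subseteq> iw_vars n \<Longrightarrow> nc_mono w \<in> carrier (nc_algebra n)"
  by (auto simp: mem_nc_algebra coeff_mono)

lemma coeff_sum: "nc_coeff (sum f I) w = (\<Sum>i\<in>I. nc_coeff (f i) w)"
  by (induction I rule: infinite_finite_induct) (simp_all add: zero_ncps.rep_eq plus_ncps.rep_eq)

lemma truncation_eq:
  assumes "F \<in> carrier (nc_algebra n)"
  shows "nc_coeff (\<Sum>w\<in>iw_words n m. nc_smult (nc_coeff F w) (nc_mono w)) v = (if length v < m then nc_coeff F v else 0)"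
proof -
  have "nc_coeff (\<Sum>w\<in>iw_words n m. nc_smult (nc_coeff F w) (nc_mono w)) v
      = (\<Sum>w\<in>iw_words n m. if v = w then nc_coeff F w else 0)"
    unfolding coeff_sum by (intro sum.cong refl) (simp add: nc_smult.rep_eq coeff_mono)
  also have "\<dots> = (if v \<in> iw_words n m then nc_coeff F v else 0)" by simp
  finally show ?thesis using assms by (auto simp: iw_words_def mem_nc_algebra)
qed

text \<open>Powers of a single variable are monomials, so each word receives a contribution from at
  most one r.\<close>

lemma coeff_one_plus_power:
  "nc_coeff (one_plus_power (nc_var l) q) w = (if w = replicate (length w) l then padic_gchoose q (length w) else 0)"
proof -
  have "nc_coeff (one_plus_power (nc_var l) q) w
      = (\<Sum>r\<le>length w. if w = replicate r l then padic_gchoose q r else 0)"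
    unfolding one_plus_power_def var_power by (auto simp: Abs_ncps_inverse coeff_mono intro!: sum.cong)
  also have "\<dots> = (\<Sum>r\<in>{length w}. if w = replicate r l then padic_gchoose q r else 0)"
    by (rule sum.mono_neutral_right) auto
  finally show ?thesis by simp
qed

lemma one_plus_power_closed: "l \<in> iw_vars n \<Longrightarrow> one_plus_power (nc_var l) q \<in> carrier (nc_algebra n)"
  unfolding mem_nc_algebra coeff_one_plus_power
proof (intro allI impI)
  fix w assume "l \<in> iw_vars n" "\<not> set w \<subseteq> iw_vars n"
  then have "w \<noteq> replicate (length w) l" by (metis in_set_replicate subsetI)
  then show "(if w = replicate (length w) l then padic_gchoose q (length w) else 0) = 0" by simp
qed

context iwasawa_setup
begin

section \<open>The evaluation is a continuous algebra homomorphism\<close>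

lemma partial_sum_outside: "N \<in> ONS \<Longrightarrow> C \<notin> carrier (G Mod N) \<Longrightarrow> partial_sum F m N C = 0"
  unfolding partial_sum_def by (intro sum.neutral) (auto simp: word_elt_outside iw_words_def)

lemma phi_outside: "N \<in> ONS \<Longrightarrow> C \<notin> carrier (G Mod N) \<Longrightarrow> phi F N C = 0"
  by (rule phi_eqI) (auto simp: partial_sum_outside)

lemma phi_T: "N \<in> ONS \<Longrightarrow> phi F N \<in> carrier (T N)"
  unfolding mem_group_ring[OF finite_group.fin[OF Q_finite_group]] using phi_outside by blast

lemma partial_sum_transition:
  assumes NM: "N \<in> ONS" "M \<in> ONS" "N \<subseteq> M"
  shows "partial_sum F m M C = (\<Sum>X\<in>carrier (G Mod N). if M <#>\<^bsub>G\<^esub> X = C then partial_sum F m N X else 0)"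
proof -
  have w: "word_elt w M C = (\<Sum>X\<in>carrier (G Mod N). if M <#>\<^bsub>G\<^esub> X = C then word_elt w N X else 0)" if "w \<in> iw_words n m" for w
  proof -
    have c: "word_elt w \<in> carrier L" using that by (intro word_elt_closed) (auto simp: iw_words_def)
    then have "word_elt w N \<in> carrier (T N)" "word_elt w M = group_ring_map (\<lambda>C. M <#>\<^bsub>G\<^esub> C) (word_elt w N)" using NM by (auto simp: mem_L)
    then show ?thesis using group_ring_map_eq[OF finite_group.fin[OF Q_finite_group[OF NM(1)]]] by simp
  qed
  have "partial_sum F m M C = (\<Sum>w\<in>iw_words n m. \<Sum>X\<in>carrier (G Mod N). if M <#>\<^bsub>G\<^esub> X = C then nc_coeff F w * word_elt w N X else 0)"
    unfolding partial_sum_def by (auto simp: w sum_distrib_left intro!: sum.cong)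
  also have "\<dots> = (\<Sum>X\<in>carrier (G Mod N). \<Sum>w\<in>iw_words n m. if M <#>\<^bsub>G\<^esub> X = C then nc_coeff F w * word_elt w N X else 0)"
    by (rule sum.swap)
  finally show ?thesis unfolding partial_sum_def by (auto intro!: sum.cong)
qed

lemma phi_closed: "phi F \<in> carrier L"
  unfolding mem_L
proof (intro conjI ballI impI)
  show "phi F \<in> extensional ONS" by (simp add: phi_def)
  fix N assume N: "N \<in> ONS"
  show "phi F N \<in> carrier (T N)" by (rule phi_T[OF N])
  fix M assume M: "M \<in> ONS" and NM: "N \<subseteq> M"
  show "group_ring_map (\<lambda>C. M <#>\<^bsub>G\<^esub> C) (phi F N) = phi F M"
  proof
    fix C
    have "phi F M C = (\<Sum>X\<in>carrier (G Mod N). if M <#>\<^bsub>G\<^esub> X = C then phi F N X else 0)"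
    proof (rule phi_eqI[OF M])
      fix k
      let ?m = "max (word_bound M k) (word_bound N k)"
      have "(\<Sum>X\<in>carrier (G Mod N). if M <#>\<^bsub>G\<^esub> X = C then phi F N X else 0) - partial_sum F ?m M C
          = (\<Sum>X\<in>carrier (G Mod N). if M <#>\<^bsub>G\<^esub> X = C then phi F N X - partial_sum F ?m N X else 0)"
        unfolding partial_sum_transition[OF N M NM] sum_subtractf[symmetric] by (intro sum.cong) auto
      also have "padic_p ^ k dvd \<dots>" using phi_cong[OF N, of k ?m] by (intro dvd_sum) auto
      finally show "\<exists>m\<ge>word_bound M k. padic_p ^ k dvd (\<Sum>X\<in>carrier (G Mod N). if M <#>\<^bsub>G\<^esub> X = C then phi F N X else 0) - partial_sum F m M C"
        by (intro exI[of _ ?m]) simp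
    qed
    then show "group_ring_map (\<lambda>C. M <#>\<^bsub>G\<^esub> C) (phi F N) C = phi F M C"
      using group_ring_map_eq[OF finite_group.fin[OF Q_finite_group[OF N]] phi_T[OF N]] by simp
  qed
qed

lemma phi_add_entry: "N \<in> ONS \<Longrightarrow> phi (F + H) N C = phi F N C + phi H N C"
proof (rule phi_eqI)
  fix k assume N: "N \<in> ONS"
  have "(phi F N C + phi H N C) - partial_sum (F + H) (word_bound N k) N C = (phi F N C - partial_sum F (word_bound N k) N C) + (phi H N C - partial_sum H (word_bound N k) N C)"
    by (simp add: partial_sum_def plus_ncps.rep_eq distrib_right sum.distrib)
  also have "padic_p ^ k dvd \<dots>" using phi_cong[OF N, of k "word_bound N k"] by (intro dvd_add) auto
  finally show "\<exists>m\<ge>word_bound N k. padic_p ^ k dvd (phi F N C + phi H N C) - partial_sum (F + H) m N C" by blast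
qed

lemma phi_smult_entry: "N \<in> ONS \<Longrightarrow> phi (nc_smult c F) N C = c * phi F N C"
proof (rule phi_eqI)
  fix k assume N: "N \<in> ONS"
  have "c * phi F N C - partial_sum (nc_smult c F) (word_bound N k) N C = c * (phi F N C - partial_sum F (word_bound N k) N C)"
    by (simp add: partial_sum_def nc_smult.rep_eq mult.assoc sum_distrib_left right_diff_distrib)
  also have "padic_p ^ k dvd \<dots>" using phi_cong[OF N, of k "word_bound N k"] by (intro dvd_mult) auto
  finally show "\<exists>m\<ge>word_bound N k. padic_p ^ k dvd c * phi F N C - partial_sum (nc_smult c F) m N C" by blast
qed

lemma phi_mono:
  assumes w: "set w \<subseteq> iw_vars n"
  shows "phi (nc_mono w) = word_elt w"
proof (rule L_ext[OF phi_closed word_elt_closed[OF w]], rule ext, rule phi_eqI)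
  fix N C k assume N: "N \<in> ONS"
  let ?m = "max (Suc (length w)) (word_bound N k)"
  have "partial_sum (nc_mono w) ?m N C = (\<Sum>v\<in>iw_words n ?m. if v = w then word_elt w N C else 0)"
    unfolding partial_sum_def coeff_mono by (intro sum.cong) auto
  also have "\<dots> = word_elt w N C" using w by (subst sum.delta[OF finite_iw_words]) (simp add: iw_words_def)
  finally show "\<exists>m\<ge>word_bound N k. padic_p ^ k dvd word_elt w N C - partial_sum (nc_mono w) m N C" by (intro exI[of _ ?m]) simp
qed

text \<open>With m the word bound, pairs of words shorter than m concatenate to words shorter than 2
  m. Any other pair has a member of length at least m, so its concatenation contributes 0 modulo
  p^k.\<close>

lemma partial_sum_mult:
  assumes N: "N \<in> ONS"
  shows "padic_p ^ k dvd partial_sum (F * H) (2 * word_bound N k) N C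
    - (\<Sum>(u, v)\<in>iw_words n (word_bound N k) \<times> iw_words n (word_bound N k). nc_coeff F u * nc_coeff H v * word_elt (u @ v) N C)"
proof -
  let ?m = "word_bound N k"
  let ?P = "{(u, v). u @ v \<in> iw_words n (2 * ?m)}" and ?W = "iw_words n ?m \<times> iw_words n ?m"
  let ?t = "\<lambda>(u, v). nc_coeff F u * nc_coeff H v * word_elt (u @ v) N C"
  have "partial_sum (F * H) (2 * ?m) N C
      = (\<Sum>w\<in>iw_words n (2 * ?m). \<Sum>j\<le>length w. nc_coeff F (take j w) * nc_coeff H (drop j w) * word_elt w N C)"
    by (simp add: partial_sum_def times_ncps.rep_eq sum_distrib_right)
  also have "\<dots> = (\<Sum>(w, j)\<in>Sigma (iw_words n (2 * ?m)) (\<lambda>w. {..length w}). nc_coeff F (take j w) * nc_coeff H (drop j w) * word_elt w N C)"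
    by (rule sum.Sigma) auto
  \<comment> \<open>A word with a cutting position is the same as a pair of words.\<close>
  also have "\<dots> = sum ?t ?P"
    by (rule sum.reindex_bij_witness[of _ "\<lambda>(u, v). (u @ v, length u)" "\<lambda>(w, j). (take j w, drop j w)"]) auto
  finally have 1: "partial_sum (F * H) (2 * ?m) N C = sum ?t ?P" .
  have "?P \<subseteq> (\<lambda>(w, j). (take j w, drop j w)) ` Sigma (iw_words n (2 * ?m)) (\<lambda>w. {..length w})"
  proof
    fix x assume "x \<in> ?P"
    then obtain u v where x: "x = (u, v)" "u @ v \<in> iw_words n (2 * ?m)" by auto
    then show "x \<in> (\<lambda>(w, j). (take j w, drop j w)) ` Sigma (iw_words n (2 * ?m)) (\<lambda>w. {..length w})"
      by (intro image_eqI[of _ _ "(u @ v, length u)"]) auto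
  qed
  then have fin: "finite ?P" by (rule finite_subset) auto
  have "?W \<subseteq> ?P" by (auto simp: iw_words_def)
  then have "sum ?t ?P - sum ?t ?W = sum ?t (?P - ?W)" using fin by (simp add: sum_diff)
  also have "padic_p ^ k dvd \<dots>"
  proof (rule dvd_sum)
    fix x assume x: "x \<in> ?P - ?W"
    then obtain u v where uv: "x = (u, v)" "u @ v \<in> iw_words n (2 * ?m)" "\<not> (u \<in> iw_words n ?m \<and> v \<in> iw_words n ?m)" by auto
    then have "set (u @ v) \<subseteq> iw_vars n" "?m \<le> length (u @ v)" by (auto simp: iw_words_def)
    then have "padic_p ^ k dvd word_elt (u @ v) N C" by (rule word_bound[OF N])
    then show "padic_p ^ k dvd ?t x" by (simp add: uv(1))
  qed
  finally show ?thesis unfolding 1 .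
qed

text \<open>Replacing both factors by partial sums changes the convolution by a multiple of p^k, and
  the convolution of the partial sums is the double sum in \<open>partial_sum_mult\<close>.\<close>

lemma phi_mult_entry:
  assumes N: "N \<in> ONS" and C: "C \<in> carrier (G Mod N)"
  shows "phi (F * H) N C = (phi F N \<otimes>\<^bsub>T N\<^esub> phi H N) C"
proof -
  interpret Q: finite_group "G Mod N" by (rule Q_finite_group[OF N])
  let ?Q = "carrier (G Mod N)"
  let ?r = "\<lambda>X. inv\<^bsub>G Mod N\<^esub> X \<otimes>\<^bsub>G Mod N\<^esub> C"
  have e: "(phi F N \<otimes>\<^bsub>T N\<^esub> phi H N) C = (\<Sum>X\<in>?Q. phi F N X * phi H N (?r X))"
    using C by (simp add: Q.group_ring_mult[OF phi_T[OF N] phi_T[OF N]])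
  show ?thesis unfolding e
  proof (rule phi_eqI[OF N])
    fix k
    let ?m = "word_bound N k"
    have "(\<Sum>X\<in>?Q. partial_sum F ?m N X * partial_sum H ?m N (?r X))
        = (\<Sum>X\<in>?Q. \<Sum>(u, v)\<in>iw_words n ?m \<times> iw_words n ?m. nc_coeff F u * nc_coeff H v * (word_elt u N X * word_elt v N (?r X)))"
      unfolding partial_sum_def sum_product sum.cartesian_product by (intro sum.cong) (auto simp: mult_ac)
    also have "\<dots> = (\<Sum>x\<in>iw_words n ?m \<times> iw_words n ?m. \<Sum>X\<in>?Q. case x of (u, v) \<Rightarrow> nc_coeff F u * nc_coeff H v * (word_elt u N X * word_elt v N (?r X)))"
      by (rule sum.swap)
    also have "\<dots> = (\<Sum>(u, v)\<in>iw_words n ?m \<times> iw_words n ?m. nc_coeff F u * nc_coeff H v * word_elt (u @ v) N C)"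
    proof (rule sum.cong[OF refl])
      fix x assume "x \<in> iw_words n ?m \<times> iw_words n ?m"
      then obtain u v where x: "x = (u, v)" "set u \<subseteq> iw_vars n" "set v \<subseteq> iw_vars n" by (auto simp: iw_words_def)
      have "word_elt u N \<in> carrier (T N)" "word_elt v N \<in> carrier (T N)" using word_elt_closed[OF x(2)] word_elt_closed[OF x(3)] N by (auto simp: mem_L)
      then have "word_elt (u @ v) N C = (\<Sum>X\<in>?Q. word_elt u N X * word_elt v N (?r X))"
        using word_elt_append[OF x(2,3)] N C by (simp add: L_simps Q.group_ring_mult)
      then show "(\<Sum>X\<in>?Q. case x of (u, v) \<Rightarrow> nc_coeff F u * nc_coeff H v * (word_elt u N X * word_elt v N (?r X)))
          = (case x of (u, v) \<Rightarrow> nc_coeff F u * nc_coeff H v * word_elt (u @ v) N C)"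
        by (simp add: x(1) sum_distrib_left)
    qed
    finally have 1: "(\<Sum>X\<in>?Q. partial_sum F ?m N X * partial_sum H ?m N (?r X))
        = (\<Sum>(u, v)\<in>iw_words n ?m \<times> iw_words n ?m. nc_coeff F u * nc_coeff H v * word_elt (u @ v) N C)" .
    have "padic_p ^ k dvd (\<Sum>X\<in>?Q. phi F N X * phi H N (?r X)) - (\<Sum>X\<in>?Q. partial_sum F ?m N X * partial_sum H ?m N (?r X))"
      unfolding sum_subtractf[symmetric]
    proof (rule dvd_sum)
      fix X
      have "phi F N X * phi H N (?r X) - partial_sum F ?m N X * partial_sum H ?m N (?r X)
          = (phi F N X - partial_sum F ?m N X) * phi H N (?r X) + partial_sum F ?m N X * (phi H N (?r X) - partial_sum H ?m N (?r X))"
        by (simp add: algebra_simps)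
      also have "padic_p ^ k dvd \<dots>"
        by (intro dvd_add dvd_mult2[OF phi_cong[OF N]] dvd_mult[OF phi_cong[OF N]]) auto
      finally show "padic_p ^ k dvd phi F N X * phi H N (?r X) - partial_sum F ?m N X * partial_sum H ?m N (?r X)" .
    qed
    from dvd_diff[OF this partial_sum_mult[OF N, of k F H C, folded 1]]
    have "padic_p ^ k dvd (\<Sum>X\<in>?Q. phi F N X * phi H N (?r X)) - partial_sum (F * H) (2 * ?m) N C" by simp
    then show "\<exists>m\<ge>word_bound N k. padic_p ^ k dvd (\<Sum>X\<in>?Q. phi F N X * phi H N (?r X)) - partial_sum (F * H) m N C"
      by (intro exI[of _ "2 * ?m"]) simp
  qed
qed

lemma phi_mult: "phi (F * H) = phi F \<otimes>\<^bsub>L\<^esub> phi H"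
proof (rule L_ext[OF phi_closed L_closed(1)[OF phi_closed phi_closed]])
  fix N assume N: "N \<in> ONS"
  show "phi (F * H) N = (phi F \<otimes>\<^bsub>L\<^esub> phi H) N"
  proof
    fix C
    have "(phi F N \<otimes>\<^bsub>T N\<^esub> phi H N) C = 0" if "C \<notin> carrier (G Mod N)"
      using that by (simp add: finite_group.group_ring_mult[OF Q_finite_group[OF N] phi_T[OF N] phi_T[OF N]])
    then show "phi (F * H) N C = (phi F \<otimes>\<^bsub>L\<^esub> phi H) N C"
      using phi_mult_entry[OF N] phi_outside[OF N] N by (cases "C \<in> carrier (G Mod N)") (simp_all add: L_simps)
  qed
qed

lemma phi_add: "phi (F + H) = phi F \<oplus>\<^bsub>L\<^esub> phi H"
  by (rule L_ext[OF phi_closed L_closed(2)[OF phi_closed phi_closed]])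
    (simp add: L_simps group_ring_simps phi_add_entry fun_eq_iff)

lemma phi_smult: "phi (nc_smult c F) = c \<odot>\<^bsub>L\<^esub> phi F"
  by (rule L_ext[OF phi_closed smult_L_closed[OF phi_closed]])
    (simp add: L_simps group_ring_simps phi_smult_entry fun_eq_iff)

lemma phi_one: "phi 1 = \<one>\<^bsub>L\<^esub>"
  using phi_mono[of "[]"] by (simp add: mono_Nil)

lemma phi_var: "l \<in> iw_vars n \<Longrightarrow> phi (nc_var l) = letter l"
  using phi_mono[of "[l]"] ring.ring_simprules(12)[OF L_ring] monoid.r_one[OF ring.is_monoid[OF L_ring] letter_closed[of l]]
  by (simp add: mono_Nil mono_Cons)

lemma continuous_map_padicI:
  fixes c :: "'p nc_series \<Rightarrow> 'p padic_int"
  assumes "\<And>k. \<exists>m. \<forall>F\<in>carrier A. \<forall>H\<in>carrier A. (\<forall>w. padic_p ^ (m - length w) dvd nc_coeff H w - nc_coeff F w) \<longrightarrow> padic_p ^ k dvd c H - c F"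
  shows "continuous_map (nc_topology n) euclidean c"
  unfolding continuous_map_def
proof (intro conjI allI impI)
  fix U :: "'p padic_int set" assume "openin euclidean U"
  then have U: "open U" by simp
  show "openin (nc_topology n) {x \<in> topspace (nc_topology n). c x \<in> U}"
    unfolding openin_nc_topology'
  proof (intro conjI ballI)
    fix F assume F: "F \<in> {x \<in> topspace (nc_topology n). c x \<in> U}"
    then obtain k where k: "\<And>y. padic_p ^ k dvd y - c F \<Longrightarrow> y \<in> U" using U unfolding open_padic_int_def by blast
    obtain m where "\<forall>F\<in>carrier A. \<forall>H\<in>carrier A. (\<forall>w. padic_p ^ (m - length w) dvd nc_coeff H w - nc_coeff F w) \<longrightarrow> padic_p ^ k dvd c H - c F"
      using assms by blast
    then show "\<exists>m. \<forall>H\<in>carrier A. (\<forall>w. padic_p ^ (m - length w) dvd nc_coeff H w - nc_coeff F w) \<longrightarrow> H \<in> {x \<in> topspace (nc_topology n). c x \<in> U}"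
      using F k by (intro exI[of _ m]) auto
  qed auto
qed auto

text \<open>Only words shorter than \<open>word_bound N k\<close> matter modulo p^k; adding k to
  this bound leaves precision p^k on each of their coefficients.\<close>

lemma phi_entry_continuous:
  assumes N: "N \<in> ONS"
  shows "continuous_map (nc_topology n) euclidean (\<lambda>F. phi F N C)"
proof (rule continuous_map_padicI)
  fix k
  have "padic_p ^ k dvd phi H N C - phi F N C"
    if "\<forall>w. padic_p ^ ((k + word_bound N k) - length w) dvd nc_coeff H w - nc_coeff F w" for F H
  proof -
    have "partial_sum H (word_bound N k) N C - partial_sum F (word_bound N k) N C = (\<Sum>w\<in>iw_words n (word_bound N k). (nc_coeff H w - nc_coeff F w) * word_elt w N C)"
      by (simp add: partial_sum_def sum_subtractf left_diff_distrib)
    also have "padic_p ^ k dvd \<dots>"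
    proof (intro dvd_sum dvd_mult2)
      fix w assume "w \<in> iw_words n (word_bound N k)"
      then have "k \<le> (k + word_bound N k) - length w" unfolding iw_words_def by auto
      then show "padic_p ^ k dvd nc_coeff H w - nc_coeff F w" using that by (meson dvd_trans le_imp_power_dvd)
    qed
    finally have "padic_p ^ k dvd partial_sum H (word_bound N k) N C - partial_sum F (word_bound N k) N C" .
    from dvd_diff[OF dvd_add[OF this phi_cong[OF N order_refl, of k H C]] phi_cong[OF N order_refl, of k F C]]
    show ?thesis by simp
  qed
  then show "\<exists>m. \<forall>F\<in>carrier A. \<forall>H\<in>carrier A. (\<forall>w. padic_p ^ (m - length w) dvd nc_coeff H w - nc_coeff F w) \<longrightarrow> padic_p ^ k dvd phi H N C - phi F N C"
    by blast
qed

lemma phi_continuous: "continuous_map (nc_topology n) (iwasawa_topology n) phi"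
proof -
  have "continuous_map (nc_topology n) (product_topology (\<lambda>_. euclidean) UNIV) (\<lambda>F. phi F N)" if "N \<in> ONS" for N
    using phi_entry_continuous[OF that] unfolding continuous_map_componentwise_UNIV by blast
  then have "continuous_map (nc_topology n) (top_of_set (carrier (T N))) (\<lambda>F. phi F N)" if "N \<in> ONS" for N
    using that phi_T[OF that] by (auto simp: continuous_map_in_subtopology euclidean_product_topology)
  then show ?thesis
    unfolding iwasawa_topology_def continuous_map_in_subtopology continuous_map_componentwise
    using phi_closed by (auto simp: phi_def)
qed

section \<open>Existence and uniqueness of the natural map\<close>

lemma Hausdorff_iwasawa_topology: "Hausdorff_space (iwasawa_topology n :: 'p iwasawa topology)"
proof -
  have "Hausdorff_space (euclidean :: 'p padic_int topology)"
    unfolding Hausdorff_space_def disjnt_def using hausdorff by auto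
  then have "Hausdorff_space (euclidean :: ('p padic_int mat set \<Rightarrow> 'p padic_int) topology)"
    by (subst euclidean_product_topology[symmetric]) (simp add: Hausdorff_space_product_topology)
  then show ?thesis
    unfolding iwasawa_topology_def
    by (intro Hausdorff_space_subtopology) (auto simp: Hausdorff_space_product_topology intro!: Hausdorff_space_subtopology)
qed

lemma iw_vars_cases:
  assumes "l \<in> iw_vars n"
  obtains \<beta> where "\<beta> \<in> neg_roots n" "l = U_var \<beta>" | \<delta> where "\<delta> \<in> simple_roots n" "l = W_var \<delta>"
    | \<alpha> where "\<alpha> \<in> pos_roots n" "l = V_var \<alpha>"
  using assms by (auto simp: iw_vars_def)

lemma natural_map_var: "is_natural_map n \<phi> \<Longrightarrow> l \<in> iw_vars n \<Longrightarrow> \<phi> (nc_var l) = letter l"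
  by (erule iw_vars_cases) (auto simp: is_natural_map_def letter_def)

text \<open>The set where two such maps agree is closed because the target is Hausdorff, and it
  contains all polynomials; the truncations of F are polynomials arbitrarily close to F.\<close>

lemma natural_map_unique:
  fixes \<phi> \<psi> :: "'p nc_series \<Rightarrow> 'p iwasawa"
  assumes \<phi>: "is_natural_map n \<phi>" and \<psi>: "is_natural_map n \<psi>"
  shows "\<phi> = \<psi>"
proof -
  define E where "E = {F \<in> carrier A. \<phi> F = \<psi> F}"
  have h: "\<phi> \<in> Ring.ring_hom A L" "\<psi> \<in> Ring.ring_hom A L" using \<phi> \<psi> by (auto simp: is_natural_map_def)
  have add: "F + H \<in> E" if "F \<in> E" "H \<in> E" for F H
    using that ring_hom_add[OF h(1), of F H] ring_hom_add[OF h(2), of F H] by (auto simp: E_def nc_algebra_closed nc_algebra_simps)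
  have mult: "F * H \<in> E" if "F \<in> E" "H \<in> E" for F H
    using that ring_hom_mult[OF h(1), of F H] ring_hom_mult[OF h(2), of F H] by (auto simp: E_def nc_algebra_mult_closed nc_algebra_simps)
  have smult: "nc_smult c F \<in> E" if F: "F \<in> E" for c F
  proof -
    have "\<phi> (c \<odot>\<^bsub>A\<^esub> F) = c \<odot>\<^bsub>L\<^esub> \<phi> F" "\<psi> (c \<odot>\<^bsub>A\<^esub> F) = c \<odot>\<^bsub>L\<^esub> \<psi> F"
      using \<phi> \<psi> F unfolding is_natural_map_def E_def by blast+
    then show ?thesis using F by (simp add: E_def nc_algebra_closed1 nc_algebra_simps)
  qed
  have one: "1 \<in> E" using ring_hom_one[OF h(1)] ring_hom_one[OF h(2)] by (auto simp: E_def nc_algebra_0_1 nc_algebra_simps)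
  have "nc_smult 0 1 = (0 :: 'p nc_series)" by (rule ncps_eqI) (simp add: nc_smult.rep_eq zero_ncps.rep_eq)
  then have zero: "0 \<in> E" using smult[OF one, of 0] by simp
  have mono: "nc_mono w \<in> E" if "set w \<subseteq> iw_vars n" for w
    using that
  proof (induction w)
    case (Cons l w)
    then have "nc_var l \<in> E" using natural_map_var[OF \<phi>] natural_map_var[OF \<psi>] by (auto simp: E_def nc_var_closed)
    then show ?case using Cons mult by (simp add: mono_Cons)
  qed (simp add: mono_Nil one)
  have sumE: "sum f I \<in> E" if "\<And>i. i \<in> I \<Longrightarrow> f i \<in> E" for f and I :: "iw_var list set"
    using that by (induction I rule: infinite_finite_induct) (auto intro: add zero)
  have trunc: "(\<Sum>w\<in>iw_words n m. nc_smult (nc_coeff F w) (nc_mono w)) \<in> E" for F m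
    by (intro sumE smult mono) (auto simp: iw_words_def)
  have "closedin (nc_topology n) {F \<in> topspace (nc_topology n). \<phi> F = \<psi> F}"
    using \<phi> \<psi> by (intro closedin_continuous_maps_eq[OF Hausdorff_iwasawa_topology]) (auto simp: is_natural_map_def)
  then have cl: "openin (nc_topology n) (carrier A - E)" by (simp add: E_def closedin_def)
  have "F \<in> E" if F: "F \<in> carrier A" for F
  proof (rule ccontr)
    assume "F \<notin> E"
    then obtain m where m: "\<And>H. H \<in> carrier A \<Longrightarrow> (\<forall>w. padic_p ^ (m - length w) dvd nc_coeff H w - nc_coeff F w) \<Longrightarrow> H \<in> carrier A - E"
      using cl F unfolding openin_nc_topology' by blast
    let ?H = "\<Sum>w\<in>iw_words n m. nc_smult (nc_coeff F w) (nc_mono w)"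
    have "\<forall>w. padic_p ^ (m - length w) dvd nc_coeff ?H w - nc_coeff F w" unfolding truncation_eq[OF F] by auto
    then show False using m[of ?H] trunc[of F m] by (auto simp: E_def)
  qed
  moreover have "\<phi> \<in> extensional (carrier A)" "\<psi> \<in> extensional (carrier A)" using \<phi> \<psi> by (auto simp: is_natural_map_def)
  ultimately show ?thesis by (intro extensionalityI[of \<phi> "carrier A" \<psi>]) (auto simp: E_def)
qed

lemma phi_natural: "is_natural_map n (restrict phi (carrier A))"
proof -
  have "restrict phi (carrier A) \<in> Ring.ring_hom A L"
    by (rule ring_hom_memI)
      (auto simp: phi_closed nc_algebra_simps nc_algebra_closed nc_algebra_mult_closed nc_algebra_0_1 phi_mult phi_add phi_one)
  moreover have "continuous_map (nc_topology n) (iwasawa_topology n) (restrict phi (carrier A))"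
    using phi_continuous by (rule continuous_map_eq) simp
  moreover have "restrict phi (carrier A) (nc_var l) = letter l" if "l \<in> iw_vars n" for l
    using that by (simp add: nc_var_closed phi_var)
  then have "restrict phi (carrier A) (nc_var (U_var \<beta>)) = letter (U_var \<beta>)" if "\<beta> \<in> neg_roots n" for \<beta>
    using that by (simp add: iw_vars_def)
  moreover have "restrict phi (carrier A) (nc_var (W_var \<delta>)) = letter (W_var \<delta>)" if "\<delta> \<in> simple_roots n" for \<delta>
    using that \<open>\<And>l. l \<in> iw_vars n \<Longrightarrow> _\<close> by (simp add: iw_vars_def)
  moreover have "restrict phi (carrier A) (nc_var (V_var \<alpha>)) = letter (V_var \<alpha>)" if "\<alpha> \<in> pos_roots n" for \<alpha>
    using that \<open>\<And>l. l \<in> iw_vars n \<Longrightarrow> _\<close> by (simp add: iw_vars_def)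
  ultimately show ?thesis unfolding is_natural_map_def
    by (auto simp: nc_algebra_simps nc_algebra_closed1 phi_smult letter_def)
qed

end

section \<open>Reduction to ordered monomials\<close>

text \<open>The numerator contains both q and q - 1, one of which is divisible by p, while r! is
  prime to p.\<close>

lemma p_dvd_gchoose_ge2:
  fixes q :: "'p::prime_card padic_int"
  assumes "padic_p dvd q \<or> padic_p dvd q - 1" "2 \<le> r" "r < CARD('p)"
  shows "padic_p dvd padic_gchoose q r"
proof -
  have "\<exists>i\<in>{0..<r}. padic_p dvd q - of_nat i"
    using assms(1)
  proof
    assume "padic_p dvd q" then show ?thesis using assms(2) by (intro bexI[of _ 0]) auto
  next
    assume "padic_p dvd q - 1" then show ?thesis using assms(2) by (intro bexI[of _ 1]) auto
  qed
  then obtain i where i: "i \<in> {0..<r}" "padic_p dvd q - of_nat i" by blast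
  have "q - of_nat i dvd (\<Prod>i=0..<r. q - of_nat i)" using i(1) by (intro dvd_prodI) auto
  then have "padic_p dvd fact r * padic_gchoose q r"
    unfolding fact_mult_gchoose by (rule dvd_trans[OF i(2)])
  moreover have "\<not> padic_p dvd (fact r :: 'p padic_int)"
  proof -
    have "\<not> int CARD('p) dvd int (fact r)"
      using assms prime_dvd_fact_iff[OF prime_card[where 'a='p]] by (simp only: int_dvd_int_iff not_le)
    then have "residue (of_nat (fact r) :: 'p padic_int) 1 \<noteq> 0"
      by (simp only: residue_of_nat dvd_eq_mod_eq_0 power_one_right not_False_eq_True)
    then show ?thesis using power_dvd_iff_residue[of 1 "fact r :: 'p padic_int"]
      by (simp only: of_nat_fact power_one_right not_False_eq_True)
  qed
  ultimately show ?thesis by (simp only: p_dvd_mult_iff simp_thms)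
qed

section \<open>Weights of words and series\<close>

context iwasawa_setup
begin

text \<open>The weight of the deviation of a generator from \<open>1\<close>, where \<open>p\<close> has weight \<open>n\<close>.\<close>

fun var_weight :: "iw_var \<Rightarrow> nat" where
  "var_weight (U_var (i, j)) = n - (i - j)"
| "var_weight (W_var \<delta>) = n"
| "var_weight (V_var (i, j)) = j - i"

definition word_weight :: "iw_var list \<Rightarrow> nat" where
  "word_weight w = sum_list (map var_weight w)"

lemma word_weight_simps [simp]: "word_weight [] = 0" "word_weight (l # w) = var_weight l + word_weight w" "word_weight (u @ v) = word_weight u + word_weight v"
  by (simp_all add: word_weight_def)

lemma var_weight_bounds: "l \<in> iw_vars n \<Longrightarrow> 1 \<le> var_weight l \<and> var_weight l \<le> n"
  using n_pos by (auto simp: iw_vars_def neg_roots_def pos_roots_def roots_def)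

lemma word_weight_bounds: "set w \<subseteq> iw_vars n \<Longrightarrow> length w \<le> word_weight w \<and> word_weight w \<le> n * length w"
  by (induction w) (use var_weight_bounds in fastforce)+

text \<open>Says that n times the p-adic valuation is at least k, phrased through a divisor so that
  no infinite valuation of 0 intervenes.\<close>

definition heavy :: "nat \<Rightarrow> 'p padic_int \<Rightarrow> bool" where
  "heavy k x \<longleftrightarrow> (\<exists>a. padic_p ^ a dvd x \<and> k \<le> n * a)"

lemma heavy_0 [simp]: "heavy k 0"
  unfolding heavy_def using n_pos by (intro exI[of _ k]) simp

lemma heavy_zero_weight [simp]: "heavy 0 x"
  unfolding heavy_def by (intro exI[of _ 0]) simp

lemma heavy_add: "heavy k x \<Longrightarrow> heavy k y \<Longrightarrow> heavy k (x + y)"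
  unfolding heavy_def
proof (elim exE conjE)
  fix a b assume ab: "padic_p ^ a dvd x" "k \<le> n * a" "padic_p ^ b dvd y" "k \<le> n * b"
  have "padic_p ^ min a b dvd x" "padic_p ^ min a b dvd y"
    by (rule dvd_trans[OF le_imp_power_dvd[OF min.cobounded1] ab(1)], rule dvd_trans[OF le_imp_power_dvd[OF min.cobounded2] ab(3)])
  then have "padic_p ^ min a b dvd x + y" by (rule dvd_add)
  moreover have "k \<le> n * min a b" using ab by (simp add: min_def)
  ultimately show "\<exists>a. padic_p ^ a dvd x + y \<and> k \<le> n * a" by blast
qed

lemma heavy_sum: "(\<And>i. i \<in> I \<Longrightarrow> heavy k (f i)) \<Longrightarrow> heavy k (sum f I)"
  by (induction I rule: infinite_finite_induct) (auto intro: heavy_add)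

lemma heavy_mult: "heavy k x \<Longrightarrow> heavy l y \<Longrightarrow> heavy (k + l) (x * y)"
  unfolding heavy_def
proof (elim exE conjE)
  fix a b assume ab: "padic_p ^ a dvd x" "k \<le> n * a" "padic_p ^ b dvd y" "l \<le> n * b"
  have "padic_p ^ (a + b) dvd x * y" unfolding power_add using ab by (intro mult_dvd_mono)
  moreover have "k + l \<le> n * (a + b)" using ab by (simp add: distrib_left)
  ultimately show "\<exists>a. padic_p ^ a dvd x * y \<and> k + l \<le> n * a" by blast
qed

lemma heavy_mult_left: "heavy k x \<Longrightarrow> heavy k (c * x)"
  using heavy_mult[of 0 c k x] by simp

lemma heavy_mono: "heavy k x \<Longrightarrow> l \<le> k \<Longrightarrow> heavy l x"
  unfolding heavy_def using order_trans by blast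

lemma heavy_uminus: "heavy k x \<Longrightarrow> heavy k (- x)"
  by (simp add: heavy_def)

lemma heavy_p: "padic_p dvd x \<Longrightarrow> heavy n x"
  unfolding heavy_def by (intro exI[of _ 1]) simp

text \<open>Series all of whose terms have weight at least k, where a coefficient contributes n for
  each factor p. Truncated subtraction leaves the coefficients of words of weight k or more
  free.\<close>

definition Fil :: "nat \<Rightarrow> 'p nc_series set" where
  "Fil k = {F \<in> carrier A. \<forall>w. heavy (k - word_weight w) (nc_coeff F w)}"

lemma Fil_carrier: "F \<in> Fil k \<Longrightarrow> F \<in> carrier A"
  by (simp add: Fil_def)

lemma Fil_0: "Fil 0 = carrier A"
  by (simp add: Fil_def)

lemma Fil_mono: "F \<in> Fil k \<Longrightarrow> l \<le> k \<Longrightarrow> F \<in> Fil l"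
  unfolding Fil_def using heavy_mono diff_le_mono by blast

lemma Fil_add: "F \<in> Fil k \<Longrightarrow> H \<in> Fil k \<Longrightarrow> F + H \<in> Fil k"
  by (simp add: Fil_def nc_algebra_closed plus_ncps.rep_eq heavy_add)

lemma Fil_uminus: "F \<in> Fil k \<Longrightarrow> - F \<in> Fil k"
  by (simp add: Fil_def nc_algebra_closed1 uminus_ncps.rep_eq heavy_uminus)

lemma Fil_zero: "0 \<in> Fil k"
  by (simp add: Fil_def nc_algebra_0_1 zero_ncps.rep_eq)

lemma Fil_smult: "F \<in> Fil k \<Longrightarrow> nc_smult c F \<in> Fil k"
  by (simp add: Fil_def nc_algebra_closed1 nc_smult.rep_eq heavy_mult_left)

lemma Fil_mult:
  assumes "F \<in> Fil k" "H \<in> Fil l"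
  shows "F * H \<in> Fil (k + l)"
  unfolding Fil_def
proof (intro CollectI conjI allI)
  show "F * H \<in> carrier A" using assms by (intro nc_algebra_mult_closed Fil_carrier)
  fix w
  show "heavy (k + l - word_weight w) (nc_coeff (F * H) w)"
    unfolding times_ncps.rep_eq
  proof (rule heavy_sum)
    fix i
    have "heavy ((k - word_weight (take i w)) + (l - word_weight (drop i w))) (nc_coeff F (take i w) * nc_coeff H (drop i w))"
      using assms by (intro heavy_mult) (auto simp: Fil_def)
    moreover have "word_weight w = word_weight (take i w) + word_weight (drop i w)" by (metis append_take_drop_id word_weight_simps(3))
    ultimately show "heavy (k + l - word_weight w) (nc_coeff F (take i w) * nc_coeff H (drop i w))"
      by (elim heavy_mono) simp
  qed
qed

lemma Fil_mult_left: "F \<in> carrier A \<Longrightarrow> H \<in> Fil l \<Longrightarrow> F * H \<in> Fil l"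
  using Fil_mult[of F 0 H l] by (simp add: Fil_0)

lemma Fil_mult_right: "F \<in> Fil l \<Longrightarrow> H \<in> carrier A \<Longrightarrow> F * H \<in> Fil l"
  using Fil_mult[of F l H 0] by (simp add: Fil_0)

lemma mono_Fil: "set w \<subseteq> iw_vars n \<Longrightarrow> nc_mono w \<in> Fil (word_weight w)"
  by (auto simp: Fil_def coeff_mono mono_closed)

lemma var_mono: "nc_var l = nc_mono [l]"
  by (simp add: mono_Cons mono_Nil)

lemma var_Fil: "l \<in> iw_vars n \<Longrightarrow> nc_var l \<in> Fil (var_weight l)"
  using mono_Fil[of "[l]"] by (simp add: var_mono)

definition Lin :: "nat \<Rightarrow> 'p nc_series set" where
  "Lin k = {F \<in> Fil k. \<forall>w. nc_coeff F w \<noteq> 0 \<longrightarrow> length w = 1}"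

lemma Lin_Fil: "F \<in> Lin k \<Longrightarrow> F \<in> Fil k" by (simp add: Lin_def)

lemma Lin_zero: "0 \<in> Lin k" by (simp add: Lin_def Fil_zero zero_ncps.rep_eq)

lemma Lin_add: "F \<in> Lin k \<Longrightarrow> H \<in> Lin k \<Longrightarrow> F + H \<in> Lin k"
  unfolding Lin_def by (auto simp: Fil_add plus_ncps.rep_eq) (metis add.right_neutral)+

lemma Lin_uminus: "F \<in> Lin k \<Longrightarrow> - F \<in> Lin k"
  by (simp add: Lin_def Fil_uminus uminus_ncps.rep_eq)

lemma Lin_var:
  assumes "l \<in> iw_vars n" "heavy (k - var_weight l) c"
  shows "nc_smult c (nc_var l) \<in> Lin k"
  using assms by (auto simp: Lin_def Fil_def nc_algebra_closed1 nc_var_closed nc_smult.rep_eq nc_var.rep_eq)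

lemma smult_one: "nc_smult 1 F = F"
  by (rule ncps_eqI) (simp add: nc_smult.rep_eq)

lemma Lin_var': "l \<in> iw_vars n \<Longrightarrow> k \<le> var_weight l \<Longrightarrow> nc_var l \<in> Lin k"
  using Lin_var[of l k 1] by (simp add: smult_one)

text \<open>For 2 <= r < p the coefficient contributes n and the power at least twice the weight of
  the variable. For r >= p the power alone must make up n + 1 plus that weight, which r >= n + 2
  ensures: this is where p > n + 1 enters.\<close>

lemma opp_approx:
  assumes l: "l \<in> iw_vars n" and q: "padic_p dvd q \<or> padic_p dvd q - 1"
  shows "one_plus_power (nc_var l) q - 1 - nc_smult q (nc_var l) \<in> Fil (n + var_weight l + 1)"
  unfolding Fil_def
proof (intro CollectI conjI allI)
  let ?F = "one_plus_power (nc_var l) q - 1 - nc_smult q (nc_var l)"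
  show "?F \<in> carrier A"
    using l by (intro nc_algebra_closed one_plus_power_closed nc_algebra_closed1 nc_var_closed nc_algebra_0_1)
  fix w
  show "heavy (n + var_weight l + 1 - word_weight w) (nc_coeff ?F w)"
  proof (cases "w = replicate (length w) l \<and> 2 \<le> length w")
    case False
    then have "nc_coeff ?F w = 0"
      by (cases w; cases "tl w")
        (auto simp: minus_ncps.rep_eq coeff_one_plus_power one_ncps.rep_eq nc_smult.rep_eq nc_var.rep_eq padic_gchoose_1)
    then show ?thesis by simp
  next
    case True
    define r where "r = length w"
    have w: "w = replicate r l" "2 \<le> r" using True by (auto simp: r_def)
    have wtr: "word_weight w = r * var_weight l" unfolding w(1) by (simp add: word_weight_def sum_list_replicate)
    have "w \<noteq> []" "w \<noteq> [l]" "w = replicate (length w) l" using True by auto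
    then have "nc_coeff ?F w = padic_gchoose q r"
      unfolding r_def by (simp add: minus_ncps.rep_eq coeff_one_plus_power one_ncps.rep_eq nc_smult.rep_eq nc_var.rep_eq)
    moreover have "heavy (n + var_weight l + 1 - r * var_weight l) (padic_gchoose q r)"
    proof (cases "r < CARD('p)")
      case True
      have "heavy n (padic_gchoose q r)" by (rule heavy_p[OF p_dvd_gchoose_ge2[OF q w(2) True]])
      moreover have "var_weight l + 1 \<le> 2 * var_weight l" using var_weight_bounds[OF l] by simp
      then have "var_weight l + 1 \<le> r * var_weight l" using w(2) by (meson mult_le_mono1 order_trans)
      ultimately show ?thesis by (elim heavy_mono) simp
    next
      case False
      then have "(n + 2) * var_weight l \<le> r * var_weight l" using p_gt by (intro mult_le_mono1) simp
      moreover have "n + var_weight l + 1 \<le> (n + 2) * var_weight l"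
      proof -
        have "n \<le> n * var_weight l" using var_weight_bounds[OF l] by simp
        then show ?thesis using var_weight_bounds[OF l] unfolding distrib_right by linarith
      qed
      ultimately show ?thesis by simp
    qed
    ultimately show ?thesis by (simp add: wtr)
  qed
qed

text \<open>The exponent supplies no factor p here, but the quadratic terms weigh twice as much as
  the variable. That is enough where the variable itself is the leading term of a
  commutator.\<close>

lemma opp_minus_one_approx:
  assumes l: "l \<in> iw_vars n"
  shows "one_plus_power (nc_var l) (- 1) - 1 + nc_var l \<in> Fil (var_weight l + 1)"
  unfolding Fil_def
proof (intro CollectI conjI allI)
  let ?F = "one_plus_power (nc_var l) (- 1) - 1 + nc_var l :: 'p nc_series"
  show "?F \<in> carrier A"
    using l by (intro nc_algebra_closed one_plus_power_closed nc_var_closed nc_algebra_0_1)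
  fix w
  show "heavy (var_weight l + 1 - word_weight w) (nc_coeff ?F w)"
  proof (cases "w = replicate (length w) l \<and> 2 \<le> length w")
    case False
    then have "nc_coeff ?F w = 0"
      by (cases w; cases "tl w")
        (auto simp: minus_ncps.rep_eq plus_ncps.rep_eq coeff_one_plus_power one_ncps.rep_eq nc_var.rep_eq padic_gchoose_1)
    then show ?thesis by simp
  next
    case True
    have "word_weight w = length w * var_weight l" using True by (metis word_weight_def map_replicate sum_list_replicate of_nat_id)
    moreover have "2 * var_weight l \<le> length w * var_weight l" using True by (intro mult_le_mono1) simp
    ultimately have "var_weight l + 1 \<le> word_weight w" using var_weight_bounds[OF l] by linarith
    then show ?thesis by simp
  qed
qed

section \<open>Commutators of two variables modulo the relations\<close>

definition rel_ideal :: "'p nc_series set" where "rel_ideal = iwasawa_ideal n"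

text \<open>Applied to commutators of two variables: the relations make them linear up to higher weight.\<close>

definition linear_mod :: "nat \<Rightarrow> 'p nc_series \<Rightarrow> bool" where
  "linear_mod k F \<longleftrightarrow> (\<exists>z\<in>Lin k. \<exists>r\<in>rel_ideal. F - z - r \<in> Fil (k + 1))"

lemma prod_list_closed:
  "(\<And>F. F \<in> set Fs \<Longrightarrow> F \<in> carrier A) \<Longrightarrow> prod_list Fs \<in> carrier A"
  by (induction Fs) (auto simp: nc_algebra_0_1 nc_algebra_mult_closed)

text \<open>Makes the whole ring a member of the family of closed ideals that is intersected, so the
  intersection is again a closed ideal inside the ring.\<close>

lemma rel_carrier:
  "iwasawa_relation n F (H :: 'p nc_series) \<Longrightarrow> F \<in> carrier A \<and> H \<in> carrier A"
proof (induction rule: iwasawa_relation.induct)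
  case (rel8 \<alpha> i j)
  then have ij: "i < j" "j < n" by (auto simp: pos_roots_def roots_def)
  then have "nc_var (W_var (c, c + 1)) \<in> carrier A" if "c \<in> set [i..<j]" for c
    using that by (intro nc_var_closed) (auto simp: iw_vars_def simple_roots_def)
  then have "prod_list (map (\<lambda>c. 1 + nc_var (W_var (c, c + 1))) [i..<j]) \<in> carrier A"
    by (intro prod_list_closed) (auto intro!: nc_algebra_closed(1) nc_algebra_0_1)
  moreover have "V_var \<alpha> \<in> iw_vars n" "U_var (neg_root \<alpha>) \<in> iw_vars n"
    using rel8 ij by (auto simp: iw_vars_def neg_root_def neg_roots_def roots_def)
  ultimately show ?case
    by (intro conjI nc_algebra_mult_closed nc_algebra_closed(1) nc_algebra_0_1 nc_var_closed one_plus_power_closed)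
qed (auto simp: iw_vars_def neg_roots_def pos_roots_def roots_def intro!: nc_algebra_mult_closed nc_algebra_closed(1)
  nc_algebra_0_1 nc_var_closed one_plus_power_closed)

lemma rel_ideal_ideal: "ideal rel_ideal A"
proof -
  let ?S = "{I. ideal I A \<and> closedin (nc_topology n) I \<and> {F - H | F H. iwasawa_relation n F H} \<subseteq> I}"
  interpret R: ring A by (rule ring_nc_algebra)
  have "carrier A \<in> ?S"
    using R.oneideal closedin_topspace[of "nc_topology n"] rel_carrier by (auto intro: nc_algebra_closed)
  then show ?thesis unfolding rel_ideal_def iwasawa_ideal_def by (intro R.i_Intersect) auto
qed

lemma rel_ideal_closed: "closedin (nc_topology n) rel_ideal"
proof -
  let ?S = "{I. ideal I A \<and> closedin (nc_topology n) I \<and> {F - H | F H. iwasawa_relation n F H} \<subseteq> I}"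
  interpret R: ring A by (rule ring_nc_algebra)
  have "carrier A \<in> ?S"
    using R.oneideal closedin_topspace[of "nc_topology n"] rel_carrier by (auto intro: nc_algebra_closed)
  then show ?thesis unfolding rel_ideal_def iwasawa_ideal_def by (intro closedin_Inter) auto
qed

lemma rel_ideal_rel: "iwasawa_relation n F H \<Longrightarrow> F - H \<in> rel_ideal"
  unfolding rel_ideal_def iwasawa_ideal_def by blast

lemma rel_ideal_carrier: "F \<in> rel_ideal \<Longrightarrow> F \<in> carrier A"
  using ideal.Icarr[OF rel_ideal_ideal] .

lemma rel_ideal_add: "F \<in> rel_ideal \<Longrightarrow> H \<in> rel_ideal \<Longrightarrow> F + H \<in> rel_ideal"
  using additive_subgroup.a_closed[OF ideal.axioms(1)[OF rel_ideal_ideal]] by (simp add: nc_algebra_simps)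

lemma rel_ideal_mult: "F \<in> rel_ideal \<Longrightarrow> H \<in> carrier A \<Longrightarrow> F * H \<in> rel_ideal" "F \<in> rel_ideal \<Longrightarrow> H \<in> carrier A \<Longrightarrow> H * F \<in> rel_ideal"
  using ideal.I_r_closed[OF rel_ideal_ideal] ideal.I_l_closed[OF rel_ideal_ideal] by (simp_all add: nc_algebra_simps)

lemma rel_ideal_smult: "F \<in> rel_ideal \<Longrightarrow> nc_smult c F \<in> rel_ideal"
proof -
  assume F: "F \<in> rel_ideal"
  have "nc_smult c F = nc_smult c 1 * F"
  proof (rule ncps_eqI)
    fix w
    have "nc_coeff (nc_smult c 1 * F) w = (\<Sum>k\<le>length w. if k = 0 then c * nc_coeff F w else 0)"
      unfolding times_ncps.rep_eq nc_smult.rep_eq one_ncps.rep_eq by (intro sum.cong refl) auto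
    then show "nc_coeff (nc_smult c F) w = nc_coeff (nc_smult c 1 * F) w" by (simp add: nc_smult.rep_eq)
  qed
  then show ?thesis using rel_ideal_mult(2)[OF F nc_algebra_closed1(2)[OF nc_algebra_0_1(2)]] by simp
qed

lemma rel_ideal_zero: "0 \<in> rel_ideal"
  using additive_subgroup.zero_closed[OF ideal.axioms(1)[OF rel_ideal_ideal]] by (simp add: nc_algebra_simps)

lemma rel_ideal_uminus: "F \<in> rel_ideal \<Longrightarrow> - F \<in> rel_ideal"
proof -
  assume "F \<in> rel_ideal"
  moreover have "nc_smult (- 1) F = - F" by (rule ncps_eqI) (simp add: nc_smult.rep_eq uminus_ncps.rep_eq)
  ultimately show ?thesis using rel_ideal_smult[of F "- 1"] by simp
qed

lemma linear_mod_uminus: "linear_mod k (x * y - y * x) \<Longrightarrow> linear_mod k (y * x - x * y)"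
  unfolding linear_mod_def
proof (elim bexE)
  fix z r assume zr: "z \<in> Lin k" "r \<in> rel_ideal" "x * y - y * x - z - r \<in> Fil (k + 1)"
  have e: "y * x - x * y - (- z) - (- r) = - (x * y - y * x - z - r)" by simp
  have "y * x - x * y - (- z) - (- r) \<in> Fil (k + 1)" unfolding e by (rule Fil_uminus[OF zr(3)])
  then show "\<exists>z\<in>Lin k. \<exists>r\<in>rel_ideal. y * x - x * y - z - r \<in> Fil (k + 1)" using Lin_uminus[OF zr(1)] rel_ideal_uminus[OF zr(2)] by blast
qed

lemma linear_mod_commute: "x * y - y * x \<in> rel_ideal \<Longrightarrow> linear_mod k (x * y - y * x)"
  unfolding linear_mod_def by (intro bexI[of _ 0] bexI[of _ "x * y - y * x"]) (auto simp: Lin_zero Fil_zero)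

text \<open>With E = 1 + z + e the relation says that x y - y x is z + e + (z + e)(y + x + y x)
  modulo the ideal, and every product here weighs at least 1 more than z has to.\<close>

lemma linear_mod_commutator:
  assumes r: "(1 + x) * (1 + y) - E * (1 + y) * (1 + x) \<in> rel_ideal" and x: "x \<in> Fil 1" and y: "y \<in> Fil 1"
    and z: "z \<in> Lin k" and E: "E - 1 - z \<in> Fil (k + 1)"
  shows "linear_mod k (x * y - y * x)"
proof -
  define e where "e = E - 1 - z"
  have Ee: "E = 1 + z + e" by (simp add: e_def)
  have "x * y - y * x - z - ((1 + x) * (1 + y) - E * (1 + y) * (1 + x)) = e + (z + e) * (y + x + y * x)"
    unfolding Ee by (simp add: algebra_simps)
  moreover have "(z + e) * (y + x + y * x) \<in> Fil (k + 1)"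
    using x y Lin_Fil[OF z] E Fil_mono[of e "k + 1" k] Fil_mult_left[OF Fil_carrier[OF y] x]
    by (intro Fil_mult Fil_add) (auto simp: e_def)
  ultimately have "x * y - y * x - z - ((1 + x) * (1 + y) - E * (1 + y) * (1 + x)) \<in> Fil (k + 1)"
    using Fil_add[OF E[folded e_def]] by (simp only:)
  then show ?thesis using z r unfolding linear_mod_def by blast
qed

text \<open>Here E is close to 1 + y instead of 1. In the applications E = (1 + y)^q with q
  congruent to 1 modulo p, and z is the correction (q - 1) y.\<close>

lemma linear_mod_torus:
  assumes r: "(1 + x) * (1 + y) - E * (1 + x) \<in> rel_ideal" and x: "x \<in> Fil 1"
    and z: "z \<in> Lin k" and E: "E - 1 - y - z \<in> Fil (k + 1)"
  shows "linear_mod k (x * y - y * x)"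
proof -
  define e where "e = E - 1 - y - z"
  have Ee: "E = 1 + y + z + e" by (simp add: e_def)
  have "x * y - y * x - z - ((1 + x) * (1 + y) - E * (1 + x)) = e + (z + e) * x"
    unfolding Ee by (simp add: algebra_simps)
  moreover have "(z + e) * x \<in> Fil (k + 1)"
    using x Lin_Fil[OF z] E Fil_mono[of e "k + 1" k] by (intro Fil_mult Fil_add) (auto simp: e_def)
  ultimately have "x * y - y * x - z - ((1 + x) * (1 + y) - E * (1 + x)) \<in> Fil (k + 1)"
    using Fil_add[OF E[folded e_def]] by (simp only:)
  then show ?thesis using z r unfolding linear_mod_def by blast
qed

text \<open>A product of two W has weight 2 n >= n + 1, so a product of factors 1 + W is linear up
  to weight n + 1.\<close>

lemma prod_list_one_plus:
  assumes "set cs \<subseteq> {c. c + 1 < n}"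
  shows "prod_list (map (\<lambda>c. 1 + nc_var (W_var (c, c + 1))) cs) - 1 - (\<Sum>c\<leftarrow>cs. nc_var (W_var (c, c + 1))) \<in> Fil (n + 1)
    \<and> (\<Sum>c\<leftarrow>cs. nc_var (W_var (c, c + 1))) \<in> Lin n"
  using assms
proof (induction cs)
  case Nil
  show ?case by (simp add: Fil_zero Lin_zero)
next
  case (Cons c cs)
  let ?x = "nc_var (W_var (c, c + 1)) :: 'p nc_series" and ?P = "prod_list (map (\<lambda>c. 1 + nc_var (W_var (c, c + 1))) cs) :: 'p nc_series"
    and ?s = "(\<Sum>c\<leftarrow>cs. nc_var (W_var (c, c + 1))) :: 'p nc_series"
  have IH: "?P - 1 - ?s \<in> Fil (n + 1)" "?s \<in> Lin n" using Cons by auto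
  have l: "W_var (c, c + 1) \<in> iw_vars n" using Cons.prems by (auto simp: iw_vars_def simple_roots_def)
  have x: "?x \<in> Lin n" "?x \<in> Fil n" using Lin_var'[OF l, of n] var_Fil[OF l] by auto
  have "?P - 1 - ?s + ?s \<in> Fil n" using Fil_add[OF Fil_mono[OF IH(1), of n] Lin_Fil[OF IH(2)]] by simp
  then have "?x * (?P - 1) \<in> Fil (n + n)" using x by (intro Fil_mult) simp_all
  then have "?x * (?P - 1) \<in> Fil (n + 1)" using n_pos by (elim Fil_mono) simp
  then have "?x * (?P - 1) + (?P - 1 - ?s) \<in> Fil (n + 1)" using IH(1) by (rule Fil_add)
  moreover have "(1 + ?x) * ?P - 1 - (?x + ?s) = ?x * (?P - 1) + (?P - 1 - ?s)" by (simp add: algebra_simps)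
  ultimately have "(1 + ?x) * ?P - 1 - (?x + ?s) \<in> Fil (n + 1)" by (simp only:)
  then show ?case unfolding list.map prod_list.Cons sum_list.Cons using Lin_add[OF x(1) IH(2)] by blast
qed

text \<open>The weights of the two variables add up to n, the weight of the W that appear linearly.
  The exponents are congruent to 1 modulo p, so replacing the outer factors by 1 + U and 1 + V
  changes them only in weight above n.\<close>

lemma linear_mod_opposite:
  assumes a: "\<alpha> = (i, j)" "\<alpha> \<in> pos_roots n"
  shows "linear_mod n (nc_var (V_var \<alpha>) * nc_var (U_var (neg_root \<alpha>)) - nc_var (U_var (neg_root \<alpha>)) * nc_var (V_var \<alpha>))"
proof -
  let ?V = "nc_var (V_var \<alpha>) :: 'p nc_series" and ?U = "nc_var (U_var (neg_root \<alpha>)) :: 'p nc_series"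
  let ?q = "padic_powi (1 + padic_p) (- 1) :: 'p padic_int"
  have ij: "i < j" "j < n" using a by (auto simp: pos_roots_def roots_def)
  have lV: "V_var \<alpha> \<in> iw_vars n" and lU: "U_var (neg_root \<alpha>) \<in> iw_vars n"
    using a ij by (auto simp: iw_vars_def neg_root_def neg_roots_def roots_def)
  have wV: "var_weight (V_var \<alpha>) = j - i" and wU: "var_weight (U_var (neg_root \<alpha>)) = n - (j - i)" using a by (auto simp: neg_root_def)
  have V: "?V \<in> Fil (j - i)" using var_Fil[OF lV] wV by simp
  have U: "?U \<in> Fil (n - (j - i))" using var_Fil[OF lU] wU by simp
  have q: "padic_p dvd ?q - 1"
  proof -
    have "?q - 1 = - (1 div (1 + padic_p)) * padic_p"
      using unit_inverse[OF one_plus_p_unit] by (simp add: padic_powi_def algebra_simps)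
    then show ?thesis by simp
  qed
  define P where "P = one_plus_power ?U ?q"
  define S where "S = one_plus_power ?V ?q"
  define Q where "Q = prod_list (map (\<lambda>c. 1 + nc_var (W_var (c, c + 1)) :: 'p nc_series) [i..<j])"
  define s where "s = (\<Sum>c\<leftarrow>[i..<j]. nc_var (W_var (c, c + 1)) :: 'p nc_series)"
  define e1 where "e1 = P - 1 - ?U"
  define e2 where "e2 = S - 1 - ?V"
  define e3 where "e3 = Q - 1 - s"
  have sm: "nc_smult ?q F - F = nc_smult (?q - 1) F" for F :: "'p nc_series"
    by (rule ncps_eqI) (simp add: minus_ncps.rep_eq nc_smult.rep_eq left_diff_distrib)
  have small: "nc_smult ?q (nc_var l) - nc_var l \<in> Fil (n + var_weight l)" if "l \<in> iw_vars n" for l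
    using Lin_Fil[OF Lin_var[OF that, of "n + var_weight l" "?q - 1"]] heavy_p[OF q] by (simp add: sm)
  have e: "one_plus_power (nc_var l) ?q - 1 - nc_var l \<in> Fil (n + 1)" if l: "l \<in> iw_vars n" for l
  proof -
    have "one_plus_power (nc_var l) ?q - 1 - nc_smult ?q (nc_var l) + (nc_smult ?q (nc_var l) - nc_var l) \<in> Fil (n + var_weight l)"
      using opp_approx[OF l disjI2[OF q]] small[OF l] by (intro Fil_add) (auto elim: Fil_mono)
    then show ?thesis using var_weight_bounds[OF l] by (simp add: Fil_mono[of _ "n + var_weight l"])
  qed
  have e1: "e1 \<in> Fil (n + 1)" unfolding e1_def P_def by (rule e[OF lU])
  have e2: "e2 \<in> Fil (n + 1)" unfolding e2_def S_def by (rule e[OF lV])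
  have e3: "e3 \<in> Fil (n + 1)" and s: "s \<in> Lin n"
  proof -
    have "set [i..<j] \<subseteq> {c. c + 1 < n}" using ij by auto
    from prod_list_one_plus[OF this] show "e3 \<in> Fil (n + 1)" "s \<in> Lin n" unfolding e3_def Q_def s_def by blast+
  qed
  have r: "(1 + ?V) * (1 + ?U) - P * Q * S \<in> rel_ideal"
    unfolding P_def Q_def S_def using rel_ideal_rel[OF rel8[OF a]] by simp
  have c: "?U \<in> carrier A" "?V \<in> carrier A" "s \<in> carrier A" "1 \<in> carrier A"
      "e1 \<in> carrier A" "e2 \<in> carrier A" "e3 \<in> carrier A"
    using Fil_carrier U V Lin_Fil[OF s] e1 e2 e3 nc_algebra_0_1 by blast+
  \<comment> \<open>The triple product is expanded around (1 + U)(1 + s)(1 + V); each remaining term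
    contains an error, or s together with U or V.\<close>
  have "?V * ?U - ?U * ?V - s - ((1 + ?V) * (1 + ?U) - P * Q * S)
      = e1 * ((1 + s + e3) * (1 + ?V + e2)) + ((1 + ?U) * (e3 * (1 + ?V + e2)) + ((1 + ?U) * ((1 + s) * e2) + (?U * s + (?U * s * ?V + s * ?V))))"
  proof -
    have "P = 1 + ?U + e1" "S = 1 + ?V + e2" "Q = 1 + s + e3" by (simp_all add: e1_def e2_def e3_def)
    then show ?thesis by (simp add: algebra_simps)
  qed
  also have "\<dots> \<in> Fil (n + 1)"
  proof -
    have sF: "s \<in> Fil n" by (rule Lin_Fil[OF s])
    have V1: "?V \<in> Fil 1" and U1: "?U \<in> Fil 1" using Fil_mono[OF V, of 1] Fil_mono[OF U, of 1] ij by auto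
    have "?U * s \<in> Fil (n + 1)" using Fil_mult[OF U1 sF] by simp
    moreover have "s * ?V \<in> Fil (n + 1)" using Fil_mult[OF sF V1] .
    ultimately show ?thesis using e1 e2 e3 c
      by (intro Fil_add Fil_mult_right[of e1] Fil_mult_left[of "1 + ?U"] Fil_mult_right[of e3] Fil_mult_left[of "1 + s"]
          Fil_mult_right[of "?U * s" _ ?V] nc_algebra_closed nc_algebra_mult_closed) auto
  qed
  finally show ?thesis using s r unfolding linear_mod_def by blast
qed

lemma one_plus_p_powi: "padic_p dvd padic_powi (1 + padic_p) m - (1 :: 'p padic_int)"
proof -
  have a: "padic_p dvd (1 + padic_p) ^ k - (1 :: 'p padic_int)" for k
    using power_diff_1_eq[of "1 + padic_p :: 'p padic_int" k] by simp
  have "padic_p dvd (1 div (1 + padic_p)) ^ k - (1 :: 'p padic_int)" for k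
  proof -
    have ab: "(1 + padic_p) ^ k * (1 div (1 + padic_p)) ^ k = (1 :: 'p padic_int)"
      by (simp only: power_mult_distrib[symmetric] unit_inverse[OF one_plus_p_unit] power_one)
    have "b - 1 = - b * (a - 1)" if "a * b = 1" for a b :: "'p padic_int"
      using that by (simp add: right_diff_distrib mult.commute)
    from this[OF ab] show ?thesis using a[of k] by (simp only: dvd_mult)
  qed
  then show ?thesis using a by (simp add: padic_powi_def)
qed

lemma linear_mod_torus_var:
  assumes x: "W_var \<delta> \<in> iw_vars n" and y: "y \<in> iw_vars n" and q: "padic_p dvd (q - 1 :: 'p padic_int)"
    and r: "(1 + nc_var (W_var \<delta>)) * (1 + nc_var y) - one_plus_power (nc_var y) q * (1 + nc_var (W_var \<delta>)) \<in> rel_ideal"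
  shows "linear_mod (var_weight (W_var \<delta>) + var_weight y) (nc_var (W_var \<delta>) * nc_var y - nc_var y * nc_var (W_var \<delta>))"
proof (rule linear_mod_torus[OF r])
  show "nc_var (W_var \<delta>) \<in> Fil 1" using var_Fil[OF x] var_weight_bounds[OF x] by (auto elim: Fil_mono)
  show "nc_smult (q - 1) (nc_var y) \<in> Lin (var_weight (W_var \<delta>) + var_weight y)"
    using heavy_p[OF q] by (intro Lin_var[OF y]) simp
  have "nc_var y + nc_smult (q - 1) (nc_var y) = nc_smult q (nc_var y)"
    by (rule ncps_eqI) (simp add: plus_ncps.rep_eq nc_smult.rep_eq left_diff_distrib)
  then have e: "one_plus_power (nc_var y) q - 1 - nc_var y - nc_smult (q - 1) (nc_var y)
      = one_plus_power (nc_var y) q - 1 - nc_smult q (nc_var y)"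
    by (metis diff_diff_eq)
  show "one_plus_power (nc_var y) q - 1 - nc_var y - nc_smult (q - 1) (nc_var y) \<in> Fil (var_weight (W_var \<delta>) + var_weight y + 1)"
    unfolding e using opp_approx[OF y disjI2[OF q]] by simp
qed

text \<open>Serves the relations with exponent p or - p: the factor p supplies the weight n by which
  the two variables together outweigh the new one.\<close>

lemma linear_mod_comm_opp:
  assumes x: "x \<in> iw_vars n" and y: "y \<in> iw_vars n" and l: "l \<in> iw_vars n" and q: "padic_p dvd (q :: 'p padic_int)"
    and w: "var_weight x + var_weight y = n + var_weight l"
    and r: "(1 + nc_var x) * (1 + nc_var y) - one_plus_power (nc_var l) q * (1 + nc_var y) * (1 + nc_var x) \<in> rel_ideal"
  shows "linear_mod (var_weight x + var_weight y) (nc_var x * nc_var y - nc_var y * nc_var x)"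
proof (rule linear_mod_commutator[OF r])
  show "nc_var x \<in> Fil 1" "nc_var y \<in> Fil 1"
    using var_Fil[OF x] var_weight_bounds[OF x] var_Fil[OF y] var_weight_bounds[OF y] by (auto elim: Fil_mono)
  show "nc_smult q (nc_var l) \<in> Lin (var_weight x + var_weight y)" using heavy_p[OF q] w by (intro Lin_var[OF l]) simp
  show "one_plus_power (nc_var l) q - 1 - nc_smult q (nc_var l) \<in> Fil (var_weight x + var_weight y + 1)"
    using opp_approx[OF l disjI1[OF q]] w by simp
qed

lemma linear_mod_comm_var:
  assumes x: "x \<in> iw_vars n" and y: "y \<in> iw_vars n" and l: "l \<in> iw_vars n" and w: "var_weight x + var_weight y = var_weight l"
    and r: "(1 + nc_var x) * (1 + nc_var y) - (1 + nc_var l) * (1 + nc_var y) * (1 + nc_var x) \<in> rel_ideal"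
  shows "linear_mod (var_weight x + var_weight y) (nc_var x * nc_var y - nc_var y * nc_var x)"
proof (rule linear_mod_commutator[OF r])
  show "nc_var x \<in> Fil 1" "nc_var y \<in> Fil 1"
    using var_Fil[OF x] var_weight_bounds[OF x] var_Fil[OF y] var_weight_bounds[OF y] by (auto elim: Fil_mono)
  show "nc_var l \<in> Lin (var_weight x + var_weight y)" using w by (intro Lin_var'[OF l]) simp
  show "1 + nc_var l - 1 - nc_var l \<in> Fil (var_weight x + var_weight y + 1)" by (simp add: Fil_zero)
qed

lemma linear_mod_comm_inv:
  assumes x: "x \<in> iw_vars n" and y: "y \<in> iw_vars n" and l: "l \<in> iw_vars n" and w: "var_weight x + var_weight y = var_weight l"
    and r: "(1 + nc_var x) * (1 + nc_var y) - one_plus_power (nc_var l) (- 1) * (1 + nc_var y) * (1 + nc_var x) \<in> rel_ideal"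
  shows "linear_mod (var_weight x + var_weight y) (nc_var x * nc_var y - nc_var y * nc_var x)"
proof (rule linear_mod_commutator[OF r])
  show "nc_var x \<in> Fil 1" "nc_var y \<in> Fil 1"
    using var_Fil[OF x] var_weight_bounds[OF x] var_Fil[OF y] var_weight_bounds[OF y] by (auto elim: Fil_mono)
  show "- nc_var l \<in> Lin (var_weight x + var_weight y)" using w by (intro Lin_uminus Lin_var'[OF l]) simp
  show "one_plus_power (nc_var l) (- 1) - 1 - - nc_var l \<in> Fil (var_weight x + var_weight y + 1)"
    using opp_minus_one_approx[OF l] w by simp
qed

text \<open>A positive and a negative root are opposite, or composable in one of two ways with
  positive or negative sum, or their matrices commute. In the composable cases the weights add up to
  that of the sum, plus n exactly when a factor p appears.\<close>

lemma linear_mod_VU: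
  assumes a: "\<alpha> \<in> pos_roots n" and b: "\<beta> \<in> neg_roots n"
  shows "linear_mod (var_weight (V_var \<alpha>) + var_weight (U_var \<beta>)) (nc_var (V_var \<alpha>) * nc_var (U_var \<beta>) - nc_var (U_var \<beta>) * nc_var (V_var \<alpha>))"
proof -
  obtain i j where ij: "\<alpha> = (i, j)" "i < j" "j < n" using a by (auto simp: pos_roots_def roots_def)
  obtain k l where kl: "\<beta> = (k, l)" "l < k" "k < n" using b by (auto simp: neg_roots_def roots_def)
  have x: "V_var \<alpha> \<in> iw_vars n" and y: "U_var \<beta> \<in> iw_vars n" using a b by (auto simp: iw_vars_def)
  have V: "V_var (r, s) \<in> iw_vars n" if "r < s" "s < n" for r s using that by (auto simp: iw_vars_def pos_roots_def roots_def)
  have U: "U_var (r, s) \<in> iw_vars n" if "s < r" "r < n" for r s using that by (auto simp: iw_vars_def neg_roots_def roots_def)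
  consider "\<beta> = neg_root \<alpha>" | "k = j" "i < l" | "k = j" "l < i" | "l = i" "k < j" | "l = i" "j < k"
    | "\<alpha> \<noteq> neg_root \<beta>" "\<not> sum_is_root n \<alpha> \<beta>"
    using ij kl by (auto simp: neg_root_def sum_is_root_def roots_def) linarith+
  then show ?thesis
  proof cases
    case 1
    then show ?thesis using linear_mod_opposite[OF ij(1) a] ij by (simp add: neg_root_def)
  next
    case 2
    show ?thesis
      by (rule linear_mod_comm_opp[OF x y V[of i l] _ _ rel_ideal_rel[OF rel4[of \<alpha> i j \<beta> l]]]) (use 2 ij kl a b in auto)
  next
    case 3
    show ?thesis
      by (rule linear_mod_comm_var[OF x y U[of l i] _ rel_ideal_rel[OF rel5[of \<alpha> i j \<beta> l]]]) (use 3 ij kl a b in auto)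
  next
    case 4
    show ?thesis
      by (rule linear_mod_comm_opp[OF x y V[of k j] _ _ rel_ideal_rel[OF rel6[of \<alpha> i j \<beta> k]]]) (use 4 ij kl a b in auto)
  next
    case 5
    show ?thesis
      by (rule linear_mod_comm_inv[OF x y U[of j k] _ rel_ideal_rel[OF rel7[of \<alpha> i j \<beta> k]]]) (use 5 ij kl a b in auto)
  next
    case 6
    show ?thesis by (rule linear_mod_commute[OF rel_ideal_rel[OF rel3[OF a b 6]]])
  qed
qed

text \<open>When the roots compose in the other order, the same relation is read backwards, with the
  opposite sign.\<close>

lemma linear_mod_UU:
  assumes a: "\<alpha> \<in> neg_roots n" and b: "\<beta> \<in> neg_roots n"
  shows "linear_mod (var_weight (U_var \<alpha>) + var_weight (U_var \<beta>)) (nc_var (U_var \<alpha>) * nc_var (U_var \<beta>) - nc_var (U_var \<beta>) * nc_var (U_var \<alpha>))"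
proof -
  have U: "U_var (r, s) \<in> iw_vars n" if "s < r" "r < n" for r s using that by (auto simp: iw_vars_def neg_roots_def roots_def)
  have *: "linear_mod (var_weight (U_var (i, j)) + var_weight (U_var (j, k))) (nc_var (U_var (i, j)) * nc_var (U_var (j, k)) - nc_var (U_var (j, k)) * nc_var (U_var (i, j)))"
    if "j < i" "k < j" "i < n" for i j k
    by (rule linear_mod_comm_opp[OF U U U[of k i] _ _ rel_ideal_rel[OF rel10[of _ i j _ k]]])
      (use that in \<open>auto simp: neg_roots_def roots_def\<close>)
  obtain i j where ij: "\<alpha> = (i, j)" "j < i" "i < n" using a by (auto simp: neg_roots_def roots_def)
  obtain k l where kl: "\<beta> = (k, l)" "l < k" "k < n" using b by (auto simp: neg_roots_def roots_def)
  consider "j = k" | "l = i" | "\<not> sum_is_root n \<alpha> \<beta>" using ij kl by (auto simp: sum_is_root_def)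
  then show ?thesis
  proof cases
    case 1
    then show ?thesis using *[of j i l] ij kl by simp
  next
    case 2
    then show ?thesis using linear_mod_uminus[OF *[of i k j]] ij kl by (simp add: add.commute)
  next
    case 3
    show ?thesis by (rule linear_mod_commute[OF rel_ideal_rel[OF rel9[OF a b 3]]])
  qed
qed

lemma linear_mod_VV:
  assumes a: "\<alpha> \<in> pos_roots n" and b: "\<beta> \<in> pos_roots n"
  shows "linear_mod (var_weight (V_var \<alpha>) + var_weight (V_var \<beta>)) (nc_var (V_var \<alpha>) * nc_var (V_var \<beta>) - nc_var (V_var \<beta>) * nc_var (V_var \<alpha>))"
proof -
  have V: "V_var (r, s) \<in> iw_vars n" if "r < s" "s < n" for r s using that by (auto simp: iw_vars_def pos_roots_def roots_def)
  have *: "linear_mod (var_weight (V_var (i, j)) + var_weight (V_var (j, k))) (nc_var (V_var (i, j)) * nc_var (V_var (j, k)) - nc_var (V_var (j, k)) * nc_var (V_var (i, j)))"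
    if "i < j" "j < k" "k < n" for i j k
    by (rule linear_mod_comm_var[OF V V V[of i k] _ rel_ideal_rel[OF rel14[of _ i j _ k]]])
      (use that in \<open>auto simp: pos_roots_def roots_def\<close>)
  obtain i j where ij: "\<alpha> = (i, j)" "i < j" "j < n" using a by (auto simp: pos_roots_def roots_def)
  obtain k l where kl: "\<beta> = (k, l)" "k < l" "l < n" using b by (auto simp: pos_roots_def roots_def)
  consider "j = k" | "l = i" | "\<not> sum_is_root n \<alpha> \<beta>" using ij kl by (auto simp: sum_is_root_def)
  then show ?thesis
  proof cases
    case 1
    then show ?thesis using *[of i j l] ij kl by simp
  next
    case 2
    then show ?thesis using linear_mod_uminus[OF *[of k i j]] ij kl by (simp add: add.commute)
  next
    case 3
    show ?thesis by (rule linear_mod_commute[OF rel_ideal_rel[OF rel13[OF a b 3]]])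
  qed
qed

lemma linear_mod_vars:
  assumes x: "x \<in> iw_vars n" and y: "y \<in> iw_vars n"
  shows "linear_mod (var_weight x + var_weight y) (nc_var x * nc_var y - nc_var y * nc_var x)"
proof -
  have WU: "linear_mod (var_weight (W_var \<delta>) + var_weight (U_var \<beta>)) (nc_var (W_var \<delta>) * nc_var (U_var \<beta>) - nc_var (U_var \<beta>) * nc_var (W_var \<delta>))"
    if "\<delta> \<in> simple_roots n" "\<beta> \<in> neg_roots n" for \<delta> \<beta>
    by (rule linear_mod_torus_var[OF _ _ one_plus_p_powi rel_ideal_rel[OF rel1[OF that(2,1)]]]) (use that in \<open>auto simp: iw_vars_def\<close>)
  have WV: "linear_mod (var_weight (W_var \<delta>) + var_weight (V_var \<beta>)) (nc_var (W_var \<delta>) * nc_var (V_var \<beta>) - nc_var (V_var \<beta>) * nc_var (W_var \<delta>))"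
    if "\<delta> \<in> simple_roots n" "\<beta> \<in> pos_roots n" for \<delta> \<beta>
    by (rule linear_mod_torus_var[OF _ _ one_plus_p_powi rel_ideal_rel[OF rel2[OF that(2,1)]]]) (use that in \<open>auto simp: iw_vars_def\<close>)
  have WW: "linear_mod k (nc_var (W_var \<delta>) * nc_var (W_var \<beta>) - nc_var (W_var \<beta>) * nc_var (W_var \<delta>))"
    if "\<delta> \<in> simple_roots n" "\<beta> \<in> simple_roots n" for \<delta> \<beta> k
    by (rule linear_mod_commute[OF rel_ideal_rel[OF rel12[OF that]]])
  have sym: "linear_mod (var_weight x + var_weight y) (nc_var x * nc_var y - nc_var y * nc_var x)"
    if "linear_mod (var_weight y + var_weight x) (nc_var y * nc_var x - nc_var x * nc_var y)" for x y
    using linear_mod_uminus[OF that] by (simp add: add.commute)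
  show ?thesis
    using x y unfolding iw_vars_def
    by (elim UnE imageE) (auto intro: WU WV WW linear_mod_UU linear_mod_VV linear_mod_VU sym[OF WU] sym[OF WV] sym[OF linear_mod_VU] simp del: var_weight.simps)
qed

section \<open>Sorting words\<close>

definition short_part :: "nat \<Rightarrow> nat \<Rightarrow> 'p nc_series set" where
  "short_part l k = {F \<in> Fil k. \<forall>w. nc_coeff F w \<noteq> 0 \<longrightarrow> length w < l}"

text \<open>Congruence modulo the relations, shorter words and higher weight: the induction that sorts words decreases
  the length at constant weight.\<close>

definition near :: "nat \<Rightarrow> nat \<Rightarrow> 'p nc_series \<Rightarrow> 'p nc_series \<Rightarrow> bool" where
  "near l k F H \<longleftrightarrow> (\<exists>s\<in>short_part l k. \<exists>r\<in>rel_ideal. F - H - s - r \<in> Fil (k + 1))"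

lemma short_part_zero: "0 \<in> short_part l k" by (simp add: short_part_def Fil_zero zero_ncps.rep_eq)

lemma short_part_add: "F \<in> short_part l k \<Longrightarrow> H \<in> short_part l k \<Longrightarrow> F + H \<in> short_part l k"
  unfolding short_part_def by (auto simp: Fil_add plus_ncps.rep_eq) (metis add.right_neutral)+

lemma near_refl: "near l k F F"
  unfolding near_def by (intro bexI[of _ 0] bexI[OF _ short_part_zero]) (simp_all add: Fil_zero rel_ideal_zero)

lemma near_trans:
  assumes "near l k F H" "near l k H K"
  shows "near l k F K"
proof -
  obtain s r s' r' where a: "s \<in> short_part l k" "r \<in> rel_ideal" "F - H - s - r \<in> Fil (k + 1)"
      "s' \<in> short_part l k" "r' \<in> rel_ideal" "H - K - s' - r' \<in> Fil (k + 1)" using assms unfolding near_def by blast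
  have "F - K - (s + s') - (r + r') = (F - H - s - r) + (H - K - s' - r')" by simp
  then have "F - K - (s + s') - (r + r') \<in> Fil (k + 1)" using Fil_add[OF a(3,6)] by (simp only:)
  then show ?thesis unfolding near_def using short_part_add[OF a(1,4)] rel_ideal_add[OF a(2,5)] by blast
qed

lemma short_part_var_mult:
  assumes l: "x \<in> iw_vars n" and s: "s \<in> short_part l k"
  shows "nc_var x * s \<in> short_part (Suc l) (var_weight x + k)"
  using s Fil_mult[OF var_Fil[OF l]] by (auto simp: short_part_def coeff_var_mult neq_Nil_conv split: if_splits)

lemma near_var_mult:
  assumes x: "x \<in> iw_vars n" and F: "near l k F H"
  shows "near (Suc l) (var_weight x + k) (nc_var x * F) (nc_var x * H)"
proof -
  obtain s r where a: "s \<in> short_part l k" "r \<in> rel_ideal" "F - H - s - r \<in> Fil (k + 1)" using F unfolding near_def by blast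
  have "nc_var x * F - nc_var x * H - nc_var x * s - nc_var x * r = nc_var x * (F - H - s - r)"
    by (simp add: right_diff_distrib)
  then have "nc_var x * F - nc_var x * H - nc_var x * s - nc_var x * r \<in> Fil (var_weight x + k + 1)"
    using Fil_mult[OF var_Fil[OF x] a(3)] by simp
  then show ?thesis unfolding near_def
    using short_part_var_mult[OF x a(1)] rel_ideal_mult(2)[OF a(2) nc_var_closed[OF x]] by blast
qed

lemma Lin_mono_mult:
  assumes z: "z \<in> Lin k" and v: "set v \<subseteq> iw_vars n"
  shows "z * nc_mono v \<in> short_part (Suc (Suc (length v))) (k + word_weight v)"
proof -
  have "length w < Suc (Suc (length v))" if "nc_coeff (z * nc_mono v) w \<noteq> 0" for w
  proof -
    obtain i where i: "i \<le> length w" "nc_coeff z (take i w) * nc_coeff (nc_mono v) (drop i w) \<noteq> 0"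
      using \<open>nc_coeff (z * nc_mono v) w \<noteq> 0\<close> unfolding times_ncps.rep_eq by (meson atMost_iff sum.neutral)
    then have "length (take i w) = 1" "drop i w = v"
      using z by (auto simp: Lin_def coeff_mono split: if_splits)
    then have "length w = 1 + length v" by (metis append_take_drop_id length_append)
    then show ?thesis by simp
  qed
  then show ?thesis using Fil_mult[OF Lin_Fil[OF z] mono_Fil[OF v]] by (simp add: short_part_def)
qed

text \<open>The commutator of two letters is linear up to higher weight, so a swap leaves only words
  that are one letter shorter.\<close>

lemma near_swap:
  assumes x: "x \<in> iw_vars n" and y: "y \<in> iw_vars n" and v: "set v \<subseteq> iw_vars n"
  shows "near (length (x # y # v)) (word_weight (x # y # v)) (nc_mono (x # y # v)) (nc_mono (y # x # v))"
proof -
  obtain z r where zr: "z \<in> Lin (var_weight x + var_weight y)" "r \<in> rel_ideal"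
      "nc_var x * nc_var y - nc_var y * nc_var x - z - r \<in> Fil (var_weight x + var_weight y + 1)"
    using linear_mod_vars[OF x y] unfolding linear_mod_def by blast
  have "nc_mono (x # y # v) - nc_mono (y # x # v) - z * nc_mono v - r * nc_mono v
      = (nc_var x * nc_var y - nc_var y * nc_var x - z - r) * nc_mono v"
    by (simp add: mono_Cons left_diff_distrib mult.assoc)
  then have "nc_mono (x # y # v) - nc_mono (y # x # v) - z * nc_mono v - r * nc_mono v \<in> Fil (word_weight (x # y # v) + 1)"
    using Fil_mult[OF zr(3) mono_Fil[OF v]] by (simp add: add_ac)
  moreover have "z * nc_mono v \<in> short_part (length (x # y # v)) (word_weight (x # y # v))"
    using Lin_mono_mult[OF zr(1) v] by (simp add: add_ac)
  ultimately show ?thesis unfolding near_def using rel_ideal_mult(1)[OF zr(2) mono_closed[OF v]] by blast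
qed

lemma near_move:
  assumes x: "x \<in> iw_vars n" and "set a \<subseteq> iw_vars n" and b: "set b \<subseteq> iw_vars n"
  shows "near (length (x # a @ b)) (word_weight (x # a @ b)) (nc_mono (x # a @ b)) (nc_mono (a @ x # b))"
  using assms(2)
proof (induction a)
  case Nil
  show ?case by (simp add: near_refl)
next
  case (Cons y a)
  have y: "y \<in> iw_vars n" and a: "set (a @ b) \<subseteq> iw_vars n" using Cons.prems b by auto
  have "near (Suc (length (x # a @ b))) (var_weight y + word_weight (x # a @ b)) (nc_mono (y # x # a @ b)) (nc_mono (y # a @ x # b))"
    using near_var_mult[OF y Cons.IH] Cons.prems by (simp add: mono_Cons)
  then have "near (length (x # y # a @ b)) (word_weight (x # y # a @ b)) (nc_mono (y # x # a @ b)) (nc_mono (y # a @ x # b))"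
    by (simp add: add_ac)
  from near_trans[OF near_swap[OF x y a] this] show ?case by simp
qed

text \<open>The tail is permuted first; then the head is moved to its place by adjacent
  swaps.\<close>

lemma near_perm:
  assumes "mset w = mset w'" "set w \<subseteq> iw_vars n"
  shows "near (length w) (word_weight w) (nc_mono w) (nc_mono w')"
  using assms
proof (induction w arbitrary: w')
  case Nil
  then show ?case by (simp add: near_refl)
next
  case (Cons x w)
  have "x \<in> set w'" using Cons.prems(1) by (metis list.set_intros(1) set_mset_mset)
  then obtain a b where w': "w' = a @ x # b" by (meson split_list)
  have m: "mset w = mset (a @ b)" using Cons.prems(1) w' by simp
  have x: "x \<in> iw_vars n" and ws: "set w \<subseteq> iw_vars n" using Cons.prems by auto
  have ab: "set (a @ b) \<subseteq> iw_vars n" using m ws by (metis set_mset_mset)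
  have len: "length w = length (a @ b)" using m by (metis size_mset)
  have wtm: "word_weight w = word_weight (a @ b)" using m unfolding word_weight_def by (metis mset_map sum_mset_sum_list)
  have "near (length (x # a @ b)) (word_weight (x # a @ b)) (nc_mono (x # w)) (nc_mono (x # a @ b))"
    using near_var_mult[OF x Cons.IH[OF m ws]] len wtm by (simp add: mono_Cons)
  from near_trans[OF this near_move[OF x, of a b]] show ?case using ab len wtm by (simp add: w')
qed

end

section \<open>Ordered monomials span modulo the ideal\<close>

lemma count_concat_replicate:
  "distinct ls \<Longrightarrow> count (mset (concat (map (\<lambda>l. replicate (e l) l) ls))) x = (if x \<in> set ls then e x else 0)"
  by (induction ls) auto

context iwasawa_setup
begin

text \<open>In this order, a product of elementary matrices for the lower (upper) roots has the parameters themselves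
  as its entries below (above) the diagonal.\<close>

definition lowers :: "root list" where "lowers = concat (map (\<lambda>j. map (\<lambda>i. (i, j)) [Suc j..<n]) [0..<n])"
definition uppers :: "root list" where "uppers = concat (map (\<lambda>i. map (\<lambda>j. (i, j)) [Suc i..<n]) (rev [0..<n]))"

definition letters :: "iw_var list" where
  "letters = map U_var lowers @ map (\<lambda>c. W_var (c, c + 1)) [0..<n - 1] @ map V_var uppers"

lemma set_lowers: "set lowers = neg_roots n"
  by (auto simp: lowers_def neg_roots_def roots_def image_iff)

lemma set_uppers: "set uppers = pos_roots n"
  by (auto simp: uppers_def pos_roots_def roots_def image_iff)

lemma set_letters: "set letters = iw_vars n"
  unfolding letters_def iw_vars_def by (auto simp: set_lowers set_uppers simple_roots_def)

lemma distinct_concat_map: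
  "distinct xs \<Longrightarrow> (\<And>x. x \<in> set xs \<Longrightarrow> distinct (f x)) \<Longrightarrow> (\<And>x y. x \<in> set xs \<Longrightarrow> y \<in> set xs \<Longrightarrow> x \<noteq> y \<Longrightarrow> set (f x) \<inter> set (f y) = {})
    \<Longrightarrow> distinct (concat (map f xs))"
  by (induction xs) auto

lemma distinct_lowers: "distinct lowers"
  unfolding lowers_def by (rule distinct_concat_map) (auto simp: distinct_map inj_on_def)

lemma distinct_uppers: "distinct uppers"
  unfolding uppers_def by (rule distinct_concat_map) (auto simp: distinct_map inj_on_def)

lemma distinct_letters: "distinct letters"
  unfolding letters_def using distinct_lowers distinct_uppers by (auto simp: distinct_map inj_on_def)

text \<open>Exponent functions that agree on the variables give the same word; uniqueness is
  therefore always stated for the words.\<close>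

definition oword :: "(iw_var \<Rightarrow> nat) \<Rightarrow> iw_var list" where
  "oword e = concat (map (\<lambda>l. replicate (e l) l) letters)"

lemma set_oword: "set (oword e) \<subseteq> iw_vars n"
  by (auto simp: oword_def set_letters)

lemma mset_oword: "set w \<subseteq> iw_vars n \<Longrightarrow> mset (oword (count (mset w))) = mset w"
  by (rule multiset_eqI) (auto simp: oword_def count_concat_replicate[OF distinct_letters] set_letters not_in_iff[symmetric])

definition sorted_series :: "'p nc_series set" where
  "sorted_series = {F \<in> carrier A. \<forall>w. nc_coeff F w \<noteq> 0 \<longrightarrow> w \<in> range oword}"

definition sortable :: "nat \<Rightarrow> 'p nc_series set" where
  "sortable k = {F \<in> carrier A. \<exists>s\<in>sorted_series. \<exists>r\<in>rel_ideal. F - s - r \<in> Fil k}"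

lemma sorted_series_zero: "0 \<in> sorted_series" by (simp add: sorted_series_def nc_algebra_0_1 zero_ncps.rep_eq)

lemma sorted_series_add: "F \<in> sorted_series \<Longrightarrow> H \<in> sorted_series \<Longrightarrow> F + H \<in> sorted_series"
  unfolding sorted_series_def by (auto simp: nc_algebra_closed plus_ncps.rep_eq) (metis add.right_neutral)+

lemma sorted_series_smult: "F \<in> sorted_series \<Longrightarrow> nc_smult c F \<in> sorted_series"
  unfolding sorted_series_def by (auto simp: nc_algebra_closed1 nc_smult.rep_eq)

lemma smult_simps:
  "nc_smult c (F + H) = nc_smult c F + nc_smult c (H :: ('v, 'a::comm_ring_1) ncps)"
  "nc_smult c (F - H) = nc_smult c F - nc_smult c H" "nc_smult c (nc_smult d F) = nc_smult (c * d) F"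
  "nc_smult c 0 = (0 :: ('v, 'a) ncps)"
  by (rule ncps_eqI, simp add: plus_ncps.rep_eq minus_ncps.rep_eq nc_smult.rep_eq zero_ncps.rep_eq distrib_left right_diff_distrib mult.assoc)+

lemma smult_sum: "nc_smult c (sum f I) = (\<Sum>i\<in>I. nc_smult c (f i))"
  by (induction I rule: infinite_finite_induct) (simp_all add: smult_simps)

lemma sortable_add:
  assumes "F \<in> sortable k" "H \<in> sortable k" shows "F + H \<in> sortable k"
proof -
  obtain s r s' r' where a: "s \<in> sorted_series" "r \<in> rel_ideal" "F - s - r \<in> Fil k" "s' \<in> sorted_series" "r' \<in> rel_ideal" "H - s' - r' \<in> Fil k"
    using assms unfolding sortable_def by blast
  have "F + H - (s + s') - (r + r') = (F - s - r) + (H - s' - r')" by simp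
  then have "F + H - (s + s') - (r + r') \<in> Fil k" using Fil_add[OF a(3,6)] by (simp only:)
  then show ?thesis using assms sorted_series_add[OF a(1,4)] rel_ideal_add[OF a(2,5)] unfolding sortable_def by (auto intro: nc_algebra_closed)
qed

lemma sortable_smult:
  assumes "F \<in> sortable k" shows "nc_smult c F \<in> sortable k"
proof -
  obtain s r where a: "s \<in> sorted_series" "r \<in> rel_ideal" "F - s - r \<in> Fil k" using assms unfolding sortable_def by blast
  have "nc_smult c F - nc_smult c s - nc_smult c r \<in> Fil k" using Fil_smult[OF a(3), of c] by (simp only: smult_simps)
  then show ?thesis using assms sorted_series_smult[OF a(1)] rel_ideal_smult[OF a(2)] unfolding sortable_def by (auto intro: nc_algebra_closed1)
qed

lemma sortable_Fil: "F \<in> Fil k \<Longrightarrow> F \<in> sortable k"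
  unfolding sortable_def using Fil_carrier sorted_series_zero rel_ideal_zero by (auto intro!: bexI[of _ 0])

lemma sortable_sorted_series: "F \<in> sorted_series \<Longrightarrow> F \<in> sortable k"
  unfolding sortable_def using Fil_zero rel_ideal_zero by (auto simp: sorted_series_def intro!: bexI[of _ F] bexI[of _ 0])

lemma sortable_rel_ideal: "F \<in> rel_ideal \<Longrightarrow> F \<in> sortable k"
proof -
  assume F: "F \<in> rel_ideal"
  have "F - 0 - F \<in> Fil k" by (simp add: Fil_zero)
  then show ?thesis unfolding sortable_def using F sorted_series_zero rel_ideal_carrier by blast
qed

lemma sortable_sum: "(\<And>i. i \<in> I \<Longrightarrow> f i \<in> sortable k) \<Longrightarrow> sum f I \<in> sortable k"
  by (induction I rule: infinite_finite_induct) (auto intro: sortable_add sortable_sorted_series sorted_series_zero)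

text \<open>Sorting w leaves an error of higher weight, which p^a carries into
  \<open>Fil (k + 1)\<close>, and shorter words, which are handled by induction on the length. The
  factor p^a is part of the claim because a lighter short word comes with further powers of p in its
  coefficient.\<close>

lemma span_word:
  "set w \<subseteq> iw_vars n \<Longrightarrow> k \<le> n * a + word_weight w \<Longrightarrow> nc_smult (padic_p ^ a) (nc_mono w) \<in> sortable (k + 1)"
proof (induction "length w" arbitrary: w k a rule: less_induct)
  case less
  let ?v = "oword (count (mset w))"
  let ?c = "padic_p ^ a :: 'p padic_int"
  obtain s r where sr: "s \<in> short_part (length w) (word_weight w)" "r \<in> rel_ideal" "nc_mono w - nc_mono ?v - s - r \<in> Fil (word_weight w + 1)"
    using near_perm[OF mset_oword[OF less.prems(1), symmetric] less.prems(1)] unfolding near_def by blast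
  define f where "f = nc_mono w - nc_mono ?v - s - r"
  have sc: "s \<in> carrier A" using sr(1) by (auto simp: short_part_def Fil_carrier)
  have "nc_smult ?c f \<in> Fil (k + 1)"
  proof -
    have "heavy (n * a) ?c" unfolding heavy_def by (intro exI[of _ a]) simp
    then have "heavy (n * a + (word_weight w + 1 - word_weight u)) (?c * nc_coeff f u)" for u
      using sr(3) by (intro heavy_mult) (auto simp: Fil_def f_def)
    then have "heavy (k + 1 - word_weight u) (?c * nc_coeff f u)" for u
      by (rule heavy_mono) (use less.prems(2) in simp)
    then show ?thesis using sr(3) by (simp add: Fil_def f_def[symmetric] nc_algebra_closed1 nc_smult.rep_eq)
  qed
  moreover have "nc_smult ?c s \<in> sortable (k + 1)"
  proof -
    have "s = (\<Sum>u\<in>iw_words n (length w). nc_smult (nc_coeff s u) (nc_mono u))"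
      by (rule ncps_eqI, unfold truncation_eq[OF sc]) (use sr(1) in \<open>auto simp: short_part_def\<close>)
    then have "nc_smult ?c s = (\<Sum>u\<in>iw_words n (length w). nc_smult ?c (nc_smult (nc_coeff s u) (nc_mono u)))"
      using smult_sum by metis
    also have "\<dots> \<in> sortable (k + 1)"
    proof (rule sortable_sum)
      fix u assume u: "u \<in> iw_words n (length w)"
      have "heavy (word_weight w - word_weight u) (nc_coeff s u)" using sr(1) by (auto simp: short_part_def Fil_def)
      then obtain b c where b: "nc_coeff s u = padic_p ^ b * c" "word_weight w - word_weight u \<le> n * b" unfolding heavy_def by (auto elim!: dvdE)
      have "nc_smult (padic_p ^ (a + b)) (nc_mono u) \<in> sortable (k + 1)"
        using u b(2) less.prems(2) by (intro less.hyps) (auto simp: iw_words_def distrib_left)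
      then have "nc_smult c (nc_smult (padic_p ^ (a + b)) (nc_mono u)) \<in> sortable (k + 1)" by (rule sortable_smult)
      then show "nc_smult ?c (nc_smult (nc_coeff s u) (nc_mono u)) \<in> sortable (k + 1)"
        by (simp add: smult_simps b(1) power_add mult_ac)
    qed
    finally show ?thesis .
  qed
  moreover have "nc_mono ?v \<in> sorted_series" unfolding sorted_series_def by (auto simp: coeff_mono mono_closed[OF set_oword])
  then have "nc_smult ?c (nc_mono ?v) \<in> sortable (k + 1)" by (intro sortable_sorted_series sorted_series_smult)
  moreover have "nc_smult ?c r \<in> sortable (k + 1)" using sr(2) by (intro sortable_rel_ideal rel_ideal_smult)
  ultimately have "nc_smult ?c f + nc_smult ?c s + nc_smult ?c (nc_mono ?v) + nc_smult ?c r \<in> sortable (k + 1)"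
    by (intro sortable_add[OF sortable_add[OF sortable_add[OF sortable_Fil]]])
  then show ?case by (simp add: f_def smult_simps)
qed

text \<open>A word longer than k has weight above k already, so only finitely many words have to be
  sorted.\<close>

lemma Fil_sortable:
  assumes F: "F \<in> Fil k" shows "F \<in> sortable (k + 1)"
proof -
  let ?t = "\<Sum>w\<in>iw_words n (k + 1). nc_smult (nc_coeff F w) (nc_mono w)"
  have "?t \<in> sortable (k + 1)"
  proof (rule sortable_sum)
    fix w assume w: "w \<in> iw_words n (k + 1)"
    have "heavy (k - word_weight w) (nc_coeff F w)" using F by (auto simp: Fil_def)
    then obtain b c where b: "nc_coeff F w = padic_p ^ b * c" "k - word_weight w \<le> n * b" unfolding heavy_def by (auto elim!: dvdE)
    have "nc_smult (padic_p ^ b) (nc_mono w) \<in> sortable (k + 1)"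
      using w b(2) by (intro span_word) (auto simp: iw_words_def)
    from sortable_smult[OF this, of c] show "nc_smult (nc_coeff F w) (nc_mono w) \<in> sortable (k + 1)"
      by (simp add: smult_simps b(1) mult.commute)
  qed
  moreover have "F - ?t \<in> Fil (k + 1)"
  proof -
    have "heavy (k + 1 - word_weight w) (nc_coeff (F - ?t) w)" for w
    proof (cases "length w < k + 1 \<or> \<not> set w \<subseteq> iw_vars n")
      case True
      then have "nc_coeff (F - ?t) w = 0"
        using Fil_carrier[OF F] unfolding minus_ncps.rep_eq truncation_eq[OF Fil_carrier[OF F]] by (auto simp: mem_nc_algebra)
      then show ?thesis by simp
    next
      case False
      then have "k + 1 \<le> word_weight w" using word_weight_bounds[of w] by linarith
      then show ?thesis by simp
    qed
    moreover have "?t \<in> carrier A" using \<open>?t \<in> sortable (k + 1)\<close> by (simp add: sortable_def)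
    ultimately show ?thesis using Fil_carrier[OF F] by (simp add: Fil_def nc_algebra_closed)
  qed
  ultimately have "?t + (F - ?t) \<in> sortable (k + 1)" by (rule sortable_add[OF _ sortable_Fil])
  then show ?thesis by simp
qed

lemma carrier_sortable: "F \<in> carrier A \<Longrightarrow> F \<in> sortable k"
proof (induction k)
  case 0
  then show ?case using sortable_Fil[of F 0] by (simp add: Fil_0)
next
  case (Suc k)
  then obtain s r where a: "s \<in> sorted_series" "r \<in> rel_ideal" "F - s - r \<in> Fil k" unfolding sortable_def by blast
  have "s + r + (F - s - r) \<in> sortable (k + 1)" by (rule sortable_add[OF sortable_add[OF sortable_sorted_series[OF a(1)] sortable_rel_ideal[OF a(2)]] Fil_sortable[OF a(3)]])
  then show ?case by simp
qed

text \<open>Each letter weighs between 1 and n, so the filtration by weight and the one defining the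
  topology are cofinal; this is one direction, \<open>Fil_imp_near\<close> the other.\<close>

lemma near_imp_Fil:
  assumes "D \<in> carrier A" "\<And>w. padic_p ^ (k - length w) dvd nc_coeff D w"
  shows "D \<in> Fil k"
  unfolding Fil_def
proof (intro CollectI conjI allI assms(1))
  fix w
  show "heavy (k - word_weight w) (nc_coeff D w)"
  proof (cases "set w \<subseteq> iw_vars n")
    case True
    have "1 * (k - length w) \<le> n * (k - length w)" using n_pos by (intro mult_le_mono1) simp
    then have "k - word_weight w \<le> n * (k - length w)" using word_weight_bounds[OF True] by linarith
    then show ?thesis unfolding heavy_def using assms(2) by blast
  qed (use assms(1) in \<open>simp add: mem_nc_algebra\<close>)
qed

lemma Fil_imp_near:
  assumes "D \<in> Fil (n * m)"
  shows "padic_p ^ (m - length w) dvd nc_coeff D w"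
proof (cases "set w \<subseteq> iw_vars n")
  case True
  obtain a where a: "padic_p ^ a dvd nc_coeff D w" "n * m - word_weight w \<le> n * a"
    using assms unfolding Fil_def heavy_def by blast
  have "n * m \<le> n * (a + length w)" using a(2) word_weight_bounds[OF True] unfolding distrib_left by linarith
  then have "m - length w \<le> a" using n_pos by simp
  then show ?thesis by (rule dvd_trans[OF le_imp_power_dvd a(1)])
qed (use Fil_carrier[OF assms] in \<open>simp add: mem_nc_algebra\<close>)

text \<open>For each k the ordered series congruent to F modulo the ideal and \<open>Fil k\<close>
  form a nonempty closed set. By compactness these nested sets have a common element s, and F - s is
  a limit of elements of the closed ideal.\<close>

lemma sorted_representative:
  assumes F: "F \<in> carrier A"
  shows "\<exists>s\<in>sorted_series. F - s \<in> rel_ideal"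
proof -
  define C where "C k = {s \<in> sorted_series. \<exists>r\<in>rel_ideal. F - s - r \<in> Fil k}" for k
  have SSc: "sorted_series \<subseteq> carrier A" by (auto simp: sorted_series_def)
  have "closedin (nc_topology n) (C k)" for k
    unfolding closedin_def openin_nc_topology' topspace_nc_topology
  proof (intro conjI ballI)
    show "C k \<subseteq> carrier A" using SSc by (auto simp: C_def)
    fix H assume H: "H \<in> carrier A - C k"
    show "\<exists>m. \<forall>H'\<in>carrier A. (\<forall>w. padic_p ^ (m - length w) dvd nc_coeff H' w - nc_coeff H w) \<longrightarrow> H' \<in> carrier A - C k"
    proof (cases "H \<in> sorted_series")
      \<comment> \<open>A nonzero coefficient at a word that is not ordered stays nonzero
        nearby.\<close>
      case False
      then obtain w where w: "nc_coeff H w \<noteq> 0" "w \<notin> range oword" using H by (auto simp: sorted_series_def)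
      then obtain k0 where k0: "\<not> padic_p ^ k0 dvd nc_coeff H w - 0" using padic_eqI by blast
      show ?thesis
      proof (intro exI[of _ "k0 + length w"] ballI impI)
        fix H' assume H': "H' \<in> carrier A" "\<forall>u. padic_p ^ (k0 + length w - length u) dvd nc_coeff H' u - nc_coeff H u"
        have "padic_p ^ k0 dvd nc_coeff H' w - nc_coeff H w" using H'(2)[rule_format, of w] by simp
        then have "nc_coeff H' w \<noteq> 0" using k0 by auto
        then have "H' \<notin> sorted_series" using w by (auto simp: sorted_series_def)
        then show "H' \<in> carrier A - C k" using H' by (simp add: C_def)
      qed
    next
      case True
      show ?thesis
      proof (intro exI[of _ k] ballI impI)
        fix H' assume H': "H' \<in> carrier A" "\<forall>u. padic_p ^ (k - length u) dvd nc_coeff H' u - nc_coeff H u"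
        have d: "H' - H \<in> Fil k"
          using H' H by (intro near_imp_Fil) (auto simp: nc_algebra_closed minus_ncps.rep_eq)
        have "H' \<notin> C k"
        proof
          assume "H' \<in> C k"
          then obtain r where r: "r \<in> rel_ideal" "F - H' - r \<in> Fil k" by (auto simp: C_def)
          have "F - H - r = (F - H' - r) + (H' - H)" by simp
          then have "F - H - r \<in> Fil k" using Fil_add[OF r(2) d] by (simp only:)
          then show False using H True r(1) by (auto simp: C_def)
        qed
        then show "H' \<in> carrier A - C k" using H' by simp
      qed
    qed
  qed simp
  moreover have "C k \<noteq> {}" for k using carrier_sortable[OF F, of k] by (auto simp: sortable_def C_def)
  moreover have "decseq C" unfolding decseq_def C_def using Fil_mono by blast
  ultimately have "(\<Inter>k. C k) \<noteq> {}"
    using compact_space_imp_nest[OF compact_space_nc_topology] by blast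
  then obtain s where s: "\<And>k. s \<in> C k" by blast
  have sS: "s \<in> sorted_series" using s[of 0] by (simp add: C_def)
  have sc: "s \<in> carrier A" using sS SSc by blast
  have "F - s \<in> rel_ideal"
  proof (rule ccontr)
    assume n: "F - s \<notin> rel_ideal"
    have "openin (nc_topology n) (carrier A - rel_ideal)" using rel_ideal_closed by (simp add: closedin_def)
    then obtain m where m: "\<And>H. H \<in> carrier A \<Longrightarrow> (\<forall>w. padic_p ^ (m - length w) dvd nc_coeff H w - nc_coeff (F - s) w) \<Longrightarrow> H \<notin> rel_ideal"
      using n F sc nc_algebra_closed(2)[OF F sc] unfolding openin_nc_topology' by blast
    obtain r where r: "r \<in> rel_ideal" "F - s - r \<in> Fil (n * m)" using s[of "n * m"] by (auto simp: C_def)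
    have "padic_p ^ (m - length w) dvd nc_coeff r w - nc_coeff (F - s) w" for w
      using Fil_imp_near[OF r(2), of w] by (simp add: minus_ncps.rep_eq) (metis dvd_minus_iff minus_diff_eq)
    then show False using m[OF rel_ideal_carrier[OF r(1)]] r(1) by blast
  qed
  then show ?thesis using sS by blast
qed

end

section \<open>The relations\<close>

lemma (in finite_group) gr_basis_mult:
  assumes "a \<in> carrier H" "b \<in> carrier H"
  shows "gr_basis a \<otimes>\<^bsub>group_ring H\<^esub> gr_basis b = gr_basis (a \<otimes> b)"
proof
  fix z
  have "z \<otimes> inv b = a \<longleftrightarrow> z = a \<otimes> b" if "z \<in> carrier H"
    using inv_solve_right[OF assms(1) that assms(2)] by metis
  then show "(gr_basis a \<otimes>\<^bsub>group_ring H\<^esub> gr_basis b) z = gr_basis (a \<otimes> b) z"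
    unfolding group_ring_mult_basis[OF gr_basis_closed[OF assms(1)] assms(2)] using assms by (auto simp: gr_basis_def)
qed

context iwasawa_setup
begin

section \<open>Images of group elements and one-parameter families\<close>

lemma iwasawa_of_mult:
  assumes "g \<in> carrier G" "h \<in> carrier G"
  shows "iwasawa_of n (g * h) = iwasawa_of n g \<otimes>\<^bsub>L\<^esub> iwasawa_of n h"
  unfolding iwasawa_of_eq L_simps
  by (intro restrict_ext)
    (simp add: finite_group.gr_basis_mult[OF Q_finite_group] coset_in_Q assms coset_mult)

lemma phi_one_plus_var: "l \<in> iw_vars n \<Longrightarrow> phi (1 + nc_var l) = iwasawa_of n (gen l)"
proof -
  assume l: "l \<in> iw_vars n"
  have g: "iwasawa_of n (gen l) \<in> carrier L" by (intro iwasawa_of_closed gen_in_G l)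
  interpret R: ring L by (rule L_ring)
  have "phi (1 + nc_var l) = \<one>\<^bsub>L\<^esub> \<oplus>\<^bsub>L\<^esub> (iwasawa_of n (gen l) \<ominus>\<^bsub>L\<^esub> \<one>\<^bsub>L\<^esub>)"
    by (simp add: phi_add phi_one phi_var[OF l] letter_def)
  also have "\<dots> = iwasawa_of n (gen l) \<oplus>\<^bsub>L\<^esub> (\<one>\<^bsub>L\<^esub> \<oplus>\<^bsub>L\<^esub> \<ominus>\<^bsub>L\<^esub> \<one>\<^bsub>L\<^esub>)"
    unfolding R.minus_eq using g by (intro R.a_lcomm) simp_all
  also have "\<dots> = iwasawa_of n (gen l)" using g by (simp add: R.r_neg)
  finally show ?thesis .
qed

text \<open>Pascal's rule; it identifies the series for a natural exponent with an ordinary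
  power.\<close>

lemma one_plus_power_Suc:
  "one_plus_power (nc_var l) (of_nat (Suc j)) = (1 + nc_var l) * one_plus_power (nc_var l) (of_nat j :: 'p padic_int)"
proof (rule ncps_eqI)
  fix w
  show "nc_coeff (one_plus_power (nc_var l) (of_nat (Suc j))) w = nc_coeff ((1 + nc_var l) * one_plus_power (nc_var l) (of_nat j :: 'p padic_int)) w"
    unfolding distrib_right mult_1_left plus_ncps.rep_eq coeff_var_mult coeff_one_plus_power
    by (cases w) (auto simp: padic_gchoose_of_nat simp del: of_nat_Suc)
qed

lemma phi_one_plus_power_nat:
  assumes l: "l \<in> iw_vars n"
  shows "phi (one_plus_power (nc_var l) (of_nat j)) = iwasawa_of n (gen l [^]\<^bsub>G\<^esub> j)"
proof (induction j)
  case 0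
  have "one_plus_power (nc_var l) (of_nat 0) = (1 :: 'p nc_series)"
    by (rule ncps_eqI) (auto simp: coeff_one_plus_power padic_gchoose_of_nat one_ncps.rep_eq binomial_eq_0 simp del: of_nat_0)
  then show ?case by (simp add: phi_one one_L iwahori_simps)
next
  case (Suc j)
  interpret Gr: group G by (rule group_G)
  have g: "gen l \<in> carrier G" by (rule gen_in_G[OF l])
  have "gen l [^]\<^bsub>G\<^esub> Suc j = gen l * (gen l [^]\<^bsub>G\<^esub> j)" using Gr.nat_pow_Suc2[OF g, of j] by (simp add: iwahori_simps)
  then show ?case
    unfolding one_plus_power_Suc phi_mult Suc.IH phi_one_plus_var[OF l]
    using g by (simp add: iwasawa_of_mult)
qed

text \<open>Both sides depend continuously on q modulo each N and agree on the natural numbers,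
  which are dense. \<open>X\<close> is the one-parameter family that interpolates the powers of the
  generator.\<close>

lemma phi_one_plus_power:
  assumes l: "l \<in> iw_vars n"
    and X: "\<And>j. X (of_nat j) = gen l [^]\<^bsub>G\<^esub> j" "\<And>q. X q \<in> carrier G"
    and cont: "\<And>N. N \<in> ONS \<Longrightarrow> \<exists>K. \<forall>q q'. padic_p ^ K dvd q - q' \<longrightarrow> coset N (X q) = coset N (X q')"
  shows "phi (one_plus_power (nc_var l) q) = iwasawa_of n (X q)"
proof (rule L_ext[OF phi_closed iwasawa_of_closed[OF X(2)]], rule ext, rule padic_eqI)
  fix N C k assume N: "N \<in> ONS"
  let ?m = "word_bound N k"
  obtain K1 where K1: "\<And>q q'. padic_p ^ K1 dvd q - q' \<Longrightarrow> coset N (X q) = coset N (X q')" using cont[OF N] by blast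
  obtain K2 where K2: "\<And>q q' r. padic_p ^ K2 dvd q - q' \<Longrightarrow> r \<le> ?m \<Longrightarrow> padic_p ^ k dvd padic_gchoose q r - padic_gchoose (q' :: 'p padic_int) r"
    using padic_gchoose_cong[where 'p='p, of ?m k] by blast
  obtain j where j: "padic_p ^ max K1 K2 dvd q - of_nat j" using padic_approx_nat by blast
  have j1: "padic_p ^ K1 dvd q - of_nat j" by (rule dvd_trans[OF le_imp_power_dvd j]) simp
  have j2: "padic_p ^ K2 dvd q - of_nat j" by (rule dvd_trans[OF le_imp_power_dvd j]) simp
  have "partial_sum (one_plus_power (nc_var l) q) ?m N C - partial_sum (one_plus_power (nc_var l) (of_nat j)) ?m N C
      = (\<Sum>w\<in>iw_words n ?m. (nc_coeff (one_plus_power (nc_var l) q) w - nc_coeff (one_plus_power (nc_var l) (of_nat j)) w) * word_elt w N C)"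
    by (simp add: partial_sum_def sum_subtractf left_diff_distrib)
  also have "padic_p ^ k dvd \<dots>"
  proof (intro dvd_sum dvd_mult2)
    fix w assume "w \<in> iw_words n ?m"
    then show "padic_p ^ k dvd nc_coeff (one_plus_power (nc_var l) q) w - nc_coeff (one_plus_power (nc_var l) (of_nat j)) w"
      using K2[OF j2, of "length w"] by (simp add: coeff_one_plus_power iw_words_def)
  qed
  finally have d: "padic_p ^ k dvd partial_sum (one_plus_power (nc_var l) q) ?m N C - partial_sum (one_plus_power (nc_var l) (of_nat j)) ?m N C" .
  have e: "iwasawa_of n (X q) N C = phi (one_plus_power (nc_var l) (of_nat j)) N C"
    unfolding phi_one_plus_power_nat[OF l] X(1)[symmetric] using K1[OF j1] N by (simp add: iwasawa_of_eq)
  from dvd_diff[OF dvd_add[OF phi_cong[OF N order_refl, of k "one_plus_power (nc_var l) q" C] d]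
      phi_cong[OF N order_refl, of k "one_plus_power (nc_var l) (of_nat j)" C]]
  show "padic_p ^ k dvd phi (one_plus_power (nc_var l) q) N C - iwasawa_of n (X q) N C"
    unfolding e by simp
qed

section \<open>Identities between elementary and diagonal matrices\<close>

lemma x_left_entry:
  assumes "M \<in> carrier_mat n n" "i < n" "j < n" "i \<noteq> j" "a < n" "b < n"
  shows "(x_mat n (i, j) s * M) $$ (a, b) = M $$ (a, b) + (if a = i then s * M $$ (j, b) else 0)"
proof -
  have "(x_mat n (i, j) s * M) $$ (a, b) = (\<Sum>k<n. (if k = a then M $$ (k, b) else 0) + (if k = j then (if a = i then s * M $$ (j, b) else 0) else 0))"
    unfolding mat_mult_entry[OF x_mat_carrier assms(1,5,6)]
    using assms by (intro sum.cong refl) (auto simp: x_mat_entry distrib_right)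
  then show ?thesis using assms by (simp add: sum.distrib)
qed

lemma x_mat_mult_add:
  assumes "\<alpha> \<in> roots n"
  shows "x_mat n \<alpha> s * x_mat n \<alpha> t = (x_mat n \<alpha> (s + t) :: 'p padic_int mat)"
proof -
  obtain i j where ij: "\<alpha> = (i, j)" "i < n" "j < n" "i \<noteq> j" using assms by (auto simp: roots_def)
  show ?thesis
  proof (rule eq_matI)
    fix a b assume "a < dim_row (x_mat n \<alpha> (s + t) :: 'p padic_int mat)" "b < dim_col (x_mat n \<alpha> (s + t) :: 'p padic_int mat)"
    then have ab: "a < n" "b < n" by (simp_all add: x_mat_def)
    show "(x_mat n \<alpha> s * x_mat n \<alpha> t) $$ (a, b) = (x_mat n \<alpha> (s + t) :: 'p padic_int mat) $$ (a, b)"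
      unfolding ij(1) x_left_entry[OF x_mat_carrier ij(2-4) ab] using ij ab by (auto simp: x_mat_entry)
  qed (simp_all add: x_mat_def)
qed

lemma x_mat_0: "x_mat n \<alpha> 0 = (1\<^sub>m n :: 'p padic_int mat)"
  by (rule eq_matI) (auto simp: x_mat_def)

lemma x_mat_pow:
  assumes "\<alpha> \<in> roots n"
  shows "x_mat n \<alpha> c [^]\<^bsub>G\<^esub> (j :: nat) = x_mat n \<alpha> (c * of_nat j)"
proof (induction j)
  case (Suc j)
  interpret Gr: group G by (rule group_G)
  show ?case using Suc by (simp add: Gr.nat_pow_Suc iwahori_simps x_mat_mult_add[OF assms] algebra_simps)
qed (simp add: iwahori_simps x_mat_0)

lemma x_mat_coset_cong:
  assumes \<alpha>: "\<alpha> \<in> roots n" and c: "fst \<alpha> > snd \<alpha> \<longrightarrow> padic_p dvd c" and N: "N \<in> ONS"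
  shows "\<exists>K. \<forall>q q'. padic_p ^ K dvd q - q' \<longrightarrow> coset N (x_mat n \<alpha> (c * q)) = coset N (x_mat n \<alpha> (c * q'))"
proof -
  obtain k where k: "cong_subgroup n k \<subseteq> N" using open_normal_contains_cong[OF N] by blast
  have xG: "x_mat n \<alpha> (c * q) \<in> carrier G" for q using c by (intro x_mat_in_G[OF \<alpha>]) auto
  have "coset N (x_mat n \<alpha> (c * q)) = coset N (x_mat n \<alpha> (c * q'))" if d: "padic_p ^ Suc k dvd q - q'" for q q'
  proof -
    have "x_mat n \<alpha> (c * (q - q')) \<in> cong_subgroup n k"
      unfolding cong_subgroup_def
    proof (intro CollectI conjI allI impI xG)
      fix i j assume ij: "i < n" "j < n"
      have "padic_p ^ (if i < j then k else Suc k) dvd c * (q - q')"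
        by (rule dvd_mult[OF dvd_trans[OF le_imp_power_dvd d]]) simp
      then show "padic_p ^ (if i < j then k else Suc k) dvd (x_mat n \<alpha> (c * (q - q')) - 1\<^sub>m n) $$ (i, j)"
        using ij by (auto simp: x_mat_entry)
    qed
    then have "x_mat n \<alpha> (c * (q - q')) \<in> N" using k by blast
    moreover have "c * q' + c * (q - q') = c * q" by (simp add: right_diff_distrib)
    ultimately show ?thesis using coset_absorb[OF N xG[of q'], of "x_mat n \<alpha> (c * (q - q'))"] by (simp only: x_mat_mult_add[OF \<alpha>])
  qed
  then show ?thesis by blast
qed

lemma phi_opp_U: "\<beta> \<in> neg_roots n \<Longrightarrow> phi (one_plus_power (nc_var (U_var \<beta>)) q) = iwasawa_of n (x_mat n \<beta> (padic_p * q))"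
  by (rule phi_one_plus_power)
    (auto simp: iw_vars_def neg_roots_def x_mat_pow intro!: x_mat_in_G x_mat_coset_cong)

lemma phi_opp_V: "\<alpha> \<in> pos_roots n \<Longrightarrow> phi (one_plus_power (nc_var (V_var \<alpha>)) q) = iwasawa_of n (x_mat n \<alpha> (1 * q))"
  by (rule phi_one_plus_power[where X = "\<lambda>q. x_mat n \<alpha> (1 * q)"])
    (auto simp: iw_vars_def pos_roots_def x_mat_pow intro!: x_mat_in_G x_mat_coset_cong[of _ 1, simplified])

lemma h_left_entry:
  assumes "M \<in> carrier_mat n n" "a < n" "b < n"
  shows "(h_mat n \<delta> u * M) $$ (a, b) = h_mat n \<delta> u $$ (a, a) * M $$ (a, b)"
proof -
  have "(h_mat n \<delta> u * M) $$ (a, b) = (\<Sum>k<n. if k = a then h_mat n \<delta> u $$ (a, a) * M $$ (a, b) else 0)"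
    unfolding mat_mult_entry[OF h_mat_carrier assms] using assms by (intro sum.cong refl) (auto simp: h_mat_def)
  then show ?thesis using assms by simp
qed

lemma h_right_entry:
  assumes "M \<in> carrier_mat n n" "a < n" "b < n"
  shows "(M * h_mat n \<delta> u) $$ (a, b) = M $$ (a, b) * h_mat n \<delta> u $$ (b, b)"
proof -
  have "(M * h_mat n \<delta> u) $$ (a, b) = (\<Sum>k<n. if k = b then M $$ (a, b) * h_mat n \<delta> u $$ (b, b) else 0)"
    unfolding mat_mult_entry[OF assms(1) h_mat_carrier assms(2,3)] using assms by (intro sum.cong refl) (auto simp: h_mat_def)
  then show ?thesis using assms by simp
qed

lemma eq_mat_n: "X \<in> carrier_mat n n \<Longrightarrow> Y \<in> carrier_mat n n \<Longrightarrow> (\<And>a b. a < n \<Longrightarrow> b < n \<Longrightarrow> X $$ (a, b) = Y $$ (a, b)) \<Longrightarrow> X = Y"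
  by (rule eq_matI) auto

lemma x_commutator1:
  assumes "i < n" "j < n" "k < n" "i \<noteq> j" "j \<noteq> k" "i \<noteq> k"
  shows "x_mat n (i, j) s * x_mat n (j, k) t = (x_mat n (i, k) (s * t) * x_mat n (j, k) t * x_mat n (i, j) s :: 'p padic_int mat)"
proof -
  have a: "x_mat n (i, k) (s * t) * x_mat n (j, k) t * x_mat n (i, j) s
      = x_mat n (i, k) (s * t) * (x_mat n (j, k) t * x_mat n (i, j) s)"
    by (rule assoc_mult_mat[OF x_mat_carrier x_mat_carrier x_mat_carrier])
  have c: "x_mat n (j, k) t * x_mat n (i, j) s \<in> carrier_mat n n" by (rule mult_carrier_mat[OF x_mat_carrier x_mat_carrier])
  show ?thesis unfolding a
    by (rule eq_mat_n[OF mult_carrier_mat[OF x_mat_carrier x_mat_carrier] mult_carrier_mat[OF x_mat_carrier c]])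
      (use assms in \<open>auto simp: x_left_entry c x_mat_entry algebra_simps simp del: index_mult_mat\<close>)
qed

lemma x_commutator2:
  assumes "i < n" "j < n" "k < n" "i \<noteq> j" "j \<noteq> k" "i \<noteq> k"
  shows "x_mat n (i, j) s * x_mat n (k, i) t = (x_mat n (k, j) (- (s * t)) * x_mat n (k, i) t * x_mat n (i, j) s :: 'p padic_int mat)"
proof -
  have a: "x_mat n (k, j) (- (s * t)) * x_mat n (k, i) t * x_mat n (i, j) s
      = x_mat n (k, j) (- (s * t)) * (x_mat n (k, i) t * x_mat n (i, j) s)"
    by (rule assoc_mult_mat[OF x_mat_carrier x_mat_carrier x_mat_carrier])
  have c: "x_mat n (k, i) t * x_mat n (i, j) s \<in> carrier_mat n n" by (rule mult_carrier_mat[OF x_mat_carrier x_mat_carrier])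
  show ?thesis unfolding a
    by (rule eq_mat_n[OF mult_carrier_mat[OF x_mat_carrier x_mat_carrier] mult_carrier_mat[OF x_mat_carrier c]])
      (use assms in \<open>auto simp: x_left_entry c x_mat_entry algebra_simps simp del: index_mult_mat\<close>)
qed

lemma x_commute:
  assumes "i < n" "j < n" "k < n" "l < n" "i \<noteq> j" "k \<noteq> l" "j \<noteq> k" "i \<noteq> l"
  shows "x_mat n (i, j) s * x_mat n (k, l) t = (x_mat n (k, l) t * x_mat n (i, j) s :: 'p padic_int mat)"
  by (rule eq_mat_n[OF mult_carrier_mat[OF x_mat_carrier x_mat_carrier] mult_carrier_mat[OF x_mat_carrier x_mat_carrier]])
    (use assms in \<open>auto simp: x_left_entry x_mat_entry algebra_simps simp del: index_mult_mat\<close>)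

lemma h_entry:
  "a < n \<Longrightarrow> b < n \<Longrightarrow> h_mat n \<delta> u $$ (a, b) = (if a \<noteq> b then 0 else if a = fst \<delta> then u else if a = snd \<delta> then 1 div u else 1)"
  by (simp add: h_mat_def)

lemma h_commute: "h_mat n \<delta> u * h_mat n \<epsilon> v = (h_mat n \<epsilon> v * h_mat n \<delta> u :: 'p padic_int mat)"
  by (rule eq_mat_n[OF mult_carrier_mat[OF h_mat_carrier h_mat_carrier] mult_carrier_mat[OF h_mat_carrier h_mat_carrier]])
    (auto simp: h_left_entry h_entry simp del: index_mult_mat)

text \<open>The inner diagonal entries cancel, so the product of the W-factors in the relation for
  opposite roots telescopes to one diagonal matrix attached to (i, j).\<close>

lemma h_mat_join:
  assumes "i < j" "j + 1 < n" "(u :: 'p padic_int) dvd 1"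
  shows "h_mat n (i, j) u * h_mat n (j, j + 1) u = h_mat n (i, j + 1) u"
  by (rule eq_mat_n[OF mult_carrier_mat[OF h_mat_carrier h_mat_carrier] h_mat_carrier])
    (use assms unit_inverse[OF assms(3)] in \<open>auto simp: h_left_entry h_entry mult.commute simp del: index_mult_mat\<close>)

lemma prod_W:
  assumes "i < j" "j < n"
  shows "h_mat n (i, j) (1 + padic_p) \<in> carrier G \<and>
    phi (prod_list (map (\<lambda>c. 1 + nc_var (W_var (c, c + 1))) [i..<j])) = iwasawa_of n (h_mat n (i, j) (1 + padic_p))"
proof -
  have W: "h_mat n (c, c + 1) (1 + padic_p) \<in> carrier G"
      "phi (1 + nc_var (W_var (c, c + 1))) = iwasawa_of n (h_mat n (c, c + 1) (1 + padic_p))" if "c + 1 < n" for c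
    using gen_in_G[of "W_var (c, c + 1)"] phi_one_plus_var[of "W_var (c, c + 1)"] that
    by (auto simp: iw_vars_def simple_roots_def)
  have "Suc i \<le> j" using assms by simp
  then show ?thesis using assms(2)
  proof (induction j rule: dec_induct)
    case base
    then show ?case using W[of i] by simp
  next
    case (step j)
    have IH: "h_mat n (i, j) (1 + padic_p) \<in> carrier G"
      "phi (prod_list (map (\<lambda>c. 1 + nc_var (W_var (c, c + 1))) [i..<j])) = iwasawa_of n (h_mat n (i, j) (1 + padic_p))"
      using step by auto
    have Wj: "h_mat n (j, j + 1) (1 + padic_p) \<in> carrier G"
      "phi (1 + nc_var (W_var (j, j + 1))) = iwasawa_of n (h_mat n (j, j + 1) (1 + padic_p))" using W[of j] step by auto
    have e: "h_mat n (i, j) (1 + padic_p) * h_mat n (j, j + 1) (1 + padic_p) = (h_mat n (i, j + 1) (1 + padic_p) :: 'p padic_int mat)"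
      using step by (intro h_mat_join one_plus_p_unit) auto
    have p: "prod_list (map (\<lambda>c. 1 + nc_var (W_var (c, c + 1))) [i..<Suc j])
        = prod_list (map (\<lambda>c. 1 + nc_var (W_var (c, c + 1))) [i..<j]) * (1 + nc_var (W_var (j, j + 1)) :: 'p nc_series)"
      using step by simp
    show ?case
      unfolding p phi_mult IH(2) Wj(2) iwasawa_of_mult[OF IH(1) Wj(1), symmetric] e
      using iwahori_mult_closed[OF IH(1) Wj(1)] e by simp
  qed
qed

text \<open>In the 2 by 2 block of i and j, the matrix with rows (1 + p, 1) and (p, 1) is decomposed
  as lower times diagonal times upper, with q the inverse of 1 + p.\<close>

lemma opposite_relation_mat:
  assumes "i < j" "j < n" and q: "(1 + padic_p) * q = (1 :: 'p padic_int)" and q1: "1 div (1 + padic_p) = q"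
  shows "x_mat n (i, j) 1 * x_mat n (j, i) padic_p
    = x_mat n (j, i) (padic_p * q) * (h_mat n (i, j) (1 + padic_p) * x_mat n (i, j) (1 * q))"
proof -
  have c: "h_mat n (i, j) (1 + padic_p) * x_mat n (i, j) (1 * q) \<in> carrier_mat n n"
    by (rule mult_carrier_mat[OF h_mat_carrier x_mat_carrier])
  \<comment> \<open>The equation (1 + p) q = 1 in the shapes in which it arises from the expanded
    matrix entries.\<close>
  have q2: "q + padic_p * q = 1" using q by (simp add: distrib_right)
  have q3: "q + padic_p * (q * (q + padic_p * q)) = 1" unfolding q2 using q2 by simp
  have q5: "q + (padic_p * (q * q) + padic_p * (padic_p * (q * q))) = 1" using q3 by (simp add: distrib_left mult_ac)
  have q4: "padic_p * q + padic_p * (padic_p * q) = padic_p" using arg_cong[OF q2, of "\<lambda>x. padic_p * x"] by (simp add: distrib_left)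
  have h: "h_mat n (i, j) (1 + padic_p) $$ (a, a) = (if a = i then 1 + padic_p else if a = j then q else 1)" if "a < n" for a
    using that by (simp add: h_mat_def q1)
  show ?thesis
  proof (rule eq_mat_n[OF mult_carrier_mat[OF x_mat_carrier x_mat_carrier] mult_carrier_mat[OF x_mat_carrier c]])
    fix a b assume ab: "a < n" "b < n"
    have l: "(x_mat n (i, j) 1 * x_mat n (j, i) padic_p) $$ (a, b) = x_mat n (j, i) padic_p $$ (a, b) + (if a = i then 1 * x_mat n (j, i) padic_p $$ (j, b) else 0 :: 'p padic_int)"
      using assms(1,2) ab by (intro x_left_entry x_mat_carrier) auto
    have e: "(h_mat n (i, j) (1 + padic_p) * x_mat n (i, j) (1 * q)) $$ (a', b) = h_mat n (i, j) (1 + padic_p) $$ (a', a') * x_mat n (i, j) (1 * q) $$ (a', b)" if "a' < n" for a'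
      using that ab by (intro h_left_entry x_mat_carrier)
    have r: "(x_mat n (j, i) (padic_p * q) * (h_mat n (i, j) (1 + padic_p) * x_mat n (i, j) (1 * q))) $$ (a, b)
        = h_mat n (i, j) (1 + padic_p) $$ (a, a) * x_mat n (i, j) (1 * q) $$ (a, b)
          + (if a = j then padic_p * q * (h_mat n (i, j) (1 + padic_p) $$ (i, i) * x_mat n (i, j) (1 * q) $$ (i, b)) else 0)"
      using assms(1,2) ab x_left_entry[OF c, of j i a b "padic_p * q"] e[of a] e[of i] by simp
    show "(x_mat n (i, j) 1 * x_mat n (j, i) padic_p) $$ (a, b)
        = (x_mat n (j, i) (padic_p * q) * (h_mat n (i, j) (1 + padic_p) * x_mat n (i, j) (1 * q))) $$ (a, b)"
      unfolding l r
      using assms(1,2) ab q q2 q4 q5 by (auto simp: x_mat_entry h mult_ac distrib_left distrib_right)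
  qed
qed

lemma powi_simps:
  "padic_powi u 0 = (1 :: 'p padic_int)" "padic_powi u 1 = u" "padic_powi u 2 = u * u"
  "padic_powi u (- 1) = 1 div u" "padic_powi u (- 2) = (1 div u) * (1 div u)"
  by (simp_all add: padic_powi_def power2_eq_square)

text \<open>1 + p is a natural number greater than 1. Multiplying by a large power of it makes both
  exponents natural, and distinct powers stay distinct in characteristic 0.\<close>

lemma powi_inj:
  assumes "padic_powi (1 + padic_p) m = (padic_powi (1 + padic_p) m' :: 'p padic_int)"
  shows "m = m'"
proof -
  let ?u = "1 + padic_p :: 'p padic_int"
  have s: "padic_powi ?u m * ?u ^ k = ?u ^ nat (m + int k)" if "0 \<le> m + int k" for m k
  proof (cases "m \<ge> 0")
    case True
    then show ?thesis by (simp add: padic_powi_def nat_add_distrib power_add)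
  next
    case False
    have "k = nat (- m) + nat (m + int k)" using False that by simp
    then have k: "?u ^ k = ?u ^ nat (- m) * ?u ^ nat (m + int k)" by (metis power_add)
    have "(1 div ?u) ^ nat (- m) * ?u ^ nat (- m) = 1"
      unfolding power_mult_distrib[symmetric] using unit_inverse[OF one_plus_p_unit] by (simp add: mult.commute)
    then have "(1 div ?u) ^ nat (- m) * (?u ^ nat (- m) * ?u ^ nat (m + int k)) = ?u ^ nat (m + int k)"
      by (simp only: mult.assoc[symmetric] mult_1_left)
    moreover have "padic_powi ?u m = (1 div ?u) ^ nat (- m)" using False by (simp add: padic_powi_def)
    ultimately show ?thesis by (simp only: k)
  qed
  define k where "k = nat (\<bar>m\<bar> + \<bar>m'\<bar>)"
  have k: "0 \<le> m + int k" "0 \<le> m' + int k" by (auto simp: k_def)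
  have "?u ^ nat (m + int k) = ?u ^ nat (m' + int k)" using s[OF k(1)] s[OF k(2)] assms by simp
  moreover have "?u = of_nat (Suc CARD('p))" by (simp add: padic_p_def)
  ultimately have "of_nat (Suc CARD('p) ^ nat (m + int k)) = (of_nat (Suc CARD('p) ^ nat (m' + int k)) :: 'p padic_int)"
    by (simp only: of_nat_power)
  then have "Suc CARD('p) ^ nat (m + int k) = Suc CARD('p) ^ nat (m' + int k)" by (rule iffD1[OF of_nat_eq_iff])
  moreover have "1 < Suc CARD('p)" using p_gt2 by simp
  ultimately have "nat (m + int k) = nat (m' + int k)" using power_inject_exp by blast
  then show ?thesis using k by simp
qed

lemma x_mat_inj: "\<sigma> \<in> roots n \<Longrightarrow> x_mat n \<sigma> s = (x_mat n \<sigma> t :: 'p padic_int mat) \<Longrightarrow> s = t"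
proof -
  assume s: "\<sigma> \<in> roots n" and e: "x_mat n \<sigma> s = (x_mat n \<sigma> t :: 'p padic_int mat)"
  obtain i j where ij: "\<sigma> = (i, j)" "i < n" "j < n" "i \<noteq> j" using s by (auto simp: roots_def)
  show ?thesis using arg_cong[OF e, of "\<lambda>X. X $$ (i, j)"] ij by (simp add: x_mat_entry)
qed

text \<open>\<open>root_pairing\<close> is a definite description, so its value has to be exhibited
  and shown unique. Conjugation scales the entry of the root by the quotient of two diagonal
  entries, and the unit 1 + p alone already determines the exponent.\<close>

lemma torus_relation_mat:
  assumes \<sigma>: "\<sigma> \<in> roots n" and \<delta>: "\<delta> \<in> simple_roots n"
  shows "h_mat n \<delta> (1 + padic_p) * x_mat n \<sigma> t
    = x_mat n \<sigma> (padic_powi (1 + padic_p) (root_pairing TYPE('p) n \<sigma> \<delta>) * t) * (h_mat n \<delta> (1 + padic_p) :: 'p padic_int mat)"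
proof -
  interpret SL: group "SL n :: 'p padic_int mat monoid" by (rule group_SL)
  obtain i j where ij: "\<sigma> = (i, j)" "i < n" "j < n" "i \<noteq> j" using \<sigma> by (auto simp: roots_def)
  obtain c where c: "\<delta> = (c, c + 1)" "c + 1 < n" using \<delta> by (auto simp: simple_roots_def)
  have SLc: "h_mat n \<delta> u \<in> carrier (SL n)" "x_mat n \<sigma> t \<in> carrier (SL n)" if "u dvd 1" for u t :: "'p padic_int"
    using that by (simp_all add: SL_def det_h_mat[OF \<delta>] det_x_mat[OF \<sigma>])
  have conj: "h_mat n \<delta> u \<otimes>\<^bsub>SL n\<^esub> x_mat n \<sigma> t \<otimes>\<^bsub>SL n\<^esub> inv\<^bsub>SL n\<^esub> (h_mat n \<delta> u) = x_mat n \<sigma> s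
      \<longleftrightarrow> h_mat n \<delta> u * x_mat n \<sigma> t = x_mat n \<sigma> s * h_mat n \<delta> u" if u: "u dvd 1" for u t s :: "'p padic_int"
    using SL.inv_solve_right'[of "x_mat n \<sigma> s" "h_mat n \<delta> u \<otimes>\<^bsub>SL n\<^esub> x_mat n \<sigma> t" "h_mat n \<delta> u"] SLc[OF u]
      SL.m_closed[OF SLc(1)[OF u] SLc(2)[OF u]] by (simp add: SL_def)
  \<comment> \<open>The exponent of u in the a-th diagonal entry of the torus element.\<close>
  let ?e = "\<lambda>a. if a = c then 1 else if a = c + 1 then - 1 else 0 :: int"
  define m where "m = ?e i - ?e j"
  have ex: "h_mat n \<delta> u * x_mat n \<sigma> t = x_mat n \<sigma> (padic_powi u m * t) * h_mat n \<delta> u" if u: "u dvd 1" for u t :: "'p padic_int"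
  proof -
    have hm: "h_mat n \<delta> u $$ (i, i) = padic_powi u m * h_mat n \<delta> u $$ (j, j)"
      using unit_inverse[OF u] ij c by (auto simp: m_def h_mat_def powi_simps[simplified] powi_simps mult.assoc mult.commute mult.left_commute)
    then have hm': "h_mat n \<delta> u $$ (i, i) * t = padic_powi u m * t * h_mat n \<delta> u $$ (j, j)" by (simp add: mult_ac)
    show ?thesis
      by (rule eq_mat_n[OF mult_carrier_mat[OF h_mat_carrier x_mat_carrier] mult_carrier_mat[OF x_mat_carrier h_mat_carrier]])
        (use hm' ij in \<open>auto simp: h_left_entry h_right_entry x_mat_entry simp del: index_mult_mat\<close>)
  qed
  have "root_pairing TYPE('p) n \<sigma> \<delta> = m"
    unfolding root_pairing_def
  proof (rule the_equality)
    show "\<forall>u t :: 'p padic_int. u dvd 1 \<longrightarrow> h_mat n \<delta> u \<otimes>\<^bsub>SL n\<^esub> x_mat n \<sigma> t \<otimes>\<^bsub>SL n\<^esub> inv\<^bsub>SL n\<^esub> (h_mat n \<delta> u) = x_mat n \<sigma> (padic_powi u m * t)"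
      using ex conj by blast
    fix m' assume m': "\<forall>u t :: 'p padic_int. u dvd 1 \<longrightarrow> h_mat n \<delta> u \<otimes>\<^bsub>SL n\<^esub> x_mat n \<sigma> t \<otimes>\<^bsub>SL n\<^esub> inv\<^bsub>SL n\<^esub> (h_mat n \<delta> u) = x_mat n \<sigma> (padic_powi u m' * t)"
    let ?u = "1 + padic_p :: 'p padic_int"
    have "h_mat n \<delta> ?u \<otimes>\<^bsub>SL n\<^esub> x_mat n \<sigma> 1 \<otimes>\<^bsub>SL n\<^esub> inv\<^bsub>SL n\<^esub> (h_mat n \<delta> ?u) = x_mat n \<sigma> (padic_powi ?u m' * 1)"
      using m' one_plus_p_unit by blast
    moreover have "h_mat n \<delta> ?u \<otimes>\<^bsub>SL n\<^esub> x_mat n \<sigma> 1 \<otimes>\<^bsub>SL n\<^esub> inv\<^bsub>SL n\<^esub> (h_mat n \<delta> ?u) = x_mat n \<sigma> (padic_powi ?u m * 1)"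
      using ex[OF one_plus_p_unit] conj[OF one_plus_p_unit] by blast
    ultimately have "padic_powi ?u m' * 1 = padic_powi ?u m * 1" using x_mat_inj[OF \<sigma>] by metis
    then show "m' = m" using powi_inj by simp
  qed
  then show ?thesis using ex[OF one_plus_p_unit] by simp
qed

text \<open>The commuting relations are written without the summand 1; adding 1 + x + y to both
  sides turns them into statements about group elements.\<close>

lemma phi_mult_commute:
  assumes x: "x \<in> iw_vars n" and y: "y \<in> iw_vars n" and c: "gen x * gen y = gen y * gen x"
  shows "phi (nc_var x * nc_var y) = phi (nc_var y * nc_var x)"
proof -
  have e: "phi ((1 + nc_var x) * (1 + nc_var y)) = phi ((1 + nc_var y) * (1 + nc_var x))"
    unfolding phi_mult phi_one_plus_var[OF x] phi_one_plus_var[OF y]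
    using iwasawa_of_mult[OF gen_in_G[OF x] gen_in_G[OF y]] iwasawa_of_mult[OF gen_in_G[OF y] gen_in_G[OF x]] c by simp
  have d: "(1 + nc_var x) * (1 + nc_var y) = (1 + nc_var x + nc_var y) + nc_var x * (nc_var y :: 'p nc_series)"
    "(1 + nc_var y) * (1 + nc_var x) = (1 + nc_var x + nc_var y) + nc_var y * (nc_var x :: 'p nc_series)" by (simp_all add: algebra_simps)
  show ?thesis
  proof (rule L_ext[OF phi_closed phi_closed], rule ext)
    fix N C assume "N \<in> ONS"
    then show "phi (nc_var x * nc_var y) N C = phi (nc_var y * nc_var x) N C"
      using fun_cong[OF fun_cong[OF e[unfolded d]], of N C] by (simp add: phi_add_entry)
  qed
qed

lemma phi_relation:
  "iwasawa_relation n F (H :: 'p nc_series) \<Longrightarrow> phi F = phi H"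
proof (induction rule: iwasawa_relation.induct)
  have U: "U_var \<beta> \<in> iw_vars n" "\<beta> \<in> roots n" "phi (1 + nc_var (U_var \<beta>)) = iwasawa_of n (x_mat n \<beta> padic_p)" "x_mat n \<beta> padic_p \<in> carrier G"
      "x_mat n \<beta> (padic_p * q) \<in> carrier G"
    if "\<beta> \<in> neg_roots n" for \<beta> q
    using that gen_in_G[of "U_var \<beta>"] phi_one_plus_var[of "U_var \<beta>"] x_mat_in_G[of \<beta> "padic_p * q"] by (auto simp: iw_vars_def neg_roots_def)
  have V: "V_var \<beta> \<in> iw_vars n" "\<beta> \<in> roots n" "phi (1 + nc_var (V_var \<beta>)) = iwasawa_of n (x_mat n \<beta> 1)" "x_mat n \<beta> 1 \<in> carrier G"
      "x_mat n \<beta> (1 * q) \<in> carrier G"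
    if "\<beta> \<in> pos_roots n" for \<beta> q
    using that gen_in_G[of "V_var \<beta>"] phi_one_plus_var[of "V_var \<beta>"] x_mat_in_G[of \<beta> "1 * q"] by (auto simp: iw_vars_def pos_roots_def)
  have W: "W_var \<delta> \<in> iw_vars n" "phi (1 + nc_var (W_var \<delta>)) = iwasawa_of n (h_mat n \<delta> (1 + padic_p))" "h_mat n \<delta> (1 + padic_p) \<in> carrier G"
    if "\<delta> \<in> simple_roots n" for \<delta>
    using that gen_in_G[of "W_var \<delta>"] phi_one_plus_var[of "W_var \<delta>"] by (auto simp: iw_vars_def)
  note im = iwasawa_of_mult[symmetric] iwahori_mult_closed
  {
    case (rel1 \<beta> \<delta>)
    show ?case unfolding phi_mult phi_opp_U[OF rel1(1)] U(3)[OF rel1(1)] W(2)[OF rel1(2)]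
      by (simp only: im U(4,5)[OF rel1(1)] W(3)[OF rel1(2)])
        (simp only: torus_relation_mat[OF U(2)[OF rel1(1)] rel1(2)] mult.commute)
  next
    case (rel2 \<alpha> \<delta>)
    show ?case unfolding phi_mult phi_opp_V[OF rel2(1)] V(3)[OF rel2(1)] W(2)[OF rel2(2)]
      by (simp only: im V(4,5)[OF rel2(1)] W(3)[OF rel2(2)])
        (simp only: torus_relation_mat[OF V(2)[OF rel2(1)] rel2(2)] mult_1_left mult_1_right)
  next
    case (rel3 \<alpha> \<beta>)
    then show ?case
      by (intro phi_mult_commute V(1) U(1))
        (auto simp: pos_roots_def neg_roots_def roots_def neg_root_def sum_is_root_def intro!: x_commute)
  next
    case (rel4 \<alpha> i j \<beta> k)
    then have r: "i < n" "j < n" "k < n" "i \<noteq> j" "j \<noteq> k" "i \<noteq> k" and ik: "(i, k) \<in> pos_roots n" by (auto simp: pos_roots_def neg_roots_def roots_def)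
    show ?case unfolding phi_mult phi_opp_V[OF ik] V(3)[OF rel4(3)] U(3)[OF rel4(4)]
      by (simp only: im V(4)[OF rel4(3)] V(5)[OF ik] U(4)[OF rel4(4)]) (simp only: rel4(1,2) x_commutator1[OF r])
  next
    case (rel5 \<alpha> i j \<beta> k)
    then have r: "i < n" "j < n" "k < n" "i \<noteq> j" "j \<noteq> k" "i \<noteq> k" and ik: "(i, k) \<in> neg_roots n" by (auto simp: pos_roots_def neg_roots_def roots_def)
    show ?case unfolding phi_mult U(3)[OF ik] V(3)[OF rel5(3)] U(3)[OF rel5(4)]
      by (simp only: im V(4)[OF rel5(3)] U(4)[OF ik] U(4)[OF rel5(4)]) (simp only: rel5(1,2) x_commutator1[OF r] mult_1_left)
  next
    case (rel6 \<alpha> i j \<beta> k)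
    then have r: "i < n" "j < n" "k < n" "i \<noteq> j" "j \<noteq> k" "i \<noteq> k" and ik: "(k, j) \<in> pos_roots n" by (auto simp: pos_roots_def neg_roots_def roots_def)
    show ?case unfolding phi_mult phi_opp_V[OF ik] V(3)[OF rel6(3)] U(3)[OF rel6(4)]
      by (simp only: im V(4)[OF rel6(3)] V(5)[OF ik] U(4)[OF rel6(4)]) (simp only: rel6(1,2) x_commutator2[OF r] mult_1_left)
  next
    case (rel7 \<alpha> i j \<beta> k)
    then have r: "i < n" "j < n" "k < n" "i \<noteq> j" "j \<noteq> k" "i \<noteq> k" and ik: "(k, j) \<in> neg_roots n" by (auto simp: pos_roots_def neg_roots_def roots_def)
    show ?case unfolding phi_mult phi_opp_U[OF ik] V(3)[OF rel7(3)] U(3)[OF rel7(4)]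
      by (simp only: im V(4)[OF rel7(3)] U(5)[OF ik] U(4)[OF rel7(4)]) (simp only: rel7(1,2) x_commutator2[OF r] mult_1_left mult_minus_right mult_1_right)
  next
    case (rel8 \<alpha> i j)
    let ?q = "padic_powi (1 + padic_p) (- 1) :: 'p padic_int"
    have ij: "i < j" "j < n" "\<alpha> = (i, j)" "neg_root \<alpha> = (j, i)" "(j, i) \<in> neg_roots n" "(i, j) \<in> pos_roots n"
      using rel8 by (auto simp: pos_roots_def neg_roots_def roots_def neg_root_def)
    have q: "?q = 1 div (1 + padic_p)" by (simp add: padic_powi_def)
    have D: "h_mat n (i, j) (1 + padic_p) \<in> carrier G"
      "phi (prod_list (map (\<lambda>c. 1 + nc_var (W_var (c, c + 1))) [i..<j])) = iwasawa_of n (h_mat n (i, j) (1 + padic_p))"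
      using prod_W[OF ij(1,2)] by auto
    have as: "x_mat n (j, i) (padic_p * ?q) * h_mat n (i, j) (1 + padic_p) * x_mat n (i, j) (1 * ?q)
        = x_mat n (j, i) (padic_p * ?q) * (h_mat n (i, j) (1 + padic_p) * x_mat n (i, j) (1 * ?q))"
      by (rule assoc_mult_mat[OF x_mat_carrier h_mat_carrier x_mat_carrier])
    have e: "x_mat n (i, j) 1 * x_mat n (j, i) padic_p = x_mat n (j, i) (padic_p * ?q) * h_mat n (i, j) (1 + padic_p) * x_mat n (i, j) (1 * ?q)"
      unfolding as unfolding q by (rule opposite_relation_mat[OF ij(1,2) unit_inverse[OF one_plus_p_unit] refl])
    show ?case unfolding ij(3) ij(4)[unfolded ij(3)] phi_mult phi_opp_U[OF ij(5)] phi_opp_V[OF ij(6)] V(3)[OF ij(6)] U(3)[OF ij(5)] D(2)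
      by (simp only: im V(4,5)[OF ij(6)] U(4,5)[OF ij(5)] D(1) e)
  next
    case (rel9 \<alpha> \<beta>)
    then show ?case
      by (intro phi_mult_commute U(1))
        (auto simp: pos_roots_def neg_roots_def roots_def neg_root_def sum_is_root_def intro!: x_commute)
  next
    case (rel10 \<alpha> i j \<beta> k)
    then have r: "i < n" "j < n" "k < n" "i \<noteq> j" "j \<noteq> k" "i \<noteq> k" and ik: "(i, k) \<in> neg_roots n" by (auto simp: neg_roots_def roots_def)
    show ?case unfolding phi_mult phi_opp_U[OF ik] U(3)[OF rel10(3)] U(3)[OF rel10(4)]
      by (simp only: im U(4)[OF rel10(3)] U(5)[OF ik] U(4)[OF rel10(4)]) (simp only: rel10(1,2) x_commutator1[OF r])
  next
    case (rel11 \<alpha> i j \<beta> k)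
    then have r: "i < n" "j < n" "k < n" "i \<noteq> j" "j \<noteq> k" "i \<noteq> k" and ik: "(k, j) \<in> neg_roots n" by (auto simp: neg_roots_def roots_def)
    show ?case unfolding phi_mult phi_opp_U[OF ik] U(3)[OF rel11(3)] U(3)[OF rel11(4)]
      by (simp only: im U(4)[OF rel11(3)] U(5)[OF ik] U(4)[OF rel11(4)]) (simp only: rel11(1,2) x_commutator2[OF r] mult_minus_right)
  next
    case (rel12 \<delta> \<epsilon>)
    then show ?case by (intro phi_mult_commute W(1)) (auto intro: h_commute)
  next
    case (rel13 \<alpha> \<beta>)
    then show ?case
      by (intro phi_mult_commute V(1))
        (auto simp: pos_roots_def neg_roots_def roots_def neg_root_def sum_is_root_def intro!: x_commute)
  next
    case (rel14 \<alpha> i j \<beta> k)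
    then have r: "i < n" "j < n" "k < n" "i \<noteq> j" "j \<noteq> k" "i \<noteq> k" and ik: "(i, k) \<in> pos_roots n" by (auto simp: pos_roots_def roots_def)
    show ?case unfolding phi_mult V(3)[OF ik] V(3)[OF rel14(3)] V(3)[OF rel14(4)]
      by (simp only: im V(4)[OF rel14(3)] V(4)[OF ik] V(4)[OF rel14(4)]) (simp only: rel14(1,2) x_commutator1[OF r] mult_1_left)
  next
    case (rel15 \<alpha> i j \<beta> k)
    then have r: "k < n" "i < n" "j < n" "k \<noteq> i" "i \<noteq> j" "k \<noteq> j" and ik: "(k, j) \<in> pos_roots n" by (auto simp: pos_roots_def roots_def)
    show ?case unfolding phi_mult V(3)[OF ik] V(3)[OF rel15(3)] V(3)[OF rel15(4)]
      by (simp only: im V(4)[OF rel15(3)] V(4)[OF ik] V(4)[OF rel15(4)]) (simp only: rel15(1,2) x_commutator1[OF r] mult_1_left)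
  }
qed

lemma zero_L: "\<zero>\<^bsub>L\<^esub> = phi 0"
proof -
  have "nc_smult 0 0 = (0 :: 'p nc_series)" by (rule ncps_eqI) (simp add: nc_smult.rep_eq zero_ncps.rep_eq)
  then have "phi 0 = 0 \<odot>\<^bsub>L\<^esub> phi 0" using phi_smult[of 0 0] by simp
  then show ?thesis by (simp add: L_simps group_ring_simps)
qed

lemma phi_hom: "ring_hom_ring A L phi"
  by (rule ring_hom_ringI2[OF ring_nc_algebra L_ring], rule ring_hom_memI)
    (auto simp: phi_closed nc_algebra_simps phi_mult phi_add phi_one)

lemma phi_zero_iff: "phi F = \<zero>\<^bsub>L\<^esub> \<longleftrightarrow> (\<forall>N\<in>ONS. \<forall>C. phi F N C = 0)"
proof -
  have z: "\<zero>\<^bsub>L\<^esub> N C = 0" if "N \<in> ONS" for N C using that by (simp add: L_simps group_ring_simps)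
  have zc: "\<zero>\<^bsub>L\<^esub> \<in> carrier L" unfolding zero_L by (rule phi_closed)
  show ?thesis
  proof
    assume "phi F = \<zero>\<^bsub>L\<^esub>" then show "\<forall>N\<in>ONS. \<forall>C. phi F N C = 0" using z by simp
  next
    assume "\<forall>N\<in>ONS. \<forall>C. phi F N C = 0"
    then show "phi F = \<zero>\<^bsub>L\<^esub>" by (intro L_ext[OF phi_closed zc] ext) (simp add: z)
  qed
qed

lemma phi_diff_zero: "phi F = phi H \<Longrightarrow> phi (F - H) = \<zero>\<^bsub>L\<^esub>"
proof -
  assume e: "phi F = phi H"
  have "phi F N C = phi (F - H) N C + phi H N C" if "N \<in> ONS" for N C
    using phi_add_entry[OF that, of "F - H" H C] by simp
  then show ?thesis unfolding phi_zero_iff using e by simp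
qed

lemma topspace_iwasawa_topology: "topspace (iwasawa_topology n) = carrier L"
  by (auto simp: iwasawa_topology_def mem_L PiE_iff extensional_def)

text \<open>The kernel is an ideal, contains the relations, and is closed as the preimage of a point
  of a Hausdorff space; the ideal of the relations is the least such set.\<close>

lemma rel_ideal_kernel: "F \<in> rel_ideal \<Longrightarrow> phi F = \<zero>\<^bsub>L\<^esub>"
proof -
  assume F: "F \<in> rel_ideal"
  let ?K = "a_kernel A L phi"
  have K: "?K = {F \<in> carrier A. phi F = \<zero>\<^bsub>L\<^esub>}" by (simp add: a_kernel_def' )
  have "ideal ?K A" by (rule ring_hom_ring.kernel_is_ideal[OF phi_hom])
  moreover have "closedin (nc_topology n) ?K"
  proof -
    have "closedin (iwasawa_topology n) {\<zero>\<^bsub>L\<^esub>}"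
      using Hausdorff_imp_t1_space[OF Hausdorff_iwasawa_topology] phi_closed[of 0] by (simp add: t1_space_closedin_singleton zero_L topspace_iwasawa_topology)
    from closedin_continuous_map_preimage[OF phi_continuous this] show ?thesis by (simp add: K)
  qed
  moreover have "{F - H | F H. iwasawa_relation n F H} \<subseteq> ?K"
    using rel_carrier phi_relation phi_diff_zero by (auto simp: K nc_algebra_closed)
  ultimately have "iwasawa_ideal n \<subseteq> ?K" unfolding iwasawa_ideal_def by blast
  then show ?thesis using F unfolding rel_ideal_def K by blast
qed

end

section \<open>Surjectivity\<close>

context iwasawa_setup
begin

lemma x_right_entry:
  assumes "M \<in> carrier_mat n n" "i < n" "j < n" "i \<noteq> j" "a < n" "b < n"
  shows "(M * x_mat n (i, j) s) $$ (a, b) = M $$ (a, b) + (if b = j then M $$ (a, i) * s else 0)"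
proof -
  have "(M * x_mat n (i, j) s) $$ (a, b) = (\<Sum>k<n. (if k = b then M $$ (a, b) else 0) + (if k = i then (if b = j then M $$ (a, i) * s else 0) else 0))"
    unfolding mat_mult_entry[OF assms(1) x_mat_carrier assms(5,6)]
    using assms by (intro sum.cong refl) (auto simp: x_mat_entry distrib_left)
  then show ?thesis using assms by (simp add: sum.distrib)
qed

lemma h_mat_mult:
  assumes "fst \<delta> \<noteq> snd \<delta>" "u dvd 1" "v dvd (1 :: 'p padic_int)"
  shows "h_mat n \<delta> u * h_mat n \<delta> v = h_mat n \<delta> (u * v)"
proof -
  have "(1 div u) * (1 div v) * (u * v) = 1"
    using unit_inverse[OF assms(2)] unit_inverse[OF assms(3)] by (metis mult.assoc mult.commute mult_1_left)
  moreover have "u * v \<noteq> 0" using assms(2,3) by auto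
  ultimately have d: "(1 div u) * (1 div v) = 1 div (u * v)" by (metis nonzero_mult_div_cancel_right)
  show ?thesis
  proof (rule eq_mat_n[OF mult_carrier_mat[OF h_mat_carrier h_mat_carrier] h_mat_carrier])
    fix a b assume "a < n" "b < n"
    then show "(h_mat n \<delta> u * h_mat n \<delta> v) $$ (a, b) = h_mat n \<delta> (u * v) $$ (a, b)"
      unfolding h_left_entry[OF h_mat_carrier \<open>a < n\<close> \<open>b < n\<close>] using assms(1) d by (auto simp: h_entry)
  qed
qed

lemma h_mat_1: "h_mat n \<delta> 1 = (1\<^sub>m n :: 'p padic_int mat)"
  by (rule eq_mat_n[OF h_mat_carrier one_carrier_mat]) (auto simp: h_entry)

lemma h_mat_pow:
  assumes "fst \<delta> \<noteq> snd \<delta>" "u dvd (1 :: 'p padic_int)"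
  shows "h_mat n \<delta> u [^]\<^bsub>G\<^esub> (j :: nat) = h_mat n \<delta> (u ^ j)"
proof (induction j)
  case (Suc j)
  interpret Gr: group G by (rule group_G)
  have "u ^ j dvd 1" using assms(2) by (metis dvd_power_same power_one)
  then show ?case using Suc assms by (simp add: Gr.nat_pow_Suc iwahori_simps h_mat_mult mult.commute)
qed (simp add: iwahori_simps h_mat_1)

lemma cong_subgroup_ONS: "cong_subgroup n k \<in> ONS"
  using cong_subgroup_open_normal[OF n_pos] .

text \<open>Surjectivity is tested modulo one congruence subgroup at a time, because there every
  torus element can be replaced by a natural power of a generator.\<close>

definition reached :: "nat \<Rightarrow> 'p padic_int mat set" where
  "reached k = {g \<in> carrier G. \<exists>F\<in>carrier A. phi F (cong_subgroup n k) = iwasawa_of n g (cong_subgroup n k)}"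

lemma reached_phi: "g \<in> carrier G \<Longrightarrow> F \<in> carrier A \<Longrightarrow> phi F = iwasawa_of n g \<Longrightarrow> g \<in> reached k"
  unfolding reached_def by (intro CollectI conjI bexI[of _ F]) simp_all

lemma reached_mult:
  assumes "g \<in> reached k" "h \<in> reached k"
  shows "g * h \<in> reached k"
proof -
  let ?N = "cong_subgroup n k"
  obtain F where F: "F \<in> carrier A" "phi F ?N = iwasawa_of n g ?N" and g: "g \<in> carrier G" using assms(1) by (auto simp: reached_def)
  obtain H where H: "H \<in> carrier A" "phi H ?N = iwasawa_of n h ?N" and h: "h \<in> carrier G" using assms(2) by (auto simp: reached_def)
  have "phi (F * H) ?N = phi F ?N \<otimes>\<^bsub>T ?N\<^esub> phi H ?N" by (simp add: phi_mult L_simps cong_subgroup_ONS)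
  also have "\<dots> = iwasawa_of n (g * h) ?N" by (simp add: F(2) H(2) iwasawa_of_mult[OF g h] L_simps cong_subgroup_ONS)
  finally show ?thesis using F(1) H(1) iwahori_mult_closed[OF g h] unfolding reached_def by (auto intro: nc_algebra_mult_closed)
qed

lemma reached_coset:
  assumes "g \<in> reached k" "h \<in> carrier G" "coset (cong_subgroup n k) h = coset (cong_subgroup n k) g"
  shows "h \<in> reached k"
  using assms by (auto simp: reached_def iwasawa_of_eq cong_subgroup_ONS)

lemma reached_x:
  assumes "i < n" "j < n" "i \<noteq> j" "i > j \<longrightarrow> padic_p dvd c"
  shows "x_mat n (i, j) c \<in> reached k"
proof (cases "i > j")
  case True
  then obtain q where q: "c = padic_p * q" using assms by (auto elim: dvdE)
  have r: "(i, j) \<in> neg_roots n" using assms True by (auto simp: neg_roots_def roots_def)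
  show ?thesis unfolding q
    by (rule reached_phi[OF _ one_plus_power_closed phi_opp_U[OF r]])
      (use r in \<open>auto simp: neg_roots_def iw_vars_def intro!: x_mat_in_G\<close>)
next
  case False
  then have r: "(i, j) \<in> pos_roots n" using assms by (auto simp: pos_roots_def roots_def)
  show ?thesis
    by (rule reached_phi[OF _ one_plus_power_closed phi_opp_V[OF r, of c, simplified]])
      (use r in \<open>auto simp: pos_roots_def iw_vars_def intro!: x_mat_in_G\<close>)
qed

lemma unit_div_cong:
  assumes "v dvd (1 :: 'p padic_int)" "padic_p ^ k dvd u - v"
  shows "padic_p ^ k dvd u * (1 div v) - 1"
proof -
  have "u * (1 div v) - 1 = (u - v) * (1 div v)" using unit_inverse[OF assms(1)] by (simp add: left_diff_distrib)
  then show ?thesis using assms(2) by simp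
qed

lemma h_mat_cong_subgroup:
  assumes \<delta>: "\<delta> \<in> simple_roots n" and w: "padic_p ^ Suc k dvd (w - 1 :: 'p padic_int)"
  shows "h_mat n \<delta> w \<in> cong_subgroup n k"
proof -
  have p: "padic_p dvd w - 1" using w by (metis dvd_trans dvd_triv_left power_Suc)
  have "\<not> padic_p dvd w" using p not_p_dvd_1 dvd_diff[of padic_p w "w - 1"] by auto
  then have wu: "w dvd 1" by (simp add: padic_unit_iff)
  have "1 div w - 1 = - ((1 div w) * (w - 1))" using unit_inverse[OF wu] by (simp add: algebra_simps)
  then have w': "padic_p ^ Suc k dvd 1 div w - 1" using w by (metis dvd_minus_iff dvd_mult)
  show ?thesis
    unfolding cong_subgroup_def
  proof (intro CollectI conjI allI impI h_mat_in_G[OF \<delta> p])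
    fix i j assume ij: "i < n" "j < n"
    then have "(h_mat n \<delta> w - 1\<^sub>m n) $$ (i, j) = h_mat n \<delta> w $$ (i, j) - (if i = j then 1 else 0)" by simp
    then show "padic_p ^ (if i < j then k else Suc k) dvd (h_mat n \<delta> w - 1\<^sub>m n) $$ (i, j)"
      using ij w w' by (auto simp: h_entry simp del: power_Suc)
  qed
qed

text \<open>Modulo p^(k+1) the unit u is a natural power of 1 + p, and the remaining quotient gives
  a diagonal matrix inside the congruence subgroup.\<close>

lemma reached_h:
  assumes \<delta>: "\<delta> \<in> simple_roots n" and u: "padic_p dvd (u - 1 :: 'p padic_int)"
  shows "h_mat n \<delta> u \<in> reached k"
proof -
  have d: "fst \<delta> \<noteq> snd \<delta>" using \<delta> by (auto simp: simple_roots_def)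
  obtain b where b: "padic_p ^ Suc k dvd (1 + padic_p) ^ b - u" using one_plus_p_power_surj[OF p_gt2 u] by blast
  let ?v = "(1 + padic_p) ^ b :: 'p padic_int"
  have v: "?v dvd 1" by (rule one_plus_p_power_unit)
  have l: "W_var \<delta> \<in> iw_vars n" using \<delta> by (simp add: iw_vars_def)
  have vG: "h_mat n \<delta> ?v \<in> carrier G"
  proof -
    interpret Gr: group G by (rule group_G)
    show ?thesis unfolding h_mat_pow[OF d one_plus_p_unit, symmetric] using gen_in_G[OF l] by simp
  qed
  have "phi (one_plus_power (nc_var (W_var \<delta>)) (of_nat b)) = iwasawa_of n (h_mat n \<delta> ?v)"
    unfolding phi_one_plus_power_nat[OF l] by (simp add: h_mat_pow[OF d one_plus_p_unit])
  then have r: "h_mat n \<delta> ?v \<in> reached k" by (intro reached_phi[OF vG one_plus_power_closed[OF l]])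
  have "padic_p ^ Suc k dvd u - ?v" using b by (metis dvd_minus_iff minus_diff_eq)
  then have w: "padic_p ^ Suc k dvd u * (1 div ?v) - 1" by (rule unit_div_cong[OF v])
  let ?w = "u * (1 div ?v)"
  have p: "padic_p dvd ?w - 1" using w by (metis dvd_trans dvd_triv_left power_Suc)
  have "\<not> padic_p dvd ?w" using p not_p_dvd_1 dvd_diff[of padic_p ?w "?w - 1"] by auto
  then have wu: "?w dvd 1" by (simp add: padic_unit_iff)
  have "?v * ?w = u" using unit_inverse[OF v] by (metis mult.assoc mult.commute mult_1_left)
  then have e: "h_mat n \<delta> ?v * h_mat n \<delta> ?w = h_mat n \<delta> u" using h_mat_mult[OF d v wu] by (simp only:)
  show ?thesis
    using reached_coset[OF r h_mat_in_G[OF \<delta> u]] coset_absorb[OF cong_subgroup_ONS vG h_mat_cong_subgroup[OF \<delta> w]] e by simp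
qed

section \<open>Gauss elimination\<close>

definition cleared :: "nat \<Rightarrow> 'p padic_int mat \<Rightarrow> bool" where
  "cleared m g \<longleftrightarrow> (\<forall>i<n. \<forall>j<n. i \<noteq> j \<longrightarrow> min i j < m \<longrightarrow> g $$ (i, j) = 0)"

lemma iwahori_diag_cong: "g \<in> carrier G \<Longrightarrow> i < n \<Longrightarrow> padic_p dvd g $$ (i, i) - (1 :: 'p padic_int)"
  by (simp add: mem_iwahori)

lemma iwahori_diag_unit:
  assumes "g \<in> carrier G" "i < n"
  shows "g $$ (i, i) dvd (1 :: 'p padic_int)"
proof -
  have "padic_p dvd g $$ (i, i) - 1" by (rule iwahori_diag_cong[OF assms])
  then have "\<not> padic_p dvd g $$ (i, i)" using not_p_dvd_1 dvd_diff[of padic_p "g $$ (i, i)" "g $$ (i, i) - 1"] by auto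
  then show ?thesis by (simp add: padic_unit_iff)
qed

text \<open>S holds the columns still to be cleared in row m. Column m is already zero off the
  diagonal, so adding a multiple of it to another column changes nothing outside row m.\<close>

lemma reached_clear_row:
  assumes m: "m < n" and step: "\<And>g. g \<in> carrier G \<Longrightarrow> cleared (Suc m) g \<Longrightarrow> g \<in> reached k" and S: "finite S"
  shows "S \<subseteq> {m<..<n} \<Longrightarrow> g \<in> carrier G \<Longrightarrow> cleared m g \<Longrightarrow> \<forall>i\<in>{m<..<n}. g $$ (i, m) = 0 \<Longrightarrow>
    \<forall>j\<in>{m<..<n} - S. g $$ (m, j) = 0 \<Longrightarrow> g \<in> reached k"
  using S
proof (induction S arbitrary: g rule: finite_induct)
  case empty
  have "g $$ (i, j) = 0" if "i < n" "j < n" "i \<noteq> j" "min i j < Suc m" for i j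
  proof (cases "min i j < m")
    case True
    then show ?thesis using empty(3) that unfolding cleared_def by blast
  next
    case False
    then have "min i j = m" using that by simp
    then have "i = m \<and> j \<in> {m<..<n} \<or> j = m \<and> i \<in> {m<..<n}" using that by (auto simp: min_def split: if_splits)
    then show ?thesis using empty(4,5) by auto
  qed
  then show ?case by (intro step[OF empty(2)]) (simp add: cleared_def)
next
  case (insert j S)
  have j: "m < j" "j < n" using insert.prems(1) by auto
  have gm: "g \<in> carrier_mat n n" by (rule iwahori_carrier_mat[OF insert.prems(2)])
  define t where "t = g $$ (m, j) * (1 div g $$ (m, m))"
  have t: "g $$ (m, m) * t = g $$ (m, j)"
    using unit_inverse[OF iwahori_diag_unit[OF insert.prems(2) m]] unfolding t_def by (metis mult.assoc mult.commute mult_1_left)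
  let ?x = "x_mat n (m, j) (- t)"
  have xG: "x_mat n (m, j) c \<in> carrier G" for c using m j by (intro x_mat_in_G) (auto simp: roots_def)
  have e: "(g * ?x) $$ (a, b) = g $$ (a, b) - (if b = j then g $$ (a, m) * t else 0)" if "a < n" "b < n" for a b
    using x_right_entry[OF gm m j(2) _ that, of "- t"] j by auto
  have "g * ?x \<in> reached k"
  proof (rule insert.IH)
    show "g * ?x \<in> carrier G" by (rule iwahori_mult_closed[OF insert.prems(2) xG])
    show "cleared m (g * ?x)"
      unfolding cleared_def
    proof (intro allI impI)
      fix a b assume ab: "a < n" "b < n" "a \<noteq> b" "min a b < m"
      have g0: "g $$ (a, b) = 0" using insert.prems(3) ab unfolding cleared_def by blast
      have "g $$ (a, m) = 0" if "b = j"
      proof -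
        have "a < m" using ab that j by auto
        then have "a \<noteq> m" "min a m < m" by auto
        then show ?thesis using insert.prems(3) ab m unfolding cleared_def by blast
      qed
      then show "(g * ?x) $$ (a, b) = 0" using e[OF ab(1,2)] g0 by auto
    qed
    show "\<forall>i\<in>{m<..<n}. (g * ?x) $$ (i, m) = 0" using e insert.prems(4) m j by auto
    show "\<forall>b\<in>{m<..<n} - S. (g * ?x) $$ (m, b) = 0"
    proof
      fix b assume b: "b \<in> {m<..<n} - S"
      then show "(g * ?x) $$ (m, b) = 0" using e[OF m, of b] insert.prems(5) t by auto
    qed
    show "S \<subseteq> {m<..<n}" using insert.prems(1) by auto
  qed
  moreover have "x_mat n (m, j) t \<in> reached k" using m j by (intro reached_x) auto
  ultimately have "g * ?x * x_mat n (m, j) t \<in> reached k" by (rule reached_mult)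
  moreover have "g * ?x * x_mat n (m, j) t = g * (?x * x_mat n (m, j) t)" by (rule assoc_mult_mat[OF gm x_mat_carrier x_mat_carrier])
  moreover have "?x * x_mat n (m, j) t = 1\<^sub>m n" using m j by (subst x_mat_mult_add) (auto simp: roots_def x_mat_0)
  ultimately show ?case using gm by simp
qed

text \<open>Entries below the diagonal are divisible by p and the pivot is a unit, so the multiplier
  is a multiple of p, as a lower elementary matrix in G requires.\<close>

lemma reached_clear_column:
  assumes m: "m < n" and step: "\<And>g. g \<in> carrier G \<Longrightarrow> cleared (Suc m) g \<Longrightarrow> g \<in> reached k" and S: "finite S"
  shows "S \<subseteq> {m<..<n} \<Longrightarrow> g \<in> carrier G \<Longrightarrow> cleared m g \<Longrightarrow> \<forall>i\<in>{m<..<n} - S. g $$ (i, m) = 0 \<Longrightarrow> g \<in> reached k"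
  using S
proof (induction S arbitrary: g rule: finite_induct)
  case empty
  show ?case by (rule reached_clear_row[OF m step, of "{m<..<n}"]) (use empty in auto)
next
  case (insert i S)
  have i: "m < i" "i < n" using insert.prems(1) by auto
  have gm: "g \<in> carrier_mat n n" by (rule iwahori_carrier_mat[OF insert.prems(2)])
  define t where "t = g $$ (i, m) * (1 div g $$ (m, m))"
  have t: "t * g $$ (m, m) = g $$ (i, m)"
    using unit_inverse[OF iwahori_diag_unit[OF insert.prems(2) m]] unfolding t_def by (metis mult.assoc mult.commute mult_1_right)
  have "padic_p dvd g $$ (i, m)" using insert.prems(2) i m by (auto simp: mem_iwahori)
  then have pt: "padic_p dvd t" by (simp add: t_def)
  let ?x = "x_mat n (i, m) (- t)"
  have xG: "x_mat n (i, m) (- t) \<in> carrier G" using m i pt by (intro x_mat_in_G) (auto simp: roots_def)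
  have e: "(?x * g) $$ (a, b) = g $$ (a, b) - (if a = i then t * g $$ (m, b) else 0)" if "a < n" "b < n" for a b
    using x_left_entry[OF gm i(2) m _ that, of "- t"] i by auto
  have "?x * g \<in> reached k"
  proof (rule insert.IH)
    show "?x * g \<in> carrier G" by (rule iwahori_mult_closed[OF xG insert.prems(2)])
    show "cleared m (?x * g)"
      unfolding cleared_def
    proof (intro allI impI)
      fix a b assume ab: "a < n" "b < n" "a \<noteq> b" "min a b < m"
      have g0: "g $$ (a, b) = 0" using insert.prems(3) ab unfolding cleared_def by blast
      have "g $$ (m, b) = 0" if "a = i"
      proof -
        have "b < m" using ab that i by auto
        then have "m \<noteq> b" "min m b < m" by auto
        then show ?thesis using insert.prems(3) ab m unfolding cleared_def by blast
      qed
      then show "(?x * g) $$ (a, b) = 0" using e[OF ab(1,2)] g0 by auto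
    qed
    show "\<forall>b\<in>{m<..<n} - S. (?x * g) $$ (b, m) = 0"
    proof
      fix b assume b: "b \<in> {m<..<n} - S"
      then show "(?x * g) $$ (b, m) = 0" using e[OF _ m, of b] insert.prems(4) t by auto
    qed
    show "S \<subseteq> {m<..<n}" using insert.prems(1) by auto
  qed
  moreover have "x_mat n (i, m) t \<in> reached k" using m i pt by (intro reached_x) auto
  ultimately have "x_mat n (i, m) t * (?x * g) \<in> reached k" by (simp only: reached_mult)
  moreover have "x_mat n (i, m) t * (?x * g) = x_mat n (i, m) t * ?x * g" by (rule assoc_mult_mat[OF x_mat_carrier x_mat_carrier gm, symmetric])
  moreover have "x_mat n (i, m) t * ?x = 1\<^sub>m n" using m i by (subst x_mat_mult_add) (auto simp: roots_def x_mat_0)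
  ultimately show ?case using gm by simp
qed

lemma reached_one: "1\<^sub>m n \<in> reached k"
  by (rule reached_phi[of _ 1]) (simp_all add: phi_one one_L iwahori_one_closed nc_algebra_0_1)

text \<open>A torus element for (m, m + 1) makes the m-th diagonal entry 1 and moves it into the
  next entry; the last entry is then 1 by the determinant.\<close>

lemma reached_diagonal:
  assumes "g \<in> carrier G" "cleared n g" "\<forall>a<m. g $$ (a, a) = 1" "m < n"
  shows "g \<in> reached k"
proof -
  have "m \<le> n - 1" using assms(4) by simp
  then show ?thesis using assms(1-3)
  proof (induction m arbitrary: g rule: inc_induct)
    case base
    have gm: "g \<in> carrier_mat n n" by (rule iwahori_carrier_mat[OF base(1)])
    have off: "g $$ (a, b) = 0" if "a < n" "b < n" "a \<noteq> b" for a b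
      using base(2) that unfolding cleared_def by auto
    have "1 = det g" using base(1) by (simp add: mem_iwahori)
    also have "det g = prod_list (diag_mat g)"
      using off gm by (intro det_upper_triangular[OF _ gm]) (auto simp: upper_triangular_def)
    also have "diag_mat g = map (\<lambda>i. g $$ (i, i)) [0..<n]" using gm by (auto simp: diag_mat_def)
    also have "prod_list \<dots> = (\<Prod>i<n. g $$ (i, i))"
      by (subst prod.distinct_set_conv_list[OF distinct_upt, symmetric]) (simp add: atLeast0LessThan)
    also have "\<dots> = (\<Prod>i\<in>{n - 1}. g $$ (i, i))"
    proof (rule prod.mono_neutral_right)
      show "\<forall>i\<in>{..<n} - {n - 1}. g $$ (i, i) = 1"
      proof
        fix i assume "i \<in> {..<n} - {n - 1}"
        then have "i < n - 1" by auto
        then show "g $$ (i, i) = 1" using base(3) by blast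
      qed
    qed (use n_pos in auto)
    finally have "g $$ (n - 1, n - 1) = 1" by simp
    then have "g $$ (a, a) = 1" if "a < n" for a using base(3) that by (cases "a = n - 1") auto
    then have "g = 1\<^sub>m n" using off by (intro eq_mat_n[OF gm one_carrier_mat]) auto
    then show ?case using reached_one by simp
  next
    case (step m)
    have m: "m + 1 < n" "m < n" using step.hyps by auto
    have \<delta>: "(m, m + 1) \<in> simple_roots n" using m by (auto simp: simple_roots_def)
    have gm: "g \<in> carrier_mat n n" by (rule iwahori_carrier_mat[OF step.prems(1)])
    let ?u = "g $$ (m, m)"
    have u: "?u dvd 1" "padic_p dvd ?u - 1" using iwahori_diag_unit[OF step.prems(1) m(2)] iwahori_diag_cong[OF step.prems(1) m(2)] by auto
    let ?v = "1 div ?u"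
    have uv: "?u * ?v = 1" by (rule unit_inverse[OF u(1)])
    then have v1: "?v dvd 1" by (metis dvd_triv_right)
    have "?v - 1 = - (?v * (?u - 1))" using uv by (simp add: algebra_simps)
    then have v: "padic_p dvd ?v - 1" using u(2) by (metis dvd_minus_iff dvd_mult)
    have hG: "h_mat n (m, m + 1) ?v \<in> carrier G" by (rule h_mat_in_G[OF \<delta> v])
    have e: "(h_mat n (m, m + 1) ?v * g) $$ (a, b) = h_mat n (m, m + 1) ?v $$ (a, a) * g $$ (a, b)" if "a < n" "b < n" for a b
      by (rule h_left_entry[OF gm that])
    have "h_mat n (m, m + 1) ?v * g \<in> reached k"
    proof (rule step.IH)
      show "h_mat n (m, m + 1) ?v * g \<in> carrier G" by (rule iwahori_mult_closed[OF hG step.prems(1)])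
      show "cleared n (h_mat n (m, m + 1) ?v * g)" using e step.prems(2) unfolding cleared_def by auto
      show "\<forall>a<Suc m. (h_mat n (m, m + 1) ?v * g) $$ (a, a) = 1"
      proof (intro allI impI)
        fix a assume a: "a < Suc m"
        show "(h_mat n (m, m + 1) ?v * g) $$ (a, a) = 1"
        proof (cases "a = m")
          case True
          then show ?thesis using e[OF m(2) m(2)] uv m by (simp add: h_entry mult.commute)
        next
          case False
          then have "a < m" using a by simp
          then show ?thesis using e[of a a] step.prems(3) m by (simp add: h_entry)
        qed
      qed
    qed
    moreover have "h_mat n (m, m + 1) ?u \<in> reached k" by (rule reached_h[OF \<delta> u(2)])
    ultimately have "h_mat n (m, m + 1) ?u * (h_mat n (m, m + 1) ?v * g) \<in> reached k" by (simp only: reached_mult)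
    moreover have "h_mat n (m, m + 1) ?u * (h_mat n (m, m + 1) ?v * g) = h_mat n (m, m + 1) ?u * h_mat n (m, m + 1) ?v * g"
      by (rule assoc_mult_mat[OF h_mat_carrier h_mat_carrier gm, symmetric])
    moreover have "h_mat n (m, m + 1) ?u * h_mat n (m, m + 1) ?v = 1\<^sub>m n"
      using h_mat_mult[OF _ u(1) v1, of "(m, m + 1)"] by (simp add: uv h_mat_1)
    ultimately show ?case using gm by simp
  qed
qed

lemma reached_all: "g \<in> carrier G \<Longrightarrow> g \<in> reached k"
proof -
  have "g \<in> carrier G \<Longrightarrow> cleared m g \<Longrightarrow> g \<in> reached k" if "m \<le> n" for m g
    using that
  proof (induction m arbitrary: g rule: inc_induct)
    case base
    then show ?case using reached_diagonal[of g 0] n_pos by simp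
  next
    case (step m)
    show ?case by (rule reached_clear_column[OF step.hyps(2) step.IH, of "{m<..<n}"]) (use step.prems in auto)
  qed
  from this[of 0] show "g \<in> carrier G \<Longrightarrow> g \<in> reached k" by (simp add: cleared_def)
qed

section \<open>From group elements to the whole Iwasawa algebra\<close>

lemma phi_sum_entry:
  assumes N: "N \<in> ONS"
  shows "finite S \<Longrightarrow> phi (\<Sum>x\<in>S. F x) N C = (\<Sum>x\<in>S. phi (F x) N C)"
proof (induction S rule: finite_induct)
  case empty
  have "phi 0 N C = phi (0 + 0) N C" by simp
  then show ?case using phi_add_entry[OF N, of 0 0 C] by simp
qed (simp add: phi_add_entry[OF N])

lemma sum_closed_A: "(\<And>x. x \<in> S \<Longrightarrow> F x \<in> carrier A) \<Longrightarrow> (\<Sum>x\<in>S. F x) \<in> carrier A"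
  by (induction S rule: infinite_finite_induct) (auto simp: nc_algebra_closed nc_algebra_0_1)

text \<open>The cosets are a basis of the group ring of the finite quotient, and each basis element
  is the image of a series.\<close>

lemma phi_surj_level:
  assumes l: "z \<in> carrier L"
  shows "\<exists>F\<in>carrier A. phi F (cong_subgroup n k) = z (cong_subgroup n k)"
proof -
  let ?N = "cong_subgroup n k :: 'p padic_int mat set"
  let ?Q = "carrier (G Mod ?N)"
  have N: "?N \<in> ONS" by (rule cong_subgroup_ONS)
  have fin: "finite ?Q" by (rule finite_group.fin[OF Q_finite_group[OF N]])
  have "\<exists>F\<in>carrier A. \<forall>D. phi F ?N D = (if D = C then 1 else 0)" if C: "C \<in> ?Q" for C
  proof -
    obtain g where g: "g \<in> carrier G" "C = coset ?N g" using C by (auto simp: carrier_Q)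
    obtain F where "F \<in> carrier A" "phi F ?N = iwasawa_of n g ?N" using reached_all[OF g(1), of k] by (auto simp: reached_def)
    then show ?thesis using g N by (intro bexI[of _ F]) (auto simp: iwasawa_of_def)
  qed
  then obtain B where B: "\<And>C. C \<in> ?Q \<Longrightarrow> B C \<in> carrier A" "\<And>C D. C \<in> ?Q \<Longrightarrow> phi (B C) ?N D = (if D = C then 1 else 0)" by metis
  let ?F = "\<Sum>C\<in>?Q. nc_smult (z ?N C) (B C)"
  have out: "z ?N D = 0" if "D \<notin> ?Q" for D
    using l N that by (auto simp: mem_L mem_group_ring[OF fin])
  have "phi ?F ?N D = z ?N D" for D
  proof -
    have "phi ?F ?N D = (\<Sum>C\<in>?Q. if C = D then z ?N D else 0)"
      unfolding phi_sum_entry[OF N fin] phi_smult_entry[OF N] by (intro sum.cong refl) (auto simp: B(2))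
    also have "\<dots> = z ?N D" using fin out[of D] by (cases "D \<in> ?Q") auto
    finally show ?thesis .
  qed
  moreover have "?F \<in> carrier A" by (intro sum_closed_A nc_algebra_closed1 B(1))
  ultimately show ?thesis by blast
qed

text \<open>The preimages of z at the congruence levels are nested, nonempty and closed in a compact
  space. A series common to all of them maps to z, because every open normal subgroup contains a
  congruence subgroup.\<close>

lemma phi_surj: "phi ` carrier A = carrier L"
proof
  show "phi ` carrier A \<subseteq> carrier L" using phi_closed by blast
  show "carrier L \<subseteq> phi ` carrier A"
  proof
    fix z assume l: "z \<in> carrier L"
    let ?N = "\<lambda>k. cong_subgroup n k :: 'p padic_int mat set"
    define S where "S k = {F \<in> carrier A. phi F (?N k) = z (?N k)}" for k
    have trans: "x M = y M" if "x \<in> carrier L" "y \<in> carrier L" "N \<in> ONS" "M \<in> ONS" "N \<subseteq> M" "x N = y N" for x y N M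
      using that unfolding mem_L by metis
    have "(\<Inter>k. S k) \<noteq> {}"
    proof (rule compact_space_imp_nest[OF compact_space_nc_topology])
      fix k
      have "S k = (\<Inter>C. {F \<in> topspace (nc_topology n). phi F (?N k) C \<in> {z (?N k) C}})"
        by (auto simp: S_def topspace_nc_topology)
      moreover have "closedin (nc_topology n) {F \<in> topspace (nc_topology n). phi F (?N k) C \<in> {z (?N k) C}}" for C
        by (rule closedin_continuous_map_preimage[OF phi_entry_continuous[OF cong_subgroup_ONS]]) simp
      ultimately show "closedin (nc_topology n) (S k)" by auto
      show "S k \<noteq> {}" using phi_surj_level[OF l] by (auto simp: S_def)
    next
      show "decseq S"
        unfolding decseq_def S_def
        using trans[OF phi_closed l cong_subgroup_ONS cong_subgroup_ONS cong_subgroup_antimono] by blast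
    qed
    then obtain F where F: "F \<in> carrier A" "\<And>k. phi F (?N k) = z (?N k)" by (auto simp: S_def)
    have "phi F = z"
    proof (rule L_ext[OF phi_closed l])
      fix N assume N: "N \<in> ONS"
      obtain k where k: "?N k \<subseteq> N" using open_normal_contains_cong[OF N] by blast
      show "phi F N = z N" by (rule trans[OF phi_closed l cong_subgroup_ONS N k F(2)])
    qed
    then show "z \<in> phi ` carrier A" using F(1) by blast
  qed
qed

end

section \<open>Independence of the ordered monomials\<close>

lemma delta_dvd:
  fixes f :: "'a::semiring_0 mat \<Rightarrow> 'b::comm_ring_1"
  assumes "\<And>y. y \<in> S \<Longrightarrow> a dvd f y" and "\<And>y g. y \<in> S \<Longrightarrow> g \<in> S \<Longrightarrow> y * g \<in> S"
  shows "set gs \<subseteq> S \<Longrightarrow> y \<in> S \<Longrightarrow> a dvd delta gs f y"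
  using assms by (induction gs arbitrary: y) (auto intro!: dvd_diff)

lemma set_mono_subseq: "subseq u w \<Longrightarrow> set u \<subseteq> set w"
  by (induction rule: list_emb.induct) auto

lemma subseq_replicate: "subseq u (replicate m l) \<Longrightarrow> \<exists>j\<le>m. u = replicate j l"
proof -
  assume s: "subseq u (replicate m l)"
  have "set u \<subseteq> {l}" using set_mono_subseq[OF s] by (auto simp: subset_iff)
  then have "u = replicate (length u) l" by (metis replicate_length_same singletonD subsetD)
  moreover have "length u \<le> m" using list_emb_length[OF s] by simp
  ultimately show ?thesis by blast
qed

text \<open>Subwords of an ordered word are ordered with smaller exponents; the expansion of an
  ordered product of factors g - 1 thus involves ordered words only.\<close>

lemma subseq_concat_replicate:
  "distinct ls \<Longrightarrow> subseq u (concat (map (\<lambda>l. replicate (e l) l) ls)) \<Longrightarrow>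
    \<exists>d. (\<forall>l. d l \<le> e l) \<and> u = concat (map (\<lambda>l. replicate (d l) l) ls)"
proof (induction ls arbitrary: u)
  case Nil
  then show ?case by (intro exI[of _ e]) simp
next
  case (Cons l ls)
  from Cons.prems(2) obtain u1 u2 where u: "u = u1 @ u2" "subseq u1 (replicate (e l) l)" "subseq u2 (concat (map (\<lambda>l. replicate (e l) l) ls))"
    by (auto simp: subseq_append_iff)
  obtain j where j: "j \<le> e l" "u1 = replicate j l" using subseq_replicate[OF u(2)] by blast
  obtain d where d: "\<forall>l. d l \<le> e l" "u2 = concat (map (\<lambda>l. replicate (d l) l) ls)" using Cons.IH[OF _ u(3)] Cons.prems(1) by auto
  have m: "map (\<lambda>l'. replicate ((d(l := j)) l') l') ls = map (\<lambda>l. replicate (d l) l) ls"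
    using Cons.prems(1) by (intro map_cong refl) auto
  have "u = concat (map (\<lambda>l'. replicate ((d(l := j)) l') l') (l # ls))"
    unfolding u(1) j(2) d(2) by (simp only: m list.map concat.simps fun_upd_same)
  moreover have "\<forall>l'. (d(l := j)) l' \<le> e l'" using d(1) j(1) by simp
  ultimately show ?case by blast
qed

section \<open>Coefficients of words at cosets\<close>

context iwasawa_setup
begin

definition mprod :: "'p padic_int mat list \<Rightarrow> 'p padic_int mat" where
  "mprod gs = foldr (*) gs (1\<^sub>m n)"

lemma mprod_simps: "mprod [] = 1\<^sub>m n" "mprod (g # gs) = g * mprod gs"
  by (simp_all add: mprod_def)

lemma mprod_carrier: "set gs \<subseteq> carrier_mat n n \<Longrightarrow> mprod gs \<in> carrier_mat n n"
  by (induction gs) (auto simp: mprod_simps)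

lemma mprod_closed: "set gs \<subseteq> carrier G \<Longrightarrow> mprod gs \<in> carrier G"
  by (induction gs) (auto simp: mprod_simps iwahori_one_closed iwahori_mult_closed)

lemma mprod_append: "set gs \<subseteq> carrier_mat n n \<Longrightarrow> set hs \<subseteq> carrier_mat n n \<Longrightarrow> mprod (gs @ hs) = mprod gs * mprod hs"
proof (induction gs)
  case Nil
  then show ?case using mprod_carrier[OF Nil(2)] by (simp add: mprod_simps)
next
  case (Cons g gs)
  then show ?case
    using assoc_mult_mat[of g n n "mprod gs" n "mprod hs" n] mprod_carrier by (simp add: mprod_simps)
qed

lemma mprod_concat: "(\<And>xs. xs \<in> set xss \<Longrightarrow> set xs \<subseteq> carrier_mat n n) \<Longrightarrow> mprod (concat xss) = mprod (map mprod xss)"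
proof (induction xss)
  case (Cons xs xss)
  have "set (concat xss) \<subseteq> carrier_mat n n" using Cons.prems by auto
  then show ?case using Cons by (simp add: mprod_append mprod_simps)
qed (simp add: mprod_simps)

definition word_prod :: "iw_var list \<Rightarrow> 'p padic_int mat" where
  "word_prod w = mprod (map gen w)"

lemma gen_word_closed: "set w \<subseteq> iw_vars n \<Longrightarrow> set (map gen w) \<subseteq> carrier G"
  using gen_in_G by auto

lemma gen_word_carrier: "set w \<subseteq> iw_vars n \<Longrightarrow> set (map gen w) \<subseteq> carrier_mat n n"
  using gen_word_closed iwahori_carrier_mat by blast

lemma word_prod_closed: "set w \<subseteq> iw_vars n \<Longrightarrow> word_prod w \<in> carrier G"
  unfolding word_prod_def by (rule mprod_closed[OF gen_word_closed])

lemma word_prod_snoc: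
  assumes "set w \<subseteq> iw_vars n" "l \<in> iw_vars n"
  shows "word_prod (w @ [l]) = word_prod w * gen l"
proof -
  have "gen l \<in> carrier_mat n n" using gen_in_G[OF assms(2)] by (rule iwahori_carrier_mat)
  then show ?thesis
    using mprod_append[OF gen_word_carrier[OF assms(1)], of "[gen l]"] by (simp add: word_prod_def mprod_simps)
qed

lemma coset_mult_right_iff:
  assumes N: "N \<in> ONS" and "y \<in> carrier G" "g \<in> carrier G" "h \<in> carrier G"
  shows "coset N (y * inv\<^bsub>G\<^esub> g) = coset N h \<longleftrightarrow> coset N y = coset N (h * g)"
proof -
  interpret Q: finite_group "G Mod N" by (rule Q_finite_group[OF N])
  have i: "inv\<^bsub>G\<^esub> g \<in> carrier G" using iwahori_inv(1)[OF assms(3)] .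
  have "coset N (y * inv\<^bsub>G\<^esub> g) = coset N y \<otimes>\<^bsub>G Mod N\<^esub> inv\<^bsub>G Mod N\<^esub> coset N g"
    by (simp only: coset_inv[OF N assms(3)] coset_mult[OF N assms(2) i])
  moreover have "coset N (h * g) = coset N h \<otimes>\<^bsub>G Mod N\<^esub> coset N g"
    by (simp only: coset_mult[OF N assms(4,3)])
  ultimately show ?thesis
    using Q.inv_solve_right'[OF coset_in_Q coset_in_Q coset_in_Q, OF assms(4,2,3)] by simp
qed

lemma word_elt_snoc_entry:
  assumes "set w \<subseteq> iw_vars n" "l \<in> iw_vars n" "N \<in> ONS" "y \<in> carrier G"
  shows "word_elt (w @ [l]) N (coset N y) = word_elt w N (coset N (y * inv\<^bsub>G\<^esub> gen l)) - word_elt w N (coset N y)"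
proof -
  interpret R: ring L by (rule L_ring)
  have "word_elt (w @ [l]) = word_elt w \<otimes>\<^bsub>L\<^esub> letter l" using assms by (simp add: word_elt_append letter_closed)
  then show ?thesis using mult_letter_entry[OF word_elt_closed[OF assms(1)] assms(3,4,2)] by simp
qed

text \<open>Expanding the product of the \<open>g - 1\<close>, only the full product can contribute to a coset that contains
  no product over a proper subword.\<close>

lemma word_elt_top_coefficient:
  assumes N: "N \<in> ONS"
  shows "set w \<subseteq> iw_vars n \<Longrightarrow> y \<in> carrier G \<Longrightarrow>
    (\<And>u. subseq u w \<Longrightarrow> u \<noteq> w \<Longrightarrow> coset N y \<noteq> coset N (word_prod u)) \<Longrightarrow>
    word_elt w N (coset N y) = (if coset N y = coset N (word_prod w) then 1 else 0)"
proof (induction w arbitrary: y rule: rev_induct)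
  case Nil
  then show ?case
    by (simp add: one_L iwasawa_of_def N word_prod_def mprod_simps)
next
  case (snoc l w)
  have w: "set w \<subseteq> iw_vars n" and l: "l \<in> iw_vars n" using snoc.prems(1) by auto
  have g: "gen l \<in> carrier G" by (rule gen_in_G[OF l])
  have yg: "y * inv\<^bsub>G\<^esub> gen l \<in> carrier G" using iwahori_mult_closed[OF snoc.prems(2) iwahori_inv(1)[OF g]] .
  have shift: "coset N (y * inv\<^bsub>G\<^esub> gen l) = coset N (word_prod u) \<longleftrightarrow> coset N y = coset N (word_prod (u @ [l]))"
    if "set u \<subseteq> iw_vars n" for u
    using coset_mult_right_iff[OF N snoc.prems(2) g word_prod_closed[OF that]] by (simp only: word_prod_snoc[OF that l])
  have 1: "word_elt w N (coset N (y * inv\<^bsub>G\<^esub> gen l)) = (if coset N (y * inv\<^bsub>G\<^esub> gen l) = coset N (word_prod w) then 1 else 0)"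
  proof (rule snoc.IH[OF w yg])
    fix u assume u: "subseq u w" "u \<noteq> w"
    then have "set u \<subseteq> iw_vars n" using set_mono_subseq[OF u(1)] w by blast
    moreover have "coset N y \<noteq> coset N (word_prod (u @ [l]))" using u by (intro snoc.prems(3)) auto
    ultimately show "coset N (y * inv\<^bsub>G\<^esub> gen l) \<noteq> coset N (word_prod u)" using shift by blast
  qed
  \<comment> \<open>Each subword of w, including w itself, is a proper subword of the longer
    word.\<close>
  have ne: "coset N y \<noteq> coset N (word_prod u)" if "subseq u w" for u
  proof (rule snoc.prems(3))
    show "subseq u (w @ [l])" using that subseq_append_iff by fastforce
    show "u \<noteq> w @ [l]" using list_emb_length[OF that] by auto
  qed
  have "word_elt w N (coset N y) = (if coset N y = coset N (word_prod w) then 1 else 0)"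
    by (rule snoc.IH[OF w snoc.prems(2)]) (rule ne)
  then have "word_elt w N (coset N y) = 0" using ne[of w] by simp
  then show ?case
    unfolding word_elt_snoc_entry[OF w l N snoc.prems(2)] 1 using shift[OF w] by simp
qed

text \<open>Raising to the power p^k multiplies the parameter of an elementary matrix by p^k, and
  for U the parameter already contains one p. In the torus, (1 + p)^(p^k) is 1 modulo
  p^(k+1).\<close>

lemma gen_power_cong_subgroup:
  assumes "l \<in> iw_vars n"
  shows "gen l [^]\<^bsub>G\<^esub> (CARD('p) ^ k) \<in> cong_subgroup n k"
proof -
  have x: "x_mat n \<alpha> c \<in> cong_subgroup n k"
    if "\<alpha> \<in> roots n" "padic_p ^ (if fst \<alpha> < snd \<alpha> then k else Suc k) dvd c" for \<alpha> and c :: "'p padic_int"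
    unfolding cong_subgroup_def
  proof (intro CollectI conjI allI impI)
    have "padic_p dvd c" if "fst \<alpha> > snd \<alpha>" using that \<open>padic_p ^ _ dvd c\<close> by (auto intro: dvd_trans[of _ "padic_p ^ Suc k"])
    then show "x_mat n \<alpha> c \<in> carrier G" using that(1) by (intro x_mat_in_G) auto
    fix i j assume "i < n" "j < n"
    then show "padic_p ^ (if i < j then k else Suc k) dvd (x_mat n \<alpha> c - 1\<^sub>m n) $$ (i, j)"
      using that by (auto simp: x_mat_entry split: if_splits)
  qed
  have q: "of_nat (CARD('p) ^ k) = (padic_p ^ k :: 'p padic_int)" by (simp add: padic_p_def)
  from assms consider (U) \<beta> where "l = U_var \<beta>" "\<beta> \<in> neg_roots n" | (W) \<delta> where "l = W_var \<delta>" "\<delta> \<in> simple_roots n"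
    | (V) \<alpha> where "l = V_var \<alpha>" "\<alpha> \<in> pos_roots n" by (auto simp: iw_vars_def)
  then show ?thesis
  proof cases
    case U
    then have r: "\<beta> \<in> roots n" "\<not> fst \<beta> < snd \<beta>" by (auto simp: neg_roots_def)
    show ?thesis unfolding U(1) gen.simps x_mat_pow[OF r(1)] q using r by (intro x) auto
  next
    case W
    then have d: "fst \<delta> \<noteq> snd \<delta>" by (auto simp: simple_roots_def)
    show ?thesis unfolding W(1) gen.simps h_mat_pow[OF d one_plus_p_unit]
      by (rule h_mat_cong_subgroup[OF W(2) one_plus_p_power_cong]) simp
  next
    case V
    then have r: "\<alpha> \<in> roots n" "fst \<alpha> < snd \<alpha>" by (auto simp: pos_roots_def)
    show ?thesis unfolding V(1) gen.simps x_mat_pow[OF r(1)] q using r by (intro x) auto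
  qed
qed

text \<open>Modulo p, (g - 1)^(p^k) is g^(p^k) - 1, which is 0 in the quotient by the k-th
  congruence subgroup; factors on either side preserve divisibility by p.\<close>

lemma word_elt_power_vanishes:
  assumes l: "l \<in> iw_vars n" and a: "set a \<subseteq> iw_vars n" and b: "set b \<subseteq> iw_vars n"
  shows "padic_p dvd word_elt (a @ replicate (CARD('p) ^ k) l @ b) (cong_subgroup n k) C"
proof (cases "C \<in> carrier (G Mod cong_subgroup n k)")
  case False
  have "set (a @ replicate (CARD('p) ^ k) l @ b) \<subseteq> iw_vars n" using assms by auto
  then show ?thesis using word_elt_outside[OF _ cong_subgroup_ONS False] by (metis dvd_0_right)
next
  case True
  interpret R: ring L by (rule L_ring)
  interpret Gr: group G by (rule group_G)
  let ?N = "cong_subgroup n k :: 'p padic_int mat set"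
  let ?q = "CARD('p) ^ k"
  have N: "?N \<in> ONS" by (rule cong_subgroup_ONS)
  have r: "set (replicate ?q l) \<subseteq> iw_vars n" using l by auto
  let ?h = "inv\<^bsub>G\<^esub> gen l"
  have g: "gen l \<in> carrier G" by (rule gen_in_G[OF l])
  have h: "?h \<in> carrier G" using g by simp
  have "?h [^]\<^bsub>G\<^esub> ?q = inv\<^bsub>G\<^esub> (gen l [^]\<^bsub>G\<^esub> ?q)" using Gr.nat_pow_inv[OF g] by simp
  moreover have "subgroup ?N G" using N by (auto simp: open_normal_subgroups_def normal_def)
  ultimately have hq: "?h [^]\<^bsub>G\<^esub> ?q \<in> ?N" using gen_power_cong_subgroup[OF l, of k] by (simp add: subgroup.m_inv_closed)
  have 1: "padic_p dvd (word_elt a \<otimes>\<^bsub>L\<^esub> word_elt (replicate ?q l)) ?N (coset ?N y)" if y: "y \<in> carrier G" for y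
  proof -
    let ?f = "\<lambda>y. word_elt a ?N (coset ?N y)"
    have "((\<lambda>x. x * ?h) ^^ ?q) y = y * (?h [^]\<^bsub>G\<^esub> ?q)" by (rule funpow_mult_right[OF y h])
    then have "?f (((\<lambda>x. x * ?h) ^^ ?q) y) = ?f y" using coset_absorb[OF N y hq] by simp
    then have "padic_p dvd delta (replicate ?q ?h) ?f y"
      using delta_replicate_prime_power[OF p_gt2, of k ?h ?f y] by simp
    then show ?thesis unfolding mult_word_elt_entry[OF word_elt_closed[OF a] N y r] by simp
  qed
  obtain y where y: "y \<in> carrier G" "C = coset ?N y" using True by (auto simp: carrier_Q)
  have e: "word_elt (a @ replicate ?q l @ b) = (word_elt a \<otimes>\<^bsub>L\<^esub> word_elt (replicate ?q l)) \<otimes>\<^bsub>L\<^esub> word_elt b"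
    using a r b by (simp add: word_elt_append word_elt_closed R.m_assoc)
  have X: "word_elt a \<otimes>\<^bsub>L\<^esub> word_elt (replicate ?q l) \<in> carrier L" using word_elt_closed a r by simp
  have gs: "set (rev (map (\<lambda>l. inv\<^bsub>G\<^esub> gen l) b)) \<subseteq> carrier G" using b gen_in_G by auto
  show ?thesis
    unfolding y(2) e mult_word_elt_entry[OF X N y(1) b]
    by (rule delta_dvd[where S = "carrier G" and f = "\<lambda>y. (word_elt a \<otimes>\<^bsub>L\<^esub> word_elt (replicate ?q l)) ?N (coset ?N y)", OF 1 iwahori_mult_closed gs y(1)])
qed

lemma word_elt_oword_vanishes:
  assumes "l \<in> iw_vars n" "CARD('p) ^ k \<le> e l"
  shows "padic_p dvd word_elt (oword e) (cong_subgroup n k) C"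
proof -
  obtain xs ys where x: "letters = xs @ l # ys" using assms(1) set_letters split_list by metis
  let ?c = "\<lambda>xs. concat (map (\<lambda>l. replicate (e l) l) xs)"
  have e: "oword e = ?c xs @ replicate (CARD('p) ^ k) l @ (replicate (e l - CARD('p) ^ k) l @ ?c ys)"
    using assms(2) by (simp add: oword_def x replicate_add[symmetric])
  have sub: "set (?c zs) \<subseteq> set zs" for zs by auto
  have "set letters = insert l (set xs \<union> set ys)" using x by simp
  then have xy: "set xs \<subseteq> iw_vars n" "set ys \<subseteq> iw_vars n" using set_letters by blast+
  have "set (replicate (e l - CARD('p) ^ k) l) \<subseteq> iw_vars n" using assms(1) by (simp add: set_replicate_conv_if)
  then have "set (replicate (e l - CARD('p) ^ k) l @ ?c ys) \<subseteq> iw_vars n" using sub[of ys] xy(2) by (simp only: set_append Un_subset_iff) blast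
  then show ?thesis unfolding e by (intro word_elt_power_vanishes[OF assms(1)] subset_trans[OF sub xy(1)])
qed

end

section \<open>Uniqueness of the LDU decomposition\<close>

lemma sorted_wrt_all: "(\<And>x y. x \<in> set xs \<Longrightarrow> y \<in> set xs \<Longrightarrow> P x y) \<Longrightarrow> sorted_wrt P xs"
  by (induction xs) auto

lemma sorted_wrt_concat_map:
  "(\<And>x. x \<in> set xs \<Longrightarrow> sorted_wrt R (f x)) \<Longrightarrow> sorted_wrt (\<lambda>x y. \<forall>a\<in>set (f x). \<forall>b\<in>set (f y). R a b) xs \<Longrightarrow>
    sorted_wrt R (concat (map f xs))"
  by (induction xs) (auto simp: sorted_wrt_append)

text \<open>In a product of triangular matrices the terms before m are known and those after m
  vanish, which isolates the term at m.\<close>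

lemma dvd_remaining_term:
  fixes F F' :: "nat \<Rightarrow> 'a::comm_ring_1"
  assumes "a dvd (\<Sum>t<n. F t) - (\<Sum>t<n. F' t)" "m < n"
    and "\<And>t. t < m \<Longrightarrow> a dvd F t - F' t" "\<And>t. m < t \<Longrightarrow> t < n \<Longrightarrow> F t = 0 \<and> F' t = 0"
  shows "a dvd F m - F' m"
proof -
  have e: "(\<Sum>t<n. F t) - (\<Sum>t<n. F' t) = (F m - F' m) + (\<Sum>t\<in>{..<n} - {m}. F t - F' t)"
    using assms(2) by (simp add: sum_subtractf[symmetric] sum.remove[of "{..<n}" m])
  have "a dvd F t - F' t" if "t \<in> {..<n} - {m}" for t
    using that assms(3)[of t] assms(4)[of t] by (cases "t < m") auto
  then have "a dvd (\<Sum>t\<in>{..<n} - {m}. F t - F' t)" by (rule dvd_sum)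
  then show ?thesis using assms(1) unfolding e by (simp add: dvd_add_left_iff)
qed

lemma padic_of_nat_eqI:
  assumes "padic_p ^ k dvd (of_nat a - of_nat b :: 'p::prime_card padic_int)" "a < CARD('p) ^ k" "b < CARD('p) ^ k"
  shows "a = b"
proof -
  have "int a mod int CARD('p) ^ k = int b mod int CARD('p) ^ k"
    using assms(1) unfolding power_dvd_diff_iff_residue residue_of_nat .
  moreover have "int a < int CARD('p) ^ k" "int b < int CARD('p) ^ k"
    using assms(2,3) by (metis of_nat_less_iff of_nat_power)+
  ultimately show ?thesis by simp
qed

lemma p_power_dvd_mult_unit:
  assumes "padic_p ^ k dvd a * (d :: 'p::prime_card padic_int)" "d dvd 1"
  shows "padic_p ^ k dvd a"
proof -
  obtain c where c: "1 = d * c" using assms(2) by (rule dvdE)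
  have "a = a * d * c" using c by (metis mult.assoc mult.right_neutral)
  then show ?thesis using assms(1) by (metis dvd_mult2)
qed

text \<open>Once the earlier pivots, columns and rows agree, only the term t = m is open in column m
  and row m of the product. Column m is known modulo p^(k+1) and its lower entries carry a factor p,
  row m is known modulo p^k; either way the exponents are determined modulo p^k and, being bounded
  by it, are equal.\<close>

lemma ldu_unique:
  fixes D D' :: "nat \<Rightarrow> 'p::prime_card padic_int" and e f :: "nat \<Rightarrow> nat \<Rightarrow> nat"
  defines "l \<equiv> \<lambda>e i t. if i = t then 1 else if t < i then padic_p * of_nat (e i t) else (0 :: 'p padic_int)"
    and "v \<equiv> \<lambda>e t j. if t = j then 1 else if t < j then of_nat (e t j) else (0 :: 'p padic_int)"
  assumes g: "\<And>i j. i < n \<Longrightarrow> j < n \<Longrightarrow> padic_p ^ (if i < j then k else Suc k) dvd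
      (\<Sum>t<n. l e i t * (D t * v e t j)) - (\<Sum>t<n. l f i t * (D' t * v f t j))"
    and b: "\<And>i j. i < n \<Longrightarrow> j < n \<Longrightarrow> i \<noteq> j \<Longrightarrow> e i j < CARD('p) ^ k \<and> f i j < CARD('p) ^ k"
    and u: "\<And>t. t < n \<Longrightarrow> D' t dvd 1"
  shows "m < n \<Longrightarrow> padic_p ^ Suc k dvd D m - D' m \<and> (\<forall>i<n. m < i \<longrightarrow> e i m = f i m \<and> e m i = f m i)"
proof (induction m rule: less_induct)
  case (less m)
  have low: "l e i t = l f i t" if "t < m" "m \<le> i" "i < n" for i t
    using less.IH[of t] that less.prems by (auto simp: l_def)
  have up: "v e t j = v f t j" if "t < m" "m \<le> j" "j < n" for t j
    using less.IH[of t] that less.prems by (auto simp: v_def)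
  have Dt: "padic_p ^ Suc k dvd l e i t * (D t * v e t j) - l f i t * (D' t * v f t j)" if "t < m" "m \<le> i" "i < n" "m \<le> j" "j < n" for t i j
  proof -
    have "l e i t * (D t * v e t j) - l f i t * (D' t * v f t j) = l f i t * v f t j * (D t - D' t)"
      unfolding low[OF that(1-3)] up[OF that(1,4,5)] by (simp add: algebra_simps)
    moreover have "padic_p ^ Suc k dvd D t - D' t" using less.IH[of t] that less.prems by auto
    ultimately show ?thesis by (simp only: dvd_mult)
  qed
  have col: "padic_p ^ Suc k dvd l e i m * (D m * v e m m) - l f i m * (D' m * v f m m)" if "m \<le> i" "i < n" for i
  proof (rule dvd_remaining_term[where m = m and n = n and F = "\<lambda>t. l e i t * (D t * v e t m)" and F' = "\<lambda>t. l f i t * (D' t * v f t m)"])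
    show "padic_p ^ Suc k dvd (\<Sum>t<n. l e i t * (D t * v e t m)) - (\<Sum>t<n. l f i t * (D' t * v f t m))"
      using g[of i m] that less.prems by simp
    show "padic_p ^ Suc k dvd l e i t * (D t * v e t m) - l f i t * (D' t * v f t m)" if "t < m" for t
      using Dt[OF that \<open>m \<le> i\<close> \<open>i < n\<close> order_refl less.prems] .
    show "l e i t * (D t * v e t m) = 0 \<and> l f i t * (D' t * v f t m) = 0" if "m < t" for t
      using that by (simp add: v_def)
  qed (rule less.prems)
  have D: "padic_p ^ Suc k dvd D m - D' m" using col[of m] less.prems by (simp add: l_def v_def)
  have "e i m = f i m \<and> e m i = f m i" if i: "m < i" "i < n" for i
  proof
    have "padic_p ^ Suc k dvd padic_p * of_nat (e i m) * D m - padic_p * of_nat (f i m) * D' m"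
      using col[of i] i by (simp add: l_def v_def)
    \<comment> \<open>Trading D for D' in the first term leaves p (e - f) D', with D' a
      unit.\<close>
    from dvd_diff[OF this dvd_mult[OF D, of "padic_p * of_nat (e i m)"]]
    have "padic_p ^ Suc k dvd padic_p * ((of_nat (e i m) - of_nat (f i m)) * D' m)"
      by (simp add: algebra_simps)
    then have "padic_p ^ k dvd (of_nat (e i m) - of_nat (f i m)) * D' m" by (simp add: padic_p_def)
    from p_power_dvd_mult_unit[OF this u[OF less.prems]]
    show "e i m = f i m" by (rule padic_of_nat_eqI) (use b[of i m] i less.prems in auto)
    have "padic_p ^ k dvd l e m m * (D m * v e m i) - l f m m * (D' m * v f m i)"
    proof (rule dvd_remaining_term[where m = m and n = n and F = "\<lambda>t. l e m t * (D t * v e t i)" and F' = "\<lambda>t. l f m t * (D' t * v f t i)"])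
      show "padic_p ^ k dvd (\<Sum>t<n. l e m t * (D t * v e t i)) - (\<Sum>t<n. l f m t * (D' t * v f t i))"
        using g[of m i] i less.prems by simp
      show "padic_p ^ k dvd l e m t * (D t * v e t i) - l f m t * (D' t * v f t i)" if "t < m" for t
        by (rule dvd_trans[OF le_imp_power_dvd Dt[OF that order_refl less.prems less_imp_le[OF i(1)] i(2)]]) simp
      show "l e m t * (D t * v e t i) = 0 \<and> l f m t * (D' t * v f t i) = 0" if "m < t" for t
        using that by (simp add: l_def)
    qed (rule less.prems)
    then have 1: "padic_p ^ k dvd D m * of_nat (e m i) - D' m * of_nat (f m i)" using i by (simp add: l_def v_def)
    have "padic_p ^ k dvd D m - D' m" by (rule dvd_trans[OF le_imp_power_dvd D]) simp
    from dvd_diff[OF 1 dvd_mult[OF this, of "of_nat (e m i)"]]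
    have "padic_p ^ k dvd (of_nat (e m i) - of_nat (f m i)) * D' m" by (simp add: algebra_simps)
    from p_power_dvd_mult_unit[OF this u[OF less.prems]]
    show "e m i = f m i" by (rule padic_of_nat_eqI) (use b[of m i] i less.prems in auto)
  qed
  then show ?case using D by blast
qed

lemma one_plus_p_power_inj:
  assumes "CARD('p::prime_card) > 2" "padic_p ^ Suc k dvd ((1 + padic_p) ^ a - (1 + padic_p) ^ b :: 'p padic_int)"
    and "a < CARD('p) ^ k" "b < CARD('p) ^ k"
  shows "a = b"
proof -
  have *: "a = b" if le: "b \<le> a" and d: "padic_p ^ Suc k dvd ((1 + padic_p) ^ a - (1 + padic_p) ^ b :: 'p padic_int)"
    and a: "a < CARD('p) ^ k" for a b
  proof -
    have "(1 + padic_p) ^ a = (1 + padic_p) ^ (a - b) * ((1 + padic_p) ^ b :: 'p padic_int)"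
      using le by (simp add: power_add[symmetric])
    then have "(1 + padic_p) ^ a - (1 + padic_p) ^ b = ((1 + padic_p) ^ (a - b) - 1) * ((1 + padic_p) ^ b :: 'p padic_int)"
      by (simp only: left_diff_distrib mult_1_left)
    then have "padic_p ^ Suc k dvd ((1 + padic_p) ^ (a - b) - 1 :: 'p padic_int)"
      using d p_power_dvd_mult_unit[OF _ one_plus_p_power_unit] by metis
    then have "CARD('p) ^ k dvd a - b" by (rule one_plus_p_power_dvd[OF assms(1)])
    then have "a - b = 0" using a by (auto dest: dvd_imp_le)
    then show ?thesis using le by simp
  qed
  have "padic_p ^ Suc k dvd ((1 + padic_p) ^ b - (1 + padic_p) ^ a :: 'p padic_int)"
    using assms(2) by (metis dvd_minus_iff minus_diff_eq)
  then show ?thesis using *[of b a] *[of a b] assms by (cases "b \<le> a") auto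
qed

context iwasawa_setup
begin

text \<open>In this order no later root continues an earlier one, so the product of two matrix units
  in list order is always 0 and the parameters appear unmixed in the product of the elementary
  matrices.\<close>

lemma sorted_lowers: "sorted_wrt (\<lambda>a b. snd a \<noteq> fst b) lowers"
  unfolding lowers_def
proof (rule sorted_wrt_concat_map)
  show "sorted_wrt (\<lambda>x y. \<forall>a\<in>set (map (\<lambda>i. (i, x)) [Suc x..<n]). \<forall>b\<in>set (map (\<lambda>i. (i, y)) [Suc y..<n]). snd a \<noteq> fst b) [0..<n]"
    by (rule sorted_wrt_mono_rel[OF _ sorted_wrt_upt]) auto
qed (auto simp: sorted_wrt_map intro!: sorted_wrt_all)

lemma sorted_uppers: "sorted_wrt (\<lambda>a b. snd a \<noteq> fst b) uppers"
  unfolding uppers_def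
proof (rule sorted_wrt_concat_map)
  show "sorted_wrt (\<lambda>x y. \<forall>a\<in>set (map (Pair x) [Suc x..<n]). \<forall>b\<in>set (map (Pair y) [Suc y..<n]). snd a \<noteq> fst b) (rev [0..<n])"
    unfolding sorted_wrt_rev by (rule sorted_wrt_mono_rel[OF _ sorted_wrt_upt]) auto
qed (auto simp: sorted_wrt_map intro!: sorted_wrt_all)

lemma x_mprod_entry:
  "sorted_wrt (\<lambda>a b. snd a \<noteq> fst b) rs \<Longrightarrow> distinct rs \<Longrightarrow> set rs \<subseteq> roots n \<Longrightarrow> a < n \<Longrightarrow> b < n \<Longrightarrow>
    mprod (map (\<lambda>r. x_mat n r (t r)) rs) $$ (a, b) = (if a = b then 1 else 0) + (if (a, b) \<in> set rs then t (a, b) else 0)"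
proof (induction rs arbitrary: a b)
  case Nil
  then show ?case by (simp add: mprod_simps)
next
  case (Cons r rs)
  obtain i j where r: "r = (i, j)" "i < n" "j < n" "i \<noteq> j" using Cons.prems(3) by (auto simp: roots_def)
  have IH: "mprod (map (\<lambda>r. x_mat n r (t r)) rs) $$ (a, b) = (if a = b then 1 else 0) + (if (a, b) \<in> set rs then t (a, b) else 0)"
    if "a < n" "b < n" for a b using Cons.prems that by (intro Cons.IH) auto
  have c: "mprod (map (\<lambda>r. x_mat n r (t r)) rs) \<in> carrier_mat n n" by (rule mprod_carrier) auto
  have "(j, b) \<notin> set rs" using Cons.prems(1) r(1) by auto
  then show ?case
    using Cons.prems(2,4,5) r IH[of a b] IH[of j b] x_left_entry[OF c r(2,3,4) Cons.prems(4,5), of "t r"]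
    by (auto simp: mprod_simps)
qed

lemma h_mprod_entry:
  "distinct cs \<Longrightarrow> a < n \<Longrightarrow> b < n \<Longrightarrow> mprod (map (\<lambda>c. h_mat n (c, c + 1) (u c)) cs) $$ (a, b) =
    (if a \<noteq> b then 0 else (if a \<in> set cs then u a else 1) * (if 0 < a \<and> a - 1 \<in> set cs then 1 div u (a - 1) else 1))"
proof (induction cs)
  case Nil
  then show ?case by (simp add: mprod_simps)
next
  case (Cons c cs)
  have m: "mprod (map (\<lambda>c. h_mat n (c, c + 1) (u c)) cs) \<in> carrier_mat n n" by (rule mprod_carrier) auto
  have IH: "mprod (map (\<lambda>c. h_mat n (c, c + 1) (u c)) cs) $$ (a, b) =
      (if a \<noteq> b then 0 else (if a \<in> set cs then u a else 1) * (if 0 < a \<and> a - 1 \<in> set cs then 1 div u (a - 1) else 1))"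
    using Cons by simp
  have "mprod (map (\<lambda>c. h_mat n (c, c + 1) (u c)) (c # cs)) $$ (a, b)
      = h_mat n (c, c + 1) (u c) $$ (a, a) * mprod (map (\<lambda>c. h_mat n (c, c + 1) (u c)) cs) $$ (a, b)"
    by (simp only: list.map mprod_simps h_left_entry[OF m Cons.prems(2,3)])
  then show ?case unfolding IH using Cons.prems by (cases "a = c"; cases "a = Suc c") (auto simp: h_entry mult_ac)
qed

lemma mprod_replicate: "g \<in> carrier G \<Longrightarrow> mprod (replicate m g) = g [^]\<^bsub>G\<^esub> m"
proof (induction m)
  case (Suc m)
  interpret Gr: group G by (rule group_G)
  show ?case using Suc Gr.nat_pow_Suc2[OF Suc.prems, of m] by (simp add: mprod_simps iwahori_simps)
qed (simp add: mprod_simps iwahori_simps)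

definition lower_part :: "(iw_var \<Rightarrow> nat) \<Rightarrow> 'p padic_int mat" where
  "lower_part e = mprod (map (\<lambda>r. x_mat n r (padic_p * of_nat (e (U_var r)))) lowers)"

definition torus_part :: "(iw_var \<Rightarrow> nat) \<Rightarrow> 'p padic_int mat" where
  "torus_part e = mprod (map (\<lambda>c. h_mat n (c, c + 1) ((1 + padic_p) ^ e (W_var (c, c + 1)))) [0..<n - 1])"

definition upper_part :: "(iw_var \<Rightarrow> nat) \<Rightarrow> 'p padic_int mat" where
  "upper_part e = mprod (map (\<lambda>r. x_mat n r (1 * of_nat (e (V_var r)))) uppers)"

lemma part_carrier: "lower_part e \<in> carrier_mat n n" "torus_part e \<in> carrier_mat n n" "upper_part e \<in> carrier_mat n n"
  unfolding lower_part_def torus_part_def upper_part_def by (auto intro!: mprod_carrier)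

lemma word_prod_oword: "word_prod (oword e) = lower_part e * (torus_part e * upper_part e)"
proof -
  have gc: "gen l [^]\<^bsub>G\<^esub> m \<in> carrier_mat n n" "gen l \<in> carrier_mat n n" if "l \<in> iw_vars n" for l and m :: nat
  proof -
    interpret Gr: group G by (rule group_G)
    show "gen l [^]\<^bsub>G\<^esub> m \<in> carrier_mat n n" by (rule iwahori_carrier_mat[OF Gr.nat_pow_closed[OF gen_in_G[OF that]]])
    show "gen l \<in> carrier_mat n n" by (rule iwahori_carrier_mat[OF gen_in_G[OF that]])
  qed
  have lc: "set (map (\<lambda>l. gen l [^]\<^bsub>G\<^esub> e l) ls) \<subseteq> carrier_mat n n" if "set ls \<subseteq> iw_vars n" for ls
    using gc that by auto
  have "map gen (oword e) = concat (map (\<lambda>l. replicate (e l) (gen l)) letters)"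
    by (simp add: oword_def map_concat comp_def)
  then have "word_prod (oword e) = mprod (concat (map (\<lambda>l. replicate (e l) (gen l)) letters))"
    by (simp add: word_prod_def)
  also have "\<dots> = mprod (map mprod (map (\<lambda>l. replicate (e l) (gen l)) letters))"
    using gc(2) by (intro mprod_concat) (auto simp: set_letters)
  also have "map mprod (map (\<lambda>l. replicate (e l) (gen l)) letters) = map (\<lambda>l. gen l [^]\<^bsub>G\<^esub> e l) letters"
    by (auto simp: mprod_replicate[OF gen_in_G] set_letters)
  finally have 1: "word_prod (oword e) = mprod (map (\<lambda>l. gen l [^]\<^bsub>G\<^esub> e l) letters)" .
  have L: "mprod (map (\<lambda>l. gen l [^]\<^bsub>G\<^esub> e l) (map U_var lowers)) = lower_part e"
    unfolding lower_part_def map_map comp_def gen.simps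
    by (rule arg_cong[where f = mprod]) (auto simp: set_lowers neg_roots_def intro!: x_mat_pow)
  have D: "mprod (map (\<lambda>l. gen l [^]\<^bsub>G\<^esub> e l) (map (\<lambda>c. W_var (c, c + 1)) [0..<n - 1])) = torus_part e"
    unfolding torus_part_def map_map comp_def gen.simps
    by (rule arg_cong[where f = mprod]) (auto intro!: h_mat_pow one_plus_p_unit)
  have V: "mprod (map (\<lambda>l. gen l [^]\<^bsub>G\<^esub> e l) (map V_var uppers)) = upper_part e"
    unfolding upper_part_def map_map comp_def gen.simps
    by (rule arg_cong[where f = mprod]) (auto simp: set_uppers pos_roots_def intro!: x_mat_pow[of _ 1, simplified])
  have s: "set (map U_var lowers) \<subseteq> iw_vars n" "set (map (\<lambda>c. W_var (c, c + 1)) [0..<n - 1]) \<subseteq> iw_vars n" "set (map V_var uppers) \<subseteq> iw_vars n"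
    unfolding set_letters[symmetric] letters_def by auto
  show ?thesis
    unfolding 1 letters_def L[symmetric] D[symmetric] V[symmetric]
    using mprod_append[OF lc[OF s(1)], of "map (\<lambda>l. gen l [^]\<^bsub>G\<^esub> e l) (map (\<lambda>c. W_var (c, c + 1)) [0..<n - 1] @ map V_var uppers)"]
      mprod_append[OF lc[OF s(2)] lc[OF s(3)]] lc[of "map (\<lambda>c. W_var (c, c + 1)) [0..<n - 1] @ map V_var uppers"] s
    by (simp only: map_append set_append Un_subset_iff simp_thms)
qed

text \<open>The telescoping diagonal: the parameter at a divided by the one at a - 1, with a missing
  factor at either end.\<close>

definition torus_entry :: "(iw_var \<Rightarrow> nat) \<Rightarrow> nat \<Rightarrow> 'p padic_int" where
  "torus_entry e a = (if a < n - 1 then (1 + padic_p) ^ e (W_var (a, a + 1)) else 1) *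
    (if 0 < a then 1 div ((1 + padic_p) ^ e (W_var (a - 1, a))) else 1)"

lemma torus_part_entry: "a < n \<Longrightarrow> b < n \<Longrightarrow> torus_part e $$ (a, b) = (if a = b then torus_entry e a else 0)"
proof -
  assume ab: "a < n" "b < n"
  show ?thesis unfolding torus_part_def h_mprod_entry[OF distinct_upt ab] torus_entry_def using ab by auto
qed

lemma torus_entry_unit: "torus_entry e a dvd 1"
proof -
  have "1 div ((1 + padic_p) ^ m) dvd (1 :: 'p padic_int)" for m
    using unit_inverse[OF one_plus_p_power_unit, of m] by (metis dvd_triv_right)
  then show ?thesis unfolding torus_entry_def using one_plus_p_power_unit
    by (auto intro!: mult_dvd_mono[where b = 1 and d = 1, simplified])
qed

lemma word_prod_oword_entry:
  assumes "i < n" "j < n"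
  shows "word_prod (oword e) $$ (i, j) =
    (\<Sum>t<n. (if i = t then 1 else if t < i then padic_p * of_nat (e (U_var (i, t))) else 0) *
      (torus_entry e t * (if t = j then 1 else if t < j then of_nat (e (V_var (t, j))) else 0)))"
proof -
  have tu: "(torus_part e * upper_part e) $$ (t, j) = torus_entry e t * upper_part e $$ (t, j)" if "t < n" for t
  proof -
    have "(torus_part e * upper_part e) $$ (t, j) = (\<Sum>s<n. if s = t then torus_entry e t * upper_part e $$ (t, j) else 0)"
      unfolding mat_mult_entry[OF part_carrier(2,3) that assms(2)] using that by (intro sum.cong refl) (auto simp: torus_part_entry)
    then show ?thesis using that by simp
  qed
  have l: "lower_part e $$ (i, t) = (if i = t then 1 else if t < i then padic_p * of_nat (e (U_var (i, t))) else 0)" if "t < n" for t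
    unfolding lower_part_def
    by (subst x_mprod_entry[OF sorted_lowers distinct_lowers _ assms(1) that])
      (use assms that in \<open>auto simp: set_lowers neg_roots_def roots_def\<close>)
  have v: "upper_part e $$ (t, j) = (if t = j then 1 else if t < j then of_nat (e (V_var (t, j))) else 0)" if "t < n" for t
    unfolding upper_part_def
    by (subst x_mprod_entry[OF sorted_uppers distinct_uppers _ that assms(2)])
      (use assms that in \<open>auto simp: set_uppers pos_roots_def roots_def\<close>)
  show ?thesis
    unfolding word_prod_oword mat_mult_entry[OF part_carrier(1) mult_carrier_mat[OF part_carrier(2,3)] assms]
    by (intro sum.cong refl) (simp add: tu l v)
qed

text \<open>g - h = h (x - 1) with x in the congruence subgroup. Where x - 1 offers only p^k but
  p^(k+1) is wanted, the entry of h lies below the diagonal and supplies the missing p.\<close>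

lemma coset_cong_entry:
  assumes g: "g \<in> carrier G" and h: "h \<in> carrier G" and e: "coset (cong_subgroup n k) g = coset (cong_subgroup n k) h"
    and ij: "i < n" "j < n"
  shows "padic_p ^ (if i < j then k else Suc k) dvd g $$ (i, j) - h $$ (i, j)"
proof -
  interpret Gr: group G by (rule group_G)
  define x where "x = inv\<^bsub>G\<^esub> h * g"
  have xN: "x \<in> cong_subgroup n k" using e coset_eq_iff[OF cong_subgroup_ONS g h] by (simp add: x_def)
  have xG: "x \<in> carrier G" using xN by (simp add: cong_subgroup_def)
  have "g = h \<otimes>\<^bsub>G\<^esub> (inv\<^bsub>G\<^esub> h \<otimes>\<^bsub>G\<^esub> g)" using g h by (simp add: Gr.m_assoc[symmetric])
  then have gx: "g = h * x" by (simp add: iwahori_simps x_def)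
  have m: "h \<in> carrier_mat n n" "x \<in> carrier_mat n n" using h xG by (auto intro: iwahori_carrier_mat)
  have "g $$ (i, j) - h $$ (i, j) = (\<Sum>t<n. h $$ (i, t) * x $$ (t, j)) - (\<Sum>t<n. if t = j then h $$ (i, j) else 0)"
    unfolding gx mat_mult_entry[OF m ij] using ij by simp
  also have "\<dots> = (\<Sum>t<n. h $$ (i, t) * (x - 1\<^sub>m n) $$ (t, j))"
    unfolding sum_subtractf[symmetric] using ij m by (intro sum.cong refl) (auto simp: right_diff_distrib)
  also have "padic_p ^ (if i < j then k else Suc k) dvd \<dots>"
  proof (rule dvd_sum)
    fix t assume "t \<in> {..<n}"
    then have t: "t < n" by simp
    have x: "padic_p ^ (if t < j then k else Suc k) dvd (x - 1\<^sub>m n) $$ (t, j)"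
      using xN t ij unfolding cong_subgroup_def by blast
    show "padic_p ^ (if i < j then k else Suc k) dvd h $$ (i, t) * (x - 1\<^sub>m n) $$ (t, j)"
    proof (cases "\<not> i < j \<and> t < j")
      case True
      then have "padic_p dvd h $$ (i, t)" using h ij t by (auto simp: mem_iwahori)
      then have "padic_p * padic_p ^ k dvd h $$ (i, t) * (x - 1\<^sub>m n) $$ (t, j)"
        using x True by (intro mult_dvd_mono) auto
      then show ?thesis using True by simp
    next
      case False
      then have "padic_p ^ (if i < j then k else Suc k) dvd (padic_p :: 'p padic_int) ^ (if t < j then k else Suc k)"
        by (intro le_imp_power_dvd) auto
      then show ?thesis using x by (metis dvd_mult dvd_trans)
    qed
  qed
  finally show ?thesis .
qed

text \<open>Equal cosets make the two LDU products congruent entry by entry, so the triangular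
  exponents and, modulo p^(k+1), the diagonals agree; the order of 1 + p then fixes the torus
  exponents.\<close>

lemma oword_coset_inj:
  assumes e: "\<And>l. l \<in> iw_vars n \<Longrightarrow> e l < CARD('p) ^ k" and f: "\<And>l. l \<in> iw_vars n \<Longrightarrow> f l < CARD('p) ^ k"
    and c: "coset (cong_subgroup n k) (word_prod (oword e)) = coset (cong_subgroup n k) (word_prod (oword f))"
  shows "oword e = oword f"
proof -
  \<comment> \<open>\<open>ldu_unique\<close> takes a single exponent function for both
    triangles.\<close>
  let ?c = "\<lambda>e i j. if j < i then e (U_var (i, j)) else e (V_var (i, j)) :: nat"
  have bound: "?c e i j < CARD('p) ^ k" "?c f i j < CARD('p) ^ k" if "i < n" "j < n" "i \<noteq> j" for i j
    using e[of "U_var (i, j)"] e[of "V_var (i, j)"] f[of "U_var (i, j)"] f[of "V_var (i, j)"] that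
    by (auto simp: iw_vars_def neg_roots_def pos_roots_def roots_def)
  have ent: "word_prod (oword e) $$ (i, j) = (\<Sum>t<n. (if i = t then 1 else if t < i then padic_p * of_nat (?c e i t) else 0) *
      (torus_entry e t * (if t = j then 1 else if t < j then of_nat (?c e t j) else 0)))" if "i < n" "j < n" for i j e
    unfolding word_prod_oword_entry[OF that] by (intro sum.cong refl) auto
  have eq: "padic_p ^ Suc k dvd torus_entry e m - torus_entry f m \<and> (\<forall>i<n. m < i \<longrightarrow> ?c e i m = ?c f i m \<and> ?c e m i = ?c f m i)"
    if m: "m < n" for m
  proof (rule ldu_unique[OF _ _ _ m])
    fix i j assume ij: "i < n" "j < n"
    show "padic_p ^ (if i < j then k else Suc k) dvd
       (\<Sum>t<n. (if i = t then 1 else if t < i then padic_p * of_nat (?c e i t) else 0) *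
         (torus_entry e t * (if t = j then 1 else if t < j then of_nat (?c e t j) else 0))) -
       (\<Sum>t<n. (if i = t then 1 else if t < i then padic_p * of_nat (?c f i t) else 0) *
         (torus_entry f t * (if t = j then 1 else if t < j then of_nat (?c f t j) else 0)))"
      using coset_cong_entry[OF word_prod_closed[OF set_oword] word_prod_closed[OF set_oword] c ij] unfolding ent[OF ij] .
  qed (use bound torus_entry_unit in blast)+
  \<comment> \<open>The diagonal entries are quotients of consecutive powers of 1 + p; multiplying
    them up from the first one recovers the powers.\<close>
  have torus: "padic_p ^ Suc k dvd (1 + padic_p) ^ e (W_var (c, c + 1)) - ((1 + padic_p) ^ f (W_var (c, c + 1)) :: 'p padic_int)"
    if "c + 1 < n" for c
    using that
  proof (induction c)
    case 0
    then show ?case using eq[of 0] by (simp add: torus_entry_def)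
  next
    case (Suc c)
    let ?v = "\<lambda>e c. (1 + padic_p) ^ e (W_var (c, c + 1)) :: 'p padic_int"
    have v: "?v e (Suc c) = torus_entry e (Suc c) * ?v e c" for e :: "iw_var \<Rightarrow> nat"
      using Suc.prems unit_inverse[OF one_plus_p_power_unit, of "e (W_var (c, c + 1))"]
      by (simp add: torus_entry_def mult.assoc mult.commute)
    have "?v e (Suc c) - ?v f (Suc c) = torus_entry e (Suc c) * (?v e c - ?v f c) + (torus_entry e (Suc c) - torus_entry f (Suc c)) * ?v f c"
      unfolding v by (simp add: algebra_simps)
    moreover have "padic_p ^ Suc k dvd ?v e c - ?v f c" using Suc by simp
    moreover have "padic_p ^ Suc k dvd torus_entry e (Suc c) - torus_entry f (Suc c)" using eq[of "Suc c"] Suc.prems by simp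
    ultimately show ?case by (simp only: dvd_add dvd_mult dvd_mult2)
  qed
  have "e l = f l" if "l \<in> iw_vars n" for l
    using that unfolding iw_vars_def
  proof (elim UnE imageE)
    fix \<beta> assume b: "l = U_var \<beta>" "\<beta> \<in> neg_roots n"
    then obtain i j where "\<beta> = (i, j)" "j < i" "i < n" "j < n" by (auto simp: neg_roots_def roots_def)
    then show ?thesis using eq[of j] b by auto
  next
    fix \<delta> assume d: "l = W_var \<delta>" "\<delta> \<in> simple_roots n"
    then obtain c where "\<delta> = (c, c + 1)" "c + 1 < n" by (auto simp: simple_roots_def)
    then show ?thesis using one_plus_p_power_inj[OF p_gt2 torus] e[OF that] f[OF that] d by auto
  next
    fix \<alpha> assume a: "l = V_var \<alpha>" "\<alpha> \<in> pos_roots n"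
    then obtain i j where "\<alpha> = (i, j)" "i < j" "i < n" "j < n" by (auto simp: pos_roots_def roots_def)
    then show ?thesis using eq[of i] a by auto
  qed
  then show ?thesis unfolding oword_def set_letters[symmetric] by (metis (mono_tags, lifting) map_cong)
qed

text \<open>A proper subword of \<open>oword e\<close> is ordered with exponents below p^k and is
  shorter than \<open>oword f\<close>, so the two have different cosets; only the full word can
  contribute.\<close>

lemma oword_word_elt_leading:
  assumes e: "\<And>l. l \<in> iw_vars n \<Longrightarrow> e l < CARD('p) ^ k" and f: "\<And>l. l \<in> iw_vars n \<Longrightarrow> f l < CARD('p) ^ k"
    and le: "length (oword e) \<le> length (oword f)"
  shows "word_elt (oword e) (cong_subgroup n k) (coset (cong_subgroup n k) (word_prod (oword f))) = (if oword e = oword f then 1 else 0)"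
proof -
  let ?C = "\<lambda>w. coset (cong_subgroup n k :: 'p padic_int mat set) (word_prod w)"
  have "word_elt (oword e) (cong_subgroup n k) (?C (oword f)) = (if ?C (oword f) = ?C (oword e) then 1 else 0)"
  proof (rule word_elt_top_coefficient[OF cong_subgroup_ONS set_oword word_prod_closed[OF set_oword]])
    fix u assume u: "subseq u (oword e)" "u \<noteq> oword e"
    obtain d where d: "\<forall>l. d l \<le> e l" "u = oword d"
      using subseq_concat_replicate[OF distinct_letters u(1)[unfolded oword_def]] by (auto simp: oword_def)
    have len: "length u < length (oword e)"
      using list_emb_length[OF u(1)] subseq_same_length[OF u(1)] u(2) by (cases "length u = length (oword e)") auto
    show "?C (oword f) \<noteq> ?C u"
    proof
      assume "?C (oword f) = ?C u"
      then have "oword f = oword d"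
        unfolding d(2) using d(1) e f by (intro oword_coset_inj) (auto intro: le_less_trans)
      then show False using len le d(2) by simp
    qed
  qed
  moreover have "?C (oword f) = ?C (oword e) \<longleftrightarrow> oword e = oword f"
  proof
    assume "?C (oword f) = ?C (oword e)"
    from oword_coset_inj[OF f e this] show "oword e = oword f" by (rule sym)
  qed simp
  ultimately show ?thesis by simp
qed

text \<open>In the group algebra of \<open>G\<close> modulo a congruence subgroup, the ordered words with small multiplicities
  are triangular with respect to their length, and those with large multiplicities vanish modulo \<open>p\<close>.\<close>

lemma kernel_divisible:
  assumes s: "s \<in> sorted_series" and z: "\<And>N C. N \<in> ONS \<Longrightarrow> phi s N C = 0"
  shows "padic_p dvd nc_coeff s w"
proof (rule ccontr)
  assume w: "\<not> padic_p dvd nc_coeff s w"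
  then have "nc_coeff s w \<noteq> 0" by auto
  then obtain e0 where e0: "w = oword e0" using s by (auto simp: sorted_series_def)
  have fin: "finite (iw_vars n)" unfolding set_letters[symmetric] by simp
  \<comment> \<open>The level must be high enough for all exponents of w to lie below p^k; the sum
    of the exponents is such a level.\<close>
  define k where "k = (\<Sum>l\<in>iw_vars n. e0 l)"
  have e0k: "e0 l < CARD('p) ^ k" if "l \<in> iw_vars n" for l
  proof -
    have "e0 l \<le> k" unfolding k_def using fin that by (intro member_le_sum) auto
    also have "k < CARD('p) ^ k" using p_gt2 by (intro power_gt_expt) simp
    finally show ?thesis .
  qed
  let ?N = "cong_subgroup n k :: 'p padic_int mat set"
  have N: "?N \<in> ONS" by (rule cong_subgroup_ONS)
  let ?m = "max (word_bound ?N 1) (Suc (length w))"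
  \<comment> \<open>The words that can contribute modulo p: coefficient prime to p and exponents
    below p^k. The bound on the length makes the set finite, and longer words vanish modulo p at
    this level.\<close>
  define W where "W = {w \<in> iw_words n ?m. \<not> padic_p dvd nc_coeff s w \<and> (\<exists>e. w = oword e \<and> (\<forall>l\<in>iw_vars n. e l < CARD('p) ^ k))}"
  have "w \<in> W" using w e0 e0k set_oword[of e0] by (auto simp: W_def iw_words_def)
  moreover have "finite W" by (simp add: W_def)
  ultimately have "Max (length ` W) \<in> length ` W" by (intro Max_in) auto
  \<comment> \<open>At the coset of a longest such word v, every other term of the partial sum is
    divisible by p.\<close>
  then obtain v where v: "v \<in> W" "length v = Max (length ` W)" by auto
  have vmax: "length u \<le> length v" if "u \<in> W" for u
    unfolding v(2) using that \<open>finite W\<close> by (intro Max_ge) auto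
  obtain f where f: "v = oword f" "\<And>l. l \<in> iw_vars n \<Longrightarrow> f l < CARD('p) ^ k" using v(1) by (auto simp: W_def)
  let ?C = "coset ?N (word_prod v)"
  have term_dvd: "padic_p dvd nc_coeff s u * word_elt u ?N ?C - (if u = v then nc_coeff s v else 0)" if u: "u \<in> iw_words n ?m" for u
  proof (cases "u \<in> W")
    case True
    then obtain e where e: "u = oword e" "\<And>l. l \<in> iw_vars n \<Longrightarrow> e l < CARD('p) ^ k" by (auto simp: W_def)
    have "word_elt u ?N ?C = (if u = v then 1 else 0)"
      unfolding e(1) f(1) by (rule oword_word_elt_leading[OF e(2) f(2)]) (use vmax[OF True] e(1) f(1) in simp_all)
    then show ?thesis by simp
  next
    case False
    then have uv: "u \<noteq> v" using v(1) by auto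
    have "padic_p dvd nc_coeff s u * word_elt u ?N ?C"
    proof (cases "padic_p dvd nc_coeff s u")
      case True
      then show ?thesis by simp
    next
      case nd: False
      then have "nc_coeff s u \<noteq> 0" by auto
      then obtain e where e: "u = oword e" using s by (auto simp: sorted_series_def)
      then obtain l where "l \<in> iw_vars n" "CARD('p) ^ k \<le> e l" using False u nd unfolding W_def by (auto simp: not_less)
      then show ?thesis unfolding e by (intro dvd_mult word_elt_oword_vanishes)
    qed
    then show ?thesis using uv by simp
  qed
  have "padic_p dvd (\<Sum>u\<in>iw_words n ?m. nc_coeff s u * word_elt u ?N ?C - (if u = v then nc_coeff s v else 0))"
    by (intro dvd_sum term_dvd)
  moreover have "(\<Sum>u\<in>iw_words n ?m. if u = v then nc_coeff s v else 0) = nc_coeff s v"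
    using v(1) by (simp add: W_def)
  ultimately have 1: "padic_p dvd partial_sum s ?m ?N ?C - nc_coeff s v" by (simp add: partial_sum_def sum_subtractf)
  have 2: "padic_p dvd partial_sum s ?m ?N ?C"
    using phi_cong[OF N, of 1 ?m s ?C] z[OF N] by simp
  have "padic_p dvd nc_coeff s v" using dvd_diff[OF 2 1] by simp
  then show False using v(1) by (simp add: W_def)
qed

lemma sorted_series_divide:
  assumes s: "s \<in> sorted_series" and d: "\<And>w. a dvd nc_coeff s w"
  obtains s' where "s' \<in> sorted_series" "s = nc_smult a s'"
proof -
  \<comment> \<open>The case distinction keeps the support inside that of s, so the quotient is
    again an ordered series.\<close>
  define s' where "s' = Abs_ncps (\<lambda>w. if nc_coeff s w = 0 then 0 else SOME c. nc_coeff s w = a * c)"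
  have c: "nc_coeff s' w = (if nc_coeff s w = 0 then 0 else SOME c. nc_coeff s w = a * c)" for w
    by (simp add: s'_def Abs_ncps_inverse)
  have "nc_coeff s w = a * nc_coeff s' w" for w
    using someI_ex[OF d[of w, unfolded dvd_def]] by (auto simp: c)
  then have "s = nc_smult a s'" by (intro ncps_eqI) (simp add: nc_smult.rep_eq)
  moreover have "s' \<in> sorted_series"
    using s by (auto simp: sorted_series_def mem_nc_algebra c split: if_splits)
  ultimately show ?thesis by (rule that[rotated])
qed

text \<open>The p-adic integers have no torsion, so the series divided by p is still in the kernel
  and again divisible by p.\<close>

lemma sorted_series_independent:
  assumes s: "s \<in> sorted_series" and z: "phi s = \<zero>\<^bsub>L\<^esub>"
  shows "s = 0"
proof (rule ncps_eqI)
  fix w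
  have "\<exists>s'\<in>sorted_series. s = nc_smult (padic_p ^ k) s' \<and> (\<forall>N\<in>ONS. \<forall>C. phi s' N C = 0)" for k
  proof (induction k)
    case 0
    have "s = nc_smult 1 s" by (rule ncps_eqI) (simp add: nc_smult.rep_eq)
    then show ?case using s z phi_zero_iff by (intro bexI[of _ s]) auto
  next
    case (Suc k)
    then obtain s1 where s1: "s1 \<in> sorted_series" "s = nc_smult (padic_p ^ k) s1" "\<And>N C. N \<in> ONS \<Longrightarrow> phi s1 N C = 0" by blast
    obtain s2 where s2: "s2 \<in> sorted_series" "s1 = nc_smult padic_p s2" using sorted_series_divide[OF s1(1) kernel_divisible[OF s1(1,3)]] by blast
    have "phi s2 N C = 0" if "N \<in> ONS" for N C
      using s1(3)[OF that, of C] by (simp add: s2(2) phi_smult_entry[OF that] padic_p_def)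
    moreover have "s = nc_smult (padic_p ^ Suc k) s2"
      unfolding s1(2) s2(2) by (rule ncps_eqI) (simp add: nc_smult.rep_eq mult_ac)
    ultimately show ?case using s2(1) by blast
  qed
  note powers = this
  have "padic_p ^ k dvd nc_coeff s w - 0" for k
  proof -
    obtain s' where "s = nc_smult (padic_p ^ k) s'" using powers[of k] by blast
    then show ?thesis by (simp add: nc_smult.rep_eq)
  qed
  then show "nc_coeff s w = nc_coeff 0 w" unfolding zero_ncps.rep_eq by (rule padic_eqI)
qed

text \<open>Modulo the ideal an element of the kernel is an ordered series, which then lies in the
  kernel as well and is 0 by independence.\<close>

lemma phi_kernel: "a_kernel A L phi = rel_ideal"
proof -
  have K: "a_kernel A L phi = {F \<in> carrier A. phi F = \<zero>\<^bsub>L\<^esub>}" by (simp add: a_kernel_def')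
  show ?thesis
    unfolding K
  proof (intro equalityI subsetI CollectI conjI)
    fix F assume F: "F \<in> rel_ideal"
    then show "F \<in> carrier A" "phi F = \<zero>\<^bsub>L\<^esub>" using rel_ideal_carrier rel_ideal_kernel by auto
  next
    fix F assume "F \<in> {F \<in> carrier A. phi F = \<zero>\<^bsub>L\<^esub>}"
    then have F: "F \<in> carrier A" "phi F = \<zero>\<^bsub>L\<^esub>" by auto
    obtain s where s: "s \<in> sorted_series" "F - s \<in> rel_ideal" using sorted_representative[OF F(1)] by blast
    have "phi s N C = 0" if "N \<in> ONS" for N C
      using phi_add_entry[OF that, of "F - s" s C] F(2) rel_ideal_kernel[OF s(2)] that unfolding phi_zero_iff by simp
    then have "phi s = \<zero>\<^bsub>L\<^esub>" unfolding phi_zero_iff by blast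
    then have "s = 0" by (rule sorted_series_independent[OF s(1)])
    then show "F \<in> rel_ideal" using s(2) by simp
  qed
qed

end

section \<open>The isomorphism\<close>

text \<open>Links the explicit topology on the quotient ring to the general theory of quotient maps,
  which supplies the homeomorphism.\<close>

lemma quotient_map_quotient_topology: "quotient_map X (quotient_topology X q) q"
proof -
  have "openin (quotient_topology X q) (q ` topspace X)"
    unfolding openin_quotient_topology by (auto simp: subset_iff intro: openin_topspace[THEN back_subst[of "openin X"]])
  then have t: "topspace (quotient_topology X q) = q ` topspace X"
    using openin_quotient_topology by (metis openin_subset openin_topspace subset_antisym)
  show ?thesis unfolding quotient_map_def t openin_quotient_topology by auto
qed

context iwasawa_setup
begin

text \<open>A continuous map from a compact space onto a Hausdorff space is closed, hence a quotient
  map; no continuity of an inverse has to be checked by hand.\<close>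

lemma phi_quotient_map: "quotient_map (nc_topology n) (iwasawa_topology n) phi"
proof (rule continuous_closed_imp_quotient_map[OF phi_continuous])
  show "closed_map (nc_topology n) (iwasawa_topology n) phi"
    by (rule continuous_imp_closed_map[OF phi_continuous compact_space_nc_topology Hausdorff_iwasawa_topology])
  show "phi ` topspace (nc_topology n) = topspace (iwasawa_topology n)"
    by (simp add: topspace_nc_topology phi_surj topspace_iwasawa_topology)
qed

text \<open>The map induced by a quotient map is again a quotient map, and an injective quotient map
  is a homeomorphism; injectivity comes from the ring isomorphism.\<close>

lemma quotient_iso:
  defines "\<psi> \<equiv> \<lambda>X. the_elem (phi ` X)"
  shows "\<psi> \<in> ring_iso (A Quot rel_ideal) L" "\<And>F. F \<in> carrier A \<Longrightarrow> \<psi> (rel_ideal +>\<^bsub>A\<^esub> F) = phi F"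
    "homeomorphic_map (quotient_topology (nc_topology n) (\<lambda>F. rel_ideal +>\<^bsub>A\<^esub> F)) (iwasawa_topology n) \<psi>"
proof -
  interpret h: ring_hom_ring A L phi by (rule phi_hom)
  let ?q = "\<lambda>F. rel_ideal +>\<^bsub>A\<^esub> F"
  show iso: "\<psi> \<in> ring_iso (A Quot rel_ideal) L"
    using h.FactRing_iso_set[OF phi_surj] unfolding phi_kernel \<psi>_def .
  show val: "\<psi> (?q F) = phi F" if "F \<in> carrier A" for F
    using h.the_elem_simp[OF that] unfolding phi_kernel \<psi>_def .
  have q: "quotient_map (nc_topology n) (quotient_topology (nc_topology n) ?q) ?q" by (rule quotient_map_quotient_topology)
  have "quotient_map (nc_topology n) (iwasawa_topology n) (\<psi> \<circ> ?q)"
    by (rule quotient_map_eq[OF phi_quotient_map]) (simp add: val topspace_nc_topology)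
  then have "quotient_map (quotient_topology (nc_topology n) ?q) (iwasawa_topology n) \<psi>"
    unfolding quotient_map_compose_eq[OF q] .
  moreover have "inj_on \<psi> (topspace (quotient_topology (nc_topology n) ?q))"
  proof -
    have "topspace (quotient_topology (nc_topology n) ?q) = ?q ` carrier A"
      using quotient_imp_surjective_map[OF q] by (simp add: topspace_nc_topology)
    also have "\<dots> \<subseteq> carrier (A Quot rel_ideal)" by (auto simp: FactRing_def A_RCOSETS_def')
    finally show ?thesis using iso inj_on_subset unfolding ring_iso_def bij_betw_def by blast
  qed
  ultimately show "homeomorphic_map (quotient_topology (nc_topology n) ?q) (iwasawa_topology n) \<psi>"
    unfolding homeomorphic_map_def by blast
qed

end

theorem theorem4p5:
  fixes n :: nat
  assumes "n \<ge> 2" and "CARD('p::prime_card) > n + 1"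
  shows "(\<exists>!\<phi> :: 'p nc_series \<Rightarrow> 'p iwasawa. is_natural_map n \<phi>) \<and>
    (\<forall>\<phi> :: 'p nc_series \<Rightarrow> 'p iwasawa. is_natural_map n \<phi> \<longrightarrow>
      \<phi> ` carrier (nc_algebra n) = carrier (iwasawa_algebra n) \<and>
      (\<exists>\<psi> \<in> ring_iso (nc_algebra n Quot iwasawa_ideal n) (iwasawa_algebra n).
        (\<forall>F\<in>carrier (nc_algebra n). \<psi> (iwasawa_ideal n +>\<^bsub>nc_algebra n\<^esub> F) = \<phi> F) \<and>
        homeomorphic_map
          (quotient_topology (nc_topology n) (\<lambda>F. iwasawa_ideal n +>\<^bsub>nc_algebra n\<^esub> F))
          (iwasawa_topology n) \<psi>))"
proof -
  interpret iwasawa_setup n "TYPE('p)" using assms by unfold_locales auto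
  have eq: "\<phi> = restrict phi (carrier (nc_algebra n))" if "is_natural_map n \<phi>" for \<phi> :: "'p nc_series \<Rightarrow> 'p iwasawa"
    using natural_map_unique[OF that phi_natural] .
  show ?thesis
  proof (intro conjI allI impI)
    show "\<exists>!\<phi> :: 'p nc_series \<Rightarrow> 'p iwasawa. is_natural_map n \<phi>" using phi_natural eq by blast
    fix \<phi> :: "'p nc_series \<Rightarrow> 'p iwasawa" assume "is_natural_map n \<phi>"
    then have \<phi>: "\<phi> = restrict phi (carrier (nc_algebra n))" by (rule eq)
    show "\<phi> ` carrier (nc_algebra n) = carrier (iwasawa_algebra n)" unfolding \<phi> using phi_surj by simp
    show "\<exists>\<psi> \<in> ring_iso (nc_algebra n Quot iwasawa_ideal n) (iwasawa_algebra n).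
        (\<forall>F\<in>carrier (nc_algebra n). \<psi> (iwasawa_ideal n +>\<^bsub>nc_algebra n\<^esub> F) = \<phi> F) \<and>
        homeomorphic_map (quotient_topology (nc_topology n) (\<lambda>F. iwasawa_ideal n +>\<^bsub>nc_algebra n\<^esub> F)) (iwasawa_topology n) \<psi>"
      using quotient_iso unfolding rel_ideal_def \<phi> by (intro bexI[of _ "\<lambda>X. the_elem (phi ` X)"]) auto
  qed
qed

end
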